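(* Let $a,b\in\mathbb{C}$ with $\mathrm{Re}\,a,\mathrm{Re}\,b>0$, and let $\alpha\in\mathbb{C}\setminus\{0\}$ in part 1 and in (2a), (2b) below. 1. Let $|\mathrm{Re}\,\alpha|<1/4$. Then $$\int_0^\infty K_\alpha^2(a x) K_\alpha^2(b x) \,\mathrm{d}x=\frac{\pi^4}{8b}\csc(2\pi\alpha)\bigg\{\frac{\csc(\pi\alpha)\Gamma(2\alpha+\frac{1}{2})}{\Gamma(\frac{1}{2}-\alpha)\Gamma^3(1+\alpha)}\Big(\frac{a}{2b}\Big)^{2\alpha} {}_4F_3\bigg({\frac{1}{2},\alpha+\frac{1}{2},\alpha+\frac{1}{2},2\alpha+\frac{1}{2} \atop 2\alpha+1,\alpha+1,\alpha+1}\;\bigg|\;\frac{a^2}{b^2}\bigg)$$ $$+\frac{\csc(\pi\alpha)\Gamma(\frac{1}{2}-2\alpha)}{\Gamma(\alpha+\frac{1}{2})\Gamma^3(1-\alpha)}\Big(\frac{a}{2b}\Big)^{-2\alpha}{}_4F_3\bigg({\frac{1}{2},\frac{1}{2}-2\alpha,\frac{1}{2}-\alpha,\frac{1}{2}-\alpha \atop 1-2\alpha,1-\alpha,1-\alpha}\;\bigg|\;\frac{a^2}{b^2}\bigg)-\frac{2}{\pi\alpha}\,{}_4F_3\bigg({\frac{1}{2},\frac{1}{2},\alpha+\frac{1}{2},\frac{1}{2}-\alpha \atop 1,1-\alpha,\alpha+1}\;\bigg|\;\frac{a^2}{b^2}\bigg)\bigg\}.$$ 2. Suppose that $|\mathrm{Re}\,\alpha|<1/2$.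 (2a) If $a\neq b$, then $$\int_0^\infty xK_\alpha^2(a x) K_\alpha^2(b x) \,\mathrm{d}x=\frac{\pi^2}{8a^2}\csc^2(\pi\alpha)\bigg\{\frac{(a/b)^{2+2\alpha}}{1+2\alpha}\,{}_2F_1\bigg({1,\frac{1}{2}+\alpha \atop \frac{3}{2}+\alpha}\;\bigg|\;\frac{a^2}{b^2}\bigg)+\frac{(a/b)^{2-2\alpha}}{1-2\alpha}\,{}_2F_1\bigg({1,\frac{1}{2}-\alpha \atop \frac{3}{2}-\alpha} \;\bigg|\;\frac{a^2}{b^2}\bigg)-\frac{2a}{b}\tanh^{-1}\Big(\frac{a}{b}\Big)\bigg\}.$$ (2b) If $a=b$, then $$\int_0^\infty xK_\alpha^4(a x) \,\mathrm{d}x=-\frac{\pi^2}{16a^2}\csc^2(\pi\alpha)\Big\{\psi\big(\tfrac{1}{2}-\alpha\big)+\psi\big(\tfrac{1}{2}+\alpha\big)+4\ln(2)+2\gamma\Big\}.$$ (2c) Now let $\alpha=0$, and suppose $|a/b|\leq1$. Then, for $a\neq b$, $$\int_0^\infty xK_0^2(a x) K_0^2(b x) \,\mathrm{d}x=\frac{1}{2ab}\bigg\{\ln^2\Big(\frac{a}{b}\Big)\tanh^{-1}\Big(\frac{a}{b}\Big)-\ln\Big(\frac{a}{b}\Big)\Big[\mathrm{Li}_2\Big(\frac{a}{b}\Big)-\mathrm{Li}_2\Big(-\frac{a}{b}\Big)\Big]+\mathrm{Li}_3\Big(\frac{a}{b}\Big)-\mathrm{Li}_3\Big(-\frac{a}{b}\Big)\bigg\},$$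 and, for $a=b$, $$\int_0^\infty xK_0^4(a x) \,\mathrm{d}x=\frac{7}{8a^2}\zeta(3).$$
   Context: $K_\nu$ denotes the modified Bessel function of the second kind: for $\mathrm{Re}\,z>0$, $K_\nu(z)=\int_0^\infty e^{-z\cosh t}\cosh(\nu t)\,\mathrm{d}t$. $\psi(z)=\Gamma'(z)/\Gamma(z)$ is the digamma function, $\gamma=0.57721\ldots$ is the Euler–Mascheroni constant, $\mathrm{Li}_s(z)=\sum_{k=1}^\infty z^k/k^s$ is the polylogarithm (for $\mathrm{Re}\,s>1$ the series converges for $|z|\le 1$), and $\zeta(3)=\sum_{k=1}^\infty 1/k^3$. ${}_pF_q\big({a_1,\ldots,a_p\atop b_1,\ldots,b_q}\,\big|\,z\big)=\sum_{k=0}^\infty\frac{(a_1)_k\cdots(a_p)_k}{(b_1)_k\cdots(b_q)_k}\frac{z^k}{k!}$ for $|z|<1$ and by analytic continuation to $\mathbb{C}\setminus[1,\infty)$ (at $z=1$ by the series when convergent), with $(v)_k=v(v+1)\cdots(v+k-1)$. Complex powers and logarithms of $a/b$ are principal and $\tanh^{-1}(z)=\frac12(\ln(1+z)-\ln(1-z))$. When $a/b$ is real and greater than $1$, so that arguments lie on branch cuts, all functions on the right-hand side are taken as boundary values as $a/b$ is approached from the same side of the real axis (either side). *)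

theory Defs
  imports "HOL-Complex_Analysis.Complex_Analysis"
begin

definition bessel_K :: "complex \<Rightarrow> complex \<Rightarrow> complex" where
  "bessel_K \<nu> z = integral {0..} (\<lambda>t::real. exp (- z * of_real (cosh t)) * cosh (\<nu> * of_real t))"

definition csc :: "complex \<Rightarrow> complex" where
  "csc z = 1 / sin z"

text \<open>
  The inverse hyperbolic tangent with principal logarithms. The constant \<^const>\<open>artanh\<close> has the
  single logarithm \<open>ln ((1 + z) / (1 - z))\<close> instead, which may differ on the branch cuts.
\<close>
definition arctanh :: "complex \<Rightarrow> complex" where
  "arctanh z = (ln (1 + z) - ln (1 - z)) / 2"

text \<open>The defining series of the polylogarithm, used for \<open>Re s > 1\<close> and \<open>norm z \<le> 1\<close> only.\<close>
definition polylog :: "complex \<Rightarrow> complex \<Rightarrow> complex" where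
  "polylog s z = (\<Sum>k. z ^ Suc k / of_nat (Suc k) powr s)"

text \<open>
  The generalised hypergeometric function with upper parameters \<open>as\<close> and lower parameters \<open>bs\<close>,
  for \<open>length as = length bs + 1\<close>, where the series has radius of convergence 1.
  Outside the disc the value is that of the analytic continuation to the plane cut along
  \<open>[1, \<infinity>)\<close>, which is unique by connectedness. At \<open>z = 1\<close> the value is the sum of the series;
  the (meaningless) values at real \<open>z > 1\<close> are never used, see \<open>side_value\<close> below.
\<close>
definition cut_plane :: "complex set" where
  "cut_plane = - (complex_of_real ` {1..})"

definition hypergeo :: "complex list \<Rightarrow> complex list \<Rightarrow> complex \<Rightarrow> complex" where
  "hypergeo as bs z =
    (if norm z < 1 \<or> z \<notin> cut_plane then eval_fps (fps_hypergeo as bs 1) z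
     else THE w. \<exists>f. f holomorphic_on cut_plane \<and>
                     (\<forall>u\<in>ball 0 1. f u = eval_fps (fps_hypergeo as bs 1) u) \<and> w = f z)"

text \<open>
  The value at \<open>w = a / b\<close> of a function \<open>f\<close> of \<open>a / b\<close>. If \<open>w\<close> is real and greater than 1, then it
  is the boundary value of \<open>f\<close> as \<open>w\<close> is approached from within the half-plane \<open>H\<close> (the upper or
  the lower one).
\<close>
definition side_value :: "complex set \<Rightarrow> (complex \<Rightarrow> complex) \<Rightarrow> complex \<Rightarrow> complex" where
  "side_value H f w =
    (if w \<in> complex_of_real ` {1<..} then Lim (at w within H) f else f w)"

end

theory Submission
  imports Defs
begin

text \<open>
  After \<open>x = exp v\<close> the integrals become Lebesgue integrals over the real line of
  \<open>exp (\<sigma> v) * K\<^sub>\<alpha>(a exp v)^2 * K\<^sub>\<alpha>(b exp v)^2\<close> with \<open>\<sigma> = 1\<close> or \<open>\<sigma> = 2\<close>.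

  For small positive \<open>a\<close> they can be computed. The square of \<open>K\<^sub>\<alpha>(a x)\<close> is a sum of three power series in
  \<open>x\<close>, with leading powers \<open>2 \<alpha>\<close>, \<open>- 2 \<alpha>\<close> and 0 (\<open>bessel_K_eq_series_real\<close>, \<open>bessel_series_mult_sums\<close>), and the
  Mellin transform of \<open>K\<^sub>\<alpha>(b x)^2\<close> is a quotient of Gamma functions (\<open>Mellin_bessel_K_square\<close>). Integrating
  term by term (\<open>termwise_integral\<close>) gives three series in \<open>(a / b)^2\<close>. For \<open>\<sigma> = 1\<close> they are the three \<open>4F3\<close>
  series; for \<open>\<sigma> = 2\<close> almost everything cancels and the series \<open>\<Sum>k. z^k / (1 + 2 \<beta> + 2 k)\<close> with \<open>\<beta> = \<alpha>, - \<alpha>, 0\<close> remain,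
  which are the two \<open>2F1\<close> series and the inverse hyperbolic tangent.

  The integral is holomorphic in \<open>a\<close> on the whole half-plane. If the right-hand sides are holomorphic for \<open>a / b\<close> outside
  \<open>[1, \<infinity>)\<close>, the identity theorem gives the formulas there (\<open>KK_integral_identity\<close>); on the cut the
  integral is still continuous in \<open>a\<close>, so it equals the boundary value of the right-hand side from
  either side, provided that this boundary value exists (\<open>KK_integral_side_transfer\<close>). Both facts about the hypergeometric
  functions come from one construction. Their coefficients are products of quotients \<open>(q)\<^sub>k / (q + d)\<^sub>k\<close>, and multiplying
  coefficients by such a quotient is the same as averaging the function over \<open>z * exp (- s \<omega>)\<close>, \<open>s \<ge> 0\<close>, with
  Euler's beta kernel (\<open>continuable_pochhammer\<close>). Starting from \<open>1 / (1 - z)\<close>, this continues the series to the plane cut along the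
  spiral \<open>exp (s \<omega>)\<close>, \<open>s \<ge> 0\<close>. The direction \<open>\<omega> = 1\<close> is the cut plane, and the directions with a small imaginary
  part of either sign continue the function across the cut (\<open>hypergeo_side_limit\<close>).

  The remaining cases are limits. At \<open>a = b\<close> one lets \<open>a = t b\<close> with \<open>t \<rightarrow> 1\<close>: the \<open>4F3\<close> series converge absolutely
  at 1, and for \<open>\<sigma> = 2\<close> the logarithmic singularities cancel and leave a series for the digamma function
  (\<open>KK_integral_2_eq\<close>). Order zero is the limit \<open>\<alpha> \<rightarrow> 0\<close> inside the unit disc for \<open>a / b\<close>, where the bracket vanishes
  to second order and its second order term consists of logarithms and polylogarithms
  (\<open>KK_integral_0_disc\<close>); the unit circle is then reached along radii.
\<close>

section \<open>Integrals depending holomorphically on a parameter\<close>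

text \<open>
  Cauchy's estimate on the disc of radius \<open>r/4\<close> about \<open>w\<close>. It turns one dominating function for
  a holomorphic integrand into a dominating function for its difference quotients.
\<close>
lemma norm_deriv_le_of_bound:
  fixes f :: "complex \<Rightarrow> complex"
  assumes "f holomorphic_on ball z0 r" "\<And>z. z \<in> ball z0 r \<Longrightarrow> norm (f z) \<le> B" "w \<in> ball z0 (r/2)" "r > 0"
  shows "norm (deriv f w) \<le> 4 * B / r"
proof -
  have sub: "cball w (r/4) \<subseteq> ball z0 r"
  proof
    fix u assume "u \<in> cball w (r/4)"
    then have "dist z0 u \<le> dist z0 w + r/4" using dist_triangle[of z0 u w] by (simp add: mem_cball)
    with assms(3,4) show "u \<in> ball z0 r" by simp
  qed
  have "norm ((deriv ^^ 1) f w) \<le> fact 1 * B / (r/4) ^ 1"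
  proof (rule Cauchy_inequality)
    show "f holomorphic_on ball w (r/4)" using assms(1) sub ball_subset_cball holomorphic_on_subset by (metis subset_trans)
    show "continuous_on (cball w (r/4)) f" using assms(1) sub continuous_on_subset holomorphic_on_imp_continuous_on by blast
    show "0 < r/4" using assms by simp
    show "norm (f x) \<le> B" if "norm (w - x) = r/4" for x
      using that sub assms(2) by (auto simp: dist_norm subset_iff)
  qed
  then show ?thesis by (simp add: mult.commute)
qed

text \<open>
  Differentiation under the integral sign: a bound for the integrand on a disc bounds the
  difference quotients on the half disc, so dominated convergence applies to them.
\<close>
lemma has_field_derivative_integral:
  fixes f :: "complex \<Rightarrow> 'a \<Rightarrow> complex"
  assumes hol: "\<And>s. s \<in> space M \<Longrightarrow> (\<lambda>z. f z s) holomorphic_on ball z0 r"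
    and meas: "\<And>z. z \<in> ball z0 r \<Longrightarrow> f z \<in> borel_measurable M"
    and g: "integrable M g" and r: "r > 0"
    and dom: "\<And>z s. z \<in> ball z0 r \<Longrightarrow> s \<in> space M \<Longrightarrow> norm (f z s) \<le> g s"
  shows "((\<lambda>z. \<integral>s. f z s \<partial>M) has_field_derivative (\<integral>s. deriv (\<lambda>z. f z s) z0 \<partial>M)) (at z0)"
proof -
  define B where "B = ball z0 (r/2)"
  have B: "B \<subseteq> ball z0 r" "z0 \<in> B" "open B" using r by (auto simp: B_def)
  have z0: "z0 \<in> ball z0 r" using r by simp
  have int: "integrable M (f z)" if "z \<in> ball z0 r" for z
    using g meas[OF that] by (rule Bochner_Integration.integrable_bound) (use dom[OF that] in \<open>fastforce intro!: AE_I2\<close>)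
  have der: "((\<lambda>z. f z s) has_field_derivative deriv (\<lambda>z. f z s) z0) (at z0)" if "s \<in> space M" for s
    using hol[OF that] z0 by (simp add: holomorphic_derivI)
  have q: "norm ((f z s - f z0 s) / (z - z0)) \<le> 4 * g s / r" if "z \<in> B" "z \<noteq> z0" "s \<in> space M" for z s
  proof -
    have "norm (f z s - f z0 s) \<le> (4 * g s / r) * norm (z - z0)"
    proof (rule field_differentiable_bound[of B])
      show "convex B" by (simp add: B_def)
      show "((\<lambda>z. f z s) has_field_derivative deriv (\<lambda>z. f z s) w) (at w within B)" if "w \<in> B" for w
        using hol[OF \<open>s \<in> space M\<close>] that B
        by (meson holomorphic_derivI open_ball subsetD has_field_derivative_at_within)
      show "norm (deriv (\<lambda>z. f z s) w) \<le> 4 * g s / r" if "w \<in> B" for w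
        using norm_deriv_le_of_bound[OF hol[OF \<open>s \<in> space M\<close>] dom[OF _ \<open>s \<in> space M\<close>]] that r by (simp add: B_def)
    qed (use that B in auto)
    then show ?thesis using that by (simp add: norm_divide field_simps)
  qed
  have lim: "(\<lambda>n. \<integral>s. (f (X n) s - f z0 s) / (X n - z0) \<partial>M) \<longlonglongrightarrow> (\<integral>s. deriv (\<lambda>z. f z s) z0 \<partial>M)"
    if X: "\<forall>n. X n \<in> B - {z0}" "X \<longlonglongrightarrow> z0" for X
  proof (rule integral_dominated_convergence)
    have X1: "X n \<in> ball z0 r" for n using X B by auto
    show m: "(\<lambda>s. (f (X n) s - f z0 s) / (X n - z0)) \<in> borel_measurable M" for n
      using meas[OF X1] meas[OF z0] by simp
    have l: "(\<lambda>n. (f (X n) s - f z0 s) / (X n - z0)) \<longlonglongrightarrow> deriv (\<lambda>z. f z s) z0" if "s \<in> space M" for s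
    proof -
      have "((\<lambda>z. (f z s - f z0 s) / (z - z0)) \<longlongrightarrow> deriv (\<lambda>z. f z s) z0) (at z0)"
        using der[OF that] by (simp add: has_field_derivative_iff)
      then show ?thesis using X by (auto simp: tendsto_at_iff_sequentially o_def)
    qed
    show "AE s in M. (\<lambda>n. (f (X n) s - f z0 s) / (X n - z0)) \<longlonglongrightarrow> deriv (\<lambda>z. f z s) z0"
      using l by (auto intro!: AE_I2)
    show "(\<lambda>s. deriv (\<lambda>z. f z s) z0) \<in> borel_measurable M"
      by (rule borel_measurable_LIMSEQ_metric[OF m l])
    show "integrable M (\<lambda>s. 4 * g s / r)" using g by simp
    show "AE s in M. norm ((f (X n) s - f z0 s) / (X n - z0)) \<le> 4 * g s / r" for n
      using q X by (auto intro!: AE_I2)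
  qed
  have "((\<lambda>z. ((\<integral>s. f z s \<partial>M) - (\<integral>s. f z0 s \<partial>M)) / (z - z0)) \<longlongrightarrow> (\<integral>s. deriv (\<lambda>z. f z s) z0 \<partial>M)) (at z0 within B)"
    unfolding tendsto_at_iff_sequentially o_def
  proof (intro allI impI)
    fix X assume X: "\<forall>n. X n \<in> B - {z0}" "X \<longlonglongrightarrow> z0"
    have eq: "(\<integral>s. (f (X n) s - f z0 s) / (X n - z0) \<partial>M) = ((\<integral>s. f (X n) s \<partial>M) - (\<integral>s. f z0 s \<partial>M)) / (X n - z0)" for n
    proof -
      have "X n \<in> ball z0 r" using X B by auto
      from Bochner_Integration.integral_diff[OF int[OF this] int[OF z0]] show ?thesis
        by (simp only: integral_divide_zero)
    qed
    show "(\<lambda>n. ((\<integral>s. f (X n) s \<partial>M) - (\<integral>s. f z0 s \<partial>M)) / (X n - z0)) \<longlonglongrightarrow> (\<integral>s. deriv (\<lambda>z. f z s) z0 \<partial>M)"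
      by (rule Lim_transform_eventually[OF lim[OF X]]) (intro always_eventually allI eq)
  qed
  then show ?thesis using B by (simp add: has_field_derivative_iff at_within_open[OF B(2,3)])
qed

lemma holomorphic_on_integral:
  fixes f :: "complex \<Rightarrow> 'a \<Rightarrow> complex"
  assumes "open S" "\<And>s. s \<in> space M \<Longrightarrow> (\<lambda>z. f z s) holomorphic_on S"
    and "\<And>z. z \<in> S \<Longrightarrow> f z \<in> borel_measurable M"
    and dom: "\<And>z0. z0 \<in> S \<Longrightarrow> \<exists>r>0. \<exists>g. integrable M g \<and> (\<forall>z\<in>ball z0 r \<inter> S. \<forall>s\<in>space M. norm (f z s) \<le> g s)"
  shows "(\<lambda>z. \<integral>s. f z s \<partial>M) holomorphic_on S"
  unfolding holomorphic_on_open[OF assms(1)]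
proof
  fix z0 assume z0: "z0 \<in> S"
  obtain r g where r: "r > 0" "integrable M g" "\<forall>z\<in>ball z0 r \<inter> S. \<forall>s\<in>space M. norm (f z s) \<le> g s"
    using dom[OF z0] by auto
  obtain e where e: "e > 0" "ball z0 e \<subseteq> S" using z0 assms(1) openE by blast
  have m: "ball z0 (min e r) \<subseteq> ball z0 r \<inter> S" using e by auto
  show "\<exists>f'. ((\<lambda>z. \<integral>s. f z s \<partial>M) has_field_derivative f') (at z0)"
    by (rule exI, rule has_field_derivative_integral[where r="min e r" and g=g])
       (use r e assms m in \<open>auto intro: holomorphic_on_subset[where s=S]\<close>)
qed

section \<open>Substitutions in integrals over the real line\<close>

lemma lborel_integral_shift:
  fixes f :: "real \<Rightarrow> complex"
  shows "(LBINT t. f (t + c)) = (LBINT t. f t)"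
  using lborel_integral_real_affine[of 1 f c] by (simp add: add.commute)

lemma lborel_integrable_shift:
  fixes f :: "real \<Rightarrow> complex"
  shows "integrable lborel (\<lambda>t. f (t + c)) = integrable lborel f"
  using lborel_integrable_real_affine_iff[of 1 f c] by (simp add: add.commute)

lemma lborel_integral_reflect:
  fixes f :: "real \<Rightarrow> complex"
  shows "(LBINT t. f (c - t)) = (LBINT t. f t)"
  using lborel_integral_real_affine[of "-1" f c] by simp

lemma lborel_integrable_reflect:
  fixes f :: "real \<Rightarrow> complex"
  shows "integrable lborel (\<lambda>t. f (c - t)) = integrable lborel f"
  using lborel_integrable_real_affine_iff[of "-1" f c] by simp

text \<open>
  The substitution \<open>x = exp v\<close>. All integrals below live on the whole line, where shifts,
  reflections and linear changes of variables are available and Mellin transforms become Laplace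
  transforms.
\<close>
lemma has_integral_exp_substitution:
  fixes f :: "real \<Rightarrow> complex"
  assumes "integrable lborel (\<lambda>v. of_real (exp v) * f (exp v))"
  shows "(f has_integral (LBINT v. of_real (exp v) * f (exp v))) {0<..}"
    and "f absolutely_integrable_on {0<..}"
proof -
  have r: "range exp = {0::real<..}"
    using exp_gt_zero by (force intro: exp_ln [symmetric])
  have 1: "(\<lambda>v. \<bar>exp v\<bar> *\<^sub>R f (exp v)) absolutely_integrable_on UNIV"
    using integrable_completion[of "(\<lambda>v. of_real (exp v) * f (exp v))" lborel] assms
    by (auto simp: set_integrable_def scaleR_conv_of_real)
  have "f absolutely_integrable_on exp ` UNIV \<longleftrightarrow> (\<lambda>v. \<bar>exp v\<bar> *\<^sub>R f (exp v)) absolutely_integrable_on UNIV"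
    by (rule absolutely_integrable_change_of_variables_real) (auto intro!: derivative_eq_intros simp: inj_on_def)
  with 1 show 2: "f absolutely_integrable_on {0<..}" using r by simp
  have "integral (exp ` UNIV) f = integral UNIV (\<lambda>v. \<bar>exp v\<bar> *\<^sub>R f (exp v))"
    using has_absolute_integral_change_of_variables_real[of UNIV exp exp f] 1
    by (auto intro!: derivative_eq_intros simp: inj_on_def)
  also have "\<dots> = (LBINT v. of_real (exp v) * f (exp v))"
    using integral_lborel[OF assms] by (simp add: scaleR_conv_of_real)
  finally show "(f has_integral (LBINT v. of_real (exp v) * f (exp v))) {0<..}"
    using 2 r by (metis has_integral_integrable_integral set_lebesgue_integral_eq_integral(1))
qed

text \<open>
  Euler's integral for \<open>Gamma s\<close> with \<open>t = exp v\<close>.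
\<close>
lemma integral_exp_Gamma_1:
  assumes "Re s > 0"
  shows "integrable lborel (\<lambda>v. exp (s * of_real v - of_real (exp v)))"
    and "(LBINT v. exp (s * of_real v - of_real (exp v))) = Gamma s"
proof -
  define f where "f = (\<lambda>t. complex_of_real t powr (s - 1) / of_real (exp t))"
  have r: "range exp = {0::real<..}"
    using exp_gt_zero by (force intro: exp_ln [symmetric])
  have eq: "\<bar>exp v\<bar> *\<^sub>R f (exp v) = exp (s * of_real v - of_real (exp v))" for v :: real
  proof -
    have "s * of_real v - of_real (exp v) = (of_real v + (s - 1) * of_real v) - of_real (exp v)"
      by (simp add: algebra_simps)
    then have "exp (s * of_real v - of_real (exp v)) = exp (of_real v) * exp ((s - 1) * of_real v) / exp (of_real (exp v))"
      by (simp only: exp_diff exp_add)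
    also have "exp ((s - 1) * of_real v) = of_real (exp v) powr (s - 1)"
      by (simp add: powr_def Ln_of_real)
    finally show ?thesis by (simp add: f_def scaleR_conv_of_real exp_of_real)
  qed
  have 1: "f absolutely_integrable_on exp ` UNIV \<and> integral (exp ` UNIV) f = Gamma s"
    using absolutely_integrable_Gamma_integral'[OF assms] Gamma_integral_complex'[OF assms]
    by (auto simp: r f_def integral_unique)
  have 2: "(\<lambda>v. \<bar>exp v\<bar> *\<^sub>R f (exp v)) absolutely_integrable_on UNIV \<and> integral UNIV (\<lambda>v. \<bar>exp v\<bar> *\<^sub>R f (exp v)) = Gamma s"
    using has_absolute_integral_change_of_variables_real[of UNIV exp exp f "Gamma s"] 1
    by (auto intro!: derivative_eq_intros simp: inj_on_def)
  have m: "(\<lambda>v. exp (s * of_real v - of_real (exp v))) \<in> borel_measurable lborel" by simp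
  have eq': "(\<lambda>v. \<bar>exp v\<bar> *\<^sub>R f (exp v)) = (\<lambda>v. exp (s * of_real v - of_real (exp v)))"
    using eq by (rule ext)
  have "integrable lebesgue (\<lambda>v. exp (s * of_real v - of_real (exp v)))"
    using conjunct1[OF 2] unfolding eq' by (simp add: set_integrable_def)
  then show 3: "integrable lborel (\<lambda>v. exp (s * of_real v - of_real (exp v)))"
    using integrable_completion[OF m] by blast
  show "(LBINT v. exp (s * of_real v - of_real (exp v))) = Gamma s"
    using conjunct2[OF 2] integral_lborel[OF 3] unfolding eq' by simp
qed

lemma integral_exp_Gamma:
  assumes "Re s > 0" "c > 0"
  shows "integrable lborel (\<lambda>v. exp (s * of_real v - of_real (c * exp v)))"
    and "(LBINT v. exp (s * of_real v - of_real (c * exp v))) = Gamma s * exp (- s * of_real (ln c))"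
proof -
  define F where "F = (\<lambda>v. exp (- s * of_real (ln c)) * exp (s * of_real v - of_real (exp v)))"
  have eq: "F (v + ln c) = exp (s * of_real v - of_real (c * exp v))" for v
  proof -
    have "F (v + ln c) = exp (- s * of_real (ln c) + (s * of_real (v + ln c) - of_real (exp (v + ln c))))"
      by (simp only: F_def mult_exp_exp)
    also have "exp (v + ln c) = c * exp v" using assms(2) by (simp add: exp_add)
    also have "- s * of_real (ln c) + (s * of_real (v + ln c) - of_real (c * exp v)) = s * of_real v - of_real (c * exp v)"
      by (simp add: algebra_simps)
    finally show ?thesis .
  qed
  have F: "integrable lborel F" "(LBINT v. F v) = Gamma s * exp (- s * of_real (ln c))"
    unfolding F_def using integral_exp_Gamma_1[OF assms(1)] by (simp_all add: mult.commute)
  show "integrable lborel (\<lambda>v. exp (s * of_real v - of_real (c * exp v)))"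
    using F(1) lborel_integrable_shift[of F "ln c"] by (simp add: eq)
  show "(LBINT v. exp (s * of_real v - of_real (c * exp v))) = Gamma s * exp (- s * of_real (ln c))"
    using F(2) lborel_integral_shift[of F "ln c"] by (simp add: eq)
qed

text \<open>
  Fubini in the coordinates \<open>m = v + p\<close> and \<open>n = v - p\<close>, whose Jacobian gives the factor 1/2.
  Since \<open>cosh (v + p) + cosh (v - p)\<close> and \<open>exp (v + p) + exp (v - p)\<close> factorise, this one
  identity produces the integral for \<open>K\<^sub>\<alpha>\<close> squared, the Mellin transform of \<open>K\<^sub>0\<close> and the beta
  integral.
\<close>
lemma integral_hyperbolic_rotation:
  fixes g h :: "real \<Rightarrow> complex"
  assumes g: "integrable lborel g" and h: "integrable lborel h"
  shows "integrable (lborel \<Otimes>\<^sub>M lborel) (\<lambda>(v, p). g (v + p) * h (v - p))"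
    and "(LBINT v. LBINT p. g (v + p) * h (v - p)) = (LBINT t. g t) * (LBINT u. h u) / 2"
proof -
  have [measurable]: "g \<in> borel_measurable borel" "h \<in> borel_measurable borel"
    using g h by auto
  have aff: "(\<integral>\<^sup>+ v. norm (h (2 * v - m)) \<partial>lborel) = ennreal (1/2) * (\<integral>\<^sup>+ v. norm (h v) \<partial>lborel)" for m
  proof -
    have e: "(\<integral>\<^sup>+ v. norm (h v) \<partial>lborel) = ennreal 2 * (\<integral>\<^sup>+ v. norm (h (2 * v - m)) \<partial>lborel)"
      by (subst nn_integral_real_affine[of _ 2 "-m"]) auto
    have "ennreal (1/2) * (ennreal 2 * x) = x" for x
      unfolding mult.assoc [symmetric] by (subst ennreal_mult [symmetric]) auto
    then show ?thesis by (simp only: e)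
  qed
  have sh: "(\<integral>\<^sup>+ p. norm (g (v + p) * h (v - p)) \<partial>lborel) = (\<integral>\<^sup>+ m. norm (g m * h (2 * v - m)) \<partial>lborel)" for v
    by (subst nn_integral_real_affine[of "\<lambda>m. norm (g m * h (2 * v - m))" 1 v]) auto
  have "(\<integral>\<^sup>+ z. norm (case z of (v, p) \<Rightarrow> g (v + p) * h (v - p)) \<partial>(lborel \<Otimes>\<^sub>M lborel))
      = (\<integral>\<^sup>+ v. \<integral>\<^sup>+ p. norm (g (v + p) * h (v - p)) \<partial>lborel \<partial>lborel)"
    by (subst lborel.nn_integral_fst [symmetric]) auto
  also have "\<dots> = (\<integral>\<^sup>+ v. \<integral>\<^sup>+ m. norm (g m * h (2 * v - m)) \<partial>lborel \<partial>lborel)" by (simp only: sh)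
  also have "\<dots> = (\<integral>\<^sup>+ m. \<integral>\<^sup>+ v. norm (g m * h (2 * v - m)) \<partial>lborel \<partial>lborel)"
    by (rule lborel_pair.Fubini') auto
  also have "\<dots> = (\<integral>\<^sup>+ m. ennreal (norm (g m)) * (ennreal (1/2) * (\<integral>\<^sup>+ v. norm (h v) \<partial>lborel)) \<partial>lborel)"
    by (simp add: norm_mult ennreal_mult nn_integral_cmult aff)
  also have "\<dots> = (\<integral>\<^sup>+ m. norm (g m) \<partial>lborel) * (ennreal (1/2) * (\<integral>\<^sup>+ v. norm (h v) \<partial>lborel))"
    by (simp add: nn_integral_multc)
  also have "\<dots> < \<infinity>"
  proof -
    have "(\<integral>\<^sup>+ m. norm (g m) \<partial>lborel) < \<infinity>" "(\<integral>\<^sup>+ m. norm (h m) \<partial>lborel) < \<infinity>"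
      using g h by (simp_all add: integrable_iff_bounded)
    moreover have "ennreal (1/2) < \<infinity>" by (simp only: ennreal_less_top infinity_ennreal_def)
    ultimately show ?thesis unfolding infinity_ennreal_def ennreal_mult_less_top by blast
  qed
  finally show 1: "integrable (lborel \<Otimes>\<^sub>M lborel) (\<lambda>(v, p). g (v + p) * h (v - p))"
    by (intro integrableI_bounded) auto
  have 2: "integrable (lborel \<Otimes>\<^sub>M lborel) (\<lambda>(v, m). g m * h (2 * v - m))"
  proof (rule integrableI_bounded)
    have "(\<integral>\<^sup>+ z. norm (case z of (v, m) \<Rightarrow> g m * h (2 * v - m)) \<partial>(lborel \<Otimes>\<^sub>M lborel))
      = (\<integral>\<^sup>+ v. \<integral>\<^sup>+ m. norm (g m * h (2 * v - m)) \<partial>lborel \<partial>lborel)"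
      by (subst lborel.nn_integral_fst [symmetric]) auto
    also have "\<dots> = (\<integral>\<^sup>+ z. norm (case z of (v, p) \<Rightarrow> g (v + p) * h (v - p)) \<partial>(lborel \<Otimes>\<^sub>M lborel))"
      by (subst lborel.nn_integral_fst [symmetric]) (auto simp only: sh split_beta fst_conv snd_conv, simp)
    also have "\<dots> < \<infinity>" using 1 by (auto simp: integrable_iff_bounded)
    finally show "(\<integral>\<^sup>+ z. norm (case z of (v, m) \<Rightarrow> g m * h (2 * v - m)) \<partial>(lborel \<Otimes>\<^sub>M lborel)) < \<infinity>" .
  qed auto
  have "(LBINT v. LBINT p. g (v + p) * h (v - p)) = (LBINT v. LBINT m. g m * h (2 * v - m))"
    using lborel_integral_shift[of "\<lambda>m. g m * h (2 * v - m)" v for v]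
    by (simp add: add.commute diff_diff_eq algebra_simps)
  also have "\<dots> = (LBINT m. LBINT v. g m * h (2 * v - m))"
    using lborel_pair.Fubini_integral[OF 2] by simp
  also have "\<dots> = (LBINT m. g m * ((LBINT v. h v) / 2))"
  proof -
    have "(LBINT v. h (2 * v - m)) = (LBINT v. h v) / 2" for m
      using lborel_integral_real_affine[of 2 h "-m"] by (simp add: scaleR_conv_of_real)
    then show ?thesis by (simp only: integral_mult_right_zero)
  qed
  also have "\<dots> = (LBINT t. g t) * (LBINT u. h u) / 2" by simp
  finally show "(LBINT v. LBINT p. g (v + p) * h (v - p)) = (LBINT t. g t) * (LBINT u. h u) / 2" .
qed

section \<open>The Bessel function as an integral over the real line\<close>

lemma exp_abs_le_cosh: "exp \<bar>t\<bar> \<le> 2 * cosh (t::real)"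
  by (simp add: cosh_def abs_if field_simps)

lemma integrable_exp_reflected:
  assumes "r > 0" "c > 0"
  shows "integrable lborel (\<lambda>t::real. exp (r * t - c * exp t) + exp (r * (-t) - c * exp (-t)))"
proof -
  have "integrable lborel (\<lambda>v. exp (complex_of_real r * of_real v - of_real (c * exp v)))"
    using integral_exp_Gamma(1)[of "of_real r" c] assms by simp
  also have "(\<lambda>v. exp (complex_of_real r * of_real v - of_real (c * exp v))) = (\<lambda>v. of_real (exp (r * v - c * exp v)))"
    by (simp add: exp_of_real [symmetric])
  finally have 1: "integrable lborel (\<lambda>v. complex_of_real (exp (r * v - c * exp v)))" .
  then have 2: "integrable lborel (\<lambda>v. complex_of_real (exp (r * (-v) - c * exp (-v))))"
    using lborel_integrable_reflect[of "\<lambda>v. complex_of_real (exp (r * v - c * exp v))" 0] by simp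
  from 1 2 show ?thesis
    by (intro Bochner_Integration.integrable_add) (simp_all only: complex_of_real_integrable_eq)
qed

lemma integrable_exp_abs_cosh:
  assumes "c > 0"
  shows "integrable lborel (\<lambda>t::real. exp (r * \<bar>t\<bar> - c * cosh t))"
proof (rule Bochner_Integration.integrable_bound)
  define q where "q = \<bar>r\<bar> + 1"
  show "integrable lborel (\<lambda>t::real. exp (q * t - c/2 * exp t) + exp (q * (-t) - c/2 * exp (-t)))"
    by (rule integrable_exp_reflected) (use assms in \<open>auto simp: q_def\<close>)
  have "exp (r * \<bar>t\<bar> - c * cosh t) \<le> exp (q * \<bar>t\<bar> - c/2 * exp \<bar>t\<bar>)" for t :: real
  proof -
    have "c/2 * exp \<bar>t\<bar> \<le> c * cosh t" using exp_abs_le_cosh[of t] assms by (simp add: field_simps)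
    moreover have "r * \<bar>t\<bar> \<le> q * \<bar>t\<bar>" by (intro mult_right_mono) (auto simp: q_def)
    ultimately show ?thesis by simp
  qed
  moreover have "exp (q * \<bar>t\<bar> - c/2 * exp \<bar>t\<bar>) \<le> exp (q * t - c/2 * exp t) + exp (q * (-t) - c/2 * exp (-t))" for t :: real
    by (cases "t \<ge> 0") (simp_all add: add_increasing add_increasing2)
  ultimately have "exp (r * \<bar>t\<bar> - c * cosh t) \<le> exp (q * t - c/2 * exp t) + exp (q * (-t) - c/2 * exp (-t))" for t :: real
    by (meson order_trans)
  then show "AE t in lborel. norm (exp (r * \<bar>t\<bar> - c * cosh t)) \<le> norm (exp (q * t - c/2 * exp t) + exp (q * (-t) - c/2 * exp (-t)))"
    by (auto simp: abs_of_nonneg)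
qed (simp add: cosh_def)

lemma integrable_exp_neg_abs:
  assumes "d > 0"
  shows "integrable lborel (\<lambda>t::real. exp (- d * \<bar>t\<bar>))"
proof (rule Bochner_Integration.integrable_bound)
  show "integrable lborel (\<lambda>t::real. exp 1 * (exp (d * t - 1 * exp t) + exp (d * (-t) - 1 * exp (-t))))"
    by (intro integrable_mult_right integrable_exp_reflected) (use assms in auto)
  have a: "exp (- d * \<bar>t\<bar>) \<le> exp 1 * exp (d * (- \<bar>t\<bar>) - 1 * exp (- \<bar>t\<bar>))" for t :: real
    by (simp add: mult_exp_exp)
  have b: "exp (d * (- \<bar>t\<bar>) - 1 * exp (- \<bar>t\<bar>)) \<le> exp (d * t - 1 * exp t) + exp (d * (-t) - 1 * exp (-t))" for t :: real
    by (cases "t \<ge> 0") (simp_all add: add_increasing add_increasing2)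
  have "exp (- d * \<bar>t\<bar>) \<le> exp 1 * (exp (d * t - 1 * exp t) + exp (d * (-t) - 1 * exp (-t)))" for t :: real
    by (rule order_trans[OF a mult_left_mono[OF b]]) simp
  then show "AE t in lborel. norm (exp (- d * \<bar>t\<bar>)) \<le> norm (exp 1 * (exp (d * t - 1 * exp t) + exp (d * (-t) - 1 * exp (-t))))"
    by (auto simp: abs_of_nonneg)
qed simp

lemma norm_bessel_kernel:
  "norm (exp (\<nu> * of_real t - z * of_real (cosh t))) \<le> exp (\<bar>Re \<nu>\<bar> * \<bar>t\<bar> - Re z * cosh t)"
proof -
  have "Re \<nu> * t \<le> \<bar>Re \<nu>\<bar> * \<bar>t\<bar>" by (metis abs_ge_self abs_mult)
  then show ?thesis by simp
qed

lemma integrable_bessel_kernel: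
  assumes "Re z > 0"
  shows "integrable lborel (\<lambda>t. exp (\<nu> * of_real t - z * of_real (cosh t)))"
  by (rule Bochner_Integration.integrable_bound[OF integrable_exp_abs_cosh[OF assms, of "\<bar>Re \<nu>\<bar>"]])
     (use norm_bessel_kernel[of \<nu> _ z] in \<open>auto simp: cosh_def\<close>)

text \<open>
  The integrand with \<open>cosh (\<nu> t)\<close> is even, and the odd part \<open>sinh (\<nu> t)\<close> contributes nothing
  over the whole line; this replaces the half-line integral of the definition by a Lebesgue
  integral of a single exponential.
\<close>
lemma bessel_K_eq_integral:
  assumes "Re z > 0"
  shows "bessel_K \<nu> z = (LBINT t. exp (\<nu> * of_real t - z * of_real (cosh t))) / 2"
proof -
  define e where "e \<mu> t = exp (\<mu> * of_real t - z * of_real (cosh t))" for \<mu> and t :: real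
  define g where "g = (\<lambda>t::real. exp (- z * of_real (cosh t)) * cosh (\<nu> * of_real t))"
  have e: "integrable lborel (e \<mu>)" for \<mu> unfolding e_def by (rule integrable_bessel_kernel[OF assms])
  have g_eq: "g t = (e \<nu> t + e (-\<nu>) t) / 2" for t
    by (simp add: g_def e_def cosh_def[where 'a=complex] field_simps exp_add exp_diff scaleR_conv_of_real exp_minus)
  have g: "integrable lborel g" unfolding g_eq[abs_def] using e by simp
  have ev: "g (-t) = g t" for t by (simp add: g_def)
  have "e (-\<nu>) t = e \<nu> (0 - t)" for t by (simp add: e_def)
  then have "(LBINT t. e (-\<nu>) t) = (LBINT t. e \<nu> t)"
    using lborel_integral_reflect[of "e \<nu>" 0] by simp
  then have "(LBINT t. e \<nu> t) = (LBINT t. g t)" using e by (simp add: g_eq)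
  also have "(LBINT t. g t) = (LBINT t:{0..}. g t) + (LBINT t:{..<0}. g t)"
  proof -
    have "(LBINT t:{0..} \<union> {..<0}. g t) = (LBINT t:{0..}. g t) + (LBINT t:{..<0}. g t)"
      by (rule set_integral_Un) (use g in \<open>auto simp: set_integrable_def intro!: integrable_mult_indicator\<close>)
    also have "{0..} \<union> {..<0} = (UNIV :: real set)" by auto
    finally show ?thesis by (simp add: set_lebesgue_integral_def)
  qed
  also have "(LBINT t:{..<0}. g t) = (LBINT t:{0<..}. g t)"
    using lborel_integral_reflect[of "\<lambda>t. indicator {0<..} t *\<^sub>R g t" 0]
    by (simp add: set_lebesgue_integral_def ev indicator_def)
  also have "\<dots> = (LBINT t:{0..}. g t)"
    unfolding set_lebesgue_integral_def
    by (rule integral_cong_AE) (use g AE_lborel_singleton[of 0] in \<open>auto simp: indicator_def\<close>)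
  also have "(LBINT t:{0..}. g t) + \<dots> = 2 * integral {0..} g"
  proof -
    have "set_integrable lborel {0..} g" using g by (auto simp: set_integrable_def intro!: integrable_mult_indicator)
    then show ?thesis by (simp add: set_borel_integral_eq_integral)
  qed
  finally show ?thesis by (simp add: bessel_K_def e_def g_def)
qed

lemma bessel_K_minus: "bessel_K (- \<nu>) z = bessel_K \<nu> z"
  by (simp add: bessel_K_def)

lemma holomorphic_bessel_K: "bessel_K \<nu> holomorphic_on {z. Re z > 0}"
proof -
  have "(\<lambda>z. LBINT t. exp (\<nu> * of_real t - z * of_real (cosh t))) holomorphic_on {z. Re z > 0}"
  proof (rule holomorphic_on_integral)
    show "open {z. Re z > 0}" by (rule open_halfspace_Re_gt)
    fix z0 :: complex assume "z0 \<in> {z. Re z > 0}"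
    then have z0: "Re z0 > 0" by simp
    have "norm (exp (\<nu> * of_real t - z * of_real (cosh t))) \<le> exp (\<bar>Re \<nu>\<bar> * \<bar>t\<bar> - Re z0 / 2 * cosh t)"
      if "z \<in> ball z0 (Re z0 / 2)" for z t
    proof -
      have "Re z0 - Re z \<le> Re z0 / 2"
        using that abs_Re_le_cmod[of "z0 - z"] by (simp add: dist_norm)
      then have "Re z0 / 2 * cosh t \<le> Re z * cosh t" by (intro mult_right_mono) (auto simp: cosh_real_nonneg)
      with norm_bessel_kernel[of \<nu> t z] show ?thesis by (meson diff_left_mono exp_le_cancel_iff order_trans)
    qed
    then show "\<exists>r>0. \<exists>g. integrable lborel g \<and>
         (\<forall>z\<in>ball z0 r \<inter> {z. Re z > 0}. \<forall>t\<in>space lborel. norm (exp (\<nu> * of_real t - z * of_real (cosh t))) \<le> g t)"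
      using z0 integrable_exp_abs_cosh[of "Re z0 / 2" "\<bar>Re \<nu>\<bar>"]
      by (intro exI[of _ "Re z0 / 2"] conjI exI[of _ "\<lambda>t. exp (\<bar>Re \<nu>\<bar> * \<bar>t\<bar> - Re z0 / 2 * cosh t)"]) auto
  qed (auto intro!: holomorphic_intros simp: cosh_def)
  then have "(\<lambda>z. (LBINT t. exp (\<nu> * of_real t - z * of_real (cosh t))) / 2) holomorphic_on {z. Re z > 0}"
    by (intro holomorphic_intros) auto
  then show ?thesis
    by (rule holomorphic_transform) (simp add: bessel_K_eq_integral)
qed

lemma holomorphic_bessel_K_order:
  assumes "Re z > 0"
  shows "(\<lambda>\<nu>. bessel_K \<nu> z) holomorphic_on UNIV"
proof -
  have "(\<lambda>\<nu>. LBINT t. exp (\<nu> * of_real t - z * of_real (cosh t))) holomorphic_on UNIV"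
  proof (rule holomorphic_on_integral)
    fix \<nu>0 :: complex
    have "norm (exp (\<nu> * of_real t - z * of_real (cosh t))) \<le> exp ((\<bar>Re \<nu>0\<bar> + 1) * \<bar>t\<bar> - Re z * cosh t)"
      if "\<nu> \<in> ball \<nu>0 1" for \<nu> t
    proof -
      have "\<bar>Re \<nu>\<bar> \<le> \<bar>Re \<nu>0\<bar> + 1"
        using that abs_Re_le_cmod[of "\<nu>0 - \<nu>"] by (simp add: dist_norm)
      then have "\<bar>Re \<nu>\<bar> * \<bar>t\<bar> \<le> (\<bar>Re \<nu>0\<bar> + 1) * \<bar>t\<bar>" by (intro mult_right_mono) auto
      with norm_bessel_kernel[of \<nu> t z] show ?thesis by (meson diff_right_mono exp_le_cancel_iff order_trans)
    qed
    then show "\<exists>r>0. \<exists>g. integrable lborel g \<and>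
         (\<forall>\<nu>\<in>ball \<nu>0 r \<inter> UNIV. \<forall>t\<in>space lborel. norm (exp (\<nu> * of_real t - z * of_real (cosh t))) \<le> g t)"
      using integrable_exp_abs_cosh[OF assms, of "\<bar>Re \<nu>0\<bar> + 1"]
      by (intro exI[of _ 1] conjI exI[of _ "\<lambda>t. exp ((\<bar>Re \<nu>0\<bar> + 1) * \<bar>t\<bar> - Re z * cosh t)"]) auto
  qed (auto intro!: holomorphic_intros simp: cosh_def)
  then have "(\<lambda>\<nu>. (LBINT t. exp (\<nu> * of_real t - z * of_real (cosh t))) / 2) holomorphic_on UNIV"
    by (intro holomorphic_intros) auto
  then show ?thesis
    by (rule holomorphic_transform) (simp add: bessel_K_eq_integral assms)
qed

lemma powr_le_exp:
  fixes u \<rho> :: real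
  assumes "u > 0" "0 \<le> \<rho>" "\<rho> \<le> 1"
  shows "u powr \<rho> \<le> exp u"
proof -
  have "\<rho> * ln u \<le> u"
  proof (cases "u \<ge> 1")
    case True
    then have "\<rho> * ln u \<le> 1 * ln u" using assms by (intro mult_right_mono) auto
    also have "ln u \<le> u" using ln_bound assms by simp
    finally show ?thesis by simp
  next
    case False
    then have "\<rho> * ln u \<le> 0" using assms by (intro mult_nonneg_nonpos) auto
    then show ?thesis using assms by simp
  qed
  then show ?thesis using assms by (simp add: powr_def)
qed

text \<open>
  One bound for all orders in a strip: it serves as dominating function both for limits in the
  order and for integrals over the argument. The loss \<open>r < \<rho>\<close> is harmless because every strip
  below is open.
\<close>
lemma norm_bessel_K_le:
  assumes "r < \<rho>" "0 \<le> \<rho>" "\<rho> \<le> 1"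
  obtains C where "C \<ge> 0"
    "\<And>\<nu> z. \<bar>Re \<nu>\<bar> \<le> r \<Longrightarrow> Re z > 0 \<Longrightarrow> norm (bessel_K \<nu> z) \<le> C * Re z powr (- \<rho>) * exp (- Re z / 2)"
proof
  define D where "D = (LBINT t::real. exp (- (\<rho> - r) * \<bar>t\<bar>))"
  have D: "integrable lborel (\<lambda>t::real. exp (- (\<rho> - r) * \<bar>t\<bar>))"
    by (rule integrable_exp_neg_abs) (use assms in auto)
  show "4 powr \<rho> * D / 2 \<ge> 0" by (simp add: D_def)
  fix \<nu> z :: complex assume \<nu>: "\<bar>Re \<nu>\<bar> \<le> r" and z: "Re z > 0"
  define x where "x = Re z"
  have x: "x > 0" using z by (simp add: x_def)
  define G where "G = (\<lambda>t::real. 4 powr \<rho> * x powr (- \<rho>) * exp (- x / 2) * exp (- (\<rho> - r) * \<bar>t\<bar>))"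
  have "norm (exp (\<nu> * of_real t - z * of_real (cosh t))) \<le> G t" for t :: real
  proof -
    have "norm (exp (\<nu> * of_real t - z * of_real (cosh t))) \<le> exp (r * \<bar>t\<bar> - x * cosh t)"
      by (rule order_trans[OF norm_bessel_kernel]) (use \<nu> in \<open>auto simp: x_def intro!: mult_right_mono\<close>)
    \<comment> \<open>One half of \<open>cosh t\<close> is at least 1/2 and supplies the decay in \<open>x\<close>; the other half is at least \<open>exp \<bar>t\<bar> / 4\<close> and supplies the decay in \<open>t\<close>.\<close>
    also have "\<dots> \<le> exp (r * \<bar>t\<bar> - x / 2 - x / 4 * exp \<bar>t\<bar>)"
    proof -
      have "x * 1 \<le> x * cosh t" using x by (intro mult_left_mono) (auto simp: cosh_real_ge_1)
      moreover have "x * exp \<bar>t\<bar> \<le> x * (2 * cosh t)" using x by (intro mult_left_mono exp_abs_le_cosh) auto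
      ultimately show ?thesis by simp
    qed
    also have "\<dots> = exp (r * \<bar>t\<bar>) * exp (- x / 2) * (1 / exp (x / 4 * exp \<bar>t\<bar>))"
    proof -
      have "exp (- x / 2) = 1 / exp (x / 2)" using exp_minus[of "x / 2"] by (simp add: inverse_eq_divide)
      then show ?thesis by (simp only: exp_diff) simp
    qed
    also have "\<dots> \<le> exp (r * \<bar>t\<bar>) * exp (- x / 2) * (1 / (x / 4 * exp \<bar>t\<bar>) powr \<rho>)"
      using x assms by (intro mult_left_mono divide_left_mono powr_le_exp mult_pos_pos) auto
    also have "(x / 4 * exp \<bar>t\<bar>) powr \<rho> = x powr \<rho> * exp (\<rho> * \<bar>t\<bar>) / 4 powr \<rho>"
      using x by (simp add: powr_mult powr_divide powr_def[of "exp _"])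
    also have "exp (r * \<bar>t\<bar>) * exp (- x / 2) * (1 / \<dots>) = G t"
      using x by (simp add: G_def powr_minus field_simps exp_diff exp_minus)
    finally show ?thesis .
  qed
  then have "norm (LBINT t. exp (\<nu> * of_real t - z * of_real (cosh t))) \<le> (LBINT t. G t)"
    using D by (intro Bochner_Integration.integral_norm_bound_integral integrable_bessel_kernel[OF z]) (auto simp: G_def)
  also have "(LBINT t. G t) = 4 powr \<rho> * x powr (- \<rho>) * exp (- x / 2) * D"
    by (simp add: G_def D_def)
  finally show "norm (bessel_K \<nu> z) \<le> 4 powr \<rho> * D / 2 * Re z powr (- \<rho>) * exp (- Re z / 2)"
    by (simp add: bessel_K_eq_integral[OF z] norm_divide x_def mult_ac)
qed

section \<open>The power series of the Bessel function\<close>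

text \<open>
  Shifting the integration variable by \<open>ln (x/2)\<close> gives
  \<open>K\<^sub>\<beta>(x) = (x/2) powr (- \<beta>) * macdonald_int \<beta> (x^2/4) / 2\<close>. In this normalisation the
  derivative in \<open>y\<close> lowers the order by one, up to sign, and for \<open>Re \<beta> > 0\<close> the limit at \<open>y = 0\<close>
  is \<open>Gamma \<beta>\<close>.
\<close>
definition macdonald_int :: "complex \<Rightarrow> complex \<Rightarrow> complex" where
  "macdonald_int \<beta> y = (LBINT u. exp (\<beta> * of_real u - of_real (exp u) - y * of_real (exp (-u))))"

lemma norm_macdonald_kernel_le:
  assumes "Re y > 0" "0 < c" "c \<le> 1" "c \<le> Re y"
  shows "norm (exp (\<beta> * of_real u - of_real (exp u) - y * of_real (exp (-u)))) \<le> exp (\<bar>Re \<beta>\<bar> * \<bar>u\<bar> - 2 * c * cosh u)"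
proof -
  have "Re \<beta> * u \<le> \<bar>Re \<beta>\<bar> * \<bar>u\<bar>" by (metis abs_ge_self abs_mult)
  moreover have "c * exp u \<le> 1 * exp u" "c * exp (-u) \<le> Re y * exp (-u)" using assms by (intro mult_right_mono; simp)+
  moreover have "2 * c * cosh u = c * exp u + c * exp (-u)" by (simp add: cosh_def algebra_simps)
  ultimately have "Re \<beta> * u - exp u - Re y * exp (-u) \<le> \<bar>Re \<beta>\<bar> * \<bar>u\<bar> - 2 * c * cosh u" by linarith
  then show ?thesis by simp
qed

lemma has_field_derivative_macdonald_int:
  assumes "Re y > 0"
  shows "(macdonald_int \<beta> has_field_derivative - macdonald_int (\<beta> - 1) y) (at y)"
proof -
  define c where "c = min 1 (Re y / 2)"
  define f where "f y u = exp (\<beta> * of_real u - of_real (exp u) - y * of_real (exp (-u)))" for y and u :: real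
  have ball: "Re z \<ge> Re y / 2 \<and> Re z > 0" if "z \<in> ball y (Re y / 2)" for z
    using that complex_Re_le_cmod[of "y - z"] assms by (auto simp: dist_norm)
  have D: "((\<lambda>z. f z u) has_field_derivative - of_real (exp (-u)) * f z u) (at z)" for z u
    unfolding f_def by (auto intro!: derivative_eq_intros)
  have "((\<lambda>z. \<integral>u. f z u \<partial>lborel) has_field_derivative (\<integral>u. deriv (\<lambda>z. f z u) y \<partial>lborel)) (at y)"
  proof (rule has_field_derivative_integral)
    show "integrable lborel (\<lambda>u. exp (\<bar>Re \<beta>\<bar> * \<bar>u\<bar> - 2 * c * cosh u))"
      by (rule integrable_exp_abs_cosh) (use assms in \<open>simp add: c_def\<close>)
    show "norm (f z u) \<le> exp (\<bar>Re \<beta>\<bar> * \<bar>u\<bar> - 2 * c * cosh u)" if "z \<in> ball y (Re y / 2)" for z u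
      unfolding f_def by (rule norm_macdonald_kernel_le) (use ball[OF that] assms in \<open>auto simp: c_def\<close>)
    show "(\<lambda>z. f z u) holomorphic_on ball y (Re y / 2)" for u
      unfolding f_def by (intro holomorphic_intros)
    show "f z \<in> borel_measurable lborel" for z by (simp add: f_def[abs_def])
  qed (use assms in auto)
  also have "(\<integral>u. deriv (\<lambda>z. f z u) y \<partial>lborel) = (\<integral>u. - exp ((\<beta> - 1) * of_real u - of_real (exp u) - y * of_real (exp (-u))) \<partial>lborel)"
  proof (rule Bochner_Integration.integral_cong)
    fix u :: real
    have "deriv (\<lambda>z. f z u) y = - (of_real (exp (-u)) * f y u)" using D[of u y] DERIV_imp_deriv by fastforce
    also have "of_real (exp (-u)) * f y u = exp (of_real (-u) + (\<beta> * of_real u - of_real (exp u) - y * of_real (exp (-u))))"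
      by (simp only: f_def exp_of_real [symmetric] mult_exp_exp)
    finally show "deriv (\<lambda>z. f z u) y = - exp ((\<beta> - 1) * of_real u - of_real (exp u) - y * of_real (exp (-u)))"
      by (simp add: algebra_simps)
  qed simp
  finally show ?thesis by (simp add: macdonald_int_def[abs_def] f_def)
qed

text \<open>
  The substitution \<open>u \<mapsto> ln y - u\<close> exchanges the two exponentials in the exponent.
\<close>
lemma macdonald_int_reflect:
  assumes "y > 0"
  shows "macdonald_int \<beta> (of_real y) = of_real y powr \<beta> * macdonald_int (- \<beta>) (of_real y)"
proof -
  define f where "f \<beta> u = exp (\<beta> * of_real u - of_real (exp u) - of_real y * of_real (exp (-u)))" for \<beta> :: complex and u :: real
  have "f \<beta> (ln y - u) = of_real y powr \<beta> * f (- \<beta>) u" for u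
  proof -
    have "of_real y powr \<beta> = exp (\<beta> * of_real (ln y))"
      using assms by (simp add: powr_def Ln_of_real)
    then have "of_real y powr \<beta> * f (- \<beta>) u = exp (\<beta> * of_real (ln y) + (- \<beta> * of_real u - of_real (exp u) - of_real y * of_real (exp (-u))))"
      by (simp only: f_def mult_exp_exp)
    also have "\<dots> = f \<beta> (ln y - u)"
      using assms by (simp add: f_def exp_diff exp_minus field_simps)
    finally show ?thesis by simp
  qed
  then have "(LBINT u. f \<beta> u) = (LBINT u. of_real y powr \<beta> * f (- \<beta>) u)"
    using lborel_integral_reflect[of "f \<beta>" "ln y"] by simp
  then show ?thesis by (simp add: macdonald_int_def f_def)
qed

lemma macdonald_int_limit_0:
  assumes "Re \<beta> > 0"
  shows "((\<lambda>y. macdonald_int \<beta> (of_real y)) \<longlongrightarrow> Gamma \<beta>) (at_right 0)"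
  unfolding tendsto_at_iff_sequentially o_def
proof (intro allI impI)
  fix X :: "nat \<Rightarrow> real" assume X: "\<forall>n. X n \<in> {0<..} - {0}" "X \<longlonglongrightarrow> 0"
  have "(\<lambda>n. LBINT u. exp (\<beta> * of_real u - of_real (exp u) - of_real (X n) * of_real (exp (-u))))
     \<longlonglongrightarrow> (LBINT u. exp (\<beta> * of_real u - of_real (exp u)))"
  proof (rule integral_dominated_convergence)
    show "integrable lborel (\<lambda>u. norm (exp (\<beta> * of_real u - of_real (exp u))))"
      by (intro integrable_norm integral_exp_Gamma_1 assms)
    have "(\<lambda>n. exp (\<beta> * of_real u - of_real (exp u) - of_real (X n) * of_real (exp (-u))))
       \<longlonglongrightarrow> exp (\<beta> * of_real u - of_real (exp u) - of_real 0 * of_real (exp (-u)))" for u :: real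
      by (intro tendsto_intros X)
    then show "AE u in lborel. (\<lambda>n. exp (\<beta> * of_real u - of_real (exp u) - of_real (X n) * of_real (exp (-u))))
       \<longlonglongrightarrow> exp (\<beta> * of_real u - of_real (exp u))" by simp
    have "0 \<le> X n" for n using X(1) by (simp add: less_imp_le)
    then show "AE u in lborel. norm (exp (\<beta> * of_real u - of_real (exp u) - of_real (X n) * of_real (exp (-u))))
        \<le> norm (exp (\<beta> * of_real u - of_real (exp u)))" for n by simp
  qed auto
  then show "(\<lambda>n. macdonald_int \<beta> (of_real (X n))) \<longlonglongrightarrow> Gamma \<beta>"
    by (simp add: macdonald_int_def integral_exp_Gamma_1(2)[OF assms])
qed

lemma bessel_K_eq_macdonald_int:
  assumes "x > 0"
  shows "bessel_K \<alpha> (of_real x) = of_real (x / 2) powr (- \<alpha>) * macdonald_int \<alpha> (of_real (x\<^sup>2 / 4)) / 2"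
proof -
  define f where "f t = exp (\<alpha> * of_real t - of_real x * of_real (cosh t))" for t
  have "of_real (x / 2) powr (- \<alpha>) * exp (\<alpha> * of_real u - of_real (exp u) - of_real (x\<^sup>2 / 4) * of_real (exp (-u))) = f (u + - ln (x / 2))" for u
  proof -
    have c: "x * cosh (u + - ln (x / 2)) = exp u + x\<^sup>2 / 4 * exp (-u)"
      using assms by (simp add: cosh_def exp_diff exp_minus exp_add field_simps power2_eq_square)
    have "of_real (x / 2) powr (- \<alpha>) * exp (\<alpha> * of_real u - of_real (exp u) - of_real (x\<^sup>2 / 4) * of_real (exp (-u)))
       = exp (- \<alpha> * of_real (ln (x / 2)) + (\<alpha> * of_real u - of_real (exp u) - of_real (x\<^sup>2 / 4) * of_real (exp (-u))))"
    proof -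
      have "of_real (x / 2) powr (- \<alpha>) = exp (- \<alpha> * of_real (ln (x / 2)))"
        using assms by (simp add: powr_def Ln_of_real [symmetric])
      then show ?thesis by (simp only: mult_exp_exp)
    qed
    also have "\<dots> = exp (\<alpha> * of_real (u + - ln (x / 2)) - of_real (exp u + x\<^sup>2 / 4 * exp (-u)))"
      by (simp add: algebra_simps)
    also have "\<dots> = f (u + - ln (x / 2))" unfolding c [symmetric] by (simp add: f_def)
    finally show ?thesis .
  qed
  then have "(LBINT t. f t) = of_real (x / 2) powr (- \<alpha>) * macdonald_int \<alpha> (of_real (x\<^sup>2 / 4))"
    using lborel_integral_shift[of f "- ln (x / 2)"] by (simp add: macdonald_int_def flip: integral_mult_right_zero)
  then show ?thesis using assms by (simp add: bessel_K_eq_integral f_def)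
qed

definition bessel_coeff :: "complex \<Rightarrow> nat \<Rightarrow> complex" where
  "bessel_coeff \<beta> k = 1 / (fact k * pochhammer (1 + \<beta>) k)"

text \<open>
  The hypergeometric function \<open>0F1\<close> with lower parameter \<open>1 + \<beta>\<close>; up to a power of \<open>x\<close> and a
  Gamma factor, \<open>bessel_series \<beta> (x^2/4)\<close> is the modified Bessel function \<open>I\<^sub>\<beta>(x)\<close>.
\<close>
definition bessel_series :: "complex \<Rightarrow> complex \<Rightarrow> complex" where
  "bessel_series \<beta> y = (\<Sum>k. bessel_coeff \<beta> k * y ^ k)"

lemma bessel_coeff_0 [simp]: "bessel_coeff \<beta> 0 = 1" by (simp add: bessel_coeff_def)

lemma bessel_coeff_Suc: "bessel_coeff \<beta> (Suc k) = bessel_coeff \<beta> k / (of_nat (Suc k) * (1 + \<beta> + of_nat k))"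
  by (simp add: bessel_coeff_def pochhammer_Suc field_simps)

lemma summable_bessel_series: "summable (\<lambda>k. bessel_coeff \<beta> k * y ^ k)"
proof (rule summable_ratio_test[of "1/2" "nat \<lceil>norm (1 + \<beta>) + 2 * norm y\<rceil> + 1"])
  fix k assume k: "k \<ge> nat \<lceil>norm (1 + \<beta>) + 2 * norm y\<rceil> + 1"
  have k': "real k \<ge> norm (1 + \<beta>) + 2 * norm y + 1" using k by linarith
  have "real k - norm (1 + \<beta>) \<le> norm (1 + \<beta> + of_nat k)"
    using norm_diff_ineq[of "of_nat k" "1 + \<beta>"] by (simp add: add.commute)
  with k' have 1: "2 * norm y + 1 \<le> norm (1 + \<beta> + of_nat k)" by simp
  have "2 * norm y * 1 \<le> norm (1 + \<beta> + of_nat k) * real (Suc k)"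
    using 1 by (intro mult_mono) auto
  moreover have "0 < norm (1 + \<beta> + of_nat k) * real (Suc k)"
    using 1 norm_ge_zero[of y] by (intro mult_pos_pos; linarith)
  ultimately have "norm y / (norm (1 + \<beta> + of_nat k) * real (Suc k)) \<le> 1 / 2"
    by (subst pos_divide_le_eq) (simp_all del: of_nat_Suc)
  then have "norm (y / (of_nat (Suc k) * (1 + \<beta> + of_nat k))) \<le> 1 / 2"
    unfolding norm_divide norm_mult norm_of_nat by (simp only: mult.commute)
  then have "norm (bessel_coeff \<beta> k * y ^ k) * norm (y / (of_nat (Suc k) * (1 + \<beta> + of_nat k))) \<le> norm (bessel_coeff \<beta> k * y ^ k) * (1 / 2)"
    by (rule mult_left_mono) simp
  then show "norm (bessel_coeff \<beta> (Suc k) * y ^ Suc k) \<le> 1 / 2 * norm (bessel_coeff \<beta> k * y ^ k)"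
    by (simp add: bessel_coeff_Suc norm_mult norm_divide mult_ac del: of_nat_Suc)
qed simp

lemma bessel_series_0 [simp]: "bessel_series \<beta> 0 = 1"
proof -
  have "(\<lambda>k. bessel_coeff \<beta> k * 0 ^ k) sums bessel_coeff \<beta> 0" using powser_sums_zero by blast
  then show ?thesis by (simp add: bessel_series_def sums_iff)
qed

lemma has_field_derivative_bessel_series: 
  "(bessel_series \<beta> has_field_derivative (\<Sum>k. diffs (bessel_coeff \<beta>) k * y ^ k)) (at y)"
  unfolding bessel_series_def by (rule termdiffs_strong_converges_everywhere) (rule summable_bessel_series)

lemma diffs_bessel_coeff: "diffs (bessel_coeff \<beta>) k = bessel_coeff (\<beta> + 1) k / (1 + \<beta>)"
  by (simp add: diffs_def bessel_coeff_def pochhammer_rec add_ac del: of_nat_Suc)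

lemma has_field_derivative_bessel_series': 
  "(bessel_series \<beta> has_field_derivative bessel_series (\<beta> + 1) y / (1 + \<beta>)) (at y)"
proof -
  have "(\<lambda>k. bessel_coeff (\<beta> + 1) k * y ^ k / (1 + \<beta>)) sums (bessel_series (\<beta> + 1) y / (1 + \<beta>))"
    unfolding bessel_series_def by (intro sums_divide summable_sums summable_bessel_series)
  then have "(\<Sum>k. diffs (bessel_coeff \<beta>) k * y ^ k) = bessel_series (\<beta> + 1) y / (1 + \<beta>)"
    by (simp add: diffs_bessel_coeff sums_iff)
  then show ?thesis using has_field_derivative_bessel_series by metis
qed

text \<open>
  The left-hand side is \<open>y powr (1 - \<beta>)\<close> times the derivative of \<open>y powr \<beta> * bessel_series \<beta> y\<close>,
  so this is the rule that differentiation lowers the order, in agreement with \<open>macdonald_int\<close>.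
\<close>
lemma bessel_series_recurrence:
  assumes "Re \<beta> > 0"
  shows "\<beta> * bessel_series \<beta> y + y * bessel_series (\<beta> + 1) y / (1 + \<beta>) = \<beta> * bessel_series (\<beta> - 1) y"
proof -
  have d: "bessel_series (\<beta> + 1) y / (1 + \<beta>) = (\<Sum>k. diffs (bessel_coeff \<beta>) k * y ^ k)"
    using has_field_derivative_bessel_series has_field_derivative_bessel_series' DERIV_unique by blast
  have sd: "summable (\<lambda>k. diffs (bessel_coeff \<beta>) k * y ^ k)"
    using summable_divide[OF summable_bessel_series[of "\<beta> + 1" y], of "1 + \<beta>"] by (simp add: diffs_bessel_coeff)
  have "(\<lambda>k. of_nat k * bessel_coeff \<beta> k * y ^ (k - Suc 0)) sums (bessel_series (\<beta> + 1) y / (1 + \<beta>))"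
    using diffs_equiv[OF sd] d by simp
  then have "(\<lambda>k. y * (of_nat k * bessel_coeff \<beta> k * y ^ (k - Suc 0))) sums (y * (bessel_series (\<beta> + 1) y / (1 + \<beta>)))"
    by (rule sums_mult)
  moreover have "(\<lambda>k. y * (of_nat k * bessel_coeff \<beta> k * y ^ (k - Suc 0))) = (\<lambda>k. of_nat k * bessel_coeff \<beta> k * y ^ k)"
  proof
    show "y * (of_nat k * bessel_coeff \<beta> k * y ^ (k - Suc 0)) = of_nat k * bessel_coeff \<beta> k * y ^ k" for k
      by (cases k) auto
  qed
  ultimately have "(\<lambda>k. of_nat k * bessel_coeff \<beta> k * y ^ k) sums (y * bessel_series (\<beta> + 1) y / (1 + \<beta>))" by simp
  moreover have "(\<lambda>k. \<beta> * (bessel_coeff \<beta> k * y ^ k)) sums (\<beta> * bessel_series \<beta> y)"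
    unfolding bessel_series_def by (intro sums_mult summable_sums summable_bessel_series)
  ultimately have "(\<lambda>k. \<beta> * (bessel_coeff \<beta> k * y ^ k) + of_nat k * bessel_coeff \<beta> k * y ^ k) sums (\<beta> * bessel_series \<beta> y + y * bessel_series (\<beta> + 1) y / (1 + \<beta>))"
    by (intro sums_add)
  moreover have "\<beta> * (bessel_coeff \<beta> k * y ^ k) + of_nat k * bessel_coeff \<beta> k * y ^ k = \<beta> * (bessel_coeff (\<beta> - 1) k * y ^ k)" for k
  proof -
    have nz: "\<beta> + of_nat j \<noteq> 0" for j using assms by (auto simp: complex_eq_iff)
    then have p: "pochhammer \<beta> k \<noteq> 0" for k
      by (auto simp: pochhammer_eq_0_iff add_eq_0_iff) (metis add.right_inverse)
    have "\<beta> * pochhammer (1 + \<beta>) k = pochhammer \<beta> k * (\<beta> + of_nat k)"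
      by (metis pochhammer_rec pochhammer_rec' add.commute mult.commute)
    moreover from this have "pochhammer (1 + \<beta>) k \<noteq> 0" using p[of k] nz[of k] by auto
    ultimately have "(\<beta> + of_nat k) / pochhammer (1 + \<beta>) k = \<beta> / pochhammer \<beta> k"
      using p[of k] by (simp add: field_simps)
    moreover have "\<beta> * (bessel_coeff \<beta> k * y ^ k) + of_nat k * bessel_coeff \<beta> k * y ^ k = (\<beta> + of_nat k) / pochhammer (1 + \<beta>) k * y ^ k / fact k"
      by (simp add: bessel_coeff_def add_divide_distrib algebra_simps)
    ultimately show ?thesis by (simp add: bessel_coeff_def)
  qed
  ultimately have "(\<lambda>k. \<beta> * (bessel_coeff (\<beta> - 1) k * y ^ k)) sums (\<beta> * bessel_series \<beta> y + y * bessel_series (\<beta> + 1) y / (1 + \<beta>))" by simp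
  moreover have "(\<lambda>k. \<beta> * (bessel_coeff (\<beta> - 1) k * y ^ k)) sums (\<beta> * bessel_series (\<beta> - 1) y)"
    unfolding bessel_series_def by (intro sums_mult summable_sums summable_bessel_series)
  ultimately show ?thesis using sums_unique2 by blast
qed

text \<open>
  Both sides satisfy the same first order system, whose solution space is two-dimensional.
  Instead of a uniqueness theorem the proof uses the three Wronskian determinants of the
  integral solution and the two series solutions: they are constant, hence equal to their limits
  at the singular point 0, which are explicit.
\<close>
lemma macdonald_int_eq_series:
  assumes \<alpha>: "0 < Re \<alpha>" "Re \<alpha> < 1" and y: "y > 0"
  shows "macdonald_int \<alpha> (of_real y) = Gamma \<alpha> * bessel_series (- \<alpha>) (of_real y) + Gamma (- \<alpha>) * of_real y powr \<alpha> * bessel_series \<alpha> (of_real y)"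
proof -
  \<comment> \<open>The pairs \<open>(A, B)\<close>, \<open>(A1, B1)\<close> and \<open>(A2, B2)\<close> all solve \<open>P' = - y powr (\<alpha> - 1) * Q\<close>, \<open>Q' = - y powr (- \<alpha>) * P\<close>.\<close>
  define A where "A = macdonald_int \<alpha>"
  define B where "B = macdonald_int (1 - \<alpha>)"
  define A1 where "A1 = bessel_series (- \<alpha>)"
  define B1 where "B1 = (\<lambda>y. - (y powr (1 - \<alpha>) * bessel_series (1 - \<alpha>) y) / (1 - \<alpha>))"
  define A2 where "A2 = (\<lambda>y. y powr \<alpha> * bessel_series \<alpha> y)"
  define B2 where "B2 = (\<lambda>y. - \<alpha> * bessel_series (\<alpha> - 1) y)"
  have \<alpha>0: "\<alpha> \<noteq> 0" "1 - \<alpha> \<noteq> 0" using \<alpha> by auto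
  have dA: "(A has_field_derivative - (of_real y powr (\<alpha> - 1)) * B (of_real y)) (at (of_real y))" if "y > 0" for y
    using has_field_derivative_macdonald_int[of "of_real y" \<alpha>] macdonald_int_reflect[OF that, of "\<alpha> - 1"] that by (simp add: A_def B_def)
  have dB: "(B has_field_derivative - (of_real y powr (- \<alpha>)) * A (of_real y)) (at (of_real y))" if "y > 0" for y
    using has_field_derivative_macdonald_int[of "of_real y" "1 - \<alpha>"] macdonald_int_reflect[OF that, of "- \<alpha>"] that by (simp add: A_def B_def)
  have dA1: "(A1 has_field_derivative - (of_real y powr (\<alpha> - 1)) * B1 (of_real y)) (at (of_real y))" if "y > 0" for y :: real
  proof -
    have "complex_of_real y powr (\<alpha> - 1) * of_real y powr (1 - \<alpha>) = 1" using that by (simp add: powr_add [symmetric])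
    then have "- (of_real y powr (\<alpha> - 1)) * B1 (of_real y) = bessel_series (- \<alpha> + 1) (of_real y) / (1 + - \<alpha>)"
      by (simp add: B1_def mult.assoc [symmetric])
    then show ?thesis unfolding A1_def using has_field_derivative_bessel_series'[of "- \<alpha>" "of_real y"] by simp
  qed
  have dpow: "((\<lambda>z. z powr \<beta> * bessel_series \<beta> z) has_field_derivative \<beta> * of_real y powr (\<beta> - 1) * bessel_series (\<beta> - 1) (of_real y)) (at (of_real y))"
    if "y > 0" "Re \<beta> > 0" for y \<beta>
  proof -
    have y0: "complex_of_real y \<notin> \<real>\<^sub>\<le>\<^sub>0" using that by simp
    have p: "of_real y powr \<beta> = of_real y powr (\<beta> - 1) * (of_real y :: complex)" 
      using that by (simp add: powr_diff)
    have r: "\<beta> * bessel_series (\<beta> - 1) (of_real y) = \<beta> * bessel_series \<beta> (of_real y) + of_real y * bessel_series (\<beta> + 1) (of_real y) / (1 + \<beta>)"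
      using bessel_series_recurrence[OF that(2)] by simp
    have "((\<lambda>z. z powr \<beta> * bessel_series \<beta> z) has_field_derivative
       (\<beta> * of_real y powr (\<beta> - 1)) * bessel_series \<beta> (of_real y) + (bessel_series (\<beta> + 1) (of_real y) / (1 + \<beta>)) * of_real y powr \<beta>) (at (of_real y))"
      by (intro DERIV_mult has_field_derivative_powr y0 has_field_derivative_bessel_series')
    also have "(\<beta> * of_real y powr (\<beta> - 1)) * bessel_series \<beta> (of_real y) + (bessel_series (\<beta> + 1) (of_real y) / (1 + \<beta>)) * of_real y powr \<beta>
       = of_real y powr (\<beta> - 1) * (\<beta> * bessel_series (\<beta> - 1) (of_real y))"
      unfolding r p by (simp add: algebra_simps)
    finally show ?thesis by (simp add: mult_ac)
  qed
  have dB1: "(B1 has_field_derivative - (of_real y powr (- \<alpha>)) * A1 (of_real y)) (at (of_real y))" if "y > 0" for y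
    unfolding B1_def A1_def
    by (rule DERIV_cong[OF DERIV_cdivide[OF DERIV_minus[OF dpow[OF that, of "1 - \<alpha>"]]]]) (use \<alpha> \<alpha>0 in auto)
  have dA2: "(A2 has_field_derivative - (of_real y powr (\<alpha> - 1)) * B2 (of_real y)) (at (of_real y))" if "y > 0" for y
    unfolding A2_def B2_def
    by (rule DERIV_cong[OF dpow[OF that, of "\<alpha>"]]) (use \<alpha> in auto)
  have dB2: "(B2 has_field_derivative - (of_real y powr (- \<alpha>)) * A2 (of_real y)) (at (of_real y))" if "y > 0" for y
  proof -
    have "complex_of_real y powr (- \<alpha>) * of_real y powr \<alpha> = 1" using that by (simp add: powr_add [symmetric])
    then have e: "- (of_real y powr (- \<alpha>)) * A2 (of_real y) = - \<alpha> * (bessel_series (\<alpha> - 1 + 1) (of_real y) / (1 + (\<alpha> - 1)))"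
      using \<alpha>0 by (simp add: A2_def mult.assoc [symmetric])
    show ?thesis unfolding e unfolding B2_def by (intro DERIV_cmult has_field_derivative_bessel_series')
  qed
  have l0: "((\<lambda>y. complex_of_real y) \<longlongrightarrow> 0) (at_right 0)"
    by (intro tendsto_eq_intros) auto
  have lpow: "((\<lambda>y. complex_of_real y powr \<beta>) \<longlongrightarrow> 0) (at_right 0)" if "Re \<beta> > 0" for \<beta>
    by (rule tendsto_powr_complex_0[OF l0 tendsto_const that])
  have lser: "((\<lambda>y. bessel_series \<beta> (complex_of_real y)) \<longlongrightarrow> 1) (at_right 0)" for \<beta>
  proof -
    have "isCont (bessel_series \<beta>) 0" using has_field_derivative_bessel_series DERIV_isCont by blast
    then have "(bessel_series \<beta> \<longlongrightarrow> bessel_series \<beta> 0) (nhds 0)" by (simp add: isCont_def tendsto_nhds_iff)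
    then show ?thesis using filterlim_compose[OF _ l0] by simp
  qed
  have lA: "((\<lambda>y. A (of_real y)) \<longlongrightarrow> Gamma \<alpha>) (at_right 0)" unfolding A_def by (rule macdonald_int_limit_0[OF \<alpha>(1)])
  have lB: "((\<lambda>y. B (of_real y)) \<longlongrightarrow> Gamma (1 - \<alpha>)) (at_right 0)" unfolding B_def by (rule macdonald_int_limit_0) (use \<alpha> in simp)
  have lA1: "((\<lambda>y. A1 (of_real y)) \<longlongrightarrow> 1) (at_right 0)" unfolding A1_def by (rule lser)
  have lB1: "((\<lambda>y. B1 (of_real y)) \<longlongrightarrow> - (0 * 1) / (1 - \<alpha>)) (at_right 0)"
    unfolding B1_def by (intro tendsto_intros lpow lser) (use \<alpha> \<alpha>0 in auto)
  have lA2: "((\<lambda>y. A2 (of_real y)) \<longlongrightarrow> 0 * 1) (at_right 0)" unfolding A2_def by (intro tendsto_mult lpow lser \<alpha>)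
  have lB2: "((\<lambda>y. B2 (of_real y)) \<longlongrightarrow> - \<alpha> * 1) (at_right 0)" unfolding B2_def by (intro tendsto_intros lser)
  have wronskian: "P (of_real y) * Q' (of_real y) - P' (of_real y) * Q (of_real y) = p * q' - p' * q"
    if dP: "\<And>y. y > 0 \<Longrightarrow> (P has_field_derivative - (of_real y powr (\<alpha> - 1)) * P' (of_real y)) (at (of_real y))"
     and dP': "\<And>y. y > 0 \<Longrightarrow> (P' has_field_derivative - (of_real y powr (- \<alpha>)) * P (of_real y)) (at (of_real y))"
     and dQ: "\<And>y. y > 0 \<Longrightarrow> (Q has_field_derivative - (of_real y powr (\<alpha> - 1)) * Q' (of_real y)) (at (of_real y))"
     and dQ': "\<And>y. y > 0 \<Longrightarrow> (Q' has_field_derivative - (of_real y powr (- \<alpha>)) * Q (of_real y)) (at (of_real y))"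
     and lim: "((\<lambda>y. P (of_real y)) \<longlongrightarrow> p) (at_right 0)" "((\<lambda>y. P' (of_real y)) \<longlongrightarrow> p') (at_right 0)"
       "((\<lambda>y. Q (of_real y)) \<longlongrightarrow> q) (at_right 0)" "((\<lambda>y. Q' (of_real y)) \<longlongrightarrow> q') (at_right 0)"
    for P Q P' Q' :: "complex \<Rightarrow> complex" and p p' q q'
  proof -
    define W where "W y = P y * Q' y - P' y * Q y" for y
    have "((\<lambda>y. W (of_real y)) has_vector_derivative 0) (at y within {0<..})" if "y \<in> {0<..}" for y
    proof (rule has_vector_derivative_real_field)
      from that have y: "y > 0" by simp
      show "(W has_field_derivative 0) (at (of_real y))"
        unfolding W_def
        by (rule DERIV_cong[OF DERIV_diff[OF DERIV_mult[OF dP[OF y] dQ'[OF y]] DERIV_mult[OF dP'[OF y] dQ[OF y]]]])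
           (simp add: algebra_simps)
    qed
    then obtain c where c: "\<And>y. y \<in> {0<..} \<Longrightarrow> W (of_real y) = c"
      using has_vector_derivative_zero_constant[of "{0<..}" "\<lambda>y. W (of_real y)"] by auto
    have "((\<lambda>y. W (of_real y)) \<longlongrightarrow> p * q' - p' * q) (at_right 0)"
      unfolding W_def by (intro tendsto_intros lim)
    moreover have "((\<lambda>y. W (of_real y)) \<longlongrightarrow> c) (at_right 0)"
      by (rule tendsto_eventually) (use c in \<open>auto simp: eventually_at_filter\<close>)
    ultimately have "c = p * q' - p' * q" using tendsto_unique trivial_limit_at_right_real by blast
    then show ?thesis using c[of y] y by (simp add: W_def)
  qed
  define z where "z = complex_of_real y"
  have w1: "A z * B1 z - B z * A1 z = - Gamma (1 - \<alpha>)"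
    unfolding z_def by (subst wronskian[OF dA dB dA1 dB1 lA lB lA1 lB1]) auto
  have w2: "A z * B2 z - B z * A2 z = - \<alpha> * Gamma \<alpha>"
    unfolding z_def by (subst wronskian[OF dA dB dA2 dB2 lA lB lA2 lB2]) auto
  have w3: "A1 z * B2 z - B1 z * A2 z = - \<alpha>"
    unfolding z_def by (subst wronskian[OF dA1 dB1 dA2 dB2 lA1 lB1 lA2 lB2]) auto
  \<comment> \<open>The Pluecker relation expresses \<open>A\<close> through \<open>A1\<close> and \<open>A2\<close> with Wronskians as coefficients.\<close>
  have "A z * (A1 z * B2 z - B1 z * A2 z) = A1 z * (A z * B2 z - B z * A2 z) - A2 z * (A z * B1 z - B z * A1 z)"
    by (simp add: algebra_simps)
  then have "A z * - \<alpha> = A1 z * (- \<alpha> * Gamma \<alpha>) - A2 z * (- Gamma (1 - \<alpha>))" unfolding w1 w2 w3 .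
  moreover have "Gamma (1 - \<alpha>) = - \<alpha> * Gamma (- \<alpha>)"
  proof -
    have "- \<alpha> \<noteq> of_int n" for n
    proof
      assume "- \<alpha> = of_int n"
      then have "Re (- \<alpha>) = of_int n" by simp
      with \<alpha> have "-1 < n" "n < 0" by simp_all
      then show False by simp
    qed
    then have "- \<alpha> \<notin> \<int>\<^sub>\<le>\<^sub>0" by (auto simp: nonpos_Ints_def)
    then show ?thesis using Gamma_plus1[of "- \<alpha>"] by (simp add: add.commute)
  qed
  ultimately have "- \<alpha> * A z = - \<alpha> * (Gamma \<alpha> * A1 z + Gamma (- \<alpha>) * A2 z)" by (simp add: algebra_simps)
  then have "A z = Gamma \<alpha> * A1 z + Gamma (- \<alpha>) * A2 z" using \<alpha>0 by simp
  then show ?thesis by (simp add: A_def A1_def A2_def z_def mult.assoc)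
qed

text \<open>
  For \<open>Re \<beta> \<ge> - 1/2\<close> the Pochhammer symbol of \<open>1 + \<beta>\<close> is smallest in modulus at \<open>\<beta> = - 1/2\<close>,
  where the coefficient is \<open>4 ^ k / fact (2 * k)\<close>.
\<close>
lemma norm_bessel_coeff_le:
  assumes "Re \<beta> \<ge> - (1/2)"
  shows "norm (bessel_coeff \<beta> k) \<le> 4 ^ k / fact (2 * k)"
proof (induction k)
  case (Suc k)
  have "1/2 + real k \<le> norm (1 + \<beta> + of_nat k)"
    using complex_Re_le_cmod[of "1 + \<beta> + of_nat k"] assms by simp
  then have "norm (bessel_coeff \<beta> (Suc k)) \<le> (4 ^ k / fact (2 * k)) / (real (Suc k) * (1/2 + real k))"
    unfolding bessel_coeff_Suc norm_divide norm_mult norm_of_nat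
    using Suc by (intro frac_le mult_left_mono mult_pos_pos) auto
  also have "\<dots> = 4 ^ Suc k / fact (2 * Suc k)"
    by (simp add: divide_simps) (simp add: algebra_simps)
  finally show ?case .
qed simp

lemma bessel_series_continuous_order:
  assumes "X \<longlonglongrightarrow> \<beta>" "\<And>n. Re (X n) \<ge> - (1/2)" "Re \<beta> \<ge> - (1/2)"
  shows "(\<lambda>n::nat. bessel_series (X n) y) \<longlonglongrightarrow> bessel_series \<beta> y"
  unfolding bessel_series_def
proof (intro conjunct2[OF conjunct2[OF tannerys_theorem]])
  have nz: "pochhammer (1 + \<beta>) k \<noteq> 0" for k
  proof
    assume "pochhammer (1 + \<beta>) k = 0"
    then obtain j where "1 + \<beta> = - of_nat j" by (auto simp: pochhammer_eq_0_iff)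
    then have "Re (1 + \<beta>) = Re (- of_nat j)" by simp
    then show False using assms(3) by simp
  qed
  show "(\<lambda>n. bessel_coeff (X n) k * y ^ k) \<longlonglongrightarrow> bessel_coeff \<beta> k * y ^ k" for k
    using nz[of k] unfolding bessel_coeff_def pochhammer_prod by (intro tendsto_intros assms) auto
  show "\<forall>\<^sub>F (k, n) in sequentially \<times>\<^sub>F sequentially. norm (bessel_coeff (X n) k * y ^ k) \<le> (4 ^ k / fact (2 * k)) * norm y ^ k"
    using mult_right_mono[OF norm_bessel_coeff_le[OF assms(2)], of "norm y ^ _"]
    by (intro always_eventually) (simp add: norm_mult norm_power split_beta)
  show "summable (\<lambda>k. (4 ^ k / fact (2 * k)) * norm y ^ k)"
  proof (rule summable_comparison_test')
    show "summable (\<lambda>k. (4 * norm y) ^ k /\<^sub>R fact k)" using summable_exp_generic by blast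
    show "norm ((4 ^ k / fact (2 * k)) * norm y ^ k) \<le> (4 * norm y) ^ k /\<^sub>R fact k" for k
      using fact_mono[of k "2 * k", where 'a=real] by (simp add: power_mult_distrib divide_simps mult_left_mono)
  qed
qed simp

text \<open>
  For \<open>0 < Re \<alpha>\<close> this is the series for \<open>macdonald_int\<close>; the imaginary axis follows by
  continuity in the order, the left half of the strip because both sides are even in \<open>\<alpha>\<close>.
\<close>
lemma bessel_K_eq_series_real:
  assumes \<alpha>: "\<alpha> \<noteq> 0" "\<bar>Re \<alpha>\<bar> < 1/2" and x: "x > 0"
  shows "bessel_K \<alpha> (of_real x) = (Gamma \<alpha> * of_real (x/2) powr (- \<alpha>) * bessel_series (- \<alpha>) (of_real (x\<^sup>2/4))
      + Gamma (- \<alpha>) * of_real (x/2) powr \<alpha> * bessel_series \<alpha> (of_real (x\<^sup>2/4))) / 2" (is "_ = ?R \<alpha>")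
proof -
  have pos: "bessel_K \<alpha> (of_real x) = ?R \<alpha>" if "0 < Re \<alpha>" "Re \<alpha> < 1/2" for \<alpha>
  proof -
    have sq: "(x\<^sup>2/4) = (x/2) * (x/2)" by (simp add: power2_eq_square)
    have "complex_of_real (x/2) powr (- \<alpha>) * of_real (x\<^sup>2/4) powr \<alpha> = of_real (x/2) powr \<alpha>"
      unfolding sq of_real_mult using x by (subst powr_times_real) (auto simp: powr_add [symmetric] simp flip: of_real_divide)
    then show ?thesis
      using x that unfolding bessel_K_eq_macdonald_int[OF x] by (subst macdonald_int_eq_series) (auto simp: algebra_simps)
  qed
  have nonneg: "bessel_K \<alpha> (of_real x) = ?R \<alpha>" if "0 \<le> Re \<alpha>" "Re \<alpha> < 1/2" "\<alpha> \<noteq> 0" for \<alpha>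
  proof (cases "Re \<alpha> = 0")
    case True
    \<comment> \<open>The real part \<open>1 / (n + 3)\<close> of \<open>X n\<close> is positive and below 1/2.\<close>
    define X where "X n = \<alpha> + of_real (1 / (real n + 3))" for n
    have X: "X \<longlonglongrightarrow> \<alpha>"
    proof -
      have "(\<lambda>n. 1 / (real n + 3)) \<longlonglongrightarrow> 0" by real_asymp
      then have "(\<lambda>n. \<alpha> + of_real (1 / (real n + 3))) \<longlonglongrightarrow> \<alpha> + of_real 0" by (intro tendsto_intros)
      then show ?thesis by (simp add: X_def[abs_def])
    qed
    have Re_X: "0 < Re (X n)" "Re (X n) < 1/2" for n using True by (auto simp: X_def field_simps)
    have ne: "\<alpha> \<notin> \<int>\<^sub>\<le>\<^sub>0" "- \<alpha> \<notin> \<int>\<^sub>\<le>\<^sub>0" using that True by (auto simp: nonpos_Ints_def complex_eq_iff)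
    have x2: "complex_of_real x / 2 \<notin> \<real>\<^sub>\<le>\<^sub>0" using x by (simp add: complex_nonpos_Reals_iff)
    have "(\<lambda>n. ?R (X n)) \<longlonglongrightarrow> ?R \<alpha>"
      using Re_X x2 True
      by (intro tendsto_intros X ne bessel_series_continuous_order tendsto_minus) (auto simp: less_imp_le algebra_simps intro: order.trans[OF _ less_imp_le[OF Re_X(1)]])
    moreover have "(\<lambda>n. bessel_K (X n) (of_real x)) \<longlonglongrightarrow> bessel_K \<alpha> (of_real x)"
    proof -
      have "isCont (\<lambda>\<nu>. bessel_K \<nu> (of_real x)) \<alpha>"
        using holomorphic_on_imp_continuous_on[OF holomorphic_bessel_K_order[of "of_real x"]] x
        by (simp add: continuous_on_eq_continuous_at)
      then show ?thesis using X isCont_tendsto_compose by blast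
    qed
    moreover have "bessel_K (X n) (of_real x) = ?R (X n)" for n by (rule pos[OF Re_X])
    ultimately show ?thesis using LIMSEQ_unique by fastforce
  qed (use that pos in auto)
  show ?thesis
  proof (cases "Re \<alpha> \<ge> 0")
    case True
    then show ?thesis using nonneg \<alpha> by auto
  next
    case False
    then have "bessel_K (- \<alpha>) (of_real x) = ?R (- \<alpha>)" using nonneg[of "- \<alpha>"] \<alpha> by auto
    then show ?thesis by (simp add: bessel_K_minus add.commute)
  qed
qed

section \<open>The Mellin transform of the square of the Bessel function\<close>

text \<open>
  Fubini and translation invariance: for fixed \<open>p\<close> the shift by \<open>\<phi> p\<close> disappears.
\<close>
lemma integral_shear:
  fixes g h :: "real \<Rightarrow> complex" and \<phi> :: "real \<Rightarrow> real"
  assumes g: "integrable lborel g" and h: "integrable lborel h" and [measurable]: "\<phi> \<in> borel_measurable borel"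
  shows "integrable (lborel \<Otimes>\<^sub>M lborel) (\<lambda>(v, p). g (v + \<phi> p) * h p)"
    and "(LBINT v. LBINT p. g (v + \<phi> p) * h p) = (LBINT v. g v) * (LBINT p. h p)"
proof -
  have [measurable]: "g \<in> borel_measurable borel" "h \<in> borel_measurable borel"
    using g h by auto
  have sh: "(\<integral>\<^sup>+ v. norm (g (v + \<phi> p) * h p) \<partial>lborel) = (\<integral>\<^sup>+ v. norm (g v) \<partial>lborel) * ennreal (norm (h p))" for p
    using nn_integral_real_affine[of "\<lambda>v. norm (g v)" 1 "\<phi> p"]
    by (simp add: norm_mult ennreal_mult nn_integral_multc add.commute)
  have "(\<integral>\<^sup>+ z. norm (case z of (v, p) \<Rightarrow> g (v + \<phi> p) * h p) \<partial>(lborel \<Otimes>\<^sub>M lborel))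
      = (\<integral>\<^sup>+ p. \<integral>\<^sup>+ v. norm (g (v + \<phi> p) * h p) \<partial>lborel \<partial>lborel)"
    by (subst lborel_pair.nn_integral_snd [symmetric]) auto
  also have "\<dots> = (\<integral>\<^sup>+ v. norm (g v) \<partial>lborel) * (\<integral>\<^sup>+ p. norm (h p) \<partial>lborel)"
    by (simp add: sh nn_integral_cmult)
  also have "\<dots> < \<infinity>"
    using g h by (auto simp: integrable_iff_bounded ennreal_mult_less_top)
  finally show 1: "integrable (lborel \<Otimes>\<^sub>M lborel) (\<lambda>(v, p). g (v + \<phi> p) * h p)"
    by (intro integrableI_bounded) auto
  have "(LBINT v. LBINT p. g (v + \<phi> p) * h p) = (LBINT p. LBINT v. g (v + \<phi> p) * h p)"
    using lborel_pair.Fubini_integral[OF 1] by simp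
  also have "\<dots> = (LBINT p. (LBINT v. g v) * h p)"
    using lborel_integral_shift[of g] by simp
  also have "\<dots> = (LBINT v. g v) * (LBINT p. h p)" by simp
  finally show "(LBINT v. LBINT p. g (v + \<phi> p) * h p) = (LBINT v. g v) * (LBINT p. h p)" .
qed

lemma cosh_sum_diff: "cosh (p + q) + cosh (p - q) = 2 * cosh p * cosh (q::real)"
  by (simp add: cosh_add cosh_diff)

text \<open>
  Rotating the double integral of \<open>K\<^sub>\<alpha>(x)\<close> squared separates the order from the argument. This
  formula of Nicholson type is what makes the Mellin transform of the square computable.
\<close>
lemma bessel_K_square_eq_integral:
  assumes x: "x > 0"
  shows "bessel_K \<alpha> (of_real x) ^ 2 = (LBINT p. exp (2 * \<alpha> * of_real p) * bessel_K 0 (of_real (2 * x * cosh p)))"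
proof -
  define g where "g = (\<lambda>t. exp (\<alpha> * of_real t - of_real x * of_real (cosh t)))"
  have g: "integrable lborel g" unfolding g_def by (rule integrable_bessel_kernel) (use x in simp)
  have "g (p + q) * g (p - q) = exp (2 * \<alpha> * of_real p) * exp (0 * of_real q - of_real (2 * x * cosh p) * of_real (cosh q))" for p q
  proof -
    have "g (p + q) * g (p - q) = exp (2 * \<alpha> * of_real p - of_real x * of_real (cosh (p + q) + cosh (p - q)))"
      unfolding g_def mult_exp_exp by (simp add: algebra_simps)
    also have "\<dots> = exp (2 * \<alpha> * of_real p + (0 * of_real q - of_real (2 * x * cosh p) * of_real (cosh q)))"
      unfolding cosh_sum_diff by (simp add: mult_ac)
    finally show ?thesis by (simp only: mult_exp_exp)
  qed
  then have "(LBINT t. g t) * (LBINT t. g t) / 2 = (LBINT p. exp (2 * \<alpha> * of_real p) * (LBINT q. exp (0 * of_real q - of_real (2 * x * cosh p) * of_real (cosh q))))"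
    using integral_hyperbolic_rotation(2)[OF g g] by simp
  also have "\<dots> = (LBINT p. exp (2 * \<alpha> * of_real p) * (2 * bessel_K 0 (of_real (2 * x * cosh p))))"
  proof -
    have "(LBINT q. exp (0 * of_real q - of_real (2 * x * cosh p) * of_real (cosh q))) = 2 * bessel_K 0 (of_real (2 * x * cosh p))" for p
      by (subst bessel_K_eq_integral) (use x in \<open>simp_all add: cosh_real_pos\<close>)
    then show ?thesis by (simp only:)
  qed
  also have "\<dots> = (LBINT p. 2 * (exp (2 * \<alpha> * of_real p) * bessel_K 0 (of_real (2 * x * cosh p))))"
    by (simp only: mult.left_commute)
  also have "\<dots> = 2 * (LBINT p. exp (2 * \<alpha> * of_real p) * bessel_K 0 (of_real (2 * x * cosh p)))" by simp
  finally have "(LBINT t. g t) * (LBINT t. g t) = 4 * (LBINT p. exp (2 * \<alpha> * of_real p) * bessel_K 0 (of_real (2 * x * cosh p)))" by simp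
  then show ?thesis using x by (simp add: bessel_K_eq_integral power2_eq_square g_def)
qed

lemma integrable_cancel_factor:
  fixes c :: complex
  assumes "integrable M (\<lambda>x. c * f x)" "c \<noteq> 0"
  shows "integrable M f"
  using integrable_mult_right[OF assms(1), of "1 / c"] assms(2) by simp

text \<open>
  Here \<open>exp v * cosh t\<close> is a mean of \<open>exp (v + t)\<close> and \<open>exp (v - t)\<close>, so the double integral
  splits into two Gamma integrals.
\<close>
lemma Mellin_bessel_K_0:
  assumes s: "Re s > 0"
  shows "integrable lborel (\<lambda>v. exp (s * of_real v) * bessel_K 0 (of_real (exp v)))"
    and "(LBINT v. exp (s * of_real v) * bessel_K 0 (of_real (exp v))) = exp (s * of_real (ln 2)) * Gamma (s / 2) ^ 2 / 4"
proof -
  define g where "g = (\<lambda>m. exp (s / 2 * of_real m - of_real (1 / 2 * exp m)))"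
  have g: "integrable lborel g" "(LBINT m. g m) = Gamma (s / 2) * exp (s / 2 * of_real (ln 2))"
    using integral_exp_Gamma[of "s / 2" "1/2"] s by (simp_all add: g_def ln_div)
  have gg: "g (v + t) * g (v - t) = exp (s * of_real v) * exp (0 * of_real t - of_real (exp v) * of_real (cosh t))" for v t
  proof -
    have "exp v * cosh t = 1/2 * exp (v + t) + 1/2 * exp (v - t)"
      by (simp add: cosh_def exp_add exp_diff exp_minus field_simps)
    then have c: "complex_of_real (exp v) * of_real (cosh t) = of_real (1/2 * exp (v + t)) + of_real (1/2 * exp (v - t))"
      by (metis of_real_add of_real_mult)
    show ?thesis unfolding c g_def mult_exp_exp by (rule arg_cong[where f=exp]) (simp add: field_simps)
  qed
  have K: "(LBINT t. g (v + t) * g (v - t)) = 2 * (exp (s * of_real v) * bessel_K 0 (of_real (exp v)))" for v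
    unfolding gg by (simp add: bessel_K_eq_integral)
  have "integrable lborel (\<lambda>v. LBINT t. g (v + t) * g (v - t))"
    using lborel_pair.integrable_fst[OF integral_hyperbolic_rotation(1)[OF g(1) g(1)]] by simp
  then show "integrable lborel (\<lambda>v. exp (s * of_real v) * bessel_K 0 (of_real (exp v)))"
    unfolding K by (rule integrable_cancel_factor) simp
  have "2 * (LBINT v. exp (s * of_real v) * bessel_K 0 (of_real (exp v))) = (LBINT v. LBINT t. g (v + t) * g (v - t))"
    unfolding K by simp
  also have "\<dots> = (Gamma (s / 2) * exp (s / 2 * of_real (ln 2))) * (Gamma (s / 2) * exp (s / 2 * of_real (ln 2))) / 2"
    using integral_hyperbolic_rotation(2)[OF g(1) g(1)] g(2) by simp
  also have "\<dots> = exp (s / 2 * of_real (ln 2) + s / 2 * of_real (ln 2)) * Gamma (s / 2) ^ 2 / 2"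
    unfolding exp_add by (simp add: power2_eq_square)
  finally show "(LBINT v. exp (s * of_real v) * bessel_K 0 (of_real (exp v))) = exp (s * of_real (ln 2)) * Gamma (s / 2) ^ 2 / 4"
    by (simp add: mult.commute)
qed

text \<open>
  The beta integral in hyperbolic form: one Gamma integral in \<open>w\<close> produces the power of
  \<open>2 * cosh p\<close>, and the rotated double integral is a product of two Gamma integrals.
\<close>
lemma integral_cosh_powr:
  assumes s: "Re s > 2 * \<bar>Re \<alpha>\<bar>"
  shows "integrable lborel (\<lambda>p. exp (2 * \<alpha> * of_real p) * exp (- s * of_real (ln (2 * cosh p))))"
    and "(LBINT p. exp (2 * \<alpha> * of_real p) * exp (- s * of_real (ln (2 * cosh p)))) = Gamma (s/2 + \<alpha>) * Gamma (s/2 - \<alpha>) / (2 * Gamma s)"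
proof -
  have s0: "Re s > 0" using s by simp
  have G0: "Gamma s \<noteq> 0"
    using s0 by (auto simp: Gamma_eq_zero_iff nonpos_Ints_def)
  define g where "g = (\<lambda>m. exp ((s/2 + \<alpha>) * of_real m - of_real (exp m)))"
  define h where "h = (\<lambda>m. exp ((s/2 - \<alpha>) * of_real m - of_real (exp m)))"
  have g: "integrable lborel g" "(LBINT m. g m) = Gamma (s/2 + \<alpha>)"
    unfolding g_def using s by (auto intro!: integral_exp_Gamma_1)
  have h: "integrable lborel h" "(LBINT m. h m) = Gamma (s/2 - \<alpha>)"
    unfolding h_def using s by (auto intro!: integral_exp_Gamma_1)
  have gh: "g (w + p) * h (w - p) = exp (2 * \<alpha> * of_real p) * exp (s * of_real w - of_real (2 * cosh p * exp w))" for w p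
  proof -
    have "2 * cosh p * exp w = exp (w + p) + exp (w - p)"
      by (simp add: cosh_def exp_add exp_diff exp_minus field_simps)
    then have c: "complex_of_real (2 * cosh p * exp w) = of_real (exp (w + p)) + of_real (exp (w - p))"
      by (metis of_real_add)
    show ?thesis unfolding c g_def h_def mult_exp_exp by (rule arg_cong[where f=exp]) (simp add: field_simps)
  qed
  note int = integral_hyperbolic_rotation[OF g(1) h(1)]
  have inner: "(LBINT w. g (w + p) * h (w - p)) = Gamma s * (exp (2 * \<alpha> * of_real p) * exp (- s * of_real (ln (2 * cosh p))))" for p
    unfolding gh using integral_exp_Gamma(2)[OF s0, of "2 * cosh p"] by (simp add: cosh_real_pos)
  have "integrable lborel (\<lambda>p. LBINT w. g (w + p) * h (w - p))"
    using lborel_pair.integrable_snd[OF int(1)] by simp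
  then show "integrable lborel (\<lambda>p. exp (2 * \<alpha> * of_real p) * exp (- s * of_real (ln (2 * cosh p))))"
    unfolding inner by (rule integrable_cancel_factor) (rule G0)
  have "Gamma s * (LBINT p. exp (2 * \<alpha> * of_real p) * exp (- s * of_real (ln (2 * cosh p)))) = (LBINT p. LBINT w. g (w + p) * h (w - p))"
    unfolding inner by simp
  also have "\<dots> = (LBINT w. LBINT p. g (w + p) * h (w - p))"
    using lborel_pair.Fubini_integral[OF int(1)] by simp
  also have "\<dots> = Gamma (s/2 + \<alpha>) * Gamma (s/2 - \<alpha>) / 2" using int(2) g h by simp
  finally show "(LBINT p. exp (2 * \<alpha> * of_real p) * exp (- s * of_real (ln (2 * cosh p)))) = Gamma (s/2 + \<alpha>) * Gamma (s/2 - \<alpha>) / (2 * Gamma s)"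
    using G0 by (simp add: field_simps)
qed

definition mellin_K_square :: "complex \<Rightarrow> complex \<Rightarrow> complex" where
  "mellin_K_square \<alpha> s = exp (s * of_real (ln 2)) * Gamma (s/2 + \<alpha>) * Gamma (s/2 - \<alpha>) * Gamma (s/2) ^ 2 / (8 * Gamma s)"

text \<open>
  In the integral formula for the square the argument of \<open>K\<^sub>0\<close> is \<open>exp (v + ln (2 * cosh p))\<close>,
  so the shear separates the Mellin transform of \<open>K\<^sub>0\<close> from the beta integral.
\<close>
lemma Mellin_bessel_K_square_1:
  assumes s: "Re s > 2 * \<bar>Re \<alpha>\<bar>"
  shows "integrable lborel (\<lambda>v. exp (s * of_real v) * bessel_K \<alpha> (of_real (exp v)) ^ 2)"
    and "(LBINT v. exp (s * of_real v) * bessel_K \<alpha> (of_real (exp v)) ^ 2) = mellin_K_square \<alpha> s"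
proof -
  have s0: "Re s > 0" using s by simp
  define g where "g = (\<lambda>v. exp (s * of_real v) * bessel_K 0 (of_real (exp v)))"
  define h where "h = (\<lambda>p. exp (2 * \<alpha> * of_real p) * exp (- s * of_real (ln (2 * cosh p))))"
  have [measurable]: "(\<lambda>p::real. ln (2 * cosh p)) \<in> borel_measurable borel" by (simp add: cosh_def)
  note int = integral_shear[of g h "\<lambda>p. ln (2 * cosh p)"]
  have g: "integrable lborel g" "(LBINT v. g v) = exp (s * of_real (ln 2)) * Gamma (s / 2) ^ 2 / 4"
    using Mellin_bessel_K_0[OF s0] by (auto simp: g_def)
  have h: "integrable lborel h" "(LBINT p. h p) = Gamma (s/2 + \<alpha>) * Gamma (s/2 - \<alpha>) / (2 * Gamma s)"
    using integral_cosh_powr[OF s] by (auto simp: h_def)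
  have gh: "g (v + ln (2 * cosh p)) * h p = exp (s * of_real v) * (exp (2 * \<alpha> * of_real p) * bessel_K 0 (of_real (2 * exp v * cosh p)))" for v p
  proof -
    have e: "exp (v + ln (2 * cosh p)) = 2 * exp v * cosh p" by (simp add: exp_add cosh_real_pos)
    have "exp (s * of_real (v + ln (2 * cosh p))) * exp (- s * of_real (ln (2 * cosh p))) = exp (s * of_real v)"
      unfolding mult_exp_exp by (simp add: algebra_simps)
    moreover have "g (v + ln (2 * cosh p)) * h p = (exp (s * of_real (v + ln (2 * cosh p))) * exp (- s * of_real (ln (2 * cosh p))))
        * (exp (2 * \<alpha> * of_real p) * bessel_K 0 (of_real (exp (v + ln (2 * cosh p)))))"
      unfolding g_def h_def by (simp only: mult_ac)
    ultimately show ?thesis by (simp only: e)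
  qed
  have inner: "(LBINT p. g (v + ln (2 * cosh p)) * h p) = exp (s * of_real v) * bessel_K \<alpha> (of_real (exp v)) ^ 2" for v
    unfolding gh by (simp add: bessel_K_square_eq_integral)
  have "integrable lborel (\<lambda>v. LBINT p. g (v + ln (2 * cosh p)) * h p)"
    using lborel_pair.integrable_fst[OF int(1)] g h by simp
  then show "integrable lborel (\<lambda>v. exp (s * of_real v) * bessel_K \<alpha> (of_real (exp v)) ^ 2)"
    unfolding inner .
  show "(LBINT v. exp (s * of_real v) * bessel_K \<alpha> (of_real (exp v)) ^ 2) = mellin_K_square \<alpha> s"
  proof -
    have "(LBINT v. exp (s * of_real v) * bessel_K \<alpha> (of_real (exp v)) ^ 2) = (LBINT v. g v) * (LBINT p. h p)"
      using int(2)[OF g(1) h(1)] unfolding inner by simp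
    then show ?thesis unfolding g(2) h(2) by (simp add: mellin_K_square_def)
  qed
qed

lemma continuous_on_bessel_K_exp:
  assumes "Re z > 0"
  shows "continuous_on UNIV (\<lambda>v::real. bessel_K \<alpha> (z * of_real (exp v)))"
proof -
  have "continuous_on {z. Re z > 0} (bessel_K \<alpha>)"
    using holomorphic_bessel_K holomorphic_on_imp_continuous_on by blast
  then show ?thesis
    by (rule continuous_on_compose2) (use assms in \<open>auto intro!: continuous_intros\<close>)
qed

lemma measurable_bessel_K_exp [measurable]:
  assumes "Re z > 0"
  shows "(\<lambda>v::real. bessel_K \<alpha> (z * of_real (exp v))) \<in> borel_measurable borel"
  by (rule borel_measurable_continuous_onI[OF continuous_on_bessel_K_exp[OF assms]])

text \<open>
  The bound for \<open>K\<close> along the ray through \<open>z\<close>, locally uniform in \<open>z\<close> through the lower bound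
  \<open>m\<close> for its real part.
\<close>
lemma norm_bessel_K_exp_le:
  assumes "r < \<rho>" "0 \<le> \<rho>" "\<rho> \<le> 1"
  obtains C where "C \<ge> 0"
    "\<And>\<nu> z v m. \<bar>Re \<nu>\<bar> \<le> r \<Longrightarrow> 0 < m \<Longrightarrow> m \<le> Re z \<Longrightarrow>
       norm (bessel_K \<nu> (z * of_real (exp v))) \<le> C * m powr (- \<rho>) * exp (- \<rho> * v - m / 2 * exp v)"
proof -
  obtain C where C: "C \<ge> 0"
    "\<And>\<nu> z. \<bar>Re \<nu>\<bar> \<le> r \<Longrightarrow> Re z > 0 \<Longrightarrow> norm (bessel_K \<nu> z) \<le> C * Re z powr (- \<rho>) * exp (- Re z / 2)"
    using norm_bessel_K_le[OF assms] by blast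
  show ?thesis
  proof
    fix \<nu> z :: complex and v m :: real assume *: "\<bar>Re \<nu>\<bar> \<le> r" "0 < m" "m \<le> Re z"
    have "norm (bessel_K \<nu> (z * of_real (exp v))) \<le> C * (Re z * exp v) powr (- \<rho>) * exp (- (Re z * exp v) / 2)"
      using C(2)[OF *(1), of "z * of_real (exp v)"] * by simp
    also have "\<dots> \<le> C * (m * exp v) powr (- \<rho>) * exp (- (m * exp v) / 2)"
      using * C(1) assms by (intro mult_mono mult_left_mono powr_mono2') auto
    also have "(m * exp v) powr (- \<rho>) = m powr (- \<rho>) * exp (- \<rho> * v)"
      using * by (simp add: powr_mult powr_def[of "exp v"])
    also have "C * (m powr (- \<rho>) * exp (- \<rho> * v)) * exp (- (m * exp v) / 2) = C * m powr (- \<rho>) * exp (- \<rho> * v - m / 2 * exp v)"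
      by (simp add: mult_exp_exp mult.assoc)
    finally show "norm (bessel_K \<nu> (z * of_real (exp v))) \<le> \<dots>" .
  qed (rule C(1))
qed

text \<open>
  Stated for a general weight \<open>q\<close>: it is used with a pure exponential for the Mellin transform
  and with the second factor \<open>K\<^sub>\<alpha>(b x)\<close> squared for the integral of the theorem.
\<close>
lemma holomorphic_integral_bessel_K_square:
  fixes q :: "real \<Rightarrow> complex"
  assumes "\<bar>Re \<alpha>\<bar> < \<rho>" "\<rho> \<le> 1" and [measurable]: "q \<in> borel_measurable borel"
    and q: "\<And>m. m > 0 \<Longrightarrow> integrable lborel (\<lambda>v. norm (q v) * exp (- 2 * \<rho> * v - m * exp v))"
  shows "(\<lambda>z. LBINT v. q v * bessel_K \<alpha> (z * of_real (exp v)) ^ 2) holomorphic_on {z. Re z > 0}"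
proof (rule holomorphic_on_integral)
  show "open {z. Re z > 0}" by (rule open_halfspace_Re_gt)
  show "(\<lambda>z. q v * bessel_K \<alpha> (z * of_real (exp v)) ^ 2) holomorphic_on {z. Re z > 0}" for v
    by (intro holomorphic_intros holomorphic_on_compose_gen[OF _ holomorphic_bessel_K, unfolded o_def]) auto
  show "(\<lambda>v. q v * bessel_K \<alpha> (z * of_real (exp v)) ^ 2) \<in> borel_measurable lborel" if "z \<in> {z. Re z > 0}" for z
    using measurable_bessel_K_exp[of z \<alpha>] that by simp
  obtain C where C: "C \<ge> 0"
    "\<And>\<nu> z v m. \<bar>Re \<nu>\<bar> \<le> \<bar>Re \<alpha>\<bar> \<Longrightarrow> 0 < m \<Longrightarrow> m \<le> Re z \<Longrightarrow>
       norm (bessel_K \<nu> (z * of_real (exp v))) \<le> C * m powr (- \<rho>) * exp (- \<rho> * v - m / 2 * exp v)"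
  proof (rule norm_bessel_K_exp_le[OF assms(1) _ assms(2)])
    show "0 \<le> \<rho>" using assms(1) by linarith
  qed blast
  fix z0 :: complex assume "z0 \<in> {z. Re z > 0}"
  then have z0: "Re z0 > 0" by simp
  define m where "m = Re z0 / 2"
  define g where "g = (\<lambda>v. (C * m powr (- \<rho>))\<^sup>2 * (norm (q v) * exp (- 2 * \<rho> * v - m * exp v)))"
  have m: "m > 0" using z0 by (simp add: m_def)
  show "\<exists>r>0. \<exists>g. integrable lborel g \<and> (\<forall>z\<in>ball z0 r \<inter> {z. Re z > 0}. \<forall>v\<in>space lborel. norm (q v * bessel_K \<alpha> (z * of_real (exp v)) ^ 2) \<le> g v)"
  proof (intro exI conjI ballI)
    show "m > 0" by fact
    show "integrable lborel g" unfolding g_def using q[OF m] by simp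
    fix z v assume "z \<in> ball z0 m \<inter> {z. Re z > 0}"
    then have "Re z0 - Re z \<le> m" using complex_Re_le_cmod[of "z0 - z"] by (simp add: dist_norm)
    then have "m \<le> Re z" by (simp add: m_def)
    then have "norm (bessel_K \<alpha> (z * of_real (exp v))) ^ 2 \<le> (C * m powr (- \<rho>) * exp (- \<rho> * v - m / 2 * exp v)) ^ 2"
      using C(2)[of \<alpha> m z v] m by (intro power_mono) auto
    also have "\<dots> = (C * m powr (- \<rho>))\<^sup>2 * exp (- 2 * \<rho> * v - m * exp v)"
      by (simp add: power_mult_distrib exp_double [symmetric] algebra_simps)
    finally have "norm (q v) * norm (bessel_K \<alpha> (z * of_real (exp v))) ^ 2 \<le> norm (q v) * ((C * m powr (- \<rho>))\<^sup>2 * exp (- 2 * \<rho> * v - m * exp v))"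
      by (rule mult_left_mono) simp
    then show "norm (q v * bessel_K \<alpha> (z * of_real (exp v)) ^ 2) \<le> g v"
      by (simp add: norm_mult norm_power g_def mult_ac)
  qed
qed

lemma of_real_islimpt_Ioo:
  assumes "e > 0"
  shows "complex_of_real (e/2) islimpt (of_real ` {0<..<e})"
  unfolding islimpt_sequential
proof (intro exI conjI allI)
  show "(\<lambda>n. complex_of_real (e/2 + e / (2 * (real n + 2)))) \<longlonglongrightarrow> of_real (e/2)"
    by (intro tendsto_intros) real_asymp
  show "complex_of_real (e/2 + e / (2 * (real n + 2))) \<in> of_real ` {0<..<e} - {of_real (e/2)}" for n
  proof -
    define d where "d = e / (2 * (real n + 2))"
    have "d > 0" "d < e / 2" using assms by (auto simp: d_def field_simps add_pos_nonneg)
    then have "e/2 + d \<in> {0<..<e}" "e/2 + d \<noteq> e/2" using assms by auto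
    then have "e/2 + e / (2 * (real n + 2)) \<in> {0<..<e}" "e/2 + e / (2 * (real n + 2)) \<noteq> e/2" unfolding d_def .
    then show ?thesis by (metis DiffI image_eqI of_real_eq_iff singletonD)
  qed
qed

text \<open>
  For positive \<open>b\<close> this is the case \<open>b = 1\<close> shifted by \<open>ln b\<close>; both sides are holomorphic in
  \<open>b\<close>, so the identity theorem extends it to the half-plane.
\<close>
lemma Mellin_bessel_K_square:
  assumes s: "Re s > 2 * \<bar>Re \<alpha>\<bar>" and \<alpha>: "\<bar>Re \<alpha>\<bar> < 1/2" and b: "Re b > 0"
  shows "(LBINT v. exp (s * of_real v) * bessel_K \<alpha> (b * of_real (exp v)) ^ 2) = b powr (- s) * mellin_K_square \<alpha> s"
proof -
  define F where "F = (\<lambda>b. (LBINT v. exp (s * of_real v) * bessel_K \<alpha> (b * of_real (exp v)) ^ 2) - b powr (- s) * mellin_K_square \<alpha> s)"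
  obtain \<rho> where \<rho>: "\<bar>Re \<alpha>\<bar> < \<rho>" "\<rho> \<le> 1" "2 * \<rho> < Re s"
    using dense[of "\<bar>Re \<alpha>\<bar>" "min 1 (Re s / 2)"] s \<alpha> by auto
  have "F b = 0"
  proof (rule analytic_continuation[where f=F])
    have "(\<lambda>b. LBINT v. exp (s * of_real v) * bessel_K \<alpha> (b * of_real (exp v)) ^ 2) holomorphic_on {z. Re z > 0}"
    proof (rule holomorphic_integral_bessel_K_square[OF \<rho>(1,2)])
      fix m :: real assume m: "m > 0"
      have "integrable lborel (\<lambda>v. norm (exp (of_real (Re s - 2 * \<rho>) * of_real v - complex_of_real (m * exp v))))"
        by (intro integrable_norm integral_exp_Gamma(1) m) (use \<rho> in simp)
      then show "integrable lborel (\<lambda>v. norm (exp (s * of_real v)) * exp (- 2 * \<rho> * v - m * exp v))"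
        by (simp add: mult_exp_exp algebra_simps)
    qed simp
    then show "F holomorphic_on {z. Re z > 0}" unfolding F_def
      by (intro holomorphic_intros) (auto simp: complex_nonpos_Reals_iff)
    show "open {z. Re z > 0}" "connected {z. Re z > 0}" 
      by (auto intro!: open_halfspace_Re_gt convex_connected convex_halfspace_Re_gt)
    show "of_real ` {0<..<1} \<subseteq> {z. Re z > 0}" by auto
    show "of_real (1/2) \<in> {z. Re z > 0}" "b \<in> {z. Re z > 0}" using b by auto
    show "complex_of_real (1/2) islimpt of_real ` {0<..<1}" using of_real_islimpt_Ioo[of 1] by simp
    fix z :: complex assume "z \<in> of_real ` {0<..<1}"
    then obtain c where c: "z = of_real c" "c > 0" by auto
    define f where "f = (\<lambda>v. exp (s * of_real v) * bessel_K \<alpha> (of_real (exp v)) ^ 2)"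
    have p: "of_real c powr (- s) = exp (- s * of_real (ln c))" using c by (simp add: powr_def Ln_of_real)
    have "exp (s * of_real v) * bessel_K \<alpha> (z * of_real (exp v)) ^ 2 = exp (- s * of_real (ln c)) * f (v + ln c)" for v
    proof -
      have "exp (- s * of_real (ln c)) * exp (s * of_real (v + ln c)) = exp (s * of_real v)"
        unfolding mult_exp_exp by (simp add: algebra_simps)
      moreover have "exp (v + ln c) = c * exp v" using c by (simp add: exp_add)
      ultimately show ?thesis unfolding f_def mult.assoc [symmetric] c by simp
    qed
    then have "(LBINT v. exp (s * of_real v) * bessel_K \<alpha> (z * of_real (exp v)) ^ 2) = exp (- s * of_real (ln c)) * (LBINT v. f (v + ln c))"
      by simp
    also have "\<dots> = exp (- s * of_real (ln c)) * mellin_K_square \<alpha> s"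
      unfolding lborel_integral_shift using Mellin_bessel_K_square_1(2)[OF s] by (simp add: f_def)
    finally show "F z = 0" using p by (simp add: F_def c)
  qed
  then show ?thesis by (simp add: F_def)
qed

section \<open>Termwise integration\<close>

text \<open>
  The coefficients of a product of two \<open>0F1\<close> series, which is the classical \<open>2F3\<close> written with
  the Pochhammer symbol shifted by \<open>k\<close>.
\<close>
definition product_coeff :: "complex \<Rightarrow> complex \<Rightarrow> nat \<Rightarrow> complex" where
  "product_coeff \<mu> \<nu> k = pochhammer (\<mu> + \<nu> + 1 + of_nat k) k / (fact k * pochhammer (1 + \<mu>) k * pochhammer (1 + \<nu>) k)"

lemma pochhammer_nonzero:
  assumes "Re z > 0"
  shows "pochhammer z k \<noteq> 0"
proof
  assume "pochhammer z k = 0"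
  then obtain j where "z = - of_nat j" by (auto simp: pochhammer_eq_0_iff)
  then have "Re z = Re (- of_nat j)" by simp
  then show False using assms by simp
qed

text \<open>
  After extraction of the common denominator the Cauchy product is Vandermonde's convolution.
\<close>
lemma sum_bessel_coeff_bessel_coeff:
  assumes "Re \<mu> > -1" "Re \<nu> > -1"
  shows "(\<Sum>j\<le>k. bessel_coeff \<mu> j * bessel_coeff \<nu> (k - j)) = product_coeff \<mu> \<nu> k"
proof -
  define P where "P = pochhammer (1 + \<mu>) k * pochhammer (1 + \<nu>) k"
  have nz: "pochhammer (1 + \<mu>) i \<noteq> 0" "pochhammer (1 + \<nu>) i \<noteq> 0" for i
    using assms by (auto intro!: pochhammer_nonzero)
  have tm: "bessel_coeff \<mu> j * bessel_coeff \<nu> (k - j) = ((\<nu> + of_nat k gchoose j) * (\<mu> + of_nat k gchoose (k - j))) / P" if "j \<le> k" for j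
  proof -
    have "(\<nu> + of_nat k gchoose j) = pochhammer (1 + \<nu> + of_nat (k - j)) j / fact j"
      using that by (simp add: gbinomial_pochhammer' of_nat_diff algebra_simps)
    moreover have "(\<mu> + of_nat k gchoose (k - j)) = pochhammer (1 + \<mu> + of_nat j) (k - j) / fact (k - j)"
      using that by (simp add: gbinomial_pochhammer' of_nat_diff algebra_simps)
    moreover have "pochhammer (1 + \<mu>) k = pochhammer (1 + \<mu>) j * pochhammer (1 + \<mu> + of_nat j) (k - j)"
      by (rule pochhammer_product[OF that])
    moreover have "pochhammer (1 + \<nu>) k = pochhammer (1 + \<nu>) (k - j) * pochhammer (1 + \<nu> + of_nat (k - j)) j"
      using pochhammer_product[of "k - j" k "1 + \<nu>"] that by simp
    moreover note nz[of k]
    ultimately show ?thesis using nz[of j] nz[of "k - j"]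
      by (simp add: bessel_coeff_def P_def)
  qed
  have "(\<Sum>j\<le>k. bessel_coeff \<mu> j * bessel_coeff \<nu> (k - j)) = (\<Sum>j=0..k. (\<nu> + of_nat k gchoose j) * (\<mu> + of_nat k gchoose (k - j))) / P"
    unfolding atMost_atLeast0 sum_divide_distrib by (rule sum.cong) (auto simp: tm)
  also have "(\<Sum>j=0..k. (\<nu> + of_nat k gchoose j) * (\<mu> + of_nat k gchoose (k - j))) = (\<nu> + of_nat k + (\<mu> + of_nat k)) gchoose k"
    by (rule gbinomial_Vandermonde)
  also have "\<dots> = pochhammer (\<mu> + \<nu> + 1 + of_nat k) k / fact k"
    by (simp add: gbinomial_pochhammer' algebra_simps)
  finally show ?thesis by (simp add: product_coeff_def P_def)
qed

lemma bessel_series_mult_sums: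
  assumes "Re \<mu> > -1" "Re \<nu> > -1"
  shows "(\<lambda>k. product_coeff \<mu> \<nu> k * y ^ k) sums (bessel_series \<mu> y * bessel_series \<nu> y)"
proof -
  have abs: "summable (\<lambda>k. norm (bessel_coeff \<beta> k * y ^ k))" for \<beta>
    using powser_insidea[OF summable_bessel_series, of y "of_real (norm y + 1)" \<beta>] by simp
  have "(\<lambda>k. \<Sum>i\<le>k. (bessel_coeff \<mu> i * y ^ i) * (bessel_coeff \<nu> (k - i) * y ^ (k - i))) sums (bessel_series \<mu> y * bessel_series \<nu> y)"
    unfolding bessel_series_def by (rule Cauchy_product_sums[OF abs abs])
  also have "(\<lambda>k. \<Sum>i\<le>k. (bessel_coeff \<mu> i * y ^ i) * (bessel_coeff \<nu> (k - i) * y ^ (k - i))) = (\<lambda>k. product_coeff \<mu> \<nu> k * y ^ k)"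
  proof
    fix k
    have "(\<Sum>i\<le>k. (bessel_coeff \<mu> i * y ^ i) * (bessel_coeff \<nu> (k - i) * y ^ (k - i))) = (\<Sum>i\<le>k. (bessel_coeff \<mu> i * bessel_coeff \<nu> (k - i)) * y ^ k)"
      by (rule sum.cong) (auto simp: mult_ac power_add [symmetric])
    also have "\<dots> = product_coeff \<mu> \<nu> k * y ^ k" unfolding sum_bessel_coeff_bessel_coeff[OF assms, symmetric] sum_distrib_right ..
    finally show "(\<Sum>i\<le>k. (bessel_coeff \<mu> i * y ^ i) * (bessel_coeff \<nu> (k - i) * y ^ (k - i))) = product_coeff \<mu> \<nu> k * y ^ k" .
  qed
  finally show ?thesis .
qed

text \<open>
  The even binomial coefficients of \<open>2 * k\<close> sum to at most \<open>4 ^ k\<close>. The bound makes the product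
  series grow no faster than \<open>exp (2 * x)\<close>, the true order for a product of two functions of
  growth \<open>exp x\<close>.
\<close>
lemma norm_product_coeff_le:
  assumes "Re \<mu> \<ge> - (1/2)" "Re \<nu> \<ge> - (1/2)"
  shows "norm (product_coeff \<mu> \<nu> k) \<le> 16 ^ k / fact (2 * k)"
proof -
  have t: "norm (bessel_coeff \<mu> j * bessel_coeff \<nu> (k - j)) \<le> 4 ^ k / fact (2 * k) * real (2 * k choose (2 * j))" if "j \<le> k" for j
  proof -
    have "norm (bessel_coeff \<mu> j * bessel_coeff \<nu> (k - j)) \<le> (4 ^ j / fact (2 * j)) * (4 ^ (k - j) / fact (2 * (k - j)))"
      unfolding norm_mult by (intro mult_mono norm_bessel_coeff_le assms) auto
    also have "\<dots> = 4 ^ k / (fact (2 * j) * fact (2 * k - 2 * j))"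
      using that by (simp add: power_add [symmetric] diff_mult_distrib2)
    also have "\<dots> = 4 ^ k / fact (2 * k) * real (2 * k choose (2 * j))"
      using that by (simp add: binomial_fact)
    finally show ?thesis .
  qed
  have "norm (product_coeff \<mu> \<nu> k) \<le> (\<Sum>j\<le>k. 4 ^ k / fact (2 * k) * real (2 * k choose (2 * j)))"
  proof (subst sum_bessel_coeff_bessel_coeff [symmetric])
    show "norm (\<Sum>j\<le>k. bessel_coeff \<mu> j * bessel_coeff \<nu> (k - j)) \<le> (\<Sum>j\<le>k. 4 ^ k / fact (2 * k) * real (2 * k choose (2 * j)))"
      by (intro sum_norm_le t) simp
  qed (use assms in auto)
  also have "\<dots> = 4 ^ k / fact (2 * k) * (\<Sum>i\<in>(*) 2 ` {..k}. real (2 * k choose i))"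
    by (subst sum.reindex) (auto simp: inj_on_def sum_distrib_left)
  also have "\<dots> \<le> 4 ^ k / fact (2 * k) * (\<Sum>i\<le>2 * k. real (2 * k choose i))"
    by (intro mult_left_mono sum_mono2) auto
  also have "(\<Sum>i\<le>2 * k. real (2 * k choose i)) = 4 ^ k"
    using choose_row_sum[of "2 * k"] by (simp add: power_mult flip: of_nat_sum)
  finally show ?thesis by (simp add: power_mult_distrib [symmetric])
qed

lemma sum_even_exp_le:
  assumes "x \<ge> (0::real)"
  shows "(\<Sum>k<n. x ^ (2 * k) / fact (2 * k)) \<le> exp x"
proof -
  have "(\<Sum>k<n. x ^ (2 * k) / fact (2 * k)) \<le> (\<Sum>m<2 * n. x ^ m / fact m)"
  proof (induction n)
    case (Suc n)
    have "0 \<le> x ^ Suc (2 * n) / fact (Suc (2 * n))" using assms by (intro divide_nonneg_nonneg) auto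
    then show ?case using Suc by simp
  qed simp
  also have "\<dots> \<le> (\<Sum>m. x ^ m / fact m)"
    using summable_exp_generic[of x] assms by (intro sum_le_suminf) (auto simp: divide_inverse mult.commute)
  also have "\<dots> = exp x" by (simp add: exp_def divide_inverse mult.commute)
  finally show ?thesis .
qed

text \<open>
  What the \<open>k\<close>-th term of the product series of orders \<open>\<mu>\<close>, \<open>\<nu>\<close> contributes after integration
  against \<open>K\<^sub>\<alpha>(b x)\<close> squared, up to a factor common to all \<open>k\<close> and the power of \<open>a / b\<close>. The
  parameter \<open>\<sigma>\<close> is 1 for the integral without the factor \<open>x\<close> and 2 for the one with it.
\<close>
definition mellin_coeff :: "complex \<Rightarrow> complex \<Rightarrow> complex \<Rightarrow> complex \<Rightarrow> nat \<Rightarrow> complex" where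
  "mellin_coeff \<alpha> \<sigma> \<mu> \<nu> k = (let s = \<sigma> + \<mu> + \<nu> + 2 * of_nat k in
     product_coeff \<mu> \<nu> k * Gamma (s/2 + \<alpha>) * Gamma (s/2 - \<alpha>) * Gamma (s/2) ^ 2 / Gamma s)"

text \<open>
  The product series has growth \<open>exp (2 * a * x)\<close> and \<open>K\<^sub>\<alpha>(b x)\<close> squared is of the order of at
  most \<open>exp (- Re b * x)\<close> at infinity, so for \<open>2 * a < Re b\<close> the partial sums of absolute values
  have an integrable majorant and the Mellin transform may be applied term by term. A small
  range of \<open>a\<close> is enough, since the result is extended by analytic continuation in \<open>a\<close>.
\<close>
lemma termwise_integral:
  fixes a \<sigma> :: real
  assumes \<alpha>: "\<bar>Re \<alpha>\<bar> < 1/2" and \<mu>: "\<mu> = \<alpha> \<or> \<mu> = - \<alpha>" and \<nu>: "\<nu> = \<alpha> \<or> \<nu> = - \<alpha>"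
    and \<sigma>: "4 * \<bar>Re \<alpha>\<bar> < \<sigma>" "\<sigma> \<le> 4" and a: "0 < a" "2 * a < Re b"
  defines "f \<equiv> (\<lambda>v. exp (of_real \<sigma> * of_real v) * (of_real (a * exp v / 2) powr (\<mu> + \<nu>)
      * bessel_series \<mu> (of_real ((a * exp v)\<^sup>2 / 4)) * bessel_series \<nu> (of_real ((a * exp v)\<^sup>2 / 4))) * bessel_K \<alpha> (b * of_real (exp v)) ^ 2)"
  shows "integrable lborel f"
    and "(\<lambda>k. exp (of_real \<sigma> * of_real (ln 2)) / 8 * b powr (- of_real \<sigma>) * (of_real a / b) powr (\<mu> + \<nu>) * (mellin_coeff \<alpha> (of_real \<sigma>) \<mu> \<nu> k * ((of_real a / b)\<^sup>2) ^ k))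
            sums (LBINT v. f v)"
proof -
  define r where "r = \<bar>Re \<alpha>\<bar>"
  \<comment> \<open>Near \<open>- \<infinity>\<close> the majorant behaves like \<open>exp ((\<sigma> + Re w - 2 * \<rho>) * v)\<close> with \<open>Re w \<ge> - 2 * r\<close>; for \<open>\<rho> = \<sigma> / 4\<close> the exponent is at least \<open>\<sigma> / 2 - 2 * r > 0\<close>.\<close>
  define \<rho> where "\<rho> = \<sigma> / 4"
  define m where "m = Re b"
  define w where "w = \<mu> + \<nu>"
  have w: "Re w \<ge> - 2 * r" using \<mu> \<nu> by (auto simp: w_def r_def)
  have Re\<mu>\<nu>: "Re \<mu> > - (1/2)" "Re \<nu> > - (1/2)" using \<mu> \<nu> \<alpha> by auto
  have m: "m > 0" using a by (simp add: m_def)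
  have b0: "b \<noteq> 0" using a by auto
  obtain C where C: "C \<ge> 0"
    "\<And>\<nu> z v m. \<bar>Re \<nu>\<bar> \<le> r \<Longrightarrow> 0 < m \<Longrightarrow> m \<le> Re z \<Longrightarrow>
       norm (bessel_K \<nu> (z * of_real (exp v))) \<le> C * m powr (- \<rho>) * exp (- \<rho> * v - m / 2 * exp v)"
    by (rule norm_bessel_K_exp_le[of r \<rho>]) (use \<sigma> in \<open>auto simp: r_def \<rho>_def\<close>)
  define s where "s k = of_real \<sigma> + w + 2 * of_nat k" for k
  define t where "t k v = product_coeff \<mu> \<nu> k * of_real (a/2) powr w * of_real (a/2) ^ (2 * k) * (exp (s k * of_real v) * bessel_K \<alpha> (b * of_real (exp v)) ^ 2)" for k v
  define G where "G v = (a/2) powr Re w * (C * m powr (- \<rho>))\<^sup>2 * exp ((\<sigma> + Re w - 2 * \<rho>) * v - (m - 2 * a) * exp v)" for v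
  have pw: "of_real (a * exp v / 2) powr z = of_real (a/2) powr z * exp (z * of_real v)" for v and z :: complex
  proof -
    have "Ln (of_real (a * exp v / 2)) = of_real (ln (a/2)) + of_real v" "Ln (of_real (a / 2)) = of_real (ln (a / 2))"
    proof -
      have "Ln (of_real (a * exp v / 2)) = of_real (ln (a * exp v / 2))" using a by (intro Ln_of_real) simp
      also have "ln (a * exp v / 2) = ln (a / 2) + v" using a by (simp add: ln_mult ln_div)
      finally show "Ln (of_real (a * exp v / 2)) = of_real (ln (a/2)) + of_real v" by simp
      show "Ln (of_real (a / 2)) = of_real (ln (a / 2))" using a by (intro Ln_of_real) simp
    qed
    moreover have "complex_of_real (a * exp v / 2) \<noteq> 0" "complex_of_real (a / 2) \<noteq> 0" using a by simp_all
    ultimately show ?thesis unfolding powr_def by (simp only: if_False mult_exp_exp distrib_left)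
  qed
  have t_eq: "t k v = exp (of_real \<sigma> * of_real v) * (of_real (a * exp v / 2) powr w) * bessel_K \<alpha> (b * of_real (exp v)) ^ 2
       * (product_coeff \<mu> \<nu> k * (of_real ((a * exp v)\<^sup>2 / 4)) ^ k)" for k v
  proof -
    have "exp (s k * of_real v) = exp (of_real \<sigma> * of_real v) * exp (w * of_real v) * exp (of_real v) ^ (2 * k)"
      by (simp add: s_def exp_of_nat_mult [symmetric] exp_add [symmetric] algebra_simps)
    moreover have "complex_of_real ((a * exp v)\<^sup>2 / 4) ^ k = of_real (a/2) ^ (2 * k) * exp (of_real v) ^ (2 * k)"
      by (simp add: power_mult power_mult_distrib [symmetric] exp_of_real power2_eq_square mult_ac)
    ultimately show ?thesis unfolding t_def pw by (simp only: mult_ac)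
  qed
  have t_sums: "(\<lambda>k. t k v) sums f v" for v
  proof -
    have "(\<lambda>k. product_coeff \<mu> \<nu> k * (of_real ((a * exp v)\<^sup>2 / 4)) ^ k) sums (bessel_series \<mu> (of_real ((a * exp v)\<^sup>2 / 4)) * bessel_series \<nu> (of_real ((a * exp v)\<^sup>2 / 4)))"
      using Re\<mu>\<nu> by (intro bessel_series_mult_sums) auto
    from sums_mult[OF this, of "exp (of_real \<sigma> * of_real v) * (of_real (a * exp v / 2) powr w) * bessel_K \<alpha> (b * of_real (exp v)) ^ 2"]
    show ?thesis unfolding t_eq f_def w_def by (simp add: mult_ac)
  qed
  have bound: "(\<Sum>k<n. norm (t k v)) \<le> G v" for n v
  proof -
    define x where "x = a * exp v"
    have x: "x > 0" using a by (simp add: x_def)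
    define N where "N = exp (\<sigma> * v) * ((a/2) powr Re w * exp (Re w * v))"
    have N: "norm (exp (of_real \<sigma> * of_real v) * (of_real (a * exp v / 2) powr w)) = N"
      unfolding pw N_def norm_mult using a by (simp add: norm_powr_real_powr)
    have "(\<Sum>k<n. norm (t k v)) = N * norm (bessel_K \<alpha> (b * of_real (exp v))) ^ 2 * (\<Sum>k<n. norm (product_coeff \<mu> \<nu> k) * (x\<^sup>2 / 4) ^ k)"
      unfolding t_eq norm_mult[of "_ * _"] N norm_power sum_distrib_left
      using a by (simp add: norm_mult norm_power x_def norm_divide)
    also have "\<dots> \<le> N * norm (bessel_K \<alpha> (b * of_real (exp v))) ^ 2 * exp (2 * x)"
    proof (rule mult_left_mono)
      have "(\<Sum>k<n. norm (product_coeff \<mu> \<nu> k) * (x\<^sup>2 / 4) ^ k) \<le> (\<Sum>k<n. (2 * x) ^ (2 * k) / fact (2 * k))"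
      proof (rule sum_mono)
        fix k
        have "norm (product_coeff \<mu> \<nu> k) * (x\<^sup>2 / 4) ^ k \<le> 16 ^ k / fact (2 * k) * (x\<^sup>2 / 4) ^ k"
          using Re\<mu>\<nu> by (intro mult_right_mono norm_product_coeff_le) auto
        also have "\<dots> = (16 * (x\<^sup>2 / 4)) ^ k / fact (2 * k)"
          unfolding power_mult_distrib by (simp only: times_divide_eq_left)
        also have "16 * (x\<^sup>2 / 4) = (2 * x)\<^sup>2" by (simp add: power2_eq_square)
        finally show "norm (product_coeff \<mu> \<nu> k) * (x\<^sup>2 / 4) ^ k \<le> (2 * x) ^ (2 * k) / fact (2 * k)"
          by (simp only: power_mult)
      qed
      also have "\<dots> \<le> exp (2 * x)" using x by (intro sum_even_exp_le) simp
      finally show "(\<Sum>k<n. norm (product_coeff \<mu> \<nu> k) * (x\<^sup>2 / 4) ^ k) \<le> exp (2 * x)" .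
    qed (simp add: N_def)
    also have "\<dots> \<le> N * (C * m powr (- \<rho>) * exp (- \<rho> * v - m / 2 * exp v)) ^ 2 * exp (2 * x)"
    proof (intro mult_right_mono mult_left_mono power_mono)
      show "norm (bessel_K \<alpha> (b * of_real (exp v))) \<le> C * m powr (- \<rho>) * exp (- \<rho> * v - m / 2 * exp v)"
        by (rule C(2)) (simp_all add: r_def m_def m[unfolded m_def])
    qed (simp_all add: N_def)
    also have "\<dots> = (a/2) powr Re w * (C * m powr (- \<rho>))\<^sup>2 * (exp (\<sigma> * v) * exp (Re w * v) * exp (2 * (- \<rho> * v - m / 2 * exp v)) * exp (2 * x))"
    proof -
      have e: "exp (- \<rho> * v - m / 2 * exp v) ^ 2 = exp (2 * (- \<rho> * v - m / 2 * exp v))" by (rule exp_double [symmetric])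
      show ?thesis unfolding N_def power_mult_distrib e by (simp only: mult_ac)
    qed
    also have "exp (\<sigma> * v) * exp (Re w * v) * exp (2 * (- \<rho> * v - m / 2 * exp v)) * exp (2 * x) = exp ((\<sigma> + Re w - 2 * \<rho>) * v - (m - 2 * a) * exp v)"
      unfolding mult_exp_exp by (rule arg_cong[where f=exp]) (simp add: x_def algebra_simps)
    finally show ?thesis unfolding G_def .
  qed
  have G: "integrable lborel G"
  proof -
    have "\<sigma> + Re w - 2 * \<rho> > 0" using w \<sigma> by (simp add: \<rho>_def r_def)
    then have "integrable lborel (\<lambda>v. norm (exp (of_real (\<sigma> + Re w - 2 * \<rho>) * of_real v - complex_of_real ((m - 2 * a) * exp v))))"
      using a by (intro integrable_norm integral_exp_Gamma) (auto simp: m_def)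
    then show ?thesis unfolding G_def by (intro integrable_mult_right) simp
  qed
  have mt: "t k \<in> borel_measurable lborel" for k
    unfolding t_def using measurable_bessel_K_exp[of b \<alpha>] m by (simp add: m_def)
  have mf: "f \<in> borel_measurable lborel"
    by (rule borel_measurable_LIMSEQ_metric[where f="\<lambda>n v. \<Sum>k<n. t k v"]) (use mt t_sums in \<open>auto simp: sums_def\<close>)
  have bt: "norm (t k v) \<le> G v" for k v
    by (rule order_trans[OF member_le_sum[of k "{..<Suc k}"] bound]) auto
  have it: "integrable lborel (t k)" for k
    by (rule Bochner_Integration.integrable_bound[OF G mt]) (intro AE_I2 order_trans[OF bt], simp)
  have nS: "norm (\<Sum>k<n. t k v) \<le> G v" for n v
    using norm_sum[of "\<lambda>k. t k v" "{..<n}"] bound[of v n] by linarith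
  have mS: "(\<lambda>v. \<Sum>k<n. t k v) \<in> borel_measurable lborel" for n using mt by simp
  have lS: "AE v in lborel. (\<lambda>n. \<Sum>k<n. t k v) \<longlonglongrightarrow> f v" using t_sums by (simp add: sums_def)
  have bS: "AE v in lborel. norm (\<Sum>k<n. t k v) \<le> G v" for n using nS by simp
  have conv: "(\<lambda>n. LBINT v. (\<Sum>k<n. t k v)) \<longlonglongrightarrow> (LBINT v. f v)"
    by (rule integral_dominated_convergence[OF mf mS G lS bS])
  show "integrable lborel f"
    by (rule integrable_dominated_convergence[OF mf mS G lS bS])
  have It: "(LBINT v. t k v) = exp (of_real \<sigma> * of_real (ln 2)) / 8 * b powr (- of_real \<sigma>) * (of_real a / b) powr (\<mu> + \<nu>) * (mellin_coeff \<alpha> (of_real \<sigma>) \<mu> \<nu> k * ((of_real a / b)\<^sup>2) ^ k)" for k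
  proof -
    have sk: "Re (s k) > 2 * \<bar>Re \<alpha>\<bar>" using w \<sigma> by (simp add: s_def r_def)
    have "(LBINT v. t k v) = product_coeff \<mu> \<nu> k * of_real (a/2) powr w * of_real (a/2) ^ (2 * k) * (b powr (- s k) * mellin_K_square \<alpha> (s k))"
      unfolding t_def using Mellin_bessel_K_square[OF sk \<alpha>, of b] m by (simp add: m_def)
    also have "\<dots> = (of_real (a/2) powr w * of_real (a/2) ^ (2 * k) * b powr (- s k) * exp (s k * of_real (ln 2))) / 8 * mellin_coeff \<alpha> (of_real \<sigma>) \<mu> \<nu> k"
      by (simp add: mellin_K_square_def mellin_coeff_def Let_def s_def w_def add.assoc)
    also have "of_real (a/2) powr w * of_real (a/2) ^ (2 * k) * b powr (- s k) * exp (s k * of_real (ln 2))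
       = exp (of_real \<sigma> * of_real (ln 2)) * b powr (- of_real \<sigma>) * (of_real a / b) powr w * ((of_real a / b)\<^sup>2) ^ k"
    proof -
      define l where "l = Ln b"
      have bl: "b = exp l" using b0 by (simp add: l_def)
      \<comment> \<open>The argument of \<open>b\<close> lies strictly between \<open>- pi / 2\<close> and \<open>pi / 2\<close>, so the principal logarithms subtract.\<close>
      have "Ln (of_real a / b) = of_real (ln a) - l"
      proof -
        have "of_real a / b = exp (of_real (ln a) - l)" using a by (simp add: exp_diff bl exp_of_real)
        moreover have "- pi < Im (of_real (ln a) - l)" "Im (of_real (ln a) - l) \<le> pi"
          using a Re_Ln_pos_lt[OF b0] by (auto simp: l_def)
        ultimately show ?thesis by (simp only: Ln_exp)
      qed
      then have 1: "(of_real a / b) powr w = exp (w * (of_real (ln a) - l))" using a b0 by (simp add: powr_def)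
      have 2: "((of_real a / b)\<^sup>2) ^ k = exp (2 * of_nat k * (of_real (ln a) - l))"
      proof -
        have "of_real a / b = exp (of_real (ln a) - l)" using a by (simp add: exp_diff bl exp_of_real)
        then show ?thesis by (simp add: exp_of_nat_mult [symmetric] power_mult [symmetric] mult_ac)
      qed
      have 3: "b powr (- s k) = exp (- s k * l)" "b powr (- of_real \<sigma>) = exp (- of_real \<sigma> * l)"
        using b0 by (auto simp: powr_def l_def)
      have 4: "of_real (a/2) powr w = exp (w * (of_real (ln a) - of_real (ln 2)))"
        using a by (simp add: powr_def Ln_of_real ln_div flip: of_real_divide)
      have 5: "complex_of_real (a/2) ^ (2 * k) = exp (2 * of_nat k * (of_real (ln a) - of_real (ln 2)))"
      proof -
        have "complex_of_real (a/2) = exp (of_real (ln a) - of_real (ln 2))"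
          using a by (simp add: exp_diff exp_of_real)
        then show ?thesis by (simp add: exp_of_nat_mult [symmetric] mult_ac)
      qed
      show ?thesis unfolding 1 2 3 4 5 mult_exp_exp
        by (rule arg_cong[where f=exp]) (simp add: s_def algebra_simps)
    qed
    finally show ?thesis by (simp add: w_def mult_ac)
  qed
  have "(LBINT v. (\<Sum>k<n. t k v)) = (\<Sum>k<n. LBINT v. t k v)" for n
    using it by simp
  with conv have "(\<lambda>k. LBINT v. t k v) sums (LBINT v. f v)" by (simp add: sums_def)
  then show "(\<lambda>k. exp (of_real \<sigma> * of_real (ln 2)) / 8 * b powr (- of_real \<sigma>) * (of_real a / b) powr (\<mu> + \<nu>) * (mellin_coeff \<alpha> (of_real \<sigma>) \<mu> \<nu> k * ((of_real a / b)\<^sup>2) ^ k))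
            sums (LBINT v. f v)" unfolding It .
qed

lemma summable_mellin_coeff:
  fixes a \<sigma> :: real
  assumes "\<bar>Re \<alpha>\<bar> < 1/2" "\<mu> \<in> {\<alpha>, - \<alpha>}" "\<nu> \<in> {\<alpha>, - \<alpha>}" "4 * \<bar>Re \<alpha>\<bar> < \<sigma>" "\<sigma> \<le> 4" "0 < a" "2 * a < Re b"
  shows "summable (\<lambda>k. mellin_coeff \<alpha> (of_real \<sigma>) \<mu> \<nu> k * ((of_real a / b)\<^sup>2) ^ k)"
proof -
  have "b \<noteq> 0" using assms(6,7) by auto
  then have nz: "exp (of_real \<sigma> * of_real (ln 2)) / 8 * b powr (- of_real \<sigma>) * (of_real a / b) powr (\<mu> + \<nu>) \<noteq> 0"
    using assms(6) by simp
  have "summable (\<lambda>k. exp (of_real \<sigma> * of_real (ln 2)) / 8 * b powr (- of_real \<sigma>) * (of_real a / b) powr (\<mu> + \<nu>) * (mellin_coeff \<alpha> (of_real \<sigma>) \<mu> \<nu> k * ((of_real a / b)\<^sup>2) ^ k))"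
    by (rule sums_summable, rule termwise_integral(2)) (use assms in auto)
  then show ?thesis using nz by (simp only: summable_cmult_iff simp_thms)
qed

text \<open>
  The series for \<open>K\<^sub>\<alpha>(a x)\<close> squared has three parts, with powers \<open>2 * \<alpha>\<close>, \<open>- 2 * \<alpha>\<close> and 0 of
  \<open>x\<close>; they become the three summands of the final formulas.
\<close>
lemma integral_KK_expansion:
  fixes a \<sigma> :: real
  assumes \<alpha>: "\<alpha> \<noteq> 0" "\<bar>Re \<alpha>\<bar> < 1/2" and \<sigma>: "4 * \<bar>Re \<alpha>\<bar> < \<sigma>" "\<sigma> \<le> 4" and a: "0 < a" "2 * a < Re b"
  defines "W \<equiv> of_real a / b"
  defines "S \<equiv> \<lambda>\<mu> \<nu>. \<Sum>k. mellin_coeff \<alpha> (of_real \<sigma>) \<mu> \<nu> k * (W\<^sup>2) ^ k"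
  shows "(LBINT v. exp (of_real \<sigma> * of_real v) * bessel_K \<alpha> (of_real a * of_real (exp v)) ^ 2 * bessel_K \<alpha> (b * of_real (exp v)) ^ 2)
     = exp (of_real \<sigma> * of_real (ln 2)) / 32 * b powr (- of_real \<sigma>) *
       (Gamma (- \<alpha>) ^ 2 * W powr (2 * \<alpha>) * S \<alpha> \<alpha> + Gamma \<alpha> ^ 2 * W powr (- 2 * \<alpha>) * S (- \<alpha>) (- \<alpha>)
        + 2 * Gamma \<alpha> * Gamma (- \<alpha>) * S \<alpha> (- \<alpha>))"
proof -
  define f where "f = (\<lambda>\<mu> \<nu> v. exp (of_real \<sigma> * of_real v) * (of_real (a * exp v / 2) powr (\<mu> + \<nu>)
      * bessel_series \<mu> (of_real ((a * exp v)\<^sup>2 / 4)) * bessel_series \<nu> (of_real ((a * exp v)\<^sup>2 / 4))) * bessel_K \<alpha> (b * of_real (exp v)) ^ 2)"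
  define c where "c = exp (of_real \<sigma> * of_real (ln 2)) / 8 * b powr (- of_real \<sigma>)"
  have b0: "b \<noteq> 0" using a by auto
  have W0: "W \<noteq> 0" using b0 a by (simp add: W_def)
  have int: "integrable lborel (f \<mu> \<nu>)" if "\<mu> \<in> {\<alpha>, - \<alpha>}" "\<nu> \<in> {\<alpha>, - \<alpha>}" for \<mu> \<nu>
    unfolding f_def by (rule termwise_integral(1)) (use \<alpha> \<sigma> a that in auto)
  have If: "(LBINT v. f \<mu> \<nu> v) = c * W powr (\<mu> + \<nu>) * S \<mu> \<nu>" if "\<mu> \<in> {\<alpha>, - \<alpha>}" "\<nu> \<in> {\<alpha>, - \<alpha>}" for \<mu> \<nu>
  proof -
    have 1: "(\<lambda>k. c * W powr (\<mu> + \<nu>) * (mellin_coeff \<alpha> (of_real \<sigma>) \<mu> \<nu> k * (W\<^sup>2) ^ k)) sums (LBINT v. f \<mu> \<nu> v)"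
      unfolding f_def c_def W_def by (rule termwise_integral(2)) (use \<alpha> \<sigma> a that in auto)
    have "summable (\<lambda>k. mellin_coeff \<alpha> (of_real \<sigma>) \<mu> \<nu> k * (W\<^sup>2) ^ k)"
      unfolding W_def by (rule summable_mellin_coeff) (use \<alpha> \<sigma> a that in auto)
    then have "(\<lambda>k. c * W powr (\<mu> + \<nu>) * (mellin_coeff \<alpha> (of_real \<sigma>) \<mu> \<nu> k * (W\<^sup>2) ^ k)) sums (c * W powr (\<mu> + \<nu>) * S \<mu> \<nu>)"
      unfolding S_def by (intro sums_mult summable_sums)
    with 1 show ?thesis using sums_unique2 by blast
  qed
  have K: "exp (of_real \<sigma> * of_real v) * bessel_K \<alpha> (of_real a * of_real (exp v)) ^ 2 * bessel_K \<alpha> (b * of_real (exp v)) ^ 2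
     = (Gamma (- \<alpha>) ^ 2 * f \<alpha> \<alpha> v + Gamma \<alpha> ^ 2 * f (- \<alpha>) (- \<alpha>) v + 2 * Gamma \<alpha> * Gamma (- \<alpha>) * f \<alpha> (- \<alpha>) v) / 4" for v
  proof -
    define x where "x = a * exp v"
    define X where "X = complex_of_real (x / 2)"
    define y where "y = complex_of_real (x\<^sup>2 / 4)"
    have x: "x > 0" "X \<noteq> 0" using a by (auto simp: x_def X_def)
    have "bessel_K \<alpha> (of_real a * of_real (exp v)) = bessel_K \<alpha> (of_real x)" by (simp add: x_def)
    also have "\<dots> = (Gamma \<alpha> * X powr (- \<alpha>) * bessel_series (- \<alpha>) y + Gamma (- \<alpha>) * X powr \<alpha> * bessel_series \<alpha> y) / 2"
      unfolding X_def y_def by (rule bessel_K_eq_series_real[OF \<alpha> x(1)])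
    finally have K1: "bessel_K \<alpha> (of_real a * of_real (exp v)) = (Gamma \<alpha> * X powr (- \<alpha>) * bessel_series (- \<alpha>) y + Gamma (- \<alpha>) * X powr \<alpha> * bessel_series \<alpha> y) / 2" .
    have Ksq: "bessel_K \<alpha> (of_real a * of_real (exp v)) ^ 2 = (Gamma (- \<alpha>) ^ 2 * (X powr \<alpha> * X powr \<alpha>) * (bessel_series \<alpha> y * bessel_series \<alpha> y) + Gamma \<alpha> ^ 2 * (X powr (- \<alpha>) * X powr (- \<alpha>)) * (bessel_series (- \<alpha>) y * bessel_series (- \<alpha>) y)
       + 2 * Gamma \<alpha> * Gamma (- \<alpha>) * (X powr \<alpha> * X powr (- \<alpha>)) * (bessel_series \<alpha> y * bessel_series (- \<alpha>) y)) / 4"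
      unfolding K1 by (simp add: power2_eq_square algebra_simps)
    have f: "f \<mu> \<nu> v = exp (of_real \<sigma> * of_real v) * (X powr \<mu> * X powr \<nu> * (bessel_series \<mu> y * bessel_series \<nu> y)) * bessel_K \<alpha> (b * of_real (exp v)) ^ 2" for \<mu> \<nu>
      unfolding f_def X_def y_def x_def powr_add by (simp only: mult.assoc)
    have alg: "e * ((p * P * F + q * Q * G + 2 * r * t * R * H) / 4) * B
      = (p * (e * (P * F) * B) + q * (e * (Q * G) * B) + 2 * r * t * (e * (R * H) * B)) / 4" for e p P F q Q G r t R H B :: complex
      by (simp add: algebra_simps)
    show ?thesis unfolding Ksq f by (rule alg)
  qed
  have "(LBINT v. exp (of_real \<sigma> * of_real v) * bessel_K \<alpha> (of_real a * of_real (exp v)) ^ 2 * bessel_K \<alpha> (b * of_real (exp v)) ^ 2)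
     = (Gamma (- \<alpha>) ^ 2 * (LBINT v. f \<alpha> \<alpha> v) + Gamma \<alpha> ^ 2 * (LBINT v. f (- \<alpha>) (- \<alpha>) v) + 2 * Gamma \<alpha> * Gamma (- \<alpha>) * (LBINT v. f \<alpha> (- \<alpha>) v)) / 4"
  proof -
    have i: "integrable lborel (\<lambda>v. Gamma (- \<alpha>) ^ 2 * f \<alpha> \<alpha> v)" "integrable lborel (\<lambda>v. Gamma \<alpha> ^ 2 * f (- \<alpha>) (- \<alpha>) v)"
      "integrable lborel (\<lambda>v. 2 * Gamma \<alpha> * Gamma (- \<alpha>) * f \<alpha> (- \<alpha>) v)"
      by (intro integrable_mult_right int; simp)+
    show ?thesis unfolding K integral_divide_zero Bochner_Integration.integral_add[OF Bochner_Integration.integrable_add[OF i(1,2)] i(3)]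
      Bochner_Integration.integral_add[OF i(1,2)] integral_mult_right_zero ..
  qed
  also have "\<dots> = c / 4 *
       (Gamma (- \<alpha>) ^ 2 * W powr (2 * \<alpha>) * S \<alpha> \<alpha> + Gamma \<alpha> ^ 2 * W powr (- 2 * \<alpha>) * S (- \<alpha>) (- \<alpha>)
        + 2 * Gamma \<alpha> * Gamma (- \<alpha>) * S \<alpha> (- \<alpha>))"
  proof -
    have w: "\<alpha> + \<alpha> = 2 * \<alpha>" "- \<alpha> + - \<alpha> = - 2 * \<alpha>" "\<alpha> + - \<alpha> = 0" by simp_all
    have alg: "(p * (c * P * F) + q * (c * Q * G) + r * (c * 1 * H)) / 4 = c / 4 * (p * P * F + q * Q * G + r * H)" for p P F q Q G r H
      by (simp add: algebra_simps)
    have 1: "(LBINT v. f \<alpha> \<alpha> v) = c * W powr (2 * \<alpha>) * S \<alpha> \<alpha>"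
      "(LBINT v. f (- \<alpha>) (- \<alpha>) v) = c * W powr (- 2 * \<alpha>) * S (- \<alpha>) (- \<alpha>)"
      "(LBINT v. f \<alpha> (- \<alpha>) v) = c * 1 * S \<alpha> (- \<alpha>)"
      using If[of \<alpha> \<alpha>] If[of "- \<alpha>" "- \<alpha>"] If[of \<alpha> "- \<alpha>"] W0 unfolding w by simp_all
    show ?thesis unfolding 1 by (rule alg)
  qed
  finally show ?thesis by (simp add: c_def)
qed

section \<open>The expansions as hypergeometric series\<close>

lemma Gamma_shift:
  assumes "Re z > 0"
  shows "Gamma (z + of_nat k) = Gamma z * pochhammer z k"
proof -
  have "z \<notin> \<int>\<^sub>\<le>\<^sub>0" using assms by (auto simp: nonpos_Ints_def)
  then show ?thesis by (simp add: pochhammer_Gamma Gamma_eq_zero_iff)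
qed

lemma Gamma_nonzero: "Re z > 0 \<Longrightarrow> Gamma z \<noteq> 0"
  by (auto simp: Gamma_eq_zero_iff nonpos_Ints_def)

text \<open>
  The shifted Pochhammer symbol in the product coefficient is a quotient of Gamma values and
  cancels against the Gamma function in the denominator of the Mellin transform.
\<close>
lemma product_coeff_div_Gamma:
  assumes "Re h > - (1/2)" "\<mu> + \<nu> = 2 * h"
  shows "product_coeff \<mu> \<nu> k / Gamma (1 + 2 * h + 2 * of_nat k)
     = 1 / (fact k * pochhammer (1 + \<mu>) k * pochhammer (1 + \<nu>) k * Gamma (1 + 2 * h) * pochhammer (1 + 2 * h) k)"
proof -
  have "Gamma (1 + 2 * h + 2 * of_nat k) = Gamma ((1 + 2 * h + of_nat k) + of_nat k)" by (simp add: algebra_simps)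
  also have "\<dots> = Gamma (1 + 2 * h + of_nat k) * pochhammer (1 + 2 * h + of_nat k) k"
    using assms by (intro Gamma_shift) simp
  also have "Gamma (1 + 2 * h + of_nat k) = Gamma (1 + 2 * h) * pochhammer (1 + 2 * h) k"
    using assms by (intro Gamma_shift) simp
  finally have 1: "Gamma (1 + 2 * h + 2 * of_nat k) = Gamma (1 + 2 * h) * pochhammer (1 + 2 * h) k * pochhammer (1 + 2 * h + of_nat k) k" .
  have 2: "product_coeff \<mu> \<nu> k = pochhammer (1 + 2 * h + of_nat k) k / (fact k * pochhammer (1 + \<mu>) k * pochhammer (1 + \<nu>) k)"
    using assms(2) by (simp add: product_coeff_def add.commute)
  have "pochhammer (1 + 2 * h + of_nat k) k \<noteq> 0" using assms by (intro pochhammer_nonzero) simp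
  then show ?thesis unfolding 1 2 by simp
qed

text \<open>
  With \<open>\<sigma> = 1\<close> four Pochhammer symbols remain above and below: the series is a \<open>4F3\<close>. The number
  \<open>h\<close> is \<open>\<alpha>\<close>, \<open>- \<alpha>\<close> or 0 in the three summands.
\<close>
lemma mellin_coeff_1:
  assumes "\<bar>Re \<alpha>\<bar> < 1/4" and "\<bar>Re h\<bar> \<le> \<bar>Re \<alpha>\<bar>" "\<mu> + \<nu> = 2 * h"
  shows "mellin_coeff \<alpha> 1 \<mu> \<nu> k = (Gamma (1/2 + h + \<alpha>) * Gamma (1/2 + h - \<alpha>) * Gamma (1/2 + h) ^ 2 / Gamma (1 + 2 * h)) *
     (pochhammer (1/2 + h + \<alpha>) k * pochhammer (1/2 + h - \<alpha>) k * pochhammer (1/2 + h) k ^ 2 /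
       (pochhammer (1 + \<mu>) k * pochhammer (1 + \<nu>) k * pochhammer (1 + 2 * h) k * fact k))"
proof -
  have r: "Re (1/2 + h + \<alpha>) > 0" "Re (1/2 + h - \<alpha>) > 0" "Re (1/2 + h) > 0" using assms by auto
  define s where "s = 1 + \<mu> + \<nu> + 2 * of_nat k"
  have s: "s = 1 + 2 * h + 2 * of_nat k" using assms(3) by (simp add: s_def add.assoc)
  have half: "s / 2 = 1/2 + h + of_nat k" unfolding s by (simp add: add_divide_distrib)
  have g: "Gamma (s/2 + \<alpha>) = Gamma (1/2 + h + \<alpha>) * pochhammer (1/2 + h + \<alpha>) k"
    "Gamma (s/2 - \<alpha>) = Gamma (1/2 + h - \<alpha>) * pochhammer (1/2 + h - \<alpha>) k"
    "Gamma (s/2) = Gamma (1/2 + h) * pochhammer (1/2 + h) k"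
    unfolding Gamma_shift[OF r(1), symmetric] Gamma_shift[OF r(2), symmetric] Gamma_shift[OF r(3), symmetric]
    unfolding half by (simp_all add: algebra_simps)
  have "mellin_coeff \<alpha> 1 \<mu> \<nu> k = (product_coeff \<mu> \<nu> k / Gamma s) * (Gamma (s/2 + \<alpha>) * Gamma (s/2 - \<alpha>) * Gamma (s/2) ^ 2)"
    by (simp add: mellin_coeff_def s_def Let_def)
  also have "product_coeff \<mu> \<nu> k / Gamma s = 1 / (fact k * pochhammer (1 + \<mu>) k * pochhammer (1 + \<nu>) k * Gamma (1 + 2 * h) * pochhammer (1 + 2 * h) k)"
    unfolding s by (rule product_coeff_div_Gamma) (use assms in auto)
  finally show ?thesis unfolding g by (simp add: power_mult_distrib mult_ac)
qed

text \<open>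
  With \<open>\<sigma> = 2\<close> all Pochhammer symbols cancel once \<open>\<mu>\<close>, \<open>\<nu>\<close> and \<open>h\<close> are specialised, since then
  \<open>{1 + \<mu>, 1 + \<nu>} = {1 + h + \<alpha>, 1 + h - \<alpha>}\<close> or \<open>{1 + h, 1 + h}\<close>; only the last denominator
  survives. This is why the second integral is elementary.
\<close>
lemma mellin_coeff_2:
  assumes "\<bar>Re \<alpha>\<bar> < 1/2" and "\<bar>Re h\<bar> \<le> \<bar>Re \<alpha>\<bar>" "\<mu> + \<nu> = 2 * h"
  shows "mellin_coeff \<alpha> 2 \<mu> \<nu> k = (Gamma (1 + h + \<alpha>) * Gamma (1 + h - \<alpha>) * Gamma (1 + h) ^ 2 / Gamma (1 + 2 * h)) *
     (pochhammer (1 + h + \<alpha>) k * pochhammer (1 + h - \<alpha>) k * pochhammer (1 + h) k ^ 2 /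
       (pochhammer (1 + \<mu>) k * pochhammer (1 + \<nu>) k * pochhammer (1 + 2 * h) k * fact k)) / (1 + 2 * h + 2 * of_nat k)"
proof -
  have r: "Re (1 + h + \<alpha>) > 0" "Re (1 + h - \<alpha>) > 0" "Re (1 + h) > 0" using assms by auto
  define s where "s = 2 + \<mu> + \<nu> + 2 * of_nat k"
  have s: "s = 2 + 2 * h + 2 * of_nat k" using assms(3) by (simp add: s_def add.assoc)
  have half: "s / 2 = 1 + h + of_nat k" unfolding s by (simp add: add_divide_distrib)
  have g: "Gamma (s/2 + \<alpha>) = Gamma (1 + h + \<alpha>) * pochhammer (1 + h + \<alpha>) k"
    "Gamma (s/2 - \<alpha>) = Gamma (1 + h - \<alpha>) * pochhammer (1 + h - \<alpha>) k"
    "Gamma (s/2) = Gamma (1 + h) * pochhammer (1 + h) k"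
    unfolding Gamma_shift[OF r(1), symmetric] Gamma_shift[OF r(2), symmetric] Gamma_shift[OF r(3), symmetric]
    unfolding half by (simp_all add: algebra_simps)
  have "Gamma s = Gamma (1 + 2 * h + 2 * of_nat k + 1)" by (simp add: s algebra_simps)
  also have "\<dots> = (1 + 2 * h + 2 * of_nat k) * Gamma (1 + 2 * h + 2 * of_nat k)"
  proof (rule Gamma_plus1)
    have "Re (1 + 2 * h + 2 * of_nat k) > 0" using assms by (auto intro!: add_pos_nonneg)
    then show "1 + 2 * h + 2 * of_nat k \<notin> \<int>\<^sub>\<le>\<^sub>0" by (auto simp: nonpos_Ints_def simp del: plus_complex.sel)
  qed
  finally have Gs: "Gamma s = (1 + 2 * h + 2 * of_nat k) * Gamma (1 + 2 * h + 2 * of_nat k)" .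
  have "mellin_coeff \<alpha> 2 \<mu> \<nu> k = (product_coeff \<mu> \<nu> k / Gamma (1 + 2 * h + 2 * of_nat k)) * (Gamma (s/2 + \<alpha>) * Gamma (s/2 - \<alpha>) * Gamma (s/2) ^ 2) / (1 + 2 * h + 2 * of_nat k)"
  proof -
    have "mellin_coeff \<alpha> 2 \<mu> \<nu> k = product_coeff \<mu> \<nu> k * Gamma (s/2 + \<alpha>) * Gamma (s/2 - \<alpha>) * Gamma (s/2) ^ 2 / Gamma s"
      by (simp add: mellin_coeff_def s_def Let_def)
    moreover have "P * A * B * C / (x * y) = P / y * (A * B * C) / x" for P A B C x y :: complex
      by (simp add: mult_ac)
    ultimately show ?thesis unfolding Gs by (simp only:)
  qed
  also have "product_coeff \<mu> \<nu> k / Gamma (1 + 2 * h + 2 * of_nat k) = 1 / (fact k * pochhammer (1 + \<mu>) k * pochhammer (1 + \<nu>) k * Gamma (1 + 2 * h) * pochhammer (1 + 2 * h) k)"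
    by (rule product_coeff_div_Gamma) (use assms in auto)
  finally show ?thesis unfolding g by (simp add: power_mult_distrib mult_ac)
qed

lemma Gamma_sin_facts:
  assumes "\<bar>Re \<alpha>\<bar> < 1/2" "\<alpha> \<noteq> 0"
  defines "s \<equiv> sin (of_real pi * \<alpha>)" and "c \<equiv> cos (of_real pi * \<alpha>)"
  shows "s \<noteq> 0" "c \<noteq> 0" "Gamma (- \<alpha>) * Gamma (1 + \<alpha>) = - of_real pi / s"
    "\<alpha> * Gamma \<alpha> = Gamma (1 + \<alpha>)" "Gamma (1/2 + \<alpha>) * Gamma (1/2 - \<alpha>) = of_real pi / c"
proof -
  have nint: "\<alpha> \<noteq> of_int n" for n
  proof
    assume n: "\<alpha> = of_int n"
    then have "\<bar>real_of_int n\<bar> < 1/2" using assms(1) by simp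
    then have "n = 0" by linarith
    then show False using n assms(2) by simp
  qed
  show s0: "s \<noteq> 0"
  proof
    assume "s = 0"
    then obtain n :: int where "of_real pi * \<alpha> = of_real (of_int n * pi)" unfolding s_def sin_eq_0 by auto
    then have "of_real pi * \<alpha> = of_real pi * of_int n" by (simp add: mult.commute)
    then have "\<alpha> = of_int n" by simp
    with nint show False by blast
  qed
  show c0: "c \<noteq> 0"
  proof
    assume "c = 0"
    then obtain n :: int where "of_real pi * \<alpha> = complex_of_real (of_int n * pi) + of_real pi / 2" unfolding c_def cos_eq_0 by auto
    then have "of_real pi * \<alpha> = of_real pi * (of_int n + 1/2)" by (simp add: algebra_simps)
    then have "\<alpha> = of_int n + 1/2" by simp
    then have "Re \<alpha> = of_int n + 1/2" by simp
    then have "-1 < real_of_int n" "real_of_int n < 0" using assms(1) by linarith+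
    then show False by simp
  qed
  have "Gamma (- \<alpha>) * Gamma (1 - - \<alpha>) = of_real pi / sin (of_real pi * (- \<alpha>))" by (rule Gamma_reflection_complex)
  then show "Gamma (- \<alpha>) * Gamma (1 + \<alpha>) = - of_real pi / s" by (simp add: s_def)
  have "\<alpha> \<notin> \<int>\<^sub>\<le>\<^sub>0" using nint by (auto simp: nonpos_Ints_def)
  then show "\<alpha> * Gamma \<alpha> = Gamma (1 + \<alpha>)" using Gamma_plus1[of \<alpha>] by (simp add: add.commute)
  have "Gamma (1/2 + \<alpha>) * Gamma (1 - (1/2 + \<alpha>)) = of_real pi / sin (of_real pi * (1/2 + \<alpha>))" by (rule Gamma_reflection_complex)
  moreover have "1 - (1/2 + \<alpha>) = 1/2 - \<alpha>" by simp
  moreover have "sin (of_real pi * (1/2 + \<alpha>)) = c"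
    by (simp add: c_def distrib_left sin_add)
  ultimately show "Gamma (1/2 + \<alpha>) * Gamma (1/2 - \<alpha>) = of_real pi / c" by simp
qed

text \<open>
  The reflection formula for \<open>\<alpha>\<close> and for \<open>1/2 + \<alpha>\<close>, and Legendre's duplication formula, which
  accounts for the power of 2.
\<close>
lemma Gamma_constant_integral_1:
  assumes "\<bar>Re \<alpha>\<bar> < 1/4" "\<alpha> \<noteq> 0"
  shows "Gamma (- \<alpha>) ^ 2 * (Gamma (1/2 + 2 * \<alpha>) * Gamma (1/2) * Gamma (1/2 + \<alpha>) ^ 2 / Gamma (1 + 2 * \<alpha>)) / 16
    = of_real pi ^ 4 / 8 * csc (2 * of_real pi * \<alpha>) * (csc (of_real pi * \<alpha>) * Gamma (2 * \<alpha> + 1/2) / (Gamma (1/2 - \<alpha>) * Gamma (1 + \<alpha>) ^ 3)) * exp (- 2 * \<alpha> * of_real (ln 2))"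
proof -
  define s where "s = sin (of_real pi * \<alpha>)"
  define c where "c = cos (of_real pi * \<alpha>)"
  define G where "G = Gamma (1 + \<alpha>)"
  define g where "g = Gamma (1/2 + \<alpha>)"
  define D where "D = Gamma (1 + 2 * \<alpha>)"
  define E where "E = exp (- 2 * \<alpha> * of_real (ln 2))"
  define p where "p = complex_of_real (sqrt pi)"
  define q where "q = Gamma (1/2 - \<alpha>)"
  define X where "X = Gamma (1/2 + 2 * \<alpha>)"
  note f = Gamma_sin_facts[of \<alpha>]
  have nz: "s \<noteq> 0" "c \<noteq> 0" using f assms by (auto simp: s_def c_def)
  have nz': "G \<noteq> 0" "g \<noteq> 0" "D \<noteq> 0" "q \<noteq> 0" using assms by (auto simp: G_def g_def D_def q_def intro!: Gamma_nonzero)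
  have pp: "p * p = of_real pi" by (simp add: p_def flip: of_real_mult)
  \<comment> \<open>With \<open>p\<close> the square root of pi, reflection and duplication express \<open>Gamma (- \<alpha>)\<close>, \<open>q\<close> and \<open>E\<close> rationally through \<open>p\<close>, \<open>s\<close>, \<open>c\<close>, \<open>g\<close>, \<open>G\<close> and \<open>D\<close>.\<close>
  have A: "Gamma (- \<alpha>) = - (p * p) / (s * G)"
  proof -
    have "Gamma (- \<alpha>) * G = - (p * p) / s" using f(3) assms by (simp add: s_def G_def pp)
    then have "Gamma (- \<alpha>) = - (p * p) / s / G" by (rule eq_divide_imp[OF nz'(1)])
    then show ?thesis by simp
  qed
  have B: "g * q * c = p * p" using f(5) assms nz unfolding g_def q_def c_def pp by (simp add: divide_simps)
  have dup: "g * G = E * p * D"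
  proof -
    have "Gamma (1/2 + \<alpha>) * Gamma (1/2 + \<alpha> + 1/2) = exp ((1 - 2 * (1/2 + \<alpha>)) * of_real (ln 2)) * of_real (sqrt pi) * Gamma (2 * (1/2 + \<alpha>))"
    proof (rule Gamma_legendre_duplication)
      have "Re (1/2 + \<alpha>) > 0" "Re (1/2 + \<alpha> + 1/2) > 0" using assms by auto
      then show "1/2 + \<alpha> \<notin> \<int>\<^sub>\<le>\<^sub>0" "1/2 + \<alpha> + 1/2 \<notin> \<int>\<^sub>\<le>\<^sub>0" by (auto simp: nonpos_Ints_def simp del: plus_complex.sel)
    qed
    moreover have "1/2 + \<alpha> + 1/2 = 1 + \<alpha>" "2 * (1/2 + \<alpha>) = 1 + 2 * \<alpha>" by (simp_all add: algebra_simps)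
    ultimately show ?thesis by (simp add: g_def G_def E_def p_def D_def)
  qed
  have h: "Gamma (1/2) = p" by (simp add: Gamma_one_half_complex p_def)
  have s2: "sin (2 * of_real pi * \<alpha>) = 2 * s * c"
    using sin_double[of "of_real pi * \<alpha>"] by (simp add: s_def c_def mult.assoc)
  have E1: "E = g * G / (p * D)" using dup nz' pp by (auto simp: field_simps)
  have q1: "q = p * p / (g * c)" using B nz nz' by (simp add: field_simps)
  have pi1: "complex_of_real pi = p * p" by (simp add: pp)
  have p0: "p \<noteq> 0" by (simp add: p_def)
  have "Gamma (- \<alpha>) ^ 2 * (X * p * g ^ 2 / D) / 16 = (p * p) ^ 4 / 8 * (1 / (2 * s * c)) * (1 / s * X / (q * G ^ 3)) * E"
    unfolding A E1 q1 using nz nz' p0 by (simp add: field_simps power2_eq_square power3_eq_cube power4_eq_xxxx)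
  then show ?thesis unfolding csc_def s2 h pi1[symmetric]
    by (simp add: s_def G_def q_def E_def X_def g_def D_def add.commute)
qed

lemma hypergeo_eq_suminf:
  assumes "norm z < 1"
  shows "hypergeo as bs z = (\<Sum>k. fps_nth (fps_hypergeo as bs 1) k * z ^ k)"
  using assms by (simp add: hypergeo_def eval_fps_def)

text \<open>
  One half of Lerch's transcendent \<open>\<Phi>(z, 1, 1/2 + \<beta>)\<close>. It is the common form of the \<open>2F1\<close>
  functions, of the inverse hyperbolic tangent and, at \<open>z = 1\<close>, of the digamma function.
\<close>
definition odd_sum :: "complex \<Rightarrow> complex \<Rightarrow> complex" where
  "odd_sum \<beta> z = (\<Sum>k. z ^ k / (1 + 2 * \<beta> + 2 * of_nat k))"

lemma suminf_factor:
  fixes f :: "nat \<Rightarrow> complex"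
  assumes "summable f" "\<And>k. f k = c * g k" "c \<noteq> 0"
  shows "suminf f = c * suminf g"
proof -
  have "summable g" using assms(1) unfolding assms(2)[abs_def] using assms(3) by (simp add: summable_cmult_iff)
  moreover have "f = (\<lambda>k. c * g k)" using assms(2) by auto
  ultimately show ?thesis by (simp add: suminf_mult)
qed

lemma integral_1_expansion:
  fixes a :: real
  assumes \<alpha>: "\<alpha> \<noteq> 0" "\<bar>Re \<alpha>\<bar> < 1/4" and a: "0 < a" "2 * a < Re b"
  shows "(LBINT v. exp (of_real v) * bessel_K \<alpha> (of_real a * of_real (exp v)) ^ 2 * bessel_K \<alpha> (b * of_real (exp v)) ^ 2)
     = of_real pi ^ 4 / (8 * b) * csc (2 * of_real pi * \<alpha>) *
         (csc (of_real pi * \<alpha>) * Gamma (2 * \<alpha> + 1/2) / (Gamma (1/2 - \<alpha>) * Gamma (1 + \<alpha>) ^ 3)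
            * (of_real a / (2 * b)) powr (2 * \<alpha>)
            * hypergeo [1/2, \<alpha> + 1/2, \<alpha> + 1/2, 2 * \<alpha> + 1/2] [2 * \<alpha> + 1, \<alpha> + 1, \<alpha> + 1] ((of_real a / b) ^ 2)
          + csc (of_real pi * \<alpha>) * Gamma (1/2 - 2 * \<alpha>) / (Gamma (\<alpha> + 1/2) * Gamma (1 - \<alpha>) ^ 3)
            * (of_real a / (2 * b)) powr (- 2 * \<alpha>)
            * hypergeo [1/2, 1/2 - 2 * \<alpha>, 1/2 - \<alpha>, 1/2 - \<alpha>] [1 - 2 * \<alpha>, 1 - \<alpha>, 1 - \<alpha>] ((of_real a / b) ^ 2)
          - 2 / (of_real pi * \<alpha>)
            * hypergeo [1/2, 1/2, \<alpha> + 1/2, 1/2 - \<alpha>] [1, 1 - \<alpha>, \<alpha> + 1] ((of_real a / b) ^ 2))"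
proof -
  define W where "W = of_real a / b"
  have b0: "b \<noteq> 0" using a by auto
  have "a < norm b" using complex_Re_le_cmod[of b] a by linarith
  then have W1: "norm W < 1" using a b0 by (simp add: W_def norm_divide)
  then have W2: "norm (W\<^sup>2) < 1" by (simp add: norm_power power_less_one_iff)
  define R where "R h = Gamma (1/2 + h + \<alpha>) * Gamma (1/2 + h - \<alpha>) * Gamma (1/2 + h) ^ 2 / Gamma (1 + 2 * h)" for h
  have R0: "R h \<noteq> 0" if "\<bar>Re h\<bar> \<le> \<bar>Re \<alpha>\<bar>" for h
    unfolding R_def using that \<alpha> by (auto simp: Gamma_nonzero)
  define S where "S \<mu> \<nu> = (\<Sum>k. mellin_coeff \<alpha> 1 \<mu> \<nu> k * (W\<^sup>2) ^ k)" for \<mu> \<nu>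
  have sm: "summable (\<lambda>k. mellin_coeff \<alpha> 1 \<mu> \<nu> k * (W\<^sup>2) ^ k)" if "\<mu> \<in> {\<alpha>, - \<alpha>}" "\<nu> \<in> {\<alpha>, - \<alpha>}" for \<mu> \<nu>
    using summable_mellin_coeff[of \<alpha> \<mu> \<nu> 1 a b] \<alpha> a that by (simp add: W_def)
  have S1: "S \<alpha> \<alpha> = R \<alpha> * hypergeo [1/2, \<alpha> + 1/2, \<alpha> + 1/2, 2 * \<alpha> + 1/2] [2 * \<alpha> + 1, \<alpha> + 1, \<alpha> + 1] (W\<^sup>2)"
    unfolding S_def hypergeo_eq_suminf[OF W2]
  proof (rule suminf_factor[OF sm _ R0])
    fix k
    show "mellin_coeff \<alpha> 1 \<alpha> \<alpha> k * (W\<^sup>2) ^ k = R (\<alpha>) * (fps_nth (fps_hypergeo [1/2, \<alpha> + 1/2, \<alpha> + 1/2, 2 * \<alpha> + 1/2] [2 * \<alpha> + 1, \<alpha> + 1, \<alpha> + 1] 1) k * (W\<^sup>2) ^ k)"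
      by (subst mellin_coeff_1[where h=\<alpha>]) (use \<alpha> in \<open>simp_all add: R_def power2_eq_square mult_ac add_ac\<close>)
  qed simp_all
  have S2: "S (- \<alpha>) (- \<alpha>) = R (- \<alpha>) * hypergeo [1/2, 1/2 - 2 * \<alpha>, 1/2 - \<alpha>, 1/2 - \<alpha>] [1 - 2 * \<alpha>, 1 - \<alpha>, 1 - \<alpha>] (W\<^sup>2)"
    unfolding S_def hypergeo_eq_suminf[OF W2]
  proof (rule suminf_factor[OF sm _ R0])
    fix k
    show "mellin_coeff \<alpha> 1 (- \<alpha>) (- \<alpha>) k * (W\<^sup>2) ^ k = R (- \<alpha>) * (fps_nth (fps_hypergeo [1/2, 1/2 - 2 * \<alpha>, 1/2 - \<alpha>, 1/2 - \<alpha>] [1 - 2 * \<alpha>, 1 - \<alpha>, 1 - \<alpha>] 1) k * (W\<^sup>2) ^ k)"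
      by (subst mellin_coeff_1[where h="- \<alpha>"]) (use \<alpha> in \<open>simp_all add: R_def power2_eq_square mult_ac\<close>)
  qed simp_all
  have S3: "S \<alpha> (- \<alpha>) = R 0 * hypergeo [1/2, 1/2, \<alpha> + 1/2, 1/2 - \<alpha>] [1, 1 - \<alpha>, \<alpha> + 1] (W\<^sup>2)"
    unfolding S_def hypergeo_eq_suminf[OF W2]
  proof (rule suminf_factor[OF sm _ R0])
    fix k
    show "mellin_coeff \<alpha> 1 \<alpha> (- \<alpha>) k * (W\<^sup>2) ^ k = R (0) * (fps_nth (fps_hypergeo [1/2, 1/2, \<alpha> + 1/2, 1/2 - \<alpha>] [1, 1 - \<alpha>, \<alpha> + 1] 1) k * (W\<^sup>2) ^ k)"
      by (subst mellin_coeff_1[where h=0]) (use \<alpha> in \<open>simp_all add: R_def power2_eq_square mult_ac add_ac\<close>)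
  qed simp_all
  have half: "(of_real a / (2 * b)) powr w = W powr w * exp (- w * of_real (ln 2))" for w
  proof -
    have W: "W \<noteq> 0" using a b0 by (simp add: W_def)
    have "of_real a / (2 * b) = W * of_real (1/2)" by (simp add: W_def)
    also have "\<dots> powr w = W powr w * of_real (1/2) powr w"
      using powr_times_real_left[of "of_real (1/2)" W w] by (simp only: mult.commute) simp
    also have "of_real (1/2) powr w = exp (- w * of_real (ln 2))"
    proof -
      have "Ln (complex_of_real (1/2)) = of_real (ln (1/2))" by (rule Ln_of_real) simp
      then show ?thesis by (simp add: powr_def ln_div)
    qed
    finally show ?thesis .
  qed
  have c1: "Gamma (- \<alpha>) ^ 2 * R \<alpha> / 16 = of_real pi ^ 4 / 8 * csc (2 * of_real pi * \<alpha>) * (csc (of_real pi * \<alpha>) * Gamma (2 * \<alpha> + 1/2) / (Gamma (1/2 - \<alpha>) * Gamma (1 + \<alpha>) ^ 3)) * exp (- 2 * \<alpha> * of_real (ln 2))"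
    using Gamma_constant_integral_1[of \<alpha>] \<alpha> by (simp add: R_def add_ac)
  have c2: "Gamma \<alpha> ^ 2 * R (- \<alpha>) / 16 = of_real pi ^ 4 / 8 * csc (2 * of_real pi * \<alpha>) * (csc (of_real pi * \<alpha>) * Gamma (1/2 - 2 * \<alpha>) / (Gamma (\<alpha> + 1/2) * Gamma (1 - \<alpha>) ^ 3)) * exp (2 * \<alpha> * of_real (ln 2))"
    using Gamma_constant_integral_1[of "- \<alpha>"] \<alpha> by (simp add: R_def csc_def add_ac mult.commute[of "Gamma (1/2)"])
  have c3: "Gamma \<alpha> * Gamma (- \<alpha>) * R 0 / 8 = of_real pi ^ 4 / 8 * csc (2 * of_real pi * \<alpha>) * (- 2 / (of_real pi * \<alpha>))"
  proof -
    define s where "s = sin (of_real pi * \<alpha>)"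
    define c where "c = cos (of_real pi * \<alpha>)"
    have f: "s \<noteq> 0" "c \<noteq> 0" "Gamma (- \<alpha>) * Gamma (1 + \<alpha>) = - of_real pi / s"
      "\<alpha> * Gamma \<alpha> = Gamma (1 + \<alpha>)" "Gamma (1/2 + \<alpha>) * Gamma (1/2 - \<alpha>) = of_real pi / c"
      using Gamma_sin_facts[of \<alpha>] \<alpha> by (auto simp: s_def c_def)
    have gg: "Gamma \<alpha> * Gamma (- \<alpha>) = - of_real pi / s / \<alpha>"
    proof (rule eq_divide_imp[OF \<alpha>(1)])
      have "Gamma \<alpha> * Gamma (- \<alpha>) * \<alpha> = Gamma (- \<alpha>) * (\<alpha> * Gamma \<alpha>)" by (simp only: mult_ac)
      then show "Gamma \<alpha> * Gamma (- \<alpha>) * \<alpha> = - of_real pi / s" unfolding f(3,4) .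
    qed
    have r0: "R 0 = of_real pi / c * of_real pi"
    proof -
      have "Gamma (1/2) ^ 2 = complex_of_real pi"
        by (simp add: Gamma_one_half_complex power2_eq_square flip: of_real_mult)
      then show ?thesis by (simp add: R_def f(5))
    qed
    have cs: "csc (2 * of_real pi * \<alpha>) = 1 / (2 * s * c)"
      using sin_double[of "of_real pi * \<alpha>"] by (simp add: csc_def s_def c_def mult.assoc)
    show ?thesis unfolding gg r0 cs using f(1,2) \<alpha>(1) by (simp add: power4_eq_xxxx)
  qed
  have e: "exp (of_real (ln 2)) = (2::complex)"
    by (simp add: exp_of_real)
  have I: "(LBINT v. exp (of_real v) * bessel_K \<alpha> (of_real a * of_real (exp v)) ^ 2 * bessel_K \<alpha> (b * of_real (exp v)) ^ 2)
     = 1 / 16 * (1 / b) *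
       (Gamma (- \<alpha>) ^ 2 * W powr (2 * \<alpha>) * S \<alpha> \<alpha> + Gamma \<alpha> ^ 2 * W powr (- 2 * \<alpha>) * S (- \<alpha>) (- \<alpha>)
        + 2 * Gamma \<alpha> * Gamma (- \<alpha>) * S \<alpha> (- \<alpha>))"
  proof -
    have alg: "2 / 32 * (1 / b) * x = 1 / 16 * (1 / b) * x" for x :: complex by simp
    have pb: "b powr (- 1) = 1 / b" using b0 by (simp add: powr_minus inverse_eq_divide)
    show ?thesis unfolding S_def W_def alg [symmetric]
      by (rule integral_KK_expansion[of \<alpha> 1 a b, unfolded of_real_1 mult_1_left e pb]) (use \<alpha> a in simp_all)
  qed
  have "\<dots> = 1 / b * ((Gamma (- \<alpha>) ^ 2 * R \<alpha> / 16) * W powr (2 * \<alpha>) * hypergeo [1/2, \<alpha> + 1/2, \<alpha> + 1/2, 2 * \<alpha> + 1/2] [2 * \<alpha> + 1, \<alpha> + 1, \<alpha> + 1] (W\<^sup>2)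
     + (Gamma \<alpha> ^ 2 * R (- \<alpha>) / 16) * W powr (- 2 * \<alpha>) * hypergeo [1/2, 1/2 - 2 * \<alpha>, 1/2 - \<alpha>, 1/2 - \<alpha>] [1 - 2 * \<alpha>, 1 - \<alpha>, 1 - \<alpha>] (W\<^sup>2)
     + (Gamma \<alpha> * Gamma (- \<alpha>) * R 0 / 8) * hypergeo [1/2, 1/2, \<alpha> + 1/2, 1/2 - \<alpha>] [1, 1 - \<alpha>, \<alpha> + 1] (W\<^sup>2))"
    unfolding S1 S2 S3 by (simp add: algebra_simps)
  also have "\<dots> = of_real pi ^ 4 / (8 * b) * csc (2 * of_real pi * \<alpha>) *
         (csc (of_real pi * \<alpha>) * Gamma (2 * \<alpha> + 1/2) / (Gamma (1/2 - \<alpha>) * Gamma (1 + \<alpha>) ^ 3)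
            * (of_real a / (2 * b)) powr (2 * \<alpha>)
            * hypergeo [1/2, \<alpha> + 1/2, \<alpha> + 1/2, 2 * \<alpha> + 1/2] [2 * \<alpha> + 1, \<alpha> + 1, \<alpha> + 1] (W ^ 2)
          + csc (of_real pi * \<alpha>) * Gamma (1/2 - 2 * \<alpha>) / (Gamma (\<alpha> + 1/2) * Gamma (1 - \<alpha>) ^ 3)
            * (of_real a / (2 * b)) powr (- 2 * \<alpha>)
            * hypergeo [1/2, 1/2 - 2 * \<alpha>, 1/2 - \<alpha>, 1/2 - \<alpha>] [1 - 2 * \<alpha>, 1 - \<alpha>, 1 - \<alpha>] (W ^ 2)
          - 2 / (of_real pi * \<alpha>)
            * hypergeo [1/2, 1/2, \<alpha> + 1/2, 1/2 - \<alpha>] [1, 1 - \<alpha>, \<alpha> + 1] (W ^ 2))"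
  proof -
    have alg: "1 / b * ((P * A1 * E1) * w1 * H1 + (P * A2 * E2) * w2 * H2 + (P * (- A3)) * H3) = P / b * (A1 * (w1 * E1) * H1 + A2 * (w2 * E2) * H2 - A3 * H3)"
      for P A1 A2 A3 E1 E2 w1 w2 H1 H2 H3
      by (simp add: algebra_simps)
    have m: "- 2 / (of_real pi * \<alpha>) = - (2 / (of_real pi * \<alpha>))" "of_real pi ^ 4 / (8 * b) * csc (2 * of_real pi * \<alpha>) = of_real pi ^ 4 / 8 * csc (2 * of_real pi * \<alpha>) / b"
      "2 * \<alpha> * of_real (ln 2) = - (- 2 * \<alpha>) * of_real (ln 2)" "- 2 * \<alpha> * complex_of_real (ln 2) = - (2 * \<alpha>) * of_real (ln 2)" by simp_all
    show ?thesis unfolding c1 c2 c3 half m(1,2) unfolding m(3,4) by (rule alg)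
  qed
  finally show ?thesis using I by (simp only: W_def)
qed

lemma integral_2_expansion:
  fixes a :: real
  assumes \<alpha>: "\<alpha> \<noteq> 0" "\<bar>Re \<alpha>\<bar> < 1/2" and a: "0 < a" "2 * a < Re b"
  defines "W \<equiv> of_real a / b"
  shows "(LBINT v. exp (2 * of_real v) * bessel_K \<alpha> (of_real a * of_real (exp v)) ^ 2 * bessel_K \<alpha> (b * of_real (exp v)) ^ 2)
     = of_real pi ^ 2 / (8 * b ^ 2) * csc (of_real pi * \<alpha>) ^ 2 *
         (W powr (2 * \<alpha>) * odd_sum \<alpha> (W\<^sup>2) + W powr (- 2 * \<alpha>) * odd_sum (- \<alpha>) (W\<^sup>2) - 2 * odd_sum 0 (W\<^sup>2))"
proof -
  have b0: "b \<noteq> 0" using a by auto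
  define s where "s = sin (of_real pi * \<alpha>)"
  define G where "G = Gamma (1 + \<alpha>)"
  define G' where "G' = Gamma (1 - \<alpha>)"
  have f: "s \<noteq> 0" "Gamma (- \<alpha>) * G = - of_real pi / s" "\<alpha> * Gamma \<alpha> = G"
    using Gamma_sin_facts[of \<alpha>] \<alpha> by (auto simp: s_def G_def)
  have f': "Gamma \<alpha> * G' = of_real pi / s" "- \<alpha> * Gamma (- \<alpha>) = G'"
    using Gamma_sin_facts(3,4)[of "- \<alpha>"] \<alpha> by (auto simp: s_def G'_def)
  have G0: "G \<noteq> 0" "G' \<noteq> 0" using \<alpha> by (auto simp: G_def G'_def intro!: Gamma_nonzero)
  define S where "S \<mu> \<nu> = (\<Sum>k. mellin_coeff \<alpha> 2 \<mu> \<nu> k * (W\<^sup>2) ^ k)" for \<mu> \<nu>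
  have sm: "summable (\<lambda>k. mellin_coeff \<alpha> 2 \<mu> \<nu> k * (W\<^sup>2) ^ k)" if "\<mu> \<in> {\<alpha>, - \<alpha>}" "\<nu> \<in> {\<alpha>, - \<alpha>}" for \<mu> \<nu>
    using summable_mellin_coeff[of \<alpha> \<mu> \<nu> 2 a b] \<alpha> a that by (simp add: W_def)
  have p: "pochhammer (1 + \<alpha>) k \<noteq> 0" "pochhammer (1 - \<alpha>) k \<noteq> 0" "pochhammer (1 + 2 * \<alpha>) k \<noteq> 0" "pochhammer (1 - 2 * \<alpha>) k \<noteq> 0" for k
    using \<alpha> by (auto intro!: pochhammer_nonzero)
  have g: "Gamma (1 + 2 * \<alpha>) \<noteq> 0" "Gamma (1 - 2 * \<alpha>) \<noteq> 0" using \<alpha> by (auto intro!: Gamma_nonzero)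
  have d: "1 + \<alpha> + \<alpha> = 1 + 2 * \<alpha>" "1 - \<alpha> - \<alpha> = 1 - 2 * \<alpha>" by simp_all
  have S1: "S \<alpha> \<alpha> = G\<^sup>2 * odd_sum \<alpha> (W\<^sup>2)" unfolding S_def odd_sum_def
  proof (rule suminf_factor[OF sm])
    show "mellin_coeff \<alpha> 2 \<alpha> \<alpha> k * (W\<^sup>2) ^ k = G\<^sup>2 * ((W\<^sup>2) ^ k / (1 + 2 * \<alpha> + 2 * of_nat k))" for k
      by (subst mellin_coeff_2[where h=\<alpha>]) (use \<alpha> p[of k] g in \<open>simp_all add: G_def d power2_eq_square pochhammer_fact [symmetric]\<close>)
  qed (use G0 in auto)
  have S2: "S (- \<alpha>) (- \<alpha>) = G'\<^sup>2 * odd_sum (- \<alpha>) (W\<^sup>2)" unfolding S_def odd_sum_def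
  proof (rule suminf_factor[OF sm])
    show "mellin_coeff \<alpha> 2 (- \<alpha>) (- \<alpha>) k * (W\<^sup>2) ^ k = G'\<^sup>2 * ((W\<^sup>2) ^ k / (1 + 2 * - \<alpha> + 2 * of_nat k))" for k
      by (subst mellin_coeff_2[where h="- \<alpha>"]) (use \<alpha> p[of k] g in \<open>simp_all add: G'_def d power2_eq_square pochhammer_fact [symmetric]\<close>)
  qed (use G0 in auto)
  have S3: "S \<alpha> (- \<alpha>) = (G * G') * odd_sum 0 (W\<^sup>2)" unfolding S_def odd_sum_def
  proof (rule suminf_factor[OF sm])
    show "mellin_coeff \<alpha> 2 \<alpha> (- \<alpha>) k * (W\<^sup>2) ^ k = (G * G') * ((W\<^sup>2) ^ k / (1 + 2 * 0 + 2 * of_nat k))" for k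
      by (subst mellin_coeff_2[where h=0]) (use \<alpha> p[of k] g in \<open>simp_all add: G_def G'_def d power2_eq_square pochhammer_fact [symmetric]\<close>)
  qed (use G0 in auto)
  have e: "exp (2 * of_real (ln 2)) = (4::complex)"
    using exp_double[of "complex_of_real (ln 2)"] by (simp add: exp_of_real)
  have pb: "b powr (- 2) = 1 / b\<^sup>2"
    using b0 by (simp add: powr_minus inverse_eq_divide powr_nat')
  have I: "(LBINT v. exp (2 * of_real v) * bessel_K \<alpha> (of_real a * of_real (exp v)) ^ 2 * bessel_K \<alpha> (b * of_real (exp v)) ^ 2)
     = 1 / 8 * (1 / b\<^sup>2) *
       (Gamma (- \<alpha>) ^ 2 * W powr (2 * \<alpha>) * S \<alpha> \<alpha> + Gamma \<alpha> ^ 2 * W powr (- 2 * \<alpha>) * S (- \<alpha>) (- \<alpha>)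
        + 2 * Gamma \<alpha> * Gamma (- \<alpha>) * S \<alpha> (- \<alpha>))"
  proof -
    have alg: "4 / 32 * (1 / b\<^sup>2) * x = 1 / 8 * (1 / b\<^sup>2) * x" for x :: complex by simp
    show ?thesis unfolding S_def W_def alg [symmetric]
      by (rule integral_KK_expansion[of \<alpha> 2 a b, unfolded of_real_numeral e pb]) (use \<alpha> a in simp_all)
  qed
  have c1: "Gamma (- \<alpha>) ^ 2 * G\<^sup>2 = of_real pi ^ 2 / s\<^sup>2" unfolding power_mult_distrib [symmetric] f(2) by (simp add: power_divide)
  have c2: "Gamma \<alpha> ^ 2 * G'\<^sup>2 = of_real pi ^ 2 / s\<^sup>2" unfolding power_mult_distrib [symmetric] f'(1) by (simp add: power_divide)
  have c3: "Gamma \<alpha> * Gamma (- \<alpha>) * (G * G') = - (of_real pi ^ 2 / s\<^sup>2)"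
  proof -
    have "Gamma \<alpha> * Gamma (- \<alpha>) * (G * G') = (Gamma (- \<alpha>) * G) * (Gamma \<alpha> * G')" by (simp only: mult_ac)
    then show ?thesis unfolding f f' by (simp add: power2_eq_square)
  qed
  have "1 / 8 * (1 / b\<^sup>2) * (Gamma (- \<alpha>) ^ 2 * W powr (2 * \<alpha>) * S \<alpha> \<alpha> + Gamma \<alpha> ^ 2 * W powr (- 2 * \<alpha>) * S (- \<alpha>) (- \<alpha>)
        + 2 * Gamma \<alpha> * Gamma (- \<alpha>) * S \<alpha> (- \<alpha>))
     = 1 / (8 * b\<^sup>2) * ((Gamma (- \<alpha>) ^ 2 * G\<^sup>2) * W powr (2 * \<alpha>) * odd_sum \<alpha> (W\<^sup>2) + (Gamma \<alpha> ^ 2 * G'\<^sup>2) * W powr (- 2 * \<alpha>) * odd_sum (- \<alpha>) (W\<^sup>2)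
        + 2 * (Gamma \<alpha> * Gamma (- \<alpha>) * (G * G')) * odd_sum 0 (W\<^sup>2))"
    unfolding S1 S2 S3 by (simp add: mult_ac)
  also have "\<dots> = of_real pi ^ 2 / (8 * b ^ 2) * csc (of_real pi * \<alpha>) ^ 2 *
         (W powr (2 * \<alpha>) * odd_sum \<alpha> (W\<^sup>2) + W powr (- 2 * \<alpha>) * odd_sum (- \<alpha>) (W\<^sup>2) - 2 * odd_sum 0 (W\<^sup>2))"
  proof -
    have alg: "1 / B * (P / Q * x * X + P / Q * y * Y + 2 * (- (P / Q)) * Z) = P / B * (1 / Q) * (x * X + y * Y - 2 * Z)" for B P Q x X y Y Z :: complex
      by (simp add: algebra_simps)
    show ?thesis unfolding c1 c2 c3 csc_def power_divide s_def [symmetric] power_one by (rule alg)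
  qed
  finally show ?thesis using I by (simp only:)
qed

lemma norm_odd_sum_denominator: "1 + 2 * real k - 2 * \<bar>Re \<beta>\<bar> \<le> norm (1 + 2 * \<beta> + 2 * of_nat k)"
  using complex_Re_le_cmod[of "1 + 2 * \<beta> + 2 * of_nat k"] by auto

lemma summable_odd_sum:
  assumes "norm z < 1" "\<bar>Re \<beta>\<bar> < 1/2"
  shows "summable (\<lambda>k. z ^ k / (1 + 2 * \<beta> + 2 * of_nat k))"
proof (rule summable_comparison_test')
  define \<delta> where "\<delta> = 1 - 2 * \<bar>Re \<beta>\<bar>"
  have \<delta>: "\<delta> > 0" using assms(2) by (simp add: \<delta>_def)
  show "summable (\<lambda>k. 1 / \<delta> * norm z ^ k)" using assms(1) by (intro summable_mult summable_geometric) simp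
  show "norm (z ^ k / (1 + 2 * \<beta> + 2 * of_nat k)) \<le> 1 / \<delta> * norm z ^ k" for k
  proof -
    have "\<delta> \<le> norm (1 + 2 * \<beta> + 2 * of_nat k)" using norm_odd_sum_denominator[of k \<beta>] unfolding \<delta>_def by linarith
    then have "norm z ^ k / norm (1 + 2 * \<beta> + 2 * of_nat k) \<le> norm z ^ k / \<delta>" using \<delta> by (intro frac_le) auto
    then show ?thesis by (simp add: norm_divide norm_power)
  qed
qed

lemma hypergeo_eq_odd_sum:
  assumes "norm z < 1" "\<bar>Re \<beta>\<bar> < 1/2"
  shows "hypergeo [1, 1/2 + \<beta>] [3/2 + \<beta>] z = (1 + 2 * \<beta>) * odd_sum \<beta> z"
proof -
  have c: "fps_nth (fps_hypergeo [1, 1/2 + \<beta>] [3/2 + \<beta>] 1) k = (1 + 2 * \<beta>) * (1 / (1 + 2 * \<beta> + 2 * of_nat k))" for k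
  proof -
    define P where "P = pochhammer (3/2 + \<beta>) k"
    define Q where "Q = pochhammer (1/2 + \<beta>) k"
    have P: "P \<noteq> 0" unfolding P_def using assms(2) by (intro pochhammer_nonzero) auto
    have n0: "1 + 2 * \<beta> + 2 * of_nat k \<noteq> 0" using norm_odd_sum_denominator[of k \<beta>] assms(2) by auto
    have "Q * (1/2 + \<beta> + of_nat k) = (1/2 + \<beta>) * pochhammer (1/2 + \<beta> + 1) k"
      unfolding Q_def by (metis pochhammer_rec pochhammer_rec' mult.commute)
    also have "1/2 + \<beta> + 1 = 3/2 + \<beta>" by simp
    finally have "2 * (Q * (1/2 + \<beta> + of_nat k)) = 2 * ((1/2 + \<beta>) * P)" by (simp only: P_def)
    moreover have "2 * (Q * (1/2 + \<beta> + of_nat k)) = Q * (1 + 2 * \<beta> + 2 * of_nat k)" "2 * ((1/2 + \<beta>) * P) = (1 + 2 * \<beta>) * P"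
      by (simp_all add: algebra_simps)
    ultimately have "Q * (1 + 2 * \<beta> + 2 * of_nat k) = (1 + 2 * \<beta>) * P" by (simp only:)
    then have "Q / P = (1 + 2 * \<beta>) / (1 + 2 * \<beta> + 2 * of_nat k)"
      using P n0 by (simp add: frac_eq_eq)
    then show ?thesis by (simp add: P_def Q_def pochhammer_fact [symmetric])
  qed
  have "hypergeo [1, 1/2 + \<beta>] [3/2 + \<beta>] z = (\<Sum>k. (1 + 2 * \<beta>) * (z ^ k / (1 + 2 * \<beta> + 2 * of_nat k)))"
    unfolding hypergeo_eq_suminf[OF assms(1)] c by simp
  also have "\<dots> = (1 + 2 * \<beta>) * odd_sum \<beta> z"
    unfolding odd_sum_def by (rule suminf_mult[OF summable_odd_sum[OF assms]])
  finally show ?thesis .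
qed

lemma arctanh_eq_odd_sum:
  assumes "norm z < 1"
  shows "arctanh z = z * odd_sum 0 (z\<^sup>2)"
proof -
  have s1: "(\<lambda>n. (-1) ^ Suc n / of_nat n * z ^ n) sums ln (1 + z)" by (rule Ln_series[OF assms])
  have s2: "(\<lambda>n. (-1) ^ Suc n / of_nat n * (- z) ^ n) sums ln (1 - z)" using Ln_series[of "- z"] assms by simp
  have "(\<lambda>n. ((-1) ^ Suc n / of_nat n * z ^ n - (-1) ^ Suc n / of_nat n * (- z) ^ n) / 2) sums arctanh z"
    unfolding arctanh_def by (intro sums_divide sums_diff s1 s2)
  also have "(\<lambda>n. ((-1) ^ Suc n / of_nat n * z ^ n - (-1) ^ Suc n / of_nat n * (- z) ^ n) / 2) = (\<lambda>n. if odd n then z ^ n / of_nat n else 0)"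
    by (auto simp: fun_eq_iff power_minus[of z])
  finally have "(\<lambda>n. if odd n then z ^ n / of_nat n else 0) sums arctanh z" .
  moreover have "(\<lambda>n. if odd n then z ^ n / of_nat n else 0) sums x \<longleftrightarrow> (\<lambda>k. z ^ (2 * k + 1) / of_nat (2 * k + 1)) sums x" for x
  proof -
    have "(\<lambda>k. (\<lambda>n. if odd n then z ^ n / of_nat n else 0) (2 * k + 1)) sums x \<longleftrightarrow> (\<lambda>n. if odd n then z ^ n / of_nat n else 0) sums x"
      by (rule sums_mono_reindex) (auto simp: strict_mono_def elim!: oddE)
    then show ?thesis by simp
  qed
  ultimately have 1: "(\<lambda>k. z ^ (2 * k + 1) / of_nat (2 * k + 1)) sums arctanh z" by blast
  have "(\<lambda>k. z * ((z\<^sup>2) ^ k / (1 + 2 * 0 + 2 * of_nat k))) sums (z * odd_sum 0 (z\<^sup>2))"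
    unfolding odd_sum_def using assms by (intro sums_mult summable_sums summable_odd_sum) (auto simp: norm_power power_less_one_iff)
  moreover have "z ^ (2 * k + 1) / of_nat (2 * k + 1) = z * ((z\<^sup>2) ^ k / (1 + 2 * 0 + 2 * of_nat k))" for k
    by (simp add: power_mult)
  ultimately have "(\<lambda>k. z ^ (2 * k + 1) / of_nat (2 * k + 1)) sums (z * odd_sum 0 (z\<^sup>2))" by (simp only:)
  then show ?thesis using 1 by (rule sums_unique2[rotated])
qed

section \<open>Analytic continuation by Euler averages\<close>

text \<open>
  The plane cut along the logarithmic spiral from 1 to infinity in direction \<open>\<omega>\<close>; the usual cut
  is \<open>\<omega> = 1\<close>. A small tilt of \<open>\<omega>\<close> moves the cut away from a given point \<open>x > 1\<close>, so that a
  function continued to the tilted domain is holomorphic there.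
\<close>
definition spiral_compl :: "complex \<Rightarrow> complex set" where
  "spiral_compl \<omega> = - ((\<lambda>s. exp (of_real s * \<omega>)) ` {0..})"

text \<open>
  The parameter of a point of the spiral is determined by its modulus, so the spiral is the zero
  set of a continuous function on a closed set.
\<close>
lemma spiral_compl_altdef:
  assumes "Re \<omega> > 0"
  shows "spiral_compl \<omega> = - {z \<in> {z. 1 \<le> norm z}. z - exp (of_real (ln (norm z) / Re \<omega>) * \<omega>) = 0}"
proof -
  have "z \<in> (\<lambda>s. exp (of_real s * \<omega>)) ` {0..} \<longleftrightarrow> 1 \<le> norm z \<and> z = exp (of_real (ln (norm z) / Re \<omega>) * \<omega>)" for z
  proof
    assume "z \<in> (\<lambda>s. exp (of_real s * \<omega>)) ` {0..}"
    then obtain s where s: "s \<ge> 0" "z = exp (of_real s * \<omega>)" by auto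
    have "norm z = exp (s * Re \<omega>)" by (simp add: s)
    then show "1 \<le> norm z \<and> z = exp (of_real (ln (norm z) / Re \<omega>) * \<omega>)" using s assms by simp
  next
    assume *: "1 \<le> norm z \<and> z = exp (of_real (ln (norm z) / Re \<omega>) * \<omega>)"
    then have "ln (norm z) / Re \<omega> \<ge> 0" using assms by simp
    with * show "z \<in> (\<lambda>s. exp (of_real s * \<omega>)) ` {0..}"
      by (intro image_eqI[of _ _ "ln (norm z) / Re \<omega>"]) auto
  qed
  then show ?thesis unfolding spiral_compl_def by auto
qed

lemma open_spiral_compl:
  assumes "Re \<omega> > 0"
  shows "open (spiral_compl \<omega>)"
proof -
  have cl: "closed {z::complex. 1 \<le> norm z}" by (intro closed_Collect_le continuous_intros)
  have "closed {z \<in> {z. 1 \<le> norm z}. z - exp (of_real (ln (norm z) / Re \<omega>) * \<omega>) = 0}"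
    by (rule continuous_closed_preimage_constant[OF _ cl]) (use assms in \<open>auto intro!: continuous_intros\<close>)
  then show ?thesis unfolding spiral_compl_altdef[OF assms] by (rule open_Compl)
qed

lemma ball_subset_spiral_compl: "Re \<omega> > 0 \<Longrightarrow> ball 0 1 \<subseteq> spiral_compl \<omega>"
  by (auto simp: spiral_compl_altdef)

text \<open>
  The spiral is an orbit of the expanding flow, so its complement is invariant under the
  contracting one. Averages of \<open>f (z * exp (- s \<omega>))\<close> over \<open>s \<ge> 0\<close> therefore stay on the same
  domain.
\<close>
lemma spiral_compl_flow:
  assumes "z \<in> spiral_compl \<omega>" "s \<ge> 0"
  shows "z * exp (- (of_real s * \<omega>)) \<in> spiral_compl \<omega>"
proof -
  have "z * exp (- (of_real s * \<omega>)) \<noteq> exp (of_real t * \<omega>)" if "t \<ge> 0" for t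
  proof
    assume "z * exp (- (of_real s * \<omega>)) = exp (of_real t * \<omega>)"
    then have "z * exp (- (of_real s * \<omega>)) * exp (of_real s * \<omega>) = exp (of_real t * \<omega>) * exp (of_real s * \<omega>)" by simp
    then have "z = exp (of_real (t + s) * \<omega>)" by (simp add: mult.assoc mult_exp_exp distrib_right)
    then have "z \<in> (\<lambda>s. exp (of_real s * \<omega>)) ` {0..}"
      using assms that by (intro image_eqI[of _ _ "t + s"]) auto
    then show False using assms by (simp add: spiral_compl_def)
  qed
  then show ?thesis by (auto simp: spiral_compl_def image_iff)
qed

lemma spiral_compl_1: "spiral_compl 1 = cut_plane"
proof -
  have "(\<lambda>s. exp (complex_of_real s * 1)) ` {0..} = complex_of_real ` {1..}"
  proof (intro set_eqI iffI)
    fix z :: complex assume "z \<in> complex_of_real ` {1..}"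
    then obtain x :: real where x: "x \<ge> 1" "z = of_real x" by auto
    then have "z = exp (complex_of_real (ln x) * 1)" by (simp add: exp_of_real)
    then show "z \<in> (\<lambda>s. exp (complex_of_real s * 1)) ` {0..}" using x by (intro image_eqI[of _ _ "ln x"]) auto
  qed (auto simp: exp_of_real)
  then show ?thesis by (simp add: spiral_compl_def cut_plane_def)
qed

lemma bounded_along_flow:
  assumes f: "continuous_on (spiral_compl \<omega>) f" and \<omega>: "Re \<omega> > 0" and z0: "z0 \<in> spiral_compl \<omega>"
  obtains r B where "r > 0" "cball z0 r \<subseteq> spiral_compl \<omega>"
    "\<And>z s. z \<in> cball z0 r \<Longrightarrow> s \<ge> 0 \<Longrightarrow> norm (f (z * exp (- (of_real s * \<omega>))) :: complex) \<le> B"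
proof -
  obtain r where r: "r > 0" "cball z0 r \<subseteq> spiral_compl \<omega>"
    using open_spiral_compl[OF \<omega>] z0 open_contains_cball by blast
  define R where "R = norm z0 + r + 1"
  \<comment> \<open>At time \<open>S\<close> the flow has contracted the disc of radius \<open>R\<close> to the disc of radius 1/2, where \<open>f\<close> is bounded anyway; up to that time the orbits fill a compact set.\<close>
  define S where "S = ln (2 * R) / Re \<omega>"
  have R: "R \<ge> 1" using r by (simp add: R_def)
  have S: "S \<ge> 0" using R \<omega> by (simp add: S_def)
  define T where "T = (\<lambda>(z, s). z * exp (- (of_real s * \<omega>))) ` (cball z0 r \<times> {0..S})"
  have "compact T" unfolding T_def
    by (intro compact_continuous_image compact_Times) (auto simp: split_beta intro!: continuous_intros)
  moreover have T: "T \<subseteq> spiral_compl \<omega>" unfolding T_def using r spiral_compl_flow by auto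
  ultimately have "compact (f ` T)" using f by (meson compact_continuous_image continuous_on_subset)
  then obtain B1 where B1: "\<And>w. w \<in> T \<Longrightarrow> norm (f w) \<le> B1"
    by (metis bounded_iff compact_imp_bounded image_eqI)
  have "cball 0 (1/2) \<subseteq> spiral_compl \<omega>" using ball_subset_spiral_compl[OF \<omega>] by (auto simp: subset_iff)
  then have "compact (f ` cball 0 (1/2))" using f by (meson compact_continuous_image compact_cball continuous_on_subset)
  then obtain B2 where B2: "\<And>w. w \<in> cball 0 (1/2) \<Longrightarrow> norm (f w) \<le> B2"
    by (metis bounded_iff compact_imp_bounded image_eqI)
  show ?thesis
  proof (rule that[OF r, of "max B1 B2"])
    fix z and s :: real assume z: "z \<in> cball z0 r" and s: "s \<ge> 0"
    show "norm (f (z * exp (- (of_real s * \<omega>)))) \<le> max B1 B2"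
    proof (cases "s \<le> S")
      case True
      then have "z * exp (- (of_real s * \<omega>)) \<in> T" using z s by (force simp: T_def)
      then show ?thesis using B1 by (simp add: le_max_iff_disj)
    next
      case False
      have "norm z \<le> norm z0 + norm (z - z0)" by (metis add.commute diff_add_cancel norm_triangle_ineq)
      also have "norm (z - z0) \<le> r" using z by (simp add: dist_norm norm_minus_commute)
      finally have zR: "norm z \<le> R" by (simp add: R_def)
      have "exp (- (s * Re \<omega>)) \<le> exp (- (S * Re \<omega>))" using False \<omega> by simp
      also have "\<dots> = 1 / (2 * R)" using \<omega> R by (simp add: S_def exp_minus inverse_eq_divide)
      finally have "norm z * exp (- (s * Re \<omega>)) \<le> R * (1 / (2 * R))" using zR R by (intro mult_mono) auto
      then have "z * exp (- (of_real s * \<omega>)) \<in> cball 0 (1/2)" using R by (simp add: norm_mult)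
      then show ?thesis using B2 by (simp add: le_max_iff_disj)
    qed
  qed
qed

definition continuable :: "complex \<Rightarrow> (nat \<Rightarrow> complex) \<Rightarrow> bool" where
  "continuable \<omega> c \<longleftrightarrow> (\<exists>f. f holomorphic_on spiral_compl \<omega> \<and> (\<forall>z\<in>ball 0 1. (\<lambda>k. c k * z ^ k) sums f z))"

text \<open>
  The function \<open>F z\<close>, the integral of \<open>\<kappa> s * f (z * exp (- s \<omega>))\<close> over \<open>s \<ge> 0\<close>, has the moments
  of \<open>\<kappa>\<close> as multipliers of its coefficients and is holomorphic wherever \<open>f\<close> is.
\<close>
lemma continuable_moments:
  fixes \<kappa> :: "real \<Rightarrow> complex"
  assumes c: "continuable \<omega> c" and \<omega>: "Re \<omega> > 0" and \<kappa>: "integrable lborel \<kappa>"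
  shows "continuable \<omega> (\<lambda>k. c k * (LBINT s. \<kappa> s * exp (- (of_real (max 0 s) * \<omega>)) ^ k))"
proof -
  obtain f where f: "f holomorphic_on spiral_compl \<omega>" "\<And>z. z \<in> ball 0 1 \<Longrightarrow> (\<lambda>k. c k * z ^ k) sums f z"
    using c unfolding continuable_def by blast
  have fc: "continuous_on (spiral_compl \<omega>) f" using f(1) holomorphic_on_imp_continuous_on by blast
  \<comment> \<open>The maximum replaces negative \<open>s\<close>, where the kernels of interest vanish, by 0; so \<open>e\<close> may be integrated over the whole line.\<close>
  define e where "e s = exp (- (of_real (max 0 s) * \<omega>))" for s
  have e: "z * e s \<in> spiral_compl \<omega>" if "z \<in> spiral_compl \<omega>" for z s
    unfolding e_def by (rule spiral_compl_flow[OF that]) simp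
  have ne: "norm (e s) \<le> 1" for s using \<omega> by (simp add: e_def)
  define F where "F z = (LBINT s. \<kappa> s * f (z * e s))" for z
  have mf: "(\<lambda>s. f (z * e s)) \<in> borel_measurable borel" if "z \<in> spiral_compl \<omega>" for z
    by (rule borel_measurable_continuous_onI, rule continuous_on_compose2[OF fc])
       (use e that in \<open>auto simp: e_def intro!: continuous_intros\<close>)
  have m\<kappa>: "\<kappa> \<in> borel_measurable borel" using \<kappa> by auto
  have "F holomorphic_on spiral_compl \<omega>" unfolding F_def
  proof (rule holomorphic_on_integral)
    show "open (spiral_compl \<omega>)" by (rule open_spiral_compl[OF \<omega>])
    show "(\<lambda>z. \<kappa> s * f (z * e s)) holomorphic_on spiral_compl \<omega>" for s
      by (intro holomorphic_intros holomorphic_on_compose_gen[OF _ f(1), unfolded o_def]) (use e in auto)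
    show "(\<lambda>s. \<kappa> s * f (z * e s)) \<in> borel_measurable lborel" if "z \<in> spiral_compl \<omega>" for z
      using mf[OF that] m\<kappa> by simp
    fix z0 assume "z0 \<in> spiral_compl \<omega>"
    then obtain r B where r: "r > 0"
      "\<And>z s. z \<in> cball z0 r \<Longrightarrow> s \<ge> 0 \<Longrightarrow> norm (f (z * exp (- (of_real s * \<omega>)))) \<le> B"
      using bounded_along_flow[OF fc \<omega>] by metis
    have "norm (\<kappa> s * f (z * e s)) \<le> norm (\<kappa> s) * B" if "z \<in> ball z0 r" for z s
      unfolding norm_mult e_def using r(2)[of z "max 0 s"] that by (intro mult_left_mono) auto
    then show "\<exists>r>0. \<exists>g. integrable lborel g \<and> (\<forall>z\<in>ball z0 r \<inter> spiral_compl \<omega>. \<forall>s\<in>space lborel. norm (\<kappa> s * f (z * e s)) \<le> g s)"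
      using r(1) \<kappa> by (intro exI[of _ r] conjI exI[of _ "\<lambda>s. norm (\<kappa> s) * B"]) auto
  qed
  moreover have "(\<lambda>k. c k * (LBINT s. \<kappa> s * e s ^ k) * z ^ k) sums F z" if z: "z \<in> ball 0 1" for z
  proof -
    have zS: "z \<in> spiral_compl \<omega>" using z ball_subset_spiral_compl[OF \<omega>] by blast
    obtain w :: real where w: "norm z < w" "w < 1" using z dense[of "norm z" 1] by auto
    have "summable (\<lambda>k. c k * of_real w ^ k)" using f(2)[of "of_real w"] w sums_summable norm_ge_zero[of z] by (auto simp del: norm_ge_zero)
    then have abs: "summable (\<lambda>k. norm (c k * z ^ k))"
      using powser_insidea[of c "of_real w" z] w norm_ge_zero[of z] by (simp del: norm_ge_zero)
    define B where "B = (\<Sum>k. norm (c k * z ^ k))"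
    define t where "t k s = \<kappa> s * (c k * (z * e s) ^ k)" for k s
    have mt: "t k \<in> borel_measurable lborel" for k
      unfolding t_def using m\<kappa> by (simp add: e_def)
    have mS: "(\<lambda>s. \<Sum>k<n. t k s) \<in> borel_measurable lborel" for n using mt by simp
    have nt: "norm (t k s) \<le> norm (\<kappa> s) * norm (c k * z ^ k)" for k s
    proof -
      have "norm (e s) ^ k \<le> 1" using ne by (intro power_le_one) auto
      then have "norm (c k) * norm z ^ k * norm (e s) ^ k \<le> norm (c k) * norm z ^ k * 1" by (intro mult_left_mono) auto
      then show ?thesis by (simp add: t_def norm_mult norm_power power_mult_distrib mult_left_mono mult.assoc)
    qed
    have bS: "AE s in lborel. norm (\<Sum>k<n. t k s) \<le> norm (\<kappa> s) * B" for n
    proof (rule AE_I2)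
      fix s
      have "norm (\<Sum>k<n. t k s) \<le> (\<Sum>k<n. norm (\<kappa> s) * norm (c k * z ^ k))" by (intro sum_norm_le nt)
      also have "\<dots> = norm (\<kappa> s) * (\<Sum>k<n. norm (c k * z ^ k))" by (simp add: sum_distrib_left)
      also have "\<dots> \<le> norm (\<kappa> s) * B" unfolding B_def by (intro mult_left_mono sum_le_suminf abs) auto
      finally show "norm (\<Sum>k<n. t k s) \<le> norm (\<kappa> s) * B" .
    qed
    have lS: "AE s in lborel. (\<lambda>n. \<Sum>k<n. t k s) \<longlonglongrightarrow> \<kappa> s * f (z * e s)"
    proof (rule AE_I2)
      fix s
      have "norm (z * e s) \<le> norm z * 1" unfolding norm_mult using ne by (intro mult_left_mono) auto
      then have "z * e s \<in> ball 0 1" using z by simp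
      from sums_mult[OF f(2)[OF this], of "\<kappa> s"] show "(\<lambda>n. \<Sum>k<n. t k s) \<longlonglongrightarrow> \<kappa> s * f (z * e s)"
        unfolding t_def sums_def .
    qed
    have G: "integrable lborel (\<lambda>s. norm (\<kappa> s) * B)" using \<kappa> by simp
    have mF: "(\<lambda>s. \<kappa> s * f (z * e s)) \<in> borel_measurable lborel" using mf[OF zS] m\<kappa> by simp
    have it: "integrable lborel (t k)" for k
    proof (rule Bochner_Integration.integrable_bound[OF _ mt])
      show "integrable lborel (\<lambda>s. norm (\<kappa> s) * norm (c k * z ^ k))" using \<kappa> by simp
      show "AE s in lborel. norm (t k s) \<le> norm (norm (\<kappa> s) * norm (c k * z ^ k))" using nt by simp
    qed
    have I: "(LBINT s. t k s) = c k * (LBINT s. \<kappa> s * e s ^ k) * z ^ k" for k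
    proof -
      have "t k s = c k * z ^ k * (\<kappa> s * e s ^ k)" for s by (simp add: t_def power_mult_distrib mult_ac)
      then have "(LBINT s. t k s) = c k * z ^ k * (LBINT s. \<kappa> s * e s ^ k)" by (simp only: integral_mult_right_zero)
      then show ?thesis by (simp only: mult_ac)
    qed
    have "(\<lambda>n. LBINT s. (\<Sum>k<n. t k s)) \<longlonglongrightarrow> F z"
      unfolding F_def by (rule integral_dominated_convergence[OF mF mS G lS bS])
    moreover have "(LBINT s. (\<Sum>k<n. t k s)) = (\<Sum>k<n. c k * (LBINT s. \<kappa> s * e s ^ k) * z ^ k)" for n
      using it by (simp add: I)
    ultimately show ?thesis unfolding sums_def by simp
  qed
  ultimately show ?thesis unfolding continuable_def e_def by blast
qed

text \<open>
  Euler's beta kernel \<open>t powr (q - 1) * (1 - t) powr (d - 1)\<close> on \<open>0 < t < 1\<close> after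
  \<open>t = exp (- \<omega> s)\<close>, with the Jacobian included. Averaging with it gives a hypergeometric
  function one more upper and one more lower parameter.
\<close>
definition euler_kernel :: "complex \<Rightarrow> real \<Rightarrow> complex \<Rightarrow> real \<Rightarrow> complex" where
  "euler_kernel q d \<omega> s = (if s > 0 then \<omega> * exp (- (\<omega> * q * of_real s)) * (1 - exp (- (\<omega> * of_real s))) powr of_real (d - 1) else 0)"

lemma Re_one_minus_exp_pos:
  assumes "Re \<omega> > 0" "s > 0"
  shows "Re (1 - exp (- (\<omega> * of_real s))) > 0"
proof -
  have "Re (exp (- (\<omega> * of_real s))) \<le> norm (exp (- (\<omega> * of_real s)))" by (rule complex_Re_le_cmod)
  also have "\<dots> < 1" using assms by simp
  finally show ?thesis by simp
qed

lemma measurable_euler_kernel: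
  assumes "Re \<omega> > 0"
  shows "euler_kernel q d \<omega> \<in> borel_measurable borel"
proof -
  have "continuous_on {0<..} (euler_kernel q d \<omega>)"
  proof -
    have "continuous_on {0<..} (\<lambda>s. \<omega> * exp (- (\<omega> * q * of_real s)) * (1 - exp (- (\<omega> * complex_of_real s))) powr of_real (d - 1))"
    proof -
      have P: "Re (1 - exp (- (\<omega> * complex_of_real s))) \<ge> 0" "1 - exp (- (\<omega> * complex_of_real s)) \<noteq> 0" if "s > 0" for s
      proof -
        note R = Re_one_minus_exp_pos[OF assms that]
        show "Re (1 - exp (- (\<omega> * complex_of_real s))) \<ge> 0" using R by (rule less_imp_le)
        show "1 - exp (- (\<omega> * complex_of_real s)) \<noteq> 0"
        proof
          assume "1 - exp (- (\<omega> * complex_of_real s)) = 0"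
          from R[unfolded this] show False by simp
        qed
      qed
      have "continuous_on {0<..} (\<lambda>s. (1 - exp (- (\<omega> * complex_of_real s))) powr of_real (d - 1))"
      proof (rule continuous_on_powr_complex)
        show "{0<..} \<subseteq> {s. Re (1 - exp (- (\<omega> * complex_of_real s))) \<ge> 0 \<or> Im (1 - exp (- (\<omega> * complex_of_real s))) \<noteq> 0}"
          using P(1) by blast
        show "0 < Re (complex_of_real (d - 1))" if "s \<in> {0<..}" "1 - exp (- (\<omega> * complex_of_real s)) = 0" for s
          using P(2)[of s] that by (metis greaterThan_iff)
      qed (intro continuous_intros)+
      then show ?thesis by (intro continuous_on_mult continuous_on_const) (intro continuous_intros)
    qed
    then show ?thesis by (rule continuous_on_eq) (auto simp: euler_kernel_def)
  qed
  then have "(\<lambda>s. indicator {0<..} s *\<^sub>R euler_kernel q d \<omega> s) \<in> borel_measurable borel"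
    by (intro borel_measurable_continuous_on_indicator) auto
  moreover have "(\<lambda>s. indicator {0<..} s *\<^sub>R euler_kernel q d \<omega> s) = euler_kernel q d \<omega>"
    by (auto simp: euler_kernel_def indicator_def fun_eq_iff)
  ultimately show ?thesis by simp
qed

text \<open>
  The beta integral again. It is pulled back to the hyperbolic form of the beta integral, so
  that integrability comes with the value.
\<close>
lemma euler_kernel_1:
  assumes q: "Re q > 0" and d: "d > 0"
  shows "integrable lborel (euler_kernel q d 1)"
    and "(LBINT s. euler_kernel q d 1 s) = Gamma q * Gamma (of_real d) / Gamma (q + of_real d)"
proof -
  define \<alpha> where "\<alpha> = (q - of_real d) / 2"
  define S where "S = q + of_real d"
  have S: "Re S > 2 * \<bar>Re \<alpha>\<bar>" using q d by (auto simp: S_def \<alpha>_def)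
  \<comment> \<open>With \<open>s = g p = ln (1 + exp (- 2 * p))\<close> one has \<open>exp (- s) = exp p / (2 * cosh p)\<close> and \<open>1 - exp (- s) = exp (- p) / (2 * cosh p)\<close>.\<close>
  define g where "g p = ln (1 + exp (- 2 * p))" for p :: real
  define g' where "g' p = - 2 * exp (- 2 * p) / (1 + exp (- 2 * p))" for p :: real
  define f where "f = euler_kernel q d 1"
  define h where "h p = 2 * (exp (2 * \<alpha> * of_real p) * exp (- S * of_real (ln (2 * cosh p))))" for p :: real
  have pos: "1 + exp (- 2 * p) > 0" for p :: real by (simp add: add_pos_pos)
  have g0: "g p > 0" for p unfolding g_def by (intro ln_gt_zero) simp
  have c: "1 + exp (- 2 * p) = 2 * cosh p * exp (- p)" for p :: real
    by (simp add: cosh_def algebra_simps mult_exp_exp)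
  have g_eq: "g p = ln (2 * cosh p) - p" for p
    unfolding g_def c by (subst ln_mult) (auto simp: cosh_real_pos)
  have range: "range g = {0<..}"
  proof (intro equalityI subsetI)
    fix s :: real assume "s \<in> {0<..}"
    then have s: "exp s > 1" by simp
    have "g (- ln (exp s - 1) / 2) = s" using s by (simp add: g_def)
    then show "s \<in> range g" by (metis rangeI)
  qed (use g0 in auto)
  have inj: "inj g"
    by (rule injI) (use pos in \<open>simp add: g_def\<close>)
  have fh: "\<bar>g' p\<bar> *\<^sub>R f (g p) = h p" for p
  proof -
    define L where "L = ln (2 * cosh p)"
    have eg: "exp (- g p) = exp (p - L)" by (simp add: g_eq L_def)
    have eL: "exp L = exp p + exp (- p)" by (simp add: L_def cosh_real_pos) (simp add: cosh_def)
    have om: "1 - exp (- g p) = exp (- p - L)"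
    proof -
      have "exp p + exp (- p) > 0" by (simp add: add_pos_pos)
      then show ?thesis unfolding eg exp_diff eL by (simp add: divide_simps)
    qed
    have "exp (- 2 * p) / (1 + exp (- 2 * p)) = exp (- p - L)"
      unfolding c exp_diff by (simp add: L_def cosh_real_pos field_simps mult_exp_exp)
    then have ag: "\<bar>g' p\<bar> = 2 * exp (- p - L)" by (simp add: g'_def abs_mult abs_divide)
    have cx: "1 - exp (- complex_of_real (g p)) = of_real (exp (- p - L))"
      unfolding om[symmetric] by (simp add: exp_of_real [symmetric])
    have "complex_of_real (exp (- p - L)) powr of_real (d - 1) = of_real (exp (- p - L) powr (d - 1))"
      by (rule powr_of_real) simp
    also have "exp (- p - L) powr (d - 1) = exp ((d - 1) * (- p - L))" by (simp add: powr_def)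
    also have "complex_of_real \<dots> = exp (of_real ((d - 1) * (- p - L)))" by (simp only: exp_of_real)
    finally have "f (g p) = exp (- q * of_real (g p)) * exp (of_real ((d - 1) * (- p - L)))"
      using g0[of p] by (simp add: f_def euler_kernel_def cx)
    then have fe: "f (g p) = exp (- q * of_real (g p)) * exp (of_real ((d - 1) * (- p - L)))" .
    have E: "complex_of_real (exp (- p - L)) = exp (of_real (- p - L))" by (simp only: exp_of_real)
    have "\<bar>g' p\<bar> *\<^sub>R f (g p) = 2 * (exp (of_real (- p - L)) * (exp (- q * of_real (g p)) * exp (of_real ((d - 1) * (- p - L)))))"
      unfolding ag scaleR_conv_of_real of_real_mult E fe by (simp only: of_real_numeral mult.assoc)
    also have "\<dots> = h p" unfolding mult_exp_exp h_def
      by (rule arg_cong[where f="\<lambda>x. 2 * exp x"]) (simp add: \<alpha>_def S_def g_eq L_def field_simps)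
    finally show ?thesis .
  qed
  have h: "integrable lborel h" "(LBINT p. h p) = Gamma q * Gamma (of_real d) / Gamma (q + of_real d)"
  proof -
    have "S / 2 + \<alpha> = q" "S / 2 - \<alpha> = of_real d" by (simp_all add: S_def \<alpha>_def field_simps)
    then show "integrable lborel h" "(LBINT p. h p) = Gamma q * Gamma (of_real d) / Gamma (q + of_real d)"
      unfolding h_def using integral_cosh_powr[OF S] by (simp_all add: S_def)
  qed
  have A: "(\<lambda>p. \<bar>g' p\<bar> *\<^sub>R f (g p)) absolutely_integrable_on UNIV \<and> integral UNIV (\<lambda>p. \<bar>g' p\<bar> *\<^sub>R f (g p)) = (LBINT p. h p)"
  proof -
    have "integrable lebesgue h" using integrable_completion[of h lborel] h(1) by auto
    then show ?thesis unfolding fh using integral_lborel[OF h(1)] by (simp add: set_integrable_def)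
  qed
  have B: "((\<lambda>p. \<bar>g' p\<bar> *\<^sub>R f (g p)) absolutely_integrable_on UNIV \<and> integral UNIV (\<lambda>p. \<bar>g' p\<bar> *\<^sub>R f (g p)) = (LBINT p. h p)) \<longleftrightarrow> f absolutely_integrable_on range g \<and> integral (range g) f = (LBINT p. h p)"
  proof (rule has_absolute_integral_change_of_variables_real)
    show "(g has_field_derivative g' p) (at p within UNIV)" for p
      unfolding g_def g'_def using pos[of p] by (auto intro!: derivative_eq_intros)
  qed (use inj in simp_all)
  note F' = iffD1[OF B A, unfolded range]
  have F: "f absolutely_integrable_on {0<..}" "integral {0<..} f = (LBINT p. h p)" using F' by blast+
  have f_ind: "indicator {0<..} s *\<^sub>R f s = f s" for s by (simp add: f_def euler_kernel_def indicator_def)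
  have mf: "f \<in> borel_measurable borel" unfolding f_def by (rule measurable_euler_kernel) simp
  have mf': "f \<in> borel_measurable lborel" using mf by simp
  have "integrable lebesgue f" by (rule F(1)[unfolded set_integrable_def f_ind])
  then have i: "integrable lborel f" using integrable_completion[OF mf'] by blast
  then show "integrable lborel (euler_kernel q d 1)" by (simp only: f_def)
  have "integral {0<..} f = integral UNIV f"
  proof -
    have "(\<lambda>s. if s \<in> {0<..} then f s else 0) = f" by (auto simp: fun_eq_iff f_def euler_kernel_def)
    then show ?thesis using integral_restrict_UNIV[of "{0<..}" f] by simp
  qed
  also have "\<dots> = (LBINT s. f s)" by (rule integral_lborel[OF i])
  finally show "(LBINT s. euler_kernel q d 1 s) = Gamma q * Gamma (of_real d) / Gamma (q + of_real d)"
    using F(2) h(2) by (simp add: f_def)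
qed

lemma euler_kernel_scale:
  assumes q: "Re q > 0" and d: "d > 0" and r: "r > 0"
  shows "integrable lborel (euler_kernel q d (of_real r))"
    and "(LBINT s. euler_kernel q d (of_real r) s) = Gamma q * Gamma (of_real d) / Gamma (q + of_real d)"
proof -
  have eq: "euler_kernel q d (of_real r) s = of_real r * euler_kernel q d 1 (0 + r * s)" for s
    using r by (simp add: euler_kernel_def mult_ac zero_less_mult_iff)
  note 1 = euler_kernel_1[OF q d]
  show "integrable lborel (euler_kernel q d (of_real r))"
    unfolding eq[abs_def] using 1(1) r lborel_integrable_real_affine_iff[of r "euler_kernel q d 1" 0]
    by (intro integrable_mult_right) simp
  have "(LBINT s. euler_kernel q d 1 s) = r *\<^sub>R (LBINT s. euler_kernel q d 1 (0 + r * s))"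
    using lborel_integral_real_affine[of r "euler_kernel q d 1" 0] r by simp
  then have "(LBINT s. euler_kernel q d (of_real r) s) = (LBINT s. euler_kernel q d 1 s)"
    unfolding eq[abs_def] by (simp only: integral_mult_right_zero scaleR_conv_of_real)
  then show "(LBINT s. euler_kernel q d (of_real r) s) = Gamma q * Gamma (of_real d) / Gamma (q + of_real d)"
    using 1(2) by simp
qed

text \<open>
  Comparison with the kernel for a real direction. For \<open>d \<le> 1\<close> the exponent \<open>d - 1\<close> is
  nonpositive, so the lower bound \<open>1 - exp (- \<mu> s)\<close> for the base suffices.
\<close>
lemma norm_euler_kernel_le:
  assumes \<mu>: "\<mu> > 0" "\<mu> \<le> Re \<omega>" and \<epsilon>: "\<epsilon> \<le> Re (\<omega> * q)" and A: "norm \<omega> \<le> A" and d: "d \<le> 1"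
  shows "norm (euler_kernel q d \<omega> s) \<le> A / \<mu> * norm (euler_kernel (of_real (\<epsilon> / \<mu>)) d (of_real \<mu>) s)"
proof (cases "s > 0")
  case True
  define x where "x = 1 - exp (- (\<omega> * of_real s))"
  define y where "y = 1 - exp (- (\<mu> * s))"
  have y: "y > 0" using \<mu> True by (simp add: y_def)
  have "norm (exp (- (\<omega> * of_real s))) \<le> exp (- (\<mu> * s))" using \<mu> True by simp
  moreover have "norm (1::complex) - norm (exp (- (\<omega> * of_real s))) \<le> norm x" unfolding x_def by (rule norm_triangle_ineq2)
  ultimately have xy: "y \<le> norm x" unfolding y_def norm_one by linarith
  then have x0: "x \<noteq> 0" using y by auto
  have "norm (x powr of_real (d - 1)) = norm x powr (d - 1)" using x0 by (simp add: powr_def)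
  also have "\<dots> \<le> y powr (d - 1)" using y xy d by (intro powr_mono2') auto
  finally have 1: "norm (x powr of_real (d - 1)) \<le> y powr (d - 1)" .
  have 2: "norm (exp (- (\<omega> * q * of_real s))) \<le> exp (- (\<epsilon> * s))"
    using \<epsilon> True mult_right_mono[of \<epsilon> "Re (\<omega> * q)" s] by simp
  have A0: "A \<ge> 0" using A norm_ge_zero order_trans by blast
  have "norm (euler_kernel q d \<omega> s) = norm \<omega> * norm (exp (- (\<omega> * q * of_real s))) * norm (x powr of_real (d - 1))"
    using True by (simp add: euler_kernel_def norm_mult x_def)
  also have "\<dots> \<le> A * exp (- (\<epsilon> * s)) * y powr (d - 1)"
    using A0 by (intro mult_mono 1 2 A) auto
  also have "\<dots> = A / \<mu> * norm (euler_kernel (of_real (\<epsilon> / \<mu>)) d (of_real \<mu>) s)"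
  proof -
    have "1 - exp (- (complex_of_real \<mu> * of_real s)) = of_real y" by (simp add: y_def exp_of_real [symmetric])
    moreover have "norm (complex_of_real y powr of_real (d - 1)) = y powr (d - 1)"
      using y by (subst norm_powr_real_powr) auto
    ultimately have "norm ((1 - exp (- (complex_of_real \<mu> * of_real s))) powr of_real (d - 1)) = y powr (d - 1)"
      by (simp only:)
    then show ?thesis using \<mu> True by (simp add: euler_kernel_def norm_mult)
  qed
  finally show ?thesis .
qed (simp add: euler_kernel_def)

text \<open>
  The total mass does not depend on the direction \<open>\<omega>\<close>: it is holomorphic in \<open>\<omega>\<close> on a convex cone
  and, by rescaling \<open>s\<close>, constant on the positive reals. This replaces a rotation of the path of
  integration.
\<close>
lemma euler_kernel_integral:
  assumes q: "Re q > 0" and d: "0 < d" "d \<le> 1" and \<omega>: "Re \<omega> > 0" "Re (\<omega> * q) > 0"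
  shows "integrable lborel (euler_kernel q d \<omega>)"
    and "(LBINT s. euler_kernel q d \<omega> s) = Gamma q * Gamma (of_real d) / Gamma (q + of_real d)"
proof -
  define D where "D = {\<omega>. Re \<omega> > 0} \<inter> {\<omega>. Re (\<omega> * q) > 0}"
  have int: "integrable lborel (\<lambda>s. A / \<mu> * norm (euler_kernel (of_real (\<epsilon> / \<mu>)) d (of_real \<mu>) s))"
    if "\<mu> > 0" "\<epsilon> > 0" for A \<mu> \<epsilon>
    by (intro integrable_mult_right integrable_norm euler_kernel_scale(1) d that) (use that in simp)
  show "integrable lborel (euler_kernel q d \<omega>)"
  proof (rule Bochner_Integration.integrable_bound)
    show "integrable lborel (\<lambda>s. norm \<omega> / Re \<omega> * norm (euler_kernel (of_real (Re (\<omega> * q) / Re \<omega>)) d (of_real (Re \<omega>)) s))"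
      by (rule int[OF \<omega>])
    show "AE s in lborel. norm (euler_kernel q d \<omega> s) \<le> norm (norm \<omega> / Re \<omega> * norm (euler_kernel (of_real (Re (\<omega> * q) / Re \<omega>)) d (of_real (Re \<omega>)) s))"
    proof (rule AE_I2)
      fix s
      have "norm (euler_kernel q d \<omega> s) \<le> norm \<omega> / Re \<omega> * norm (euler_kernel (of_real (Re (\<omega> * q) / Re \<omega>)) d (of_real (Re \<omega>)) s)" (is "_ \<le> ?X")
        by (rule norm_euler_kernel_le) (use \<omega> d in auto)
      also have "?X \<le> norm ?X" unfolding real_norm_def by (rule abs_ge_self)
      finally show "norm (euler_kernel q d \<omega> s) \<le> norm ?X" .
    qed
  qed (use measurable_euler_kernel[OF \<omega>(1)] in simp)
  have open_D: "open D" unfolding D_def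
    by (intro open_Int open_Collect_less continuous_intros)
  have conv: "convex D"
  proof -
    have "{\<omega>. Re (\<omega> * q) > 0} = {\<omega>. inner (cnj q) \<omega> > 0}" by (auto simp: inner_complex_def mult.commute)
    then show ?thesis unfolding D_def by (auto intro!: convex_Int convex_halfspace_gt convex_halfspace_Re_gt)
  qed
  define M where "M \<omega> = (LBINT s. euler_kernel q d \<omega> s) - Gamma q * Gamma (of_real d) / Gamma (q + of_real d)" for \<omega>
  have "(\<lambda>\<omega>. LBINT s. euler_kernel q d \<omega> s) holomorphic_on D"
  proof (rule holomorphic_on_integral[OF open_D])
    show "(\<lambda>\<omega>. euler_kernel q d \<omega> s) holomorphic_on D" for s
    proof (cases "s > 0")
      case True
      have "1 - exp (- (\<omega> * complex_of_real s)) \<notin> \<real>\<^sub>\<le>\<^sub>0" if "\<omega> \<in> D" for \<omega>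
        using Re_one_minus_exp_pos[of \<omega> s] that True by (auto simp: D_def complex_nonpos_Reals_iff)
      then have "(\<lambda>\<omega>. \<omega> * exp (- (\<omega> * q * of_real s)) * (1 - exp (- (\<omega> * of_real s))) powr of_real (d - 1)) holomorphic_on D"
        by (intro holomorphic_intros) auto
      then show ?thesis using True by (simp add: euler_kernel_def)
    qed (simp add: euler_kernel_def)
    show "euler_kernel q d \<omega> \<in> borel_measurable lborel" if "\<omega> \<in> D" for \<omega>
      using measurable_euler_kernel[of \<omega>] that by (simp add: D_def)
    fix \<omega>0 assume \<omega>0: "\<omega>0 \<in> D"
    define \<mu> where "\<mu> = Re \<omega>0 / 2"
    define \<epsilon> where "\<epsilon> = Re (\<omega>0 * q) / 2"
    have pos: "\<mu> > 0" "\<epsilon> > 0" using \<omega>0 by (auto simp: \<mu>_def \<epsilon>_def D_def)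
    define r where "r = min \<mu> (\<epsilon> / (norm q + 1))"
    have r: "r > 0" using pos by (simp add: r_def add_nonneg_pos)
    have "\<mu> \<le> Re \<omega> \<and> \<epsilon> \<le> Re (\<omega> * q) \<and> norm \<omega> \<le> norm \<omega>0 + r" if "\<omega> \<in> ball \<omega>0 r" for \<omega>
    proof (intro conjI)
      have n: "norm (\<omega>0 - \<omega>) < r" using that by (simp add: dist_norm)
      have "Re \<omega>0 - Re \<omega> \<le> norm (\<omega>0 - \<omega>)" using complex_Re_le_cmod[of "\<omega>0 - \<omega>"] by simp
      also have "\<dots> \<le> \<mu>" using n by (simp add: r_def)
      finally show "\<mu> \<le> Re \<omega>" by (simp add: \<mu>_def)
      have "Re (\<omega>0 * q) - Re (\<omega> * q) = Re ((\<omega>0 - \<omega>) * q)" by (simp add: algebra_simps)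
      also have "\<dots> \<le> norm (\<omega>0 - \<omega>) * norm q" by (metis complex_Re_le_cmod norm_mult)
      also have "\<dots> \<le> (\<epsilon> / (norm q + 1)) * (norm q + 1)"
        using n pos by (intro mult_mono) (auto simp: r_def)
      also have "\<dots> = \<epsilon>"
      proof -
        have "norm q + 1 \<noteq> 0" using norm_ge_zero[of q] by linarith
        then show ?thesis by simp
      qed
      finally show "\<epsilon> \<le> Re (\<omega> * q)" by (simp add: \<epsilon>_def)
      show "norm \<omega> \<le> norm \<omega>0 + r" using n norm_triangle_sub[of \<omega> \<omega>0] by (simp add: norm_minus_commute)
    qed
    then show "\<exists>r>0. \<exists>g. integrable lborel g \<and> (\<forall>\<omega>\<in>ball \<omega>0 r \<inter> D. \<forall>s\<in>space lborel. norm (euler_kernel q d \<omega> s) \<le> g s)"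
      using r pos d int[OF pos, of "norm \<omega>0 + r"] norm_euler_kernel_le[of \<mu> _ \<epsilon> q "norm \<omega>0 + r" d]
      by (intro exI[of _ r] conjI exI[of _ "\<lambda>s. (norm \<omega>0 + r) / \<mu> * norm (euler_kernel (of_real (\<epsilon> / \<mu>)) d (of_real \<mu>) s)"]) auto
  qed
  then have "M holomorphic_on D" unfolding M_def by (intro holomorphic_intros)
  have "M \<omega> = 0"
  proof (rule analytic_continuation[where f=M])
    show "M holomorphic_on D" by fact
    show "open D" by fact
    show "connected D" using conv convex_connected by blast
    show "of_real ` {0<..<1} \<subseteq> D" "of_real (1/2) \<in> D" "\<omega> \<in> D" using q \<omega> by (auto simp: D_def)
    show "complex_of_real (1/2) islimpt of_real ` {0<..<1}" using of_real_islimpt_Ioo[of 1] by simp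
    show "M z = 0" if "z \<in> of_real ` {0<..<1}" for z
      using that euler_kernel_scale(2)[OF q d(1)] by (auto simp: M_def)
  qed
  then show "(LBINT s. euler_kernel q d \<omega> s) = Gamma q * Gamma (of_real d) / Gamma (q + of_real d)"
    by (simp add: M_def)
qed

text \<open>
  The \<open>k\<close>-th moment of the Euler kernel with parameter \<open>q\<close> is the total mass of the one with
  parameter \<open>q + k\<close>, and the quotient of two such masses is the quotient of Pochhammer symbols.
\<close>
lemma continuable_pochhammer:
  assumes c: "continuable \<omega> c" and q: "Re q > 0" and d: "0 < d" "d \<le> 1" and \<omega>: "Re \<omega> > 0" "Re (\<omega> * q) > 0"
  shows "continuable \<omega> (\<lambda>k. c k * (pochhammer q k / pochhammer (q + of_real d) k))"
proof -
  define B where "B q = Gamma q * Gamma (of_real d) / Gamma (q + of_real d)" for q :: complex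
  have m: "(LBINT s. euler_kernel q d \<omega> s * exp (- (of_real (max 0 s) * \<omega>)) ^ k) = B (q + of_nat k)" for k
  proof -
    have "euler_kernel q d \<omega> s * exp (- (of_real (max 0 s) * \<omega>)) ^ k = euler_kernel (q + of_nat k) d \<omega> s" for s
    proof (cases "s > 0")
      case True
      have "exp (- (\<omega> * q * of_real s)) * exp (- (of_real s * \<omega>)) ^ k = exp (- (\<omega> * (q + of_nat k) * of_real s))"
        by (simp add: exp_of_nat_mult [symmetric] mult_exp_exp algebra_simps)
      then show ?thesis using True by (simp add: euler_kernel_def max_def mult_ac)
    qed (simp add: euler_kernel_def)
    moreover have "Re (\<omega> * (q + of_nat k)) > 0" using \<omega> by (auto simp: distrib_left intro: add_pos_nonneg)
    ultimately show ?thesis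
      using euler_kernel_integral(2)[of "q + of_nat k" d \<omega>] q d \<omega> by (simp add: B_def add_pos_nonneg add.commute add.left_commute)
  qed
  have B: "B (q + of_nat k) = B q * (pochhammer q k / pochhammer (q + of_real d) k)" for k
  proof -
    have "Gamma (q + of_nat k + of_real d) = Gamma (q + of_real d) * pochhammer (q + of_real d) k"
      using Gamma_shift[of "q + of_real d" k] q d by (simp add: add_ac)
    then show ?thesis using Gamma_shift[OF q, of k] by (simp add: B_def)
  qed
  have B0: "B q \<noteq> 0" unfolding B_def using q d by (auto simp: Gamma_nonzero)
  have "continuable \<omega> (\<lambda>k. c k * B (q + of_nat k))"
    using continuable_moments[OF c \<omega>(1) euler_kernel_integral(1)[OF q d \<omega>]] unfolding m .
  then obtain f where f: "f holomorphic_on spiral_compl \<omega>" "\<And>z. z \<in> ball 0 1 \<Longrightarrow> (\<lambda>k. c k * B (q + of_nat k) * z ^ k) sums f z"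
    unfolding continuable_def by blast
  show ?thesis unfolding continuable_def
  proof (intro exI[of _ "\<lambda>z. f z / B q"] conjI ballI)
    show "(\<lambda>z. f z / B q) holomorphic_on spiral_compl \<omega>" using f(1) B0 by (intro holomorphic_intros) auto
    fix z :: complex assume "z \<in> ball 0 1"
    from sums_divide[OF f(2)[OF this], of "B q"]
    show "(\<lambda>k. c k * (pochhammer q k / pochhammer (q + of_real d) k) * z ^ k) sums (f z / B q)"
      unfolding B using B0 by (simp add: mult_ac)
  qed
qed

lemma continuable_geometric:
  assumes "Re \<omega> > 0"
  shows "continuable \<omega> (\<lambda>_. 1)"
  unfolding continuable_def
proof (intro exI[of _ "\<lambda>z. 1 / (1 - z)"] conjI ballI)
  have "exp (of_real 0 * \<omega>) \<notin> spiral_compl \<omega>" unfolding spiral_compl_def by (auto intro!: image_eqI[of _ _ 0])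
  then have "1 \<notin> spiral_compl \<omega>" by simp
  then show "(\<lambda>z. 1 / (1 - z)) holomorphic_on spiral_compl \<omega>" by (intro holomorphic_intros) auto
  show "(\<lambda>k. 1 * z ^ k) sums (1 / (1 - z))" if "z \<in> ball 0 1" for z :: complex
    using geometric_sums[of z] that by simp
qed

text \<open>
  Continuation along all spirals with direction close to 1. The direction 1 itself gives the
  function on the plane cut along \<open>[1, \<infinity>)\<close>, the neighbouring ones its boundary values on the cut
  from either side.
\<close>
definition sectorial :: "(nat \<Rightarrow> complex) \<Rightarrow> bool" where
  "sectorial c \<longleftrightarrow> (\<exists>\<eta>>0. \<forall>\<omega>. Re \<omega> = 1 \<and> \<bar>Im \<omega>\<bar> < \<eta> \<longrightarrow> continuable \<omega> c)"

lemma sectorial_geometric: "sectorial (\<lambda>_. 1)"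
  unfolding sectorial_def by (intro exI[of _ 1]) (auto intro: continuable_geometric)

text \<open>
  Only a narrower range of directions survives, because the Euler kernel must decay:
  \<open>Re (\<omega> * q) = Re q - Im \<omega> * Im q\<close> has to stay positive.
\<close>
lemma sectorial_pochhammer:
  assumes "sectorial c" and q: "Re q > 0" and d: "0 < d" "d \<le> 1"
  shows "sectorial (\<lambda>k. c k * (pochhammer q k / pochhammer (q + of_real d) k))"
proof -
  obtain \<eta> where \<eta>: "\<eta> > 0" "\<And>\<omega>. Re \<omega> = 1 \<Longrightarrow> \<bar>Im \<omega>\<bar> < \<eta> \<Longrightarrow> continuable \<omega> c"
    using assms(1) unfolding sectorial_def by blast
  define \<eta>' where "\<eta>' = min \<eta> (Re q / (\<bar>Im q\<bar> + 1))"
  show ?thesis unfolding sectorial_def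
  proof (intro exI[of _ \<eta>'] conjI allI impI)
    show "\<eta>' > 0" using \<eta> q by (simp add: \<eta>'_def add_nonneg_pos)
    fix \<omega> assume \<omega>: "Re \<omega> = 1 \<and> \<bar>Im \<omega>\<bar> < \<eta>'"
    have "Im \<omega> * Im q \<le> \<bar>Im \<omega>\<bar> * \<bar>Im q\<bar>" by (metis abs_ge_self abs_mult)
    also have "\<dots> \<le> Re q / (\<bar>Im q\<bar> + 1) * \<bar>Im q\<bar>" using \<omega> by (intro mult_right_mono) (auto simp: \<eta>'_def)
    also have "\<dots> < Re q" using q by (simp add: field_simps add_nonneg_pos)
    finally have "Re (\<omega> * q) > 0" using \<omega> by simp
    then show "continuable \<omega> (\<lambda>k. c k * (pochhammer q k / pochhammer (q + of_real d) k))"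
      using \<omega> \<eta>(2)[of \<omega>] by (intro continuable_pochhammer q d) (auto simp: \<eta>'_def)
  qed
qed

section \<open>Hypergeometric functions on the cut plane and their boundary values\<close>

lemma open_cut_plane: "open cut_plane"
  using open_spiral_compl[of 1] by (simp add: spiral_compl_1)

lemma connected_cut_plane: "connected cut_plane"
proof (rule starlike_imp_connected)
  have "closed_segment 0 z \<subseteq> cut_plane" if "z \<in> cut_plane" for z
  proof
    fix u assume "u \<in> closed_segment 0 z"
    then obtain t where t: "0 \<le> t" "t \<le> 1" "u = of_real t * z" by (auto simp: in_segment scaleR_conv_of_real)
    show "u \<in> cut_plane"
    proof (rule ccontr)
      assume "u \<notin> cut_plane"
      then obtain x where x: "x \<ge> 1" "u = of_real x" by (auto simp: cut_plane_def)
      then have t0: "t > 0" using t by (cases "t = 0") auto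
      then have "z = of_real (x / t)" using x t by (simp add: field_simps)
      moreover have "x / t \<ge> 1" using x t t0 by (simp add: field_simps)
      ultimately have "z \<in> complex_of_real ` {1..}" by (intro image_eqI[of _ _ "x / t"]) auto
      then show False using that by (simp add: cut_plane_def)
    qed
  qed
  moreover have "0 \<in> cut_plane" by (auto simp: cut_plane_def)
  ultimately show "starlike cut_plane" unfolding starlike_def by blast
qed

lemma ball_subset_cut_plane: "ball 0 1 \<subseteq> cut_plane"
  using ball_subset_spiral_compl[of 1] by (simp add: spiral_compl_1)

lemma eval_fps_eqI: "(\<lambda>k. fps_nth F k * z ^ k) sums w \<Longrightarrow> eval_fps F z = w"
  by (simp add: eval_fps_def sums_iff)

lemma hypergeo_eqI:
  assumes f: "f holomorphic_on cut_plane" "\<And>z. z \<in> ball 0 1 \<Longrightarrow> eval_fps (fps_hypergeo as bs 1) z = f z" and z: "z \<in> cut_plane"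
  shows "hypergeo as bs z = f z"
proof (cases "norm z < 1")
  case True
  then show ?thesis using f(2)[of z] by (simp add: hypergeo_def)
next
  case False
  have "(THE w. \<exists>g. g holomorphic_on cut_plane \<and> (\<forall>u\<in>ball 0 1. g u = eval_fps (fps_hypergeo as bs 1) u) \<and> w = g z) = f z"
  proof (rule the_equality)
    show "\<exists>g. g holomorphic_on cut_plane \<and> (\<forall>u\<in>ball 0 1. g u = eval_fps (fps_hypergeo as bs 1) u) \<and> f z = g z"
      using f by (intro exI[of _ f]) auto
    fix w assume "\<exists>g. g holomorphic_on cut_plane \<and> (\<forall>u\<in>ball 0 1. g u = eval_fps (fps_hypergeo as bs 1) u) \<and> w = g z"
    then obtain g where g: "g holomorphic_on cut_plane" "\<forall>u\<in>ball 0 1. g u = eval_fps (fps_hypergeo as bs 1) u" "w = g z" by blast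
    have "g z = f z"
      by (rule analytic_continuation_open[OF open_ball[of 0 1] open_cut_plane _ connected_cut_plane ball_subset_cut_plane g(1) f(1) _ z])
         (use f(2) g(2) in auto)
    then show "w = f z" using g(3) by simp
  qed
  then show ?thesis using False z by (simp add: hypergeo_def)
qed

lemma holomorphic_hypergeo:
  assumes "sectorial (fps_nth (fps_hypergeo as bs 1))"
  shows "hypergeo as bs holomorphic_on cut_plane"
proof -
  have "continuable 1 (fps_nth (fps_hypergeo as bs 1))" using assms unfolding sectorial_def by auto
  then obtain f where f: "f holomorphic_on cut_plane" "\<And>z. z \<in> ball 0 1 \<Longrightarrow> (\<lambda>k. fps_nth (fps_hypergeo as bs 1) k * z ^ k) sums f z"
    unfolding continuable_def spiral_compl_1 by blast
  have "hypergeo as bs z = f z" if "z \<in> cut_plane" for z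
    by (rule hypergeo_eqI[OF f(1) _ that]) (use f(2) in \<open>auto intro: eval_fps_eqI\<close>)
  then show ?thesis using f(1) by (metis holomorphic_transform)
qed

text \<open>
  For the upper half-plane the spiral is bent downwards, and conversely. Then the half-disc in
  \<open>H\<close> of radius \<open>R > x\<close> avoids the spiral, the continuation along it agrees with \<open>hypergeo\<close>
  there by the identity theorem, and it is continuous at \<open>x\<close>.
\<close>
lemma hypergeo_side_limit:
  assumes sec: "sectorial (fps_nth (fps_hypergeo as bs 1))"
    and H: "H = {w. Im w > 0} \<or> H = {w. Im w < 0}" and x: "x > 1"
  shows "\<exists>L. (hypergeo as bs \<longlongrightarrow> L) (at (of_real x) within H)"
proof -
  define \<tau> :: real where "\<tau> = (if H = {w. Im w > 0} then 1 else -1)"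
  have H\<tau>: "H = {w. \<tau> * Im w > 0}" and \<tau>: "\<tau> * \<tau> = 1" "\<bar>\<tau>\<bar> = 1" using H by (auto simp: \<tau>_def)
  obtain \<eta>0 where \<eta>0: "\<eta>0 > 0" "\<And>\<omega>. Re \<omega> = 1 \<Longrightarrow> \<bar>Im \<omega>\<bar> < \<eta>0 \<Longrightarrow> continuable \<omega> (fps_nth (fps_hypergeo as bs 1))"
    using sec unfolding sectorial_def by blast
  define R where "R = x + 1"
  have lnR: "ln R > 0" using x by (simp add: R_def)
  \<comment> \<open>The spiral reaches modulus \<open>R\<close> at parameter \<open>ln R\<close>; the bound \<open>\<eta> * ln R \<le> 1 < pi\<close> keeps its argument small enough not to return to \<open>H\<close> before.\<close>
  define \<eta> where "\<eta> = min (\<eta>0 / 2) (1 / ln R)"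
  have \<eta>: "\<eta> > 0" "\<eta> < \<eta>0" "\<eta> * ln R \<le> 1" using \<eta>0(1) lnR by (auto simp: \<eta>_def min_def field_simps)
  define \<omega> where "\<omega> = Complex 1 (- \<tau> * \<eta>)"
  have \<omega>: "Re \<omega> = 1" "\<bar>Im \<omega>\<bar> = \<eta>" using \<tau> \<eta> by (simp_all add: \<omega>_def abs_mult)
  obtain f where f: "f holomorphic_on spiral_compl \<omega>" "\<And>z. z \<in> ball 0 1 \<Longrightarrow> (\<lambda>k. fps_nth (fps_hypergeo as bs 1) k * z ^ k) sums f z"
    using \<eta>0(2)[of \<omega>] \<omega> \<eta> unfolding continuable_def by auto
  have spiral: "\<tau> * Im z \<le> 0 \<and> (Im z = 0 \<longrightarrow> norm z = 1)" if "z \<notin> spiral_compl \<omega>" "norm z < R" for z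
  proof -
    have "z \<in> (\<lambda>s. exp (of_real s * \<omega>)) ` {0..}" using that(1) by (simp only: spiral_compl_def Compl_iff not_not)
    then obtain s where s: "s \<ge> 0" "z = exp (of_real s * \<omega>)" by (elim imageE) simp
    have "norm z = exp s" using \<omega> by (simp add: s)
    then have "exp s < exp (ln R)" using that(2) x by (simp add: R_def)
    then have "s < ln R" by simp
    then have "\<eta> * s \<le> \<eta> * ln R" using \<eta> by simp
    then have "\<eta> * s \<le> 1" using \<eta>(3) \<open>s < ln R\<close> mult_left_mono[of s "ln R" \<eta>] \<eta>(1) by linarith
    moreover have "0 \<le> \<eta> * s" using s \<eta> by simp
    ultimately have sb: "0 \<le> \<eta> * s" "\<eta> * s \<le> 1" by simp_all
    have "Im z = exp s * sin (s * (- \<tau> * \<eta>))" by (simp add: s Im_exp \<omega>_def)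
    also have "\<dots> = - \<tau> * exp s * sin (\<eta> * s)"
      using \<tau>(2) by (cases "\<tau> = 1") (auto simp: abs_if mult_ac split: if_splits)
    finally have Im: "Im z = - \<tau> * exp s * sin (\<eta> * s)" .
    have sp: "sin (\<eta> * s) \<ge> 0" using sb pi_gt3 by (intro sin_ge_zero) auto
    have "\<tau> * Im z = - (exp s * sin (\<eta> * s))" unfolding Im using \<tau>(1) by (simp add: mult.assoc [symmetric])
    then have 1: "\<tau> * Im z \<le> 0" using sp by simp
    have 2: "norm z = 1" if "Im z = 0"
    proof -
      have "sin (\<eta> * s) = 0" using that \<tau> unfolding Im by auto
      then have "\<eta> * s = 0" using sin_gt_zero[of "\<eta> * s"] sb pi_gt3 by (cases "\<eta> * s = 0") auto
      then show ?thesis using \<eta> \<open>norm z = exp s\<close> by simp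
    qed
    from 1 2 show ?thesis by blast
  qed
  define U where "U = H \<inter> ball 0 R"
  have U1: "U \<subseteq> spiral_compl \<omega>" unfolding U_def H\<tau> using spiral by fastforce
  have U2: "U \<subseteq> cut_plane" unfolding U_def H\<tau> cut_plane_def by auto
  have xS: "of_real x \<in> spiral_compl \<omega>" using spiral[of "of_real x"] x by (auto simp: R_def)
  have convH: "convex H" "open H" using H by (auto intro: convex_halfspace_Im_gt convex_halfspace_Im_lt open_halfspace_Im_gt open_halfspace_Im_lt)
  have eq: "hypergeo as bs z = f z" if "z \<in> U" for z
  proof (rule analytic_continuation_open[of "H \<inter> ball 0 1" U "hypergeo as bs" f])
    show "open (H \<inter> ball 0 1)" "open U" using convH by (auto simp: U_def)
    have "of_real \<tau> * \<i> / 2 \<in> H \<inter> ball 0 1" unfolding H\<tau> using \<tau> by (simp add: norm_mult norm_divide)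
    then show "H \<inter> ball 0 1 \<noteq> {}" by blast
    show "connected U" unfolding U_def by (intro convex_connected convex_Int convH convex_ball)
    show "H \<inter> ball 0 1 \<subseteq> U" using x by (auto simp: U_def R_def)
    show "hypergeo as bs holomorphic_on U" using holomorphic_hypergeo[OF sec] U2 holomorphic_on_subset by blast
    show "f holomorphic_on U" using f(1) U1 holomorphic_on_subset by blast
    show "hypergeo as bs z = f z" if "z \<in> H \<inter> ball 0 1" for z
      using f(2)[of z] that by (auto simp: hypergeo_def intro!: eval_fps_eqI)
  qed fact
  have "continuous_on (spiral_compl \<omega>) f" using f(1) holomorphic_on_imp_continuous_on by blast
  then have "isCont f (of_real x)" using xS open_spiral_compl[of \<omega>] \<omega> by (simp add: continuous_on_eq_continuous_at)
  then have "(f \<longlongrightarrow> f (of_real x)) (at (of_real x) within H)" 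
    by (meson continuous_at_imp_continuous_at_within continuous_within)
  moreover have ev: "\<forall>\<^sub>F z in at (of_real x) within H. hypergeo as bs z = f z"
  proof -
    have "\<forall>\<^sub>F z in at (of_real x) within H. z \<in> ball 0 R"
      using x by (intro eventually_at_topological[THEN iffD2] exI[of _ "ball 0 R"]) (auto simp: R_def)
    moreover have "\<forall>\<^sub>F z in at (complex_of_real x) within H. z \<in> H" by (auto simp: eventually_at_filter)
    ultimately show ?thesis by eventually_elim (use eq in \<open>auto simp: U_def\<close>)
  qed
  ultimately show ?thesis using tendsto_cong[OF ev] by blast
qed

lemma at_within_halfplane_nontrivial:
  assumes "H = {w. Im w > 0} \<or> H = {w. Im w < 0}"
  shows "at (of_real x) within H \<noteq> (bot :: complex filter)"
proof -
  define \<tau> :: real where "\<tau> = (if H = {w. Im w > 0} then 1 else -1)"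
  have "complex_of_real x islimpt H" unfolding islimpt_sequential
  proof (intro exI conjI allI)
    have "(\<lambda>n. 1 / (real n + 1)) \<longlonglongrightarrow> 0" by real_asymp
    then have "(\<lambda>n. complex_of_real x + of_real (\<tau> * (1 / (real n + 1))) * \<i>) \<longlonglongrightarrow> of_real x + of_real (\<tau> * 0) * \<i>" by (intro tendsto_intros)
    then show "(\<lambda>n. complex_of_real x + of_real (\<tau> * (1 / (real n + 1))) * \<i>) \<longlonglongrightarrow> of_real x" by simp
    show "complex_of_real x + of_real (\<tau> * (1 / (real n + 1))) * \<i> \<in> H - {of_real x}" for n
      using assms by (auto simp: \<tau>_def complex_eq_iff)
  qed
  then show ?thesis by (simp add: trivial_limit_within)
qed

text \<open>
  Near a positive real point, squaring preserves the sign of the imaginary part.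
\<close>
lemma square_filterlim_halfplane:
  assumes H: "H = {w. Im w > 0} \<or> H = {w. Im w < 0}" and x: "x > 0"
  shows "filterlim (\<lambda>w. w ^ 2) (at (of_real x ^ 2) within H) (at (of_real x) within H)"
  unfolding filterlim_at
proof
  have "\<forall>\<^sub>F w in at (complex_of_real x) within H. w \<in> {w. Re w > 0}"
    using x open_halfspace_Re_gt[of 0] by (intro eventually_at_topological[THEN iffD2] exI[of _ "{w. Re w > 0}"]) auto
  moreover have "\<forall>\<^sub>F w in at (complex_of_real x) within H. w \<in> H" by (auto simp: eventually_at_filter)
  ultimately show "\<forall>\<^sub>F w in at (complex_of_real x) within H. w\<^sup>2 \<in> H \<and> w\<^sup>2 \<noteq> (complex_of_real x)\<^sup>2"
  proof eventually_elim
    case (elim w)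
    have "Im (w\<^sup>2) = 2 * Re w * Im w" by (simp add: power2_eq_square)
    moreover have "Im ((complex_of_real x)\<^sup>2) = 0" by (simp add: power2_eq_square)
    ultimately show ?case using elim H by (auto simp: mult_less_0_iff zero_less_mult_iff)
  qed
qed (intro tendsto_intros)

lemma side_value_hypergeo_limit:
  assumes sec: "sectorial (fps_nth (fps_hypergeo as bs 1))"
    and H: "H = {w. Im w > 0} \<or> H = {w. Im w < 0}" and x: "x > 1"
  shows "((\<lambda>w. hypergeo as bs (w ^ 2)) \<longlongrightarrow> side_value H (\<lambda>w. hypergeo as bs (w ^ 2)) (of_real x)) (at (of_real x) within H)"
proof -
  obtain L where "(hypergeo as bs \<longlongrightarrow> L) (at (of_real (x\<^sup>2)) within H)"
    using hypergeo_side_limit[OF sec H, of "x\<^sup>2"] x by (auto simp: one_less_power)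
  then have L: "((\<lambda>w. hypergeo as bs (w ^ 2)) \<longlongrightarrow> L) (at (of_real x) within H)"
    using filterlim_compose[OF _ square_filterlim_halfplane[OF H], of "hypergeo as bs" "nhds L" x] x by simp
  have "side_value H (\<lambda>w. hypergeo as bs (w ^ 2)) (of_real x) = Lim (at (of_real x) within H) (\<lambda>w. hypergeo as bs (w ^ 2))"
    using x by (simp add: side_value_def)
  also have "\<dots> = L" by (rule tendsto_Lim[OF at_within_halfplane_nontrivial[OF H] L])
  finally show ?thesis using L by simp
qed

lemma side_value_arctanh_limit:
  assumes H: "H = {w. Im w > 0} \<or> H = {w. Im w < 0}" and x: "x > 1"
  shows "(arctanh \<longlongrightarrow> side_value H arctanh (of_real x)) (at (of_real x) within H)"
proof -
  define \<tau> :: complex where "\<tau> = (if H = {w. Im w > 0} then 1 else -1)"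
  define g where "g w = (Ln (1 + w) - (Ln (w - 1) - \<tau> * \<i> * of_real pi)) / 2" for w
  have nn: "1 + complex_of_real x \<notin> \<real>\<^sub>\<le>\<^sub>0" "complex_of_real x - 1 \<notin> \<real>\<^sub>\<le>\<^sub>0" using x by (auto simp: complex_nonpos_Reals_iff)
  have "isCont g (of_real x)" unfolding g_def by (intro continuous_intros nn) auto
  then have "(g \<longlongrightarrow> g (of_real x)) (at (of_real x) within H)" 
    by (meson continuous_at_imp_continuous_at_within continuous_within)
  moreover have ev: "\<forall>\<^sub>F w in at (complex_of_real x) within H. g w = arctanh w"
  proof -
    have "g w = arctanh w" if "w \<in> H" for w
    proof -
      have w1: "w - 1 \<noteq> 0" using that H by auto
      have "Ln (1 - w) = Ln (- (w - 1))" by simp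
      also have "\<dots> = Ln (w - 1) - \<tau> * \<i> * of_real pi"
        using that H w1 by (subst Ln_minus) (auto simp: \<tau>_def)
      finally show ?thesis by (simp add: g_def arctanh_def)
    qed
    moreover have "\<forall>\<^sub>F w in at (complex_of_real x) within H. w \<in> H" by (auto simp: eventually_at_filter)
    ultimately show ?thesis by (auto elim: eventually_mono)
  qed
  ultimately have L: "(arctanh \<longlongrightarrow> g (of_real x)) (at (of_real x) within H)" using tendsto_cong[OF ev] by blast
  have "side_value H arctanh (of_real x) = Lim (at (of_real x) within H) arctanh"
    using x by (simp add: side_value_def)
  also have "\<dots> = g (of_real x)" by (rule tendsto_Lim[OF at_within_halfplane_nontrivial[OF H] L])
  finally show ?thesis using L by simp
qed

text \<open>
  The three \<open>4F3\<close> functions of the theorem all pair their parameters with difference 1/2, once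
  the factorial is written as the Pochhammer symbol of 1. So each arises from the geometric
  series by four Euler averages.
\<close>
lemma sectorial_hypergeo_4F3:
  assumes "Re q1 > 0" "Re q2 > 0" "Re q3 > 0" "Re q4 > 0"
    and "\<And>k. fps_nth (fps_hypergeo as bs 1) k = (pochhammer q1 k / pochhammer (q1 + of_real (1/2)) k) * (pochhammer q2 k / pochhammer (q2 + of_real (1/2)) k)
      * (pochhammer q3 k / pochhammer (q3 + of_real (1/2)) k) * (pochhammer q4 k / pochhammer (q4 + of_real (1/2)) k)"
  shows "sectorial (fps_nth (fps_hypergeo as bs 1))"
proof -
  have half: "0 < (1/2::real)" "(1/2::real) \<le> 1" by simp_all
  have "sectorial (\<lambda>k. 1 * (pochhammer q1 k / pochhammer (q1 + of_real (1/2)) k) * (pochhammer q2 k / pochhammer (q2 + of_real (1/2)) k)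
      * (pochhammer q3 k / pochhammer (q3 + of_real (1/2)) k) * (pochhammer q4 k / pochhammer (q4 + of_real (1/2)) k))"
    by (intro sectorial_pochhammer sectorial_geometric half assms(1-4))
  also have "(\<lambda>k. 1 * (pochhammer q1 k / pochhammer (q1 + of_real (1/2)) k) * (pochhammer q2 k / pochhammer (q2 + of_real (1/2)) k)
      * (pochhammer q3 k / pochhammer (q3 + of_real (1/2)) k) * (pochhammer q4 k / pochhammer (q4 + of_real (1/2)) k)) = fps_nth (fps_hypergeo as bs 1)"
    unfolding fun_eq_iff assms(5) by simp
  finally show ?thesis .
qed

text \<open>
  The ratio decays like the inverse square root of \<open>k\<close>. An induction needs an explicit majorant
  for its square, and \<open>M / (M + k)\<close> telescopes; it is available for all large \<open>M\<close> so that
  several ratios can share one \<open>M\<close>.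
\<close>
lemma pochhammer_half_ratio_bound:
  assumes "Re q > 0"
  obtains M0 where "M0 \<ge> 1" "\<And>M k. M \<ge> M0 \<Longrightarrow> norm (pochhammer q k / pochhammer (q + of_real (1/2)) k) ^ 2 \<le> M / (M + real k)"
proof
  define r where "r = Re q"
  define y where "y = Im q"
  define M0 where "M0 = 1 + r + 4 * (r\<^sup>2 + y\<^sup>2)"
  have r: "r > 0" using assms by (simp add: r_def)
  show "M0 \<ge> 1" using r by (simp add: M0_def)
  fix M k assume M: "M \<ge> M0"
  obtain S where S: "S = r\<^sup>2 + y\<^sup>2" "S \<ge> 0" by simp
  have "1 + r + 4 * S \<le> M" using M by (simp add: M0_def S(1))
  then have "M \<ge> 1 \<and> M \<ge> r \<and> M \<ge> 4 * S" using r S(2) by linarith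
  then have M1a: "M \<ge> 1" and M1b: "M \<ge> r" and M1c: "M \<ge> 4 * (r\<^sup>2 + y\<^sup>2)" by (simp_all add: S(1))
  note M1 = M1a M1b M1c
  show "norm (pochhammer q k / pochhammer (q + of_real (1/2)) k) ^ 2 \<le> M / (M + real k)"
  proof (induction k)
    case 0
    show ?case using M1 by simp
  next
    case (Suc k)
    define j where "j = real k"
    have j: "j \<ge> 0" by (simp add: j_def)
    have n1: "norm (q + of_nat k) ^ 2 = (r + j)\<^sup>2 + y\<^sup>2" by (simp add: cmod_power2 r_def y_def j_def)
    have n2: "norm (q + of_real (1/2) + of_nat k) ^ 2 = (r + 1/2 + j)\<^sup>2 + y\<^sup>2" by (simp add: cmod_power2 r_def y_def j_def)
    have pos: "(r + 1/2 + j)\<^sup>2 + y\<^sup>2 > 0" using r j by (intro add_pos_nonneg) auto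
    have a: "r * j \<le> M * j" using M1 j by (intro mult_right_mono) auto
    have b: "0 \<le> M * r" using M1 r by simp
    have gen: "A + 2 * B + D \<le> E + F + M / 4 + B + D + j / 4" if "B \<le> F" "0 \<le> E" "0 \<le> j" "4 * A \<le> M" for A B D E F :: real
      using that by linarith
    have eqs: "(r + j)\<^sup>2 + y\<^sup>2 = r\<^sup>2 + y\<^sup>2 + 2 * (r * j) + j * j" "(M + j) * (r + j + 1/4) = M * r + M * j + M / 4 + r * j + j * j + j / 4"
      by (simp_all add: power2_eq_square algebra_simps add_divide_distrib)
    have key: "(r + j)\<^sup>2 + y\<^sup>2 \<le> (M + j) * (r + j + 1/4)"
      unfolding eqs by (rule gen[OF a b j M1c])
    have step: "((r + j)\<^sup>2 + y\<^sup>2) / ((r + 1/2 + j)\<^sup>2 + y\<^sup>2) \<le> (M + j) / (M + j + 1)"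
    proof -
      have "(r + 1/2 + j)\<^sup>2 + y\<^sup>2 = ((r + j)\<^sup>2 + y\<^sup>2) + (r + j + 1/4)" by (simp add: power2_eq_square algebra_simps)
      then have "((r + j)\<^sup>2 + y\<^sup>2) * (M + j + 1) \<le> (M + j) * ((r + 1/2 + j)\<^sup>2 + y\<^sup>2)"
        using key by (simp add: algebra_simps)
      moreover have "M + j + 1 > 0" using M1 j by linarith
      ultimately have "(r + j)\<^sup>2 + y\<^sup>2 \<le> (M + j) * ((r + 1/2 + j)\<^sup>2 + y\<^sup>2) / (M + j + 1)"
        by (simp only: pos_le_divide_eq)
      then show ?thesis using pos by (simp only: pos_divide_le_eq times_divide_eq_left)
    qed
    have "norm (pochhammer q (Suc k) / pochhammer (q + of_real (1/2)) (Suc k)) ^ 2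
        = norm (pochhammer q k / pochhammer (q + of_real (1/2)) k) ^ 2 * (((r + j)\<^sup>2 + y\<^sup>2) / ((r + 1/2 + j)\<^sup>2 + y\<^sup>2))"
      unfolding n1[symmetric] n2[symmetric] pochhammer_Suc by (simp add: norm_mult norm_divide power_mult_distrib power_divide)
    also have "\<dots> \<le> M / (M + j) * ((M + j) / (M + j + 1))"
      using Suc step M1 j by (intro mult_mono) (auto simp: j_def)
    also have "\<dots> = M / (M + real (Suc k))" using M1 j by (simp add: j_def)
    finally show ?case .
  qed
qed

text \<open>
  Four factors of order \<open>k powr (- 1/2)\<close>. This absolute convergence on the closed disc settles
  the point \<open>a = b\<close>.
\<close>
lemma summable_hypergeo_4F3:
  assumes "Re q1 > 0" "Re q2 > 0" "Re q3 > 0" "Re q4 > 0"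
    and c: "\<And>k. c k = (pochhammer q1 k / pochhammer (q1 + of_real (1/2)) k) * (pochhammer q2 k / pochhammer (q2 + of_real (1/2)) k)
      * (pochhammer q3 k / pochhammer (q3 + of_real (1/2)) k) * (pochhammer q4 k / pochhammer (q4 + of_real (1/2)) k)"
  shows "summable (\<lambda>k. norm (c k))"
proof -
  obtain M1 where M1: "M1 \<ge> 1" "\<And>M k. M \<ge> M1 \<Longrightarrow> norm (pochhammer q1 k / pochhammer (q1 + of_real (1/2)) k) ^ 2 \<le> M / (M + real k)"
    by (rule pochhammer_half_ratio_bound[OF assms(1)]) (rule that)
  obtain M2 where M2': "M2 \<ge> 1" and M2: "\<And>M k. M \<ge> M2 \<Longrightarrow> norm (pochhammer q2 k / pochhammer (q2 + of_real (1/2)) k) ^ 2 \<le> M / (M + real k)"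
    by (rule pochhammer_half_ratio_bound[OF assms(2)]) (rule that)
  obtain M3 where M3': "M3 \<ge> 1" and M3: "\<And>M k. M \<ge> M3 \<Longrightarrow> norm (pochhammer q3 k / pochhammer (q3 + of_real (1/2)) k) ^ 2 \<le> M / (M + real k)"
    by (rule pochhammer_half_ratio_bound[OF assms(3)]) (rule that)
  obtain M4 where M4': "M4 \<ge> 1" and M4: "\<And>M k. M \<ge> M4 \<Longrightarrow> norm (pochhammer q4 k / pochhammer (q4 + of_real (1/2)) k) ^ 2 \<le> M / (M + real k)"
    by (rule pochhammer_half_ratio_bound[OF assms(4)]) (rule that)
  define M where "M = Max {M1, M2, M3, M4}"
  have M: "M \<ge> M1" "M \<ge> M2" "M \<ge> M3" "M \<ge> M4" by (auto simp: M_def)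
  have Mp: "M \<ge> 1" using M M1 by simp
  show ?thesis
  proof (rule summable_comparison_test')
    show "summable (\<lambda>k. M\<^sup>2 * (1 / real (Suc k) ^ 2))"
    proof (rule summable_mult)
      have "summable (\<lambda>k. inverse (real k ^ 2))" by (rule inverse_power_summable) simp
      then show "summable (\<lambda>k. 1 / real (Suc k) ^ 2)"
        by (subst (asm) summable_Suc_iff [symmetric]) (simp only: inverse_eq_divide)
    qed
    fix k
    define m where "m = M / (M + real k)"
    have m0: "m \<ge> 0" using Mp by (simp add: m_def)
    have prod4: "w * x * y * z \<le> m * m * m * m"
      if "0 \<le> w" "0 \<le> x" "0 \<le> y" "0 \<le> z" "w \<le> m" "x \<le> m" "y \<le> m" "z \<le> m" for w x y z
    proof -
      have "w * x \<le> m * m" using that m0 by (intro mult_mono) auto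
      then have "w * x * y \<le> m * m * m" using that m0 by (intro mult_mono) auto
      then show ?thesis using that m0 by (intro mult_mono) auto
    qed
    have "norm (c k) ^ 2 \<le> m * m * m * m"
      unfolding c norm_mult power_mult_distrib
    proof (rule prod4)
      show "norm (pochhammer q1 k / pochhammer (q1 + of_real (1/2)) k) ^ 2 \<le> m" unfolding m_def by (rule M1(2)[OF M(1)])
      show "norm (pochhammer q2 k / pochhammer (q2 + of_real (1/2)) k) ^ 2 \<le> m" unfolding m_def by (rule M2[OF M(2)])
      show "norm (pochhammer q3 k / pochhammer (q3 + of_real (1/2)) k) ^ 2 \<le> m" unfolding m_def by (rule M3[OF M(3)])
      show "norm (pochhammer q4 k / pochhammer (q4 + of_real (1/2)) k) ^ 2 \<le> m" unfolding m_def by (rule M4[OF M(4)])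
    qed (rule zero_le_power2)+
    also have "\<dots> = (m\<^sup>2)\<^sup>2" by (simp add: power2_eq_square)
    finally have "norm (c k) \<le> m\<^sup>2" by (rule power2_le_imp_le) simp
    also have "\<dots> = M\<^sup>2 * (1 / (M + real k) ^ 2)" by (simp add: m_def power_divide)
    also have "\<dots> \<le> M\<^sup>2 * (1 / real (Suc k) ^ 2)"
      using Mp by (intro mult_left_mono divide_left_mono power_mono) auto
    finally show "norm (norm (c k)) \<le> M\<^sup>2 * (1 / real (Suc k) ^ 2)" by simp
  qed
qed

text \<open>
  Weierstrass: the convergence is uniform on the closed disc.
\<close>
lemma continuous_on_power_series_closed_disc:
  fixes c :: "nat \<Rightarrow> complex"
  assumes "summable (\<lambda>k. norm (c k))"
  shows "continuous_on (cball 0 1) (\<lambda>z. \<Sum>k. c k * z ^ k)"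
proof (rule uniform_limit_theorem)
  show "uniform_limit (cball 0 1) (\<lambda>n z. \<Sum>k<n. c k * z ^ k) (\<lambda>z. \<Sum>k. c k * z ^ k) sequentially"
  proof (rule Weierstrass_m_test[OF _ assms])
    fix k and z :: complex assume "z \<in> cball 0 1"
    then have "norm z ^ k \<le> 1" by (intro power_le_one) auto
    then show "norm (c k * z ^ k) \<le> norm (c k)" by (simp add: norm_mult norm_power mult_left_le)
  qed
  show "\<forall>\<^sub>F n in sequentially. continuous_on (cball 0 1) (\<lambda>z. \<Sum>k<n. c k * z ^ k)"
    by (intro always_eventually allI continuous_intros)
qed simp

lemma hypergeo_tendsto_1:
  assumes "summable (\<lambda>k. norm (fps_nth (fps_hypergeo as bs 1) k))"
  shows "((\<lambda>x. hypergeo as bs (of_real x ^ 2)) \<longlongrightarrow> hypergeo as bs (1 ^ 2)) (at_left 1)"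
proof -
  define F where "F z = (\<Sum>k. fps_nth (fps_hypergeo as bs 1) k * z ^ k)" for z
  have F: "continuous_on (cball 0 1) F" unfolding F_def by (rule continuous_on_power_series_closed_disc[OF assms])
  have "1 \<notin> cut_plane" by (auto simp: cut_plane_def intro!: image_eqI[of _ _ 1])
  then have h1: "hypergeo as bs (1 ^ 2) = F (of_real 1 ^ 2)" by (simp add: hypergeo_def F_def eval_fps_def)
  have ev: "\<forall>\<^sub>F x in at_left (1::real). x \<in> {0<..<1}"
    by (rule eventually_at_leftI[of 0]) auto
  have "continuous_on {0..1} (\<lambda>x::real. F (of_real x ^ 2))"
    by (rule continuous_on_compose2[OF F]) (auto intro!: continuous_intros simp: norm_power power_le_one)
  then have "((\<lambda>x. F (of_real x ^ 2)) \<longlongrightarrow> F (of_real 1 ^ 2)) (at 1 within {0..1})"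
    unfolding continuous_on_def by (rule bspec) simp
  then have "((\<lambda>x. F (of_real x ^ 2)) \<longlongrightarrow> F (of_real 1 ^ 2)) (at_left 1)"
    by (simp add: at_within_Icc_at_left)
  moreover have "\<forall>\<^sub>F x in at_left 1. F (of_real x ^ 2) = hypergeo as bs (of_real x ^ 2)"
    using ev by eventually_elim (auto simp: hypergeo_def F_def eval_fps_def norm_power power_less_one_iff)
  ultimately show ?thesis unfolding h1 using tendsto_cong by fastforce
qed

section \<open>The integral as a holomorphic function of its argument\<close>

text \<open>
  The integral of the theorem after \<open>x = exp v\<close>; \<open>\<sigma> = 1\<close> and \<open>\<sigma> = 2\<close> correspond to the weights 1
  and \<open>x\<close>. The argument \<open>a\<close> comes last because it is the variable of the analytic continuation.
\<close>
definition KK_integral :: "real \<Rightarrow> complex \<Rightarrow> complex \<Rightarrow> complex \<Rightarrow> complex" where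
  "KK_integral \<sigma> \<alpha> b a = (LBINT v. exp (of_real \<sigma> * of_real v) * bessel_K \<alpha> (a * of_real (exp v)) ^ 2 * bessel_K \<alpha> (b * of_real (exp v)) ^ 2)"

text \<open>
  One majorant for all orders with \<open>\<bar>Re \<nu>\<bar> \<le> r\<close>, which allows the order to tend to 0 under the
  integral.
\<close>
lemma KK_dominated:
  assumes r: "0 \<le> r" "4 * r < \<sigma>" "\<sigma> \<le> 4" and a: "Re a > 0" and b: "Re b > 0"
  obtains g :: "real \<Rightarrow> real" where "integrable lborel g"
    "\<And>\<nu> v. \<bar>Re \<nu>\<bar> \<le> r \<Longrightarrow> norm (exp (of_real \<sigma> * of_real v) * bessel_K \<nu> (a * of_real (exp v)) ^ 2 * bessel_K \<nu> (b * of_real (exp v)) ^ 2) \<le> g v"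
proof -
  obtain \<rho> where \<rho>: "r < \<rho>" "4 * \<rho> < \<sigma>" using dense[of r "\<sigma> / 4"] r by auto
  have \<rho>': "0 \<le> \<rho>" "\<rho> \<le> 1" using \<rho> r by linarith+
  obtain C where C: "C \<ge> 0"
    "\<And>\<nu> z v m. \<bar>Re \<nu>\<bar> \<le> r \<Longrightarrow> 0 < m \<Longrightarrow> m \<le> Re z \<Longrightarrow>
       norm (bessel_K \<nu> (z * of_real (exp v))) \<le> C * m powr (- \<rho>) * exp (- \<rho> * v - m / 2 * exp v)"
    by (rule norm_bessel_K_exp_le[OF \<rho>(1) \<rho>']) (rule that)
  define A where "A = C * Re a powr (- \<rho>)"
  define B where "B = C * Re b powr (- \<rho>)"
  define g where "g v = A\<^sup>2 * B\<^sup>2 * exp ((\<sigma> - 4 * \<rho>) * v - (Re a + Re b) * exp v)" for v :: real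
  show ?thesis
  proof (rule that)
    have "integrable lborel (\<lambda>v. norm (exp (of_real (\<sigma> - 4 * \<rho>) * of_real v - complex_of_real ((Re a + Re b) * exp v))))"
      using \<rho> a b by (intro integrable_norm integral_exp_Gamma(1)) auto
    then have "integrable lborel (\<lambda>v. exp ((\<sigma> - 4 * \<rho>) * v - (Re a + Re b) * exp v))" by simp
    then show "integrable lborel g" unfolding g_def by (rule integrable_mult_right)
    fix \<nu> :: complex and v :: real assume \<nu>: "\<bar>Re \<nu>\<bar> \<le> r"
    have Ka: "norm (bessel_K \<nu> (a * of_real (exp v))) ^ 2 \<le> (A * exp (- \<rho> * v - Re a / 2 * exp v)) ^ 2"
      unfolding A_def by (rule power_mono[OF C(2)[OF \<nu> a order_refl] norm_ge_zero])
    have Kb: "norm (bessel_K \<nu> (b * of_real (exp v))) ^ 2 \<le> (B * exp (- \<rho> * v - Re b / 2 * exp v)) ^ 2"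
      unfolding B_def by (rule power_mono[OF C(2)[OF \<nu> b order_refl] norm_ge_zero])
    have "norm (exp (of_real \<sigma> * of_real v) * bessel_K \<nu> (a * of_real (exp v)) ^ 2 * bessel_K \<nu> (b * of_real (exp v)) ^ 2)
        = exp (\<sigma> * v) * norm (bessel_K \<nu> (a * of_real (exp v))) ^ 2 * norm (bessel_K \<nu> (b * of_real (exp v))) ^ 2"
      by (simp add: norm_mult norm_power)
    also have "\<dots> \<le> exp (\<sigma> * v) * (A * exp (- \<rho> * v - Re a / 2 * exp v)) ^ 2 * (B * exp (- \<rho> * v - Re b / 2 * exp v)) ^ 2"
      by (rule mult_mono[OF mult_left_mono[OF Ka] Kb]) auto
    also have "\<dots> = A\<^sup>2 * B\<^sup>2 * (exp (\<sigma> * v) * exp (2 * (- \<rho> * v - Re a / 2 * exp v)) * exp (2 * (- \<rho> * v - Re b / 2 * exp v)))"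
      unfolding power_mult_distrib exp_double[symmetric] by (simp only: mult_ac)
    also have "exp (\<sigma> * v) * exp (2 * (- \<rho> * v - Re a / 2 * exp v)) * exp (2 * (- \<rho> * v - Re b / 2 * exp v)) = exp ((\<sigma> - 4 * \<rho>) * v - (Re a + Re b) * exp v)"
      unfolding mult_exp_exp by (rule arg_cong[where f=exp]) (simp add: algebra_simps)
    finally show "norm (exp (of_real \<sigma> * of_real v) * bessel_K \<nu> (a * of_real (exp v)) ^ 2 * bessel_K \<nu> (b * of_real (exp v)) ^ 2) \<le> g v"
      unfolding g_def .
  qed
qed

lemma measurable_KK:
  assumes "Re a > 0" "Re b > 0"
  shows "(\<lambda>v. exp (of_real \<sigma> * of_real v) * bessel_K \<nu> (a * of_real (exp v)) ^ 2 * bessel_K \<nu> (b * of_real (exp v)) ^ 2) \<in> borel_measurable lborel"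
  using measurable_bessel_K_exp[OF assms(1), of \<nu>] measurable_bessel_K_exp[OF assms(2), of \<nu>] by simp

lemma integrable_KK:
  assumes "4 * \<bar>Re \<alpha>\<bar> < \<sigma>" "\<sigma> \<le> 4" "Re a > 0" "Re b > 0"
  shows "integrable lborel (\<lambda>v. exp (of_real \<sigma> * of_real v) * bessel_K \<alpha> (a * of_real (exp v)) ^ 2 * bessel_K \<alpha> (b * of_real (exp v)) ^ 2)"
proof -
  obtain g where g: "integrable lborel g"
    "\<And>\<nu> v. \<bar>Re \<nu>\<bar> \<le> \<bar>Re \<alpha>\<bar> \<Longrightarrow> norm (exp (of_real \<sigma> * of_real v) * bessel_K \<nu> (a * of_real (exp v)) ^ 2 * bessel_K \<nu> (b * of_real (exp v)) ^ 2) \<le> g v"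
    by (rule KK_dominated[of "\<bar>Re \<alpha>\<bar>", OF abs_ge_zero assms]) (rule that)
  show ?thesis
  proof (rule Bochner_Integration.integrable_bound[OF g(1) measurable_KK[OF assms(3,4)]], rule AE_I2)
    fix v
    have "g v \<le> norm (g v)" unfolding real_norm_def by (rule abs_ge_self)
    then show "norm (exp (of_real \<sigma> * of_real v) * bessel_K \<alpha> (a * of_real (exp v)) ^ 2 * bessel_K \<alpha> (b * of_real (exp v)) ^ 2) \<le> norm (g v)"
      using g(2)[of \<alpha> v] by linarith
  qed
qed

lemma has_integral_KK_1:
  assumes "4 * \<bar>Re \<alpha>\<bar> < 1" "Re a > 0" "Re b > 0" "KK_integral 1 \<alpha> b a = I"
  shows "((\<lambda>x. bessel_K \<alpha> (a * of_real x) ^ 2 * bessel_K \<alpha> (b * of_real x) ^ 2) has_integral I) {0<..}"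
proof -
  have eq: "(\<lambda>v. exp (of_real 1 * of_real v) * bessel_K \<alpha> (a * of_real (exp v)) ^ 2 * bessel_K \<alpha> (b * of_real (exp v)) ^ 2)
    = (\<lambda>v. of_real (exp v) * (bessel_K \<alpha> (a * of_real (exp v)) ^ 2 * bessel_K \<alpha> (b * of_real (exp v)) ^ 2))"
    by (simp add: exp_of_real mult.assoc fun_eq_iff)
  have "integrable lborel (\<lambda>v. exp (of_real 1 * of_real v) * bessel_K \<alpha> (a * of_real (exp v)) ^ 2 * bessel_K \<alpha> (b * of_real (exp v)) ^ 2)"
    by (rule integrable_KK) (use assms in auto)
  from has_integral_exp_substitution(1)[OF this[unfolded eq]] show ?thesis
    using assms(4) unfolding KK_integral_def eq by simp
qed

lemma has_integral_KK_2:
  assumes "2 * \<bar>Re \<alpha>\<bar> < 1" "Re a > 0" "Re b > 0" "KK_integral 2 \<alpha> b a = I"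
  shows "((\<lambda>x. of_real x * bessel_K \<alpha> (a * of_real x) ^ 2 * bessel_K \<alpha> (b * of_real x) ^ 2) has_integral I) {0<..}"
proof -
  have "exp (of_real 2 * complex_of_real v) = of_real (exp v) * of_real (exp v)" for v
    using exp_double[of "complex_of_real v"] by (simp add: exp_of_real power2_eq_square)
  then have eq: "(\<lambda>v. exp (of_real 2 * of_real v) * bessel_K \<alpha> (a * of_real (exp v)) ^ 2 * bessel_K \<alpha> (b * of_real (exp v)) ^ 2)
    = (\<lambda>v. of_real (exp v) * (of_real (exp v) * bessel_K \<alpha> (a * of_real (exp v)) ^ 2 * bessel_K \<alpha> (b * of_real (exp v)) ^ 2))"
    by (intro ext) (simp only: mult.assoc)
  have "integrable lborel (\<lambda>v. exp (of_real 2 * of_real v) * bessel_K \<alpha> (a * of_real (exp v)) ^ 2 * bessel_K \<alpha> (b * of_real (exp v)) ^ 2)"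
    by (rule integrable_KK) (use assms in auto)
  from has_integral_exp_substitution(1)[OF this[unfolded eq]] show ?thesis
    using assms(4) unfolding KK_integral_def eq by simp
qed

lemma holomorphic_KK_integral:
  assumes \<sigma>: "4 * \<bar>Re \<alpha>\<bar> < \<sigma>" "\<sigma> \<le> 4" and b: "Re b > 0"
  shows "KK_integral \<sigma> \<alpha> b holomorphic_on {a. Re a > 0}"
proof -
  obtain \<rho> where \<rho>: "\<bar>Re \<alpha>\<bar> < \<rho>" "4 * \<rho> < \<sigma>" using dense[of "\<bar>Re \<alpha>\<bar>" "\<sigma> / 4"] \<sigma> by auto
  have \<rho>': "0 \<le> \<rho>" "\<rho> \<le> 1" using \<rho> \<sigma> by linarith+
  obtain C where C: "C \<ge> 0"
    "\<And>\<nu> z v m. \<bar>Re \<nu>\<bar> \<le> \<bar>Re \<alpha>\<bar> \<Longrightarrow> 0 < m \<Longrightarrow> m \<le> Re z \<Longrightarrow>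
       norm (bessel_K \<nu> (z * of_real (exp v))) \<le> C * m powr (- \<rho>) * exp (- \<rho> * v - m / 2 * exp v)"
    by (rule norm_bessel_K_exp_le[OF \<rho>(1) \<rho>']) (rule that)
  define B where "B = C * Re b powr (- \<rho>)"
  define q where "q v = exp (of_real \<sigma> * of_real v) * bessel_K \<alpha> (b * of_real (exp v)) ^ 2" for v :: real
  have mq: "q \<in> borel_measurable borel" unfolding q_def using measurable_bessel_K_exp[OF b, of \<alpha>] by simp
  have "(\<lambda>a. LBINT v. q v * bessel_K \<alpha> (a * of_real (exp v)) ^ 2) holomorphic_on {a. Re a > 0}"
  proof (rule holomorphic_integral_bessel_K_square[OF \<rho>(1) \<rho>'(2) mq])
    fix m :: real assume m: "m > 0"
    show "integrable lborel (\<lambda>v. norm (q v) * exp (- 2 * \<rho> * v - m * exp v))"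
    proof (rule Bochner_Integration.integrable_bound)
      have "integrable lborel (\<lambda>v. norm (exp (of_real (\<sigma> - 4 * \<rho>) * of_real v - complex_of_real (m * exp v))))"
        using \<rho> m by (intro integrable_norm integral_exp_Gamma(1)) auto
      then have "integrable lborel (\<lambda>v. exp ((\<sigma> - 4 * \<rho>) * v - m * exp v))" by simp
      then show "integrable lborel (\<lambda>v. B\<^sup>2 * exp ((\<sigma> - 4 * \<rho>) * v - m * exp v))" by (rule integrable_mult_right)
      show "(\<lambda>v. norm (q v) * exp (- 2 * \<rho> * v - m * exp v)) \<in> borel_measurable lborel" using mq by simp
      show "AE v in lborel. norm (norm (q v) * exp (- 2 * \<rho> * v - m * exp v)) \<le> norm (B\<^sup>2 * exp ((\<sigma> - 4 * \<rho>) * v - m * exp v))"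
      proof (rule AE_I2)
        fix v :: real
        have "norm (bessel_K \<alpha> (b * of_real (exp v))) \<le> B * exp (- \<rho> * v - Re b / 2 * exp v)"
          unfolding B_def by (rule C(2)[OF order_refl b order_refl])
        also have "\<dots> \<le> B * exp (- \<rho> * v)" using C(1) b by (intro mult_left_mono) (auto simp: B_def)
        finally have K: "norm (bessel_K \<alpha> (b * of_real (exp v))) ^ 2 \<le> (B * exp (- \<rho> * v)) ^ 2"
          by (intro power_mono norm_ge_zero)
        have "norm (q v) \<le> exp (\<sigma> * v) * (B * exp (- \<rho> * v)) ^ 2"
          unfolding q_def norm_mult norm_power using mult_left_mono[OF K, of "exp (\<sigma> * v)"] by simp
        then have "norm (q v) * exp (- 2 * \<rho> * v - m * exp v) \<le> exp (\<sigma> * v) * (B * exp (- \<rho> * v)) ^ 2 * exp (- 2 * \<rho> * v - m * exp v)"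
          by (rule mult_right_mono) simp
        also have "\<dots> = B\<^sup>2 * (exp (\<sigma> * v) * exp (2 * (- \<rho> * v)) * exp (- 2 * \<rho> * v - m * exp v))"
          unfolding power_mult_distrib exp_double[symmetric] by (simp only: mult_ac)
        also have "exp (\<sigma> * v) * exp (2 * (- \<rho> * v)) * exp (- 2 * \<rho> * v - m * exp v) = exp ((\<sigma> - 4 * \<rho>) * v - m * exp v)"
          unfolding mult_exp_exp by (rule arg_cong[where f=exp]) (simp add: algebra_simps)
        finally show "norm (norm (q v) * exp (- 2 * \<rho> * v - m * exp v)) \<le> norm (B\<^sup>2 * exp ((\<sigma> - 4 * \<rho>) * v - m * exp v))" by simp
      qed
    qed
  qed
  then show ?thesis
    by (rule holomorphic_transform) (simp add: KK_integral_def q_def mult_ac)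
qed

definition slit_halfplane :: "complex \<Rightarrow> complex set" where
  "slit_halfplane b = {a. Re a > 0 \<and> a / b \<notin> of_real ` {1..}}"

lemma open_slit_halfplane:
  assumes "Re b > 0"
  shows "open (slit_halfplane b)"
proof -
  have b: "b \<noteq> 0" using assms by auto
  have "slit_halfplane b = {a. Re a > 0} \<inter> (\<lambda>a. a / b) -` cut_plane"
    by (auto simp: slit_halfplane_def cut_plane_def)
  moreover have "open ((\<lambda>a. a / b) -` cut_plane)"
    by (intro open_vimage open_cut_plane continuous_intros) (use b in auto)
  ultimately show ?thesis using open_halfspace_Re_gt by auto
qed

text \<open>
  The domain is star-shaped about \<open>b / 2\<close>: if a point of the segment from \<open>b / 2\<close> to \<open>a\<close> had
  quotient \<open>t \<ge> 1\<close>, then \<open>a / b\<close> would be real and at least 1.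
\<close>
lemma connected_slit_halfplane:
  assumes "Re b > 0"
  shows "connected (slit_halfplane b)"
proof (rule starlike_imp_connected)
  have b: "b \<noteq> 0" using assms by auto
  have mem: "b / 2 \<in> slit_halfplane b"
  proof -
    have "(1/2::complex) \<noteq> of_real x" if "x \<ge> 1" for x
    proof
      assume "(1/2::complex) = of_real x"
      then have "Re (1/2) = x" by (metis Re_complex_of_real)
      then show False using that by simp
    qed
    then show ?thesis using b assms by (auto simp: slit_halfplane_def)
  qed
  moreover have "closed_segment (b / 2) a \<subseteq> slit_halfplane b" if a: "a \<in> slit_halfplane b" for a
  proof
    fix u assume "u \<in> closed_segment (b / 2) a"
    then obtain s where s: "0 \<le> s" "s \<le> 1" "u = (1 - s) *\<^sub>R (b / 2) + s *\<^sub>R a" by (auto simp: in_segment)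
    have u: "Re u > 0"
    proof (cases "s = 0")
      case True
      show ?thesis unfolding s(3) True using assms by simp
    next
      case False
      then have "s * Re a > 0" "(1 - s) * (Re b / 2) \<ge> 0" using s a assms by (auto simp: slit_halfplane_def)
      then show ?thesis using s by simp
    qed
    have "u / b \<noteq> of_real t" if t: "t \<ge> 1" for t
    proof
      assume "u / b = of_real t"
      then have 1: "of_real t = (1 - of_real s) / 2 + of_real s * (a / b)" using s b by (simp add: scaleR_conv_of_real add_divide_distrib)
      show False
      proof (cases "s = 0")
        case True
        then have "complex_of_real t = of_real (1/2)" using 1 by simp
        then have "t = 1/2" using of_real_eq_iff by blast
        then show False using t by simp
      next
        case False
        then have s0: "s > 0" using s by simp
        define t' where "t' = (t - (1 - s) / 2) / s"
        have "of_real s * (a / b) = of_real (t - (1 - s) / 2)" using 1 by simp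
        then have "a / b = of_real t'" using s0 by (simp add: t'_def field_simps)
        moreover have "t' \<ge> 1" using s0 s t by (simp add: t'_def field_simps)
        ultimately show False using a by (auto simp: slit_halfplane_def)
      qed
    qed
    then show "u \<in> slit_halfplane b" using u by (auto simp: slit_halfplane_def)
  qed
  ultimately show "starlike (slit_halfplane b)" unfolding starlike_def by blast
qed

lemma slit_halfplane_quotient:
  assumes "a \<in> slit_halfplane b" "Re b > 0"
  shows "a / b \<notin> \<real>\<^sub>\<le>\<^sub>0" "(a / b) ^ 2 \<in> cut_plane" "1 + a / b \<notin> \<real>\<^sub>\<le>\<^sub>0" "1 - a / b \<notin> \<real>\<^sub>\<le>\<^sub>0"
proof -
  have b: "b \<noteq> 0" using assms by auto
  have neg: "a / b \<noteq> of_real t" if "t \<le> 0" for t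
  proof
    assume "a / b = of_real t"
    then have "a = of_real t * b" using b by (simp add: field_simps)
    then have "Re a = t * Re b" by simp
    then have "Re a \<le> 0" using that assms(2) by (simp add: mult_nonpos_nonneg)
    then show False using assms(1) by (simp add: slit_halfplane_def)
  qed
  have pos: "a / b \<noteq> of_real t" if "t \<ge> 1" for t using assms(1) that by (auto simp: slit_halfplane_def)
  show "a / b \<notin> \<real>\<^sub>\<le>\<^sub>0" using neg by (auto elim!: nonpos_Reals_cases)
  show "(a / b) ^ 2 \<in> cut_plane"
  proof (rule ccontr)
    assume "(a / b) ^ 2 \<notin> cut_plane"
    then obtain x where x: "x \<ge> 1" "(a / b) ^ 2 = of_real x" by (auto simp: cut_plane_def)
    then have "(a / b) ^ 2 = of_real (sqrt x) ^ 2" by (simp flip: of_real_power)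
    then have "a / b = of_real (sqrt x) \<or> a / b = of_real (- sqrt x)" by (simp add: power2_eq_iff)
    then show False using pos[of "sqrt x"] neg[of "- sqrt x"] x by auto
  qed
  show "1 + a / b \<notin> \<real>\<^sub>\<le>\<^sub>0"
  proof
    assume "1 + a / b \<in> \<real>\<^sub>\<le>\<^sub>0"
    then obtain t where "t \<le> 0" "1 + a / b = of_real t" by (auto elim!: nonpos_Reals_cases)
    then have "a / b = of_real (t - 1)" by (simp add: algebra_simps)
    then show False using neg[of "t - 1"] \<open>t \<le> 0\<close> by simp
  qed
  show "1 - a / b \<notin> \<real>\<^sub>\<le>\<^sub>0"
  proof
    assume "1 - a / b \<in> \<real>\<^sub>\<le>\<^sub>0"
    then obtain t where "t \<le> 0" "1 - a / b = of_real t" by (auto elim!: nonpos_Reals_cases)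
    then have "a / b = of_real (1 - t)" by (simp add: algebra_simps)
    then show False using pos[of "1 - t"] \<open>t \<le> 0\<close> by simp
  qed
qed

text \<open>
  The identity theorem on the slit half-plane, with a segment of small positive \<open>a\<close>, where
  termwise integration is available, as the set of agreement.
\<close>
lemma KK_integral_identity:
  assumes \<sigma>: "4 * \<bar>Re \<alpha>\<bar> < \<sigma>" "\<sigma> \<le> 4" and b: "Re b > 0"
    and R: "R holomorphic_on slit_halfplane b"
    and eq: "\<And>t. 0 < t \<Longrightarrow> 2 * t < Re b \<Longrightarrow> KK_integral \<sigma> \<alpha> b (of_real t) = R (of_real t)"
    and a: "a \<in> slit_halfplane b"
  shows "KK_integral \<sigma> \<alpha> b a = R a"
proof -
  define F where "F a = KK_integral \<sigma> \<alpha> b a - R a" for a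
  define e where "e = Re b / 2"
  have e: "e > 0" using b by (simp add: e_def)
  have sub: "of_real ` {0<..<e} \<subseteq> slit_halfplane b"
  proof
    fix z :: complex assume "z \<in> of_real ` {0<..<e}"
    then obtain t where t: "0 < t" "t < e" "z = of_real t" by auto
    have "z / b \<noteq> of_real x" if "x \<ge> 1" for x
    proof
      assume *: "z / b = of_real x"
      have "norm (z / b) < 1" using t complex_Re_le_cmod[of b] b by (simp add: norm_divide e_def divide_less_eq)
      then show False using that unfolding * by simp
    qed
    then show "z \<in> slit_halfplane b" using t by (auto simp: slit_halfplane_def)
  qed
  have "F a = 0"
  proof (rule analytic_continuation[where f=F])
    have "slit_halfplane b \<subseteq> {a. Re a > 0}" by (auto simp: slit_halfplane_def)
    then have "KK_integral \<sigma> \<alpha> b holomorphic_on slit_halfplane b"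
      using holomorphic_KK_integral[OF \<sigma> b] holomorphic_on_subset by blast
    then show "F holomorphic_on slit_halfplane b" unfolding F_def using R by (intro holomorphic_intros)
    show "open (slit_halfplane b)" "connected (slit_halfplane b)"
      using open_slit_halfplane[OF b] connected_slit_halfplane[OF b] by auto
    show "of_real ` {0<..<e} \<subseteq> slit_halfplane b" by (rule sub)
    show "of_real (e/2) \<in> slit_halfplane b" by (rule subsetD[OF sub imageI]) (use e in auto)
    show "complex_of_real (e/2) islimpt of_real ` {0<..<e}" by (rule of_real_islimpt_Ioo[OF e])
    show "F z = 0" if "z \<in> of_real ` {0<..<e}" for z using that eq by (auto simp: F_def e_def)
  qed fact
  then show ?thesis by (simp add: F_def)
qed

lemma isCont_KK_integral:
  assumes "4 * \<bar>Re \<alpha>\<bar> < \<sigma>" "\<sigma> \<le> 4" "Re b > 0" "Re a > 0"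
  shows "isCont (KK_integral \<sigma> \<alpha> b) a"
  using holomorphic_on_imp_continuous_on[OF holomorphic_KK_integral[OF assms(1-3)]] assms(4) open_halfspace_Re_gt[of 0]
  by (simp add: continuous_on_eq_continuous_at)

text \<open>
  The integral is continuous at the points \<open>a = x b\<close>, even where the closed form has a cut;
  hence the boundary value of the closed form from either side agrees with it.
\<close>
lemma KK_integral_side_transfer:
  assumes \<sigma>: "4 * \<bar>Re \<alpha>\<bar> < \<sigma>" "\<sigma> \<le> 4" and b: "Re b > 0" and x: "x > 0"
    and H: "H = {w. Im w > 0} \<or> H = {w. Im w < 0}"
    and eq: "\<And>w. w * b \<in> slit_halfplane b \<Longrightarrow> KK_integral \<sigma> \<alpha> b (w * b) = F w"
    and lim: "(F \<longlongrightarrow> L) (at (of_real x) within H)"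
  shows "KK_integral \<sigma> \<alpha> b (of_real x * b) = L"
proof -
  have b0: "b \<noteq> 0" using b by auto
  have "isCont (KK_integral \<sigma> \<alpha> b) (of_real x * b)"
    by (rule isCont_KK_integral[OF \<sigma> b]) (use x b in simp)
  moreover have "((\<lambda>w. w * b) \<longlongrightarrow> of_real x * b) (at (of_real x) within H)" by (intro tendsto_intros)
  ultimately have 1: "((\<lambda>w. KK_integral \<sigma> \<alpha> b (w * b)) \<longlongrightarrow> KK_integral \<sigma> \<alpha> b (of_real x * b)) (at (of_real x) within H)"
    by (rule isCont_tendsto_compose)
  have op: "open ((\<lambda>w. w * b) -` {a. Re a > 0})"
    by (intro open_vimage open_halfspace_Re_gt continuous_intros)
  have "\<forall>\<^sub>F w in at (complex_of_real x) within H. w \<in> (\<lambda>w. w * b) -` {a. Re a > 0}"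
    using op x b by (intro eventually_at_topological[THEN iffD2] exI[of _ "(\<lambda>w. w * b) -` {a. Re a > 0}"]) auto
  moreover have "\<forall>\<^sub>F w in at (complex_of_real x) within H. w \<in> H" by (auto simp: eventually_at_filter)
  ultimately have ev: "\<forall>\<^sub>F w in at (complex_of_real x) within H. KK_integral \<sigma> \<alpha> b (w * b) = F w"
  proof eventually_elim
    case (elim w)
    have "w \<notin> of_real ` {1..}" using elim(2) H by auto
    then show ?case using elim(1) b0 by (intro eq) (auto simp: slit_halfplane_def)
  qed
  have "((\<lambda>w. KK_integral \<sigma> \<alpha> b (w * b)) \<longlongrightarrow> L) (at (of_real x) within H)"
    using tendsto_cong[OF ev] lim by blast
  from tendsto_unique[OF at_within_halfplane_nontrivial[OF H] 1 this] show ?thesis .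
qed

text \<open>
  The same continuity along a radius of the unit disc for \<open>w = a / b\<close>.
\<close>
lemma KK_integral_left_transfer:
  assumes \<sigma>: "4 * \<bar>Re \<alpha>\<bar> < \<sigma>" "\<sigma> \<le> 4" and b: "Re b > 0" and w: "Re (w * b) > 0"
    and eq: "\<And>t. 0 < t \<Longrightarrow> t < 1 \<Longrightarrow> KK_integral \<sigma> \<alpha> b (of_real t * (w * b)) = F t"
    and lim: "(F \<longlongrightarrow> L) (at_left (1::real))"
  shows "KK_integral \<sigma> \<alpha> b (w * b) = L"
proof -
  have "isCont (KK_integral \<sigma> \<alpha> b) (of_real 1 * (w * b))"
    by (rule isCont_KK_integral[OF \<sigma> b]) (use w in simp)
  moreover have "((\<lambda>t. of_real t * (w * b)) \<longlongrightarrow> of_real 1 * (w * b)) (at_left (1::real))" by (intro tendsto_intros)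
  ultimately have 1: "((\<lambda>t. KK_integral \<sigma> \<alpha> b (of_real t * (w * b))) \<longlongrightarrow> KK_integral \<sigma> \<alpha> b (of_real 1 * (w * b))) (at_left 1)"
    by (rule isCont_tendsto_compose)
  have "\<forall>\<^sub>F t in at_left (1::real). t \<in> {0<..<1}" by (rule eventually_at_leftI[of 0]) auto
  then have ev: "\<forall>\<^sub>F t in at_left (1::real). KK_integral \<sigma> \<alpha> b (of_real t * (w * b)) = F t"
  proof eventually_elim
    case (elim t)
    then show ?case using eq[of t] by simp
  qed
  have "((\<lambda>t. KK_integral \<sigma> \<alpha> b (of_real t * (w * b))) \<longlongrightarrow> L) (at_left 1)"
    using tendsto_cong[OF ev] lim by blast
  from tendsto_unique[OF trivial_limit_at_left_real 1 this] show ?thesis by simp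
qed

section \<open>Evaluation for nonzero order\<close>

lemma real_quotient_cases:
  assumes "Re a > 0" "Re b > 0"
  shows "a \<in> slit_halfplane b \<or> a = b \<or> (\<exists>x>1. a = of_real x * b)"
proof (cases "a \<in> slit_halfplane b")
  case False
  then obtain x where x: "x \<ge> 1" "a / b = of_real x" using assms by (auto simp: slit_halfplane_def)
  have b: "b \<noteq> 0" using assms by auto
  then have ab: "a = of_real x * b" using x(2) by (metis nonzero_divide_eq_eq)
  show ?thesis
  proof (cases "x = 1")
    case True
    then show ?thesis using ab by simp
  next
    case False
    then have "x > 1" using x by simp
    then show ?thesis using ab by blast
  qed
qed simp

text \<open>
  Three positions of \<open>a / b\<close>: off the cut by the identity theorem, at 1 by absolute convergence
  of the series, and beyond 1 by boundary values.
\<close>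
lemma KK_integral_1:
  assumes \<alpha>: "\<alpha> \<noteq> 0" "\<bar>Re \<alpha>\<bar> < 1/4" and a: "Re a > 0" and b: "Re b > 0"
    and H: "H = {w. Im w > 0} \<or> H = {w. Im w < 0}"
  shows "KK_integral 1 \<alpha> b a = of_real pi ^ 4 / (8 * b) * csc (2 * of_real pi * \<alpha>) *
         (csc (of_real pi * \<alpha>) * Gamma (2 * \<alpha> + 1/2) / (Gamma (1/2 - \<alpha>) * Gamma (1 + \<alpha>) ^ 3)
            * (a / (2 * b)) powr (2 * \<alpha>)
            * side_value H (\<lambda>w. hypergeo [1/2, \<alpha> + 1/2, \<alpha> + 1/2, 2 * \<alpha> + 1/2]
                                         [2 * \<alpha> + 1, \<alpha> + 1, \<alpha> + 1] (w ^ 2)) (a / b)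
          + csc (of_real pi * \<alpha>) * Gamma (1/2 - 2 * \<alpha>) / (Gamma (\<alpha> + 1/2) * Gamma (1 - \<alpha>) ^ 3)
            * (a / (2 * b)) powr (- 2 * \<alpha>)
            * side_value H (\<lambda>w. hypergeo [1/2, 1/2 - 2 * \<alpha>, 1/2 - \<alpha>, 1/2 - \<alpha>]
                                         [1 - 2 * \<alpha>, 1 - \<alpha>, 1 - \<alpha>] (w ^ 2)) (a / b)
          - 2 / (of_real pi * \<alpha>)
            * side_value H (\<lambda>w. hypergeo [1/2, 1/2, \<alpha> + 1/2, 1/2 - \<alpha>]
                                         [1, 1 - \<alpha>, \<alpha> + 1] (w ^ 2)) (a / b))"
proof -
  have b0: "b \<noteq> 0" using b by auto
  define h1 where "h1 = hypergeo [1/2, \<alpha> + 1/2, \<alpha> + 1/2, 2 * \<alpha> + 1/2] [2 * \<alpha> + 1, \<alpha> + 1, \<alpha> + 1]"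
  define h2 where "h2 = hypergeo [1/2, 1/2 - 2 * \<alpha>, 1/2 - \<alpha>, 1/2 - \<alpha>] [1 - 2 * \<alpha>, 1 - \<alpha>, 1 - \<alpha>]"
  define h3 where "h3 = hypergeo [1/2, 1/2, \<alpha> + 1/2, 1/2 - \<alpha>] [1, 1 - \<alpha>, \<alpha> + 1]"
  have e: "1/2 + of_real (1/2) = (1::complex)" "\<alpha> + 1/2 + of_real (1/2) = \<alpha> + 1" "2 * \<alpha> + 1/2 + of_real (1/2) = 2 * \<alpha> + 1"
    "1/2 - \<alpha> + of_real (1/2) = 1 - \<alpha>" "1/2 - 2 * \<alpha> + of_real (1/2) = 1 - 2 * \<alpha>" by (simp_all add: algebra_simps)
  have re: "Re (1/2) > 0" "Re (\<alpha> + 1/2) > 0" "Re (2 * \<alpha> + 1/2) > 0" "Re (1/2 - \<alpha>) > 0" "Re (1/2 - 2 * \<alpha>) > 0" using \<alpha>(2) by auto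
  have c1: "fps_nth (fps_hypergeo [1/2, \<alpha> + 1/2, \<alpha> + 1/2, 2 * \<alpha> + 1/2] [2 * \<alpha> + 1, \<alpha> + 1, \<alpha> + 1] 1) k =
      (pochhammer (1/2) k / pochhammer (1/2 + of_real (1/2)) k) * (pochhammer (\<alpha> + 1/2) k / pochhammer (\<alpha> + 1/2 + of_real (1/2)) k)
      * (pochhammer (\<alpha> + 1/2) k / pochhammer (\<alpha> + 1/2 + of_real (1/2)) k) * (pochhammer (2 * \<alpha> + 1/2) k / pochhammer (2 * \<alpha> + 1/2 + of_real (1/2)) k)" for k
    unfolding e by (simp add: pochhammer_fact [symmetric] mult_ac)
  have c2: "fps_nth (fps_hypergeo [1/2, 1/2 - 2 * \<alpha>, 1/2 - \<alpha>, 1/2 - \<alpha>] [1 - 2 * \<alpha>, 1 - \<alpha>, 1 - \<alpha>] 1) k =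
      (pochhammer (1/2) k / pochhammer (1/2 + of_real (1/2)) k) * (pochhammer (1/2 - 2 * \<alpha>) k / pochhammer (1/2 - 2 * \<alpha> + of_real (1/2)) k)
      * (pochhammer (1/2 - \<alpha>) k / pochhammer (1/2 - \<alpha> + of_real (1/2)) k) * (pochhammer (1/2 - \<alpha>) k / pochhammer (1/2 - \<alpha> + of_real (1/2)) k)" for k
    unfolding e by (simp add: pochhammer_fact [symmetric] mult_ac)
  have c3: "fps_nth (fps_hypergeo [1/2, 1/2, \<alpha> + 1/2, 1/2 - \<alpha>] [1, 1 - \<alpha>, \<alpha> + 1] 1) k =
      (pochhammer (1/2) k / pochhammer (1/2 + of_real (1/2)) k) * (pochhammer (1/2) k / pochhammer (1/2 + of_real (1/2)) k)
      * (pochhammer (\<alpha> + 1/2) k / pochhammer (\<alpha> + 1/2 + of_real (1/2)) k) * (pochhammer (1/2 - \<alpha>) k / pochhammer (1/2 - \<alpha> + of_real (1/2)) k)" for k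
    unfolding e by (simp add: pochhammer_fact [symmetric] mult_ac)
  note sec1 = sectorial_hypergeo_4F3[OF re(1) re(2) re(2) re(3) c1]
  note sec2 = sectorial_hypergeo_4F3[OF re(1) re(5) re(4) re(4) c2]
  note sec3 = sectorial_hypergeo_4F3[OF re(1) re(1) re(2) re(4) c3]
  note sum1 = summable_hypergeo_4F3[OF re(1) re(2) re(2) re(3) c1]
  note sum2 = summable_hypergeo_4F3[OF re(1) re(5) re(4) re(4) c2]
  note sum3 = summable_hypergeo_4F3[OF re(1) re(1) re(2) re(4) c3]
  define P where "P = of_real pi ^ 4 / (8 * b) * csc (2 * of_real pi * \<alpha>)"
  define A where "A = csc (of_real pi * \<alpha>) * Gamma (2 * \<alpha> + 1/2) / (Gamma (1/2 - \<alpha>) * Gamma (1 + \<alpha>) ^ 3)"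
  define B where "B = csc (of_real pi * \<alpha>) * Gamma (1/2 - 2 * \<alpha>) / (Gamma (\<alpha> + 1/2) * Gamma (1 - \<alpha>) ^ 3)"
  define C where "C = 2 / (of_real pi * \<alpha>)"
  define F where "F w X Y Z = P * (A * (w / 2) powr (2 * \<alpha>) * X + B * (w / 2) powr (- 2 * \<alpha>) * Y - C * Z)" for w X Y Z
  have half: "a / (2 * b) = (a / b) / 2" for a by simp
  have half_slit: "a / b / 2 \<notin> \<real>\<^sub>\<le>\<^sub>0" if "a \<in> slit_halfplane b" for a
  proof
    assume "a / b / 2 \<in> \<real>\<^sub>\<le>\<^sub>0"
    then obtain t where t: "t \<le> 0" "a / b / 2 = of_real t" by (auto elim!: nonpos_Reals_cases)
    have "a / b = 2 * (a / b / 2)" by simp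
    also have "\<dots> = of_real (2 * t)" unfolding t(2) by simp
    finally show False using slit_halfplane_quotient(1)[OF that b] t(1) by (simp del: of_real_mult)
  qed
  have \<sigma>: "4 * \<bar>Re \<alpha>\<bar> < 1" "(1::real) \<le> 4" using \<alpha> by auto
  have main: "KK_integral 1 \<alpha> b a = F (a / b) (h1 ((a / b)\<^sup>2)) (h2 ((a / b)\<^sup>2)) (h3 ((a / b)\<^sup>2))" if "a \<in> slit_halfplane b" for a
  proof (rule KK_integral_identity[OF \<sigma> b _ _ that])
    have hol: "(\<lambda>a. hypergeo as bs ((a / b)\<^sup>2)) holomorphic_on slit_halfplane b" if "sectorial (fps_nth (fps_hypergeo as bs 1))" for as bs
      by (rule holomorphic_on_compose_gen[OF _ holomorphic_hypergeo[OF that], unfolded o_def])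
         (use b0 slit_halfplane_quotient(2)[OF _ b] in \<open>auto intro!: holomorphic_intros\<close>)
    show "(\<lambda>a. F (a / b) (h1 ((a / b)\<^sup>2)) (h2 ((a / b)\<^sup>2)) (h3 ((a / b)\<^sup>2))) holomorphic_on slit_halfplane b"
      unfolding F_def h1_def h2_def h3_def
      by (intro holomorphic_intros hol[OF sec1] hol[OF sec2] hol[OF sec3]) (use b0 half_slit in auto)
    fix t :: real assume t: "0 < t" "2 * t < Re b"
    show "KK_integral 1 \<alpha> b (of_real t) = F (of_real t / b) (h1 ((of_real t / b)\<^sup>2)) (h2 ((of_real t / b)\<^sup>2)) (h3 ((of_real t / b)\<^sup>2))"
      using integral_1_expansion[OF \<alpha> t] unfolding KK_integral_def F_def h1_def h2_def h3_def P_def A_def B_def C_def half by simp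
  qed
  have "KK_integral 1 \<alpha> b a = F (a / b) (side_value H (\<lambda>w. h1 (w\<^sup>2)) (a / b)) (side_value H (\<lambda>w. h2 (w\<^sup>2)) (a / b)) (side_value H (\<lambda>w. h3 (w\<^sup>2)) (a / b))"
    using real_quotient_cases[OF a b]
  proof (elim disjE exE conjE)
    assume as: "a \<in> slit_halfplane b"
    then have "a / b \<notin> of_real ` {1<..}" by (auto simp: slit_halfplane_def)
    then show ?thesis using main[OF as] by (simp add: side_value_def)
  next
    assume ab: "a = b"
    have n1: "(1::complex) \<notin> of_real ` {1<..}" by auto
    have "KK_integral 1 \<alpha> b (1 * b) = F (of_real 1) (h1 (1\<^sup>2)) (h2 (1\<^sup>2)) (h3 (1\<^sup>2))"
    proof (rule KK_integral_left_transfer[OF \<sigma> b])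
      show "Re (1 * b) > 0" using b by simp
      show "KK_integral 1 \<alpha> b (of_real t * (1 * b)) = F (of_real t) (h1 ((of_real t)\<^sup>2)) (h2 ((of_real t)\<^sup>2)) (h3 ((of_real t)\<^sup>2))" if "0 < t" "t < 1" for t
      proof -
        have "of_real t * b \<in> slit_halfplane b" using that b b0 by (auto simp: slit_halfplane_def)
        from main[OF this] show ?thesis using b0 by simp
      qed
      have nn: "complex_of_real 1 / 2 \<notin> \<real>\<^sub>\<le>\<^sub>0" by (simp add: complex_nonpos_Reals_iff)
      have "((\<lambda>t. complex_of_real t) \<longlongrightarrow> of_real 1) (at_left 1)" by (intro tendsto_intros)
      then show "((\<lambda>t. F (of_real t) (h1 ((of_real t)\<^sup>2)) (h2 ((of_real t)\<^sup>2)) (h3 ((of_real t)\<^sup>2))) \<longlongrightarrow> F (of_real 1) (h1 (1\<^sup>2)) (h2 (1\<^sup>2)) (h3 (1\<^sup>2))) (at_left 1)"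
        unfolding F_def h1_def h2_def h3_def
        by (intro tendsto_intros tendsto_powr_complex hypergeo_tendsto_1 sum1 sum2 sum3 nn) auto
    qed
    then show ?thesis using ab b0 n1 by (simp add: side_value_def)
  next
    fix x :: real assume x: "x > 1" "a = of_real x * b"
    have ab: "a / b = of_real x" using x b0 by simp
    have nn: "complex_of_real x / 2 \<notin> \<real>\<^sub>\<le>\<^sub>0" using x by (simp add: complex_nonpos_Reals_iff)
    have "KK_integral 1 \<alpha> b (of_real x * b) = F (of_real x) (side_value H (\<lambda>w. h1 (w\<^sup>2)) (of_real x)) (side_value H (\<lambda>w. h2 (w\<^sup>2)) (of_real x)) (side_value H (\<lambda>w. h3 (w\<^sup>2)) (of_real x))"
    proof (rule KK_integral_side_transfer[OF \<sigma> b _ H])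
      show "x > 0" using x by simp
      show "KK_integral 1 \<alpha> b (w * b) = F w (h1 (w\<^sup>2)) (h2 (w\<^sup>2)) (h3 (w\<^sup>2))" if "w * b \<in> slit_halfplane b" for w
        using main[OF that] b0 by simp
      show "((\<lambda>w. F w (h1 (w\<^sup>2)) (h2 (w\<^sup>2)) (h3 (w\<^sup>2))) \<longlongrightarrow> F (of_real x) (side_value H (\<lambda>w. h1 (w\<^sup>2)) (of_real x)) (side_value H (\<lambda>w. h2 (w\<^sup>2)) (of_real x)) (side_value H (\<lambda>w. h3 (w\<^sup>2)) (of_real x))) (at (of_real x) within H)"
        unfolding F_def h1_def h2_def h3_def
        by (intro tendsto_intros tendsto_powr_complex side_value_hypergeo_limit[OF sec1 H x(1)] side_value_hypergeo_limit[OF sec2 H x(1)] side_value_hypergeo_limit[OF sec3 H x(1)] nn) auto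
    qed
    then show ?thesis using ab x(2) by simp
  qed
  then show ?thesis unfolding F_def h1_def h2_def h3_def P_def A_def B_def C_def half .
qed

lemma hypergeo_form_eq_odd_sum:
  assumes \<alpha>: "\<bar>Re \<alpha>\<bar> < 1/2" and w0: "w \<noteq> 0" and w1: "norm w < 1"
  shows "of_real pi ^ 2 / (8 * (w * b) ^ 2) * csc (of_real pi * \<alpha>) ^ 2 *
     (w powr (2 + 2 * \<alpha>) / (1 + 2 * \<alpha>) * hypergeo [1, 1/2 + \<alpha>] [3/2 + \<alpha>] (w\<^sup>2)
      + w powr (2 - 2 * \<alpha>) / (1 - 2 * \<alpha>) * hypergeo [1, 1/2 + - \<alpha>] [3/2 + - \<alpha>] (w\<^sup>2) - 2 * w * arctanh w)
   = of_real pi ^ 2 / (8 * b ^ 2) * csc (of_real pi * \<alpha>) ^ 2 *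
         (w powr (2 * \<alpha>) * odd_sum \<alpha> (w\<^sup>2) + w powr (- 2 * \<alpha>) * odd_sum (- \<alpha>) (w\<^sup>2) - 2 * odd_sum 0 (w\<^sup>2))"
proof -
  have w2: "norm (w\<^sup>2) < 1" using w1 by (simp add: norm_power power_less_one_iff)
  have nz: "1 + 2 * \<alpha> \<noteq> 0" "1 - 2 * \<alpha> \<noteq> 0" using norm_odd_sum_denominator[of 0 \<alpha>] norm_odd_sum_denominator[of 0 "- \<alpha>"] \<alpha> by auto
  have p: "w powr (2 + 2 * \<alpha>) = w\<^sup>2 * w powr (2 * \<alpha>)" "w powr (2 - 2 * \<alpha>) = w\<^sup>2 * w powr (- 2 * \<alpha>)"
    using w0 powr_add[of w 2 "2 * \<alpha>"] powr_add[of w 2 "- 2 * \<alpha>"] by (simp_all add: powr_nat')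
  have hs: "hypergeo [1, 1/2 + \<alpha>] [3/2 + \<alpha>] (w\<^sup>2) = (1 + 2 * \<alpha>) * odd_sum \<alpha> (w\<^sup>2)" "hypergeo [1, 1/2 + - \<alpha>] [3/2 + - \<alpha>] (w\<^sup>2) = (1 - 2 * \<alpha>) * odd_sum (- \<alpha>) (w\<^sup>2)"
    using hypergeo_eq_odd_sum[OF w2, of \<alpha>] hypergeo_eq_odd_sum[OF w2, of "- \<alpha>"] \<alpha> by simp_all
  have alg: "p / (8 * (w * b)\<^sup>2) * c * (w\<^sup>2 * x / m * (m * X) + w\<^sup>2 * y / n * (n * Y) - 2 * w * (w * Z)) = p / (8 * b\<^sup>2) * c * (x * X + y * Y - 2 * Z)"
    if "m \<noteq> 0" "n \<noteq> 0" for p c x X y Y Z m n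
  proof -
    have "w\<^sup>2 * x / m * (m * X) + w\<^sup>2 * y / n * (n * Y) - 2 * w * (w * Z) = w\<^sup>2 * (x * X + y * Y - 2 * Z)"
      using that by (simp add: power2_eq_square algebra_simps)
    then show ?thesis using w0 by (simp add: power_mult_distrib)
  qed
  show ?thesis unfolding p hs arctanh_eq_odd_sum[OF w1] by (rule alg[OF nz])
qed

text \<open>
  For small positive \<open>a\<close> the odd sums are rewritten as \<open>2F1\<close> functions, since only these are
  defined beyond the disc; then the identity theorem applies.
\<close>
lemma KK_integral_2_slit:
  assumes \<alpha>: "\<alpha> \<noteq> 0" "\<bar>Re \<alpha>\<bar> < 1/2" and b: "Re b > 0"
  defines "h \<equiv> \<lambda>\<beta>. hypergeo [1, 1/2 + \<beta>] [3/2 + \<beta>]"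
  defines "F \<equiv> \<lambda>w X Y Z. of_real pi ^ 2 / (8 * (w * b) ^ 2) * csc (of_real pi * \<alpha>) ^ 2 *
     (w powr (2 + 2 * \<alpha>) / (1 + 2 * \<alpha>) * X + w powr (2 - 2 * \<alpha>) / (1 - 2 * \<alpha>) * Y - 2 * w * Z)"
  shows "sectorial (fps_nth (fps_hypergeo [1, 1/2 + \<alpha>] [3/2 + \<alpha>] 1))"
    "sectorial (fps_nth (fps_hypergeo [1, 1/2 - \<alpha>] [3/2 - \<alpha>] 1))"
    "a \<in> slit_halfplane b \<Longrightarrow> KK_integral 2 \<alpha> b a = F (a / b) (h \<alpha> ((a / b)\<^sup>2)) (h (- \<alpha>) ((a / b)\<^sup>2)) (arctanh (a / b))"
proof -
  have b0: "b \<noteq> 0" using b by auto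
  have sec: "sectorial (fps_nth (fps_hypergeo [1, 1/2 + \<beta>] [3/2 + \<beta>] 1))" if "\<bar>Re \<beta>\<bar> < 1/2" for \<beta>
  proof -
    have "1/2 + \<beta> + of_real 1 = 3/2 + \<beta>" by simp
    moreover have "sectorial (\<lambda>k. 1 * (pochhammer (1/2 + \<beta>) k / pochhammer (1/2 + \<beta> + of_real 1) k))"
      by (intro sectorial_pochhammer sectorial_geometric) (use that in auto)
    moreover have "fps_nth (fps_hypergeo [1, 1/2 + \<beta>] [3/2 + \<beta>] 1) = (\<lambda>k. 1 * (pochhammer (1/2 + \<beta>) k / pochhammer (3/2 + \<beta>) k))"
      by (simp add: fun_eq_iff pochhammer_fact [symmetric])
    ultimately show ?thesis by (simp only:)
  qed
  show s1: "sectorial (fps_nth (fps_hypergeo [1, 1/2 + \<alpha>] [3/2 + \<alpha>] 1))" by (rule sec[OF \<alpha>(2)])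
  have s2: "sectorial (fps_nth (fps_hypergeo [1, 1/2 + - \<alpha>] [3/2 + - \<alpha>] 1))" by (rule sec) (use \<alpha> in simp)
  then show "sectorial (fps_nth (fps_hypergeo [1, 1/2 - \<alpha>] [3/2 - \<alpha>] 1))" by simp
  have \<sigma>: "4 * \<bar>Re \<alpha>\<bar> < 2" "(2::real) \<le> 4" using \<alpha> by auto
  show "KK_integral 2 \<alpha> b a = F (a / b) (h \<alpha> ((a / b)\<^sup>2)) (h (- \<alpha>) ((a / b)\<^sup>2)) (arctanh (a / b))" if "a \<in> slit_halfplane b"
  proof (rule KK_integral_identity[OF \<sigma> b _ _ that])
    have hol: "(\<lambda>a. hypergeo as bs ((a / b)\<^sup>2)) holomorphic_on slit_halfplane b" if "sectorial (fps_nth (fps_hypergeo as bs 1))" for as bs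
      by (rule holomorphic_on_compose_gen[OF _ holomorphic_hypergeo[OF that], unfolded o_def])
         (use b0 slit_halfplane_quotient(2)[OF _ b] in \<open>auto intro!: holomorphic_intros\<close>)
    have nz: "1 + 2 * \<alpha> \<noteq> 0" "1 - 2 * \<alpha> \<noteq> 0" using norm_odd_sum_denominator[of 0 \<alpha>] norm_odd_sum_denominator[of 0 "- \<alpha>"] \<alpha>(2) by auto
    have a0: "a \<noteq> 0" if "a \<in> slit_halfplane b" for a using that by (auto simp: slit_halfplane_def)
    show "(\<lambda>a. F (a / b) (h \<alpha> ((a / b)\<^sup>2)) (h (- \<alpha>) ((a / b)\<^sup>2)) (arctanh (a / b))) holomorphic_on slit_halfplane b"
      unfolding F_def h_def arctanh_def
      by (intro holomorphic_intros hol[OF s1] hol[OF s2]) (use b0 nz a0 slit_halfplane_quotient(1,3,4)[OF _ b] in auto)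
    fix t :: real assume t: "0 < t" "2 * t < Re b"
    define w where "w = of_real t / b"
    have w0: "w \<noteq> 0" using t b0 by (simp add: w_def)
    have wb: "w * b = of_real t" using b0 by (simp add: w_def)
    have w1: "norm w < 1" using t complex_Re_le_cmod[of b] b by (simp add: norm_divide w_def divide_less_eq)
    have "F w (h \<alpha> (w\<^sup>2)) (h (- \<alpha>) (w\<^sup>2)) (arctanh w) = of_real pi ^ 2 / (8 * b ^ 2) * csc (of_real pi * \<alpha>) ^ 2 *
         (w powr (2 * \<alpha>) * odd_sum \<alpha> (w\<^sup>2) + w powr (- 2 * \<alpha>) * odd_sum (- \<alpha>) (w\<^sup>2) - 2 * odd_sum 0 (w\<^sup>2))"
      unfolding F_def h_def by (rule hypergeo_form_eq_odd_sum[OF \<alpha>(2) w0 w1])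
    then show "KK_integral 2 \<alpha> b (of_real t) = F (of_real t / b) (h \<alpha> ((of_real t / b)\<^sup>2)) (h (- \<alpha>) ((of_real t / b)\<^sup>2)) (arctanh (of_real t / b))"
      using integral_2_expansion[OF \<alpha> t] unfolding KK_integral_def w_def by simp
  qed
qed

text \<open>
  Back inside the disc, and now for every \<open>w\<close> of modulus below 1, the odd sums are the
  convenient form for the limits \<open>a \<rightarrow> b\<close> and \<open>\<alpha> \<rightarrow> 0\<close>.
\<close>
lemma KK_integral_2_disc:
  assumes \<alpha>: "\<alpha> \<noteq> 0" "\<bar>Re \<alpha>\<bar> < 1/2" and b: "Re b > 0" and w: "w * b \<in> slit_halfplane b" "norm w < 1"
  shows "KK_integral 2 \<alpha> b (w * b) = of_real pi ^ 2 / (8 * b ^ 2) * csc (of_real pi * \<alpha>) ^ 2 *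
         (w powr (2 * \<alpha>) * odd_sum \<alpha> (w\<^sup>2) + w powr (- 2 * \<alpha>) * odd_sum (- \<alpha>) (w\<^sup>2) - 2 * odd_sum 0 (w\<^sup>2))"
proof -
  have b0: "b \<noteq> 0" using b by auto
  then have q: "w * b / b = w" by simp
  have w0: "w \<noteq> 0" using w(1) by (auto simp: slit_halfplane_def)
  show ?thesis using KK_integral_2_slit(3)[OF \<alpha> b w(1)] unfolding q hypergeo_form_eq_odd_sum[OF \<alpha>(2) w0 w(2)] .
qed

lemma KK_integral_2:
  assumes \<alpha>: "\<alpha> \<noteq> 0" "\<bar>Re \<alpha>\<bar> < 1/2" and a: "Re a > 0" and b: "Re b > 0"
    and H: "H = {w. Im w > 0} \<or> H = {w. Im w < 0}" and ab: "a \<noteq> b"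
  shows "KK_integral 2 \<alpha> b a = of_real pi ^ 2 / (8 * a ^ 2) * csc (of_real pi * \<alpha>) ^ 2 *
         ((a / b) powr (2 + 2 * \<alpha>) / (1 + 2 * \<alpha>)
            * side_value H (\<lambda>w. hypergeo [1, 1/2 + \<alpha>] [3/2 + \<alpha>] (w ^ 2)) (a / b)
          + (a / b) powr (2 - 2 * \<alpha>) / (1 - 2 * \<alpha>)
            * side_value H (\<lambda>w. hypergeo [1, 1/2 - \<alpha>] [3/2 - \<alpha>] (w ^ 2)) (a / b)
          - 2 * a / b * side_value H arctanh (a / b))"
proof -
  have b0: "b \<noteq> 0" using b by auto
  define F where "F w X Y Z = of_real pi ^ 2 / (8 * (w * b) ^ 2) * csc (of_real pi * \<alpha>) ^ 2 *
     (w powr (2 + 2 * \<alpha>) / (1 + 2 * \<alpha>) * X + w powr (2 - 2 * \<alpha>) / (1 - 2 * \<alpha>) * Y - 2 * w * Z)" for w X Y Z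
  have \<sigma>: "4 * \<bar>Re \<alpha>\<bar> < 2" "(2::real) \<le> 4" using \<alpha> by auto
  note sec = KK_integral_2_slit(1,2)[OF \<alpha> b]
  have main: "KK_integral 2 \<alpha> b a = F (a / b) (hypergeo [1, 1/2 + \<alpha>] [3/2 + \<alpha>] ((a / b)\<^sup>2)) (hypergeo [1, 1/2 - \<alpha>] [3/2 - \<alpha>] ((a / b)\<^sup>2)) (arctanh (a / b))"
    if "a \<in> slit_halfplane b" for a
    using KK_integral_2_slit(3)[OF \<alpha> b that] unfolding F_def by simp
  have "KK_integral 2 \<alpha> b a = F (a / b) (side_value H (\<lambda>w. hypergeo [1, 1/2 + \<alpha>] [3/2 + \<alpha>] (w ^ 2)) (a / b))
      (side_value H (\<lambda>w. hypergeo [1, 1/2 - \<alpha>] [3/2 - \<alpha>] (w ^ 2)) (a / b)) (side_value H arctanh (a / b))"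
    using real_quotient_cases[OF a b]
  proof (elim disjE exE conjE)
    assume as: "a \<in> slit_halfplane b"
    then have "a / b \<notin> of_real ` {1<..}" by (auto simp: slit_halfplane_def)
    then show ?thesis using main[OF as] by (simp add: side_value_def)
  next
    assume "a = b"
    then show ?thesis using ab by simp
  next
    fix x :: real assume x: "x > 1" "a = of_real x * b"
    have q: "a / b = of_real x" using x b0 by simp
    have nn: "complex_of_real x \<notin> \<real>\<^sub>\<le>\<^sub>0" "8 * (complex_of_real x * b) ^ 2 \<noteq> 0" using x b0 by (auto simp: complex_nonpos_Reals_iff)
    have nz: "1 + 2 * \<alpha> \<noteq> 0" "1 - 2 * \<alpha> \<noteq> 0" using norm_odd_sum_denominator[of 0 \<alpha>] norm_odd_sum_denominator[of 0 "- \<alpha>"] \<alpha>(2) by auto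
    have "KK_integral 2 \<alpha> b (of_real x * b) = F (of_real x) (side_value H (\<lambda>w. hypergeo [1, 1/2 + \<alpha>] [3/2 + \<alpha>] (w ^ 2)) (of_real x))
      (side_value H (\<lambda>w. hypergeo [1, 1/2 - \<alpha>] [3/2 - \<alpha>] (w ^ 2)) (of_real x)) (side_value H arctanh (of_real x))"
    proof (rule KK_integral_side_transfer[OF \<sigma> b _ H])
      show "x > 0" using x by simp
      show "KK_integral 2 \<alpha> b (w * b) = F w (hypergeo [1, 1/2 + \<alpha>] [3/2 + \<alpha>] (w\<^sup>2)) (hypergeo [1, 1/2 - \<alpha>] [3/2 - \<alpha>] (w\<^sup>2)) (arctanh w)" if "w * b \<in> slit_halfplane b" for w
        using main[OF that] b0 by simp
      show "((\<lambda>w. F w (hypergeo [1, 1/2 + \<alpha>] [3/2 + \<alpha>] (w\<^sup>2)) (hypergeo [1, 1/2 - \<alpha>] [3/2 - \<alpha>] (w\<^sup>2)) (arctanh w)) \<longlongrightarrow>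
         F (of_real x) (side_value H (\<lambda>w. hypergeo [1, 1/2 + \<alpha>] [3/2 + \<alpha>] (w ^ 2)) (of_real x))
      (side_value H (\<lambda>w. hypergeo [1, 1/2 - \<alpha>] [3/2 - \<alpha>] (w ^ 2)) (of_real x)) (side_value H arctanh (of_real x))) (at (of_real x) within H)"
        unfolding F_def
        by (intro tendsto_intros tendsto_powr_complex side_value_hypergeo_limit[OF sec(1) H x(1)] side_value_hypergeo_limit[OF sec(2) H x(1)] side_value_arctanh_limit[OF H x(1)] nn nz)
    qed
    then show ?thesis using q x(2) by simp
  qed
  moreover have "a / b * b = a" "2 * (a / b) = 2 * a / b" using b0 by simp_all
  ultimately show ?thesis unfolding F_def by (simp only:)
qed

section \<open>Equal arguments and the digamma function\<close>

lemma power_series_tendsto_left_1: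
  assumes "summable (\<lambda>k. norm (c k :: complex))"
  shows "((\<lambda>x. \<Sum>k. c k * (of_real x ^ 2) ^ k) \<longlongrightarrow> (\<Sum>k. c k)) (at_left (1::real))"
proof -
  define F where "F z = (\<Sum>k. c k * z ^ k)" for z
  have F: "continuous_on (cball 0 1) F" unfolding F_def by (rule continuous_on_power_series_closed_disc[OF assms])
  have "continuous_on {0..1} (\<lambda>x::real. F (of_real x ^ 2))"
    by (rule continuous_on_compose2[OF F]) (auto intro!: continuous_intros simp: norm_power power_le_one)
  then have "((\<lambda>x. F (of_real x ^ 2)) \<longlongrightarrow> F (of_real 1 ^ 2)) (at 1 within {0..1})"
    unfolding continuous_on_def by (rule bspec) simp
  then show ?thesis by (simp add: at_within_Icc_at_left F_def)
qed

lemma odd_sum_denominator_ge: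
  assumes "\<bar>Re \<beta>\<bar> < 1/2"
  shows "(1 - 2 * \<bar>Re \<beta>\<bar>) * (2 * real k + 1) \<le> norm (1 + 2 * \<beta> + 2 * of_nat k)"
proof -
  have "0 \<le> \<bar>Re \<beta>\<bar> * real k" by simp
  then have "(1 - 2 * \<bar>Re \<beta>\<bar>) * (2 * real k + 1) \<le> 1 + 2 * real k - 2 * \<bar>Re \<beta>\<bar>" by (simp add: algebra_simps)
  then show ?thesis using norm_odd_sum_denominator[of k \<beta>] by linarith
qed

text \<open>
  The odd sums diverge logarithmically at 1; comparison of denominators reduces this to the
  inverse hyperbolic tangent.
\<close>
lemma odd_sum_log_bound:
  assumes \<beta>: "\<bar>Re \<beta>\<bar> < 1/2" and t: "0 < t" "t < 1"
  shows "norm (odd_sum \<beta> (of_real t ^ 2)) \<le> (ln (1 + t) - ln (1 - t)) / (2 * t * (1 - 2 * \<bar>Re \<beta>\<bar>))"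
proof -
  define \<delta> where "\<delta> = 1 - 2 * \<bar>Re \<beta>\<bar>"
  have \<delta>: "\<delta> > 0" using \<beta> by (simp add: \<delta>_def)
  have t2: "norm (complex_of_real t ^ 2) < 1" using t by (simp add: norm_power power_less_one_iff)
  have "arctanh (of_real t) = of_real t * odd_sum 0 (of_real t ^ 2)" by (rule arctanh_eq_odd_sum) (use t in simp)
  moreover have "arctanh (of_real t) = of_real ((ln (1 + t) - ln (1 - t)) / 2)"
  proof -
    have "Ln (1 + of_real t) = of_real (ln (1 + t))" "Ln (1 - of_real t) = of_real (ln (1 - t))"
      using t Ln_of_real[of "1 + t"] Ln_of_real[of "1 - t"] by simp_all
    then show ?thesis by (simp add: arctanh_def)
  qed
  ultimately have o: "odd_sum 0 (of_real t ^ 2) = of_real ((ln (1 + t) - ln (1 - t)) / (2 * t))"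
    using t by (simp add: field_simps)
  have s0: "(\<lambda>k. (of_real t ^ 2) ^ k / (1 + 2 * 0 + 2 * of_nat k)) sums complex_of_real ((ln (1 + t) - ln (1 - t)) / (2 * t))"
    unfolding o [symmetric] odd_sum_def by (intro summable_sums summable_odd_sum t2) simp
  have "(\<lambda>k. Re ((of_real t ^ 2) ^ k / (1 + 2 * 0 + 2 * of_nat k))) sums Re (complex_of_real ((ln (1 + t) - ln (1 - t)) / (2 * t)))"
    by (rule sums_Re[OF s0])
  also have "(\<lambda>k. Re ((of_real t ^ 2) ^ k / (1 + 2 * 0 + 2 * of_nat k))) = (\<lambda>k. (t\<^sup>2) ^ k / (2 * real k + 1))"
  proof
    fix k
    have "(complex_of_real t ^ 2) ^ k / (1 + 2 * 0 + 2 * of_nat k) = of_real ((t\<^sup>2) ^ k / (2 * real k + 1))" by (simp add: add.commute)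
    then show "Re ((of_real t ^ 2) ^ k / (1 + 2 * 0 + 2 * of_nat k)) = (t\<^sup>2) ^ k / (2 * real k + 1)" by (simp only: Re_complex_of_real)
  qed
  finally have s1: "(\<lambda>k. (t\<^sup>2) ^ k / (2 * real k + 1) / \<delta>) sums ((ln (1 + t) - ln (1 - t)) / (2 * t) / \<delta>)"
    by (intro sums_divide) simp
  have bd: "norm ((of_real t ^ 2) ^ k / (1 + 2 * \<beta> + 2 * of_nat k)) \<le> (t\<^sup>2) ^ k / (2 * real k + 1) / \<delta>" for k
  proof -
    have "norm ((of_real t ^ 2) ^ k / (1 + 2 * \<beta> + 2 * of_nat k)) = (t\<^sup>2) ^ k / norm (1 + 2 * \<beta> + 2 * of_nat k)"
      using t by (simp add: norm_divide norm_power)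
    also have "\<dots> \<le> (t\<^sup>2) ^ k / (\<delta> * (2 * real k + 1))"
      using odd_sum_denominator_ge[OF \<beta>, of k] \<delta> unfolding \<delta>_def[symmetric] by (intro frac_le mult_pos_pos) auto
    finally show ?thesis by (simp add: mult.commute)
  qed
  have "norm (odd_sum \<beta> (of_real t ^ 2)) \<le> (ln (1 + t) - ln (1 - t)) / (2 * t) / \<delta>"
    unfolding odd_sum_def sums_unique[OF s1] by (rule norm_suminf_le[OF bd sums_summable[OF s1]])
  then show ?thesis by (simp add: \<delta>_def)
qed

text \<open>
  A simple zero against a logarithmic singularity.
\<close>
lemma powr_odd_sum_tendsto_0:
  assumes \<beta>: "\<bar>Re \<beta>\<bar> < 1/2"
  shows "((\<lambda>t. (complex_of_real t powr \<gamma> - 1) * odd_sum \<beta> (of_real t ^ 2)) \<longlongrightarrow> 0) (at_left 1)"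
proof -
  have ev: "\<forall>\<^sub>F t in at_left (1::real). t \<in> {0<..<1}" by (rule eventually_at_leftI[of 0]) auto
  define \<delta> where "\<delta> = 1 - 2 * \<bar>Re \<beta>\<bar>"
  have \<delta>: "\<delta> > 0" using \<beta> by (simp add: \<delta>_def)
  define g where "g t = odd_sum \<beta> (complex_of_real t ^ 2)" for t
  have D: "((\<lambda>z. z powr \<gamma>) has_field_derivative \<gamma>) (at 1)"
    using has_field_derivative_powr[of 1 \<gamma>] by simp
  have "filterlim complex_of_real (at 1) (at_left 1)" unfolding filterlim_at
  proof
    show "\<forall>\<^sub>F t in at_left 1. complex_of_real t \<in> UNIV \<and> complex_of_real t \<noteq> 1" using ev by eventually_elim auto
    have "(complex_of_real \<longlongrightarrow> of_real 1) (at_left 1)" by (intro tendsto_intros)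
    then show "(complex_of_real \<longlongrightarrow> 1) (at_left 1)" by simp
  qed
  from filterlim_compose[OF D[unfolded has_field_derivative_iff] this]
  have q: "((\<lambda>t. (complex_of_real t powr \<gamma> - 1) / (complex_of_real t - 1)) \<longlongrightarrow> \<gamma>) (at_left 1)" by simp
  have "((\<lambda>t::real. (1 - t) * ((ln (1 + t) - ln (1 - t)) / (2 * t))) \<longlongrightarrow> 0) (at_left 1)" by real_asymp
  then have "((\<lambda>t::real. (1 - t) * ((ln (1 + t) - ln (1 - t)) / (2 * t)) / \<delta>) \<longlongrightarrow> 0 / \<delta>) (at_left 1)"
    using \<delta> by (intro tendsto_divide) auto
  then have lim: "((\<lambda>t::real. (1 - t) * ((ln (1 + t) - ln (1 - t)) / (2 * t)) / \<delta>) \<longlongrightarrow> 0) (at_left 1)" by simp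
  have "((\<lambda>t. (complex_of_real t - 1) * g t) \<longlongrightarrow> 0) (at_left 1)"
  proof (rule Lim_null_comparison[OF _ lim])
    show "\<forall>\<^sub>F t in at_left 1. norm ((complex_of_real t - 1) * g t) \<le> (1 - t) * ((ln (1 + t) - ln (1 - t)) / (2 * t)) / \<delta>"
      using ev
    proof eventually_elim
      case (elim t)
      have "norm (complex_of_real t - 1) = 1 - t"
        using elim norm_of_real[of "t - 1", where 'a=complex] by simp
      moreover have "(1 - t) * norm (g t) \<le> (1 - t) * ((ln (1 + t) - ln (1 - t)) / (2 * t * \<delta>))"
        unfolding g_def \<delta>_def using elim by (intro mult_left_mono odd_sum_log_bound[OF \<beta>]) auto
      ultimately show ?case by (simp add: norm_mult)
    qed
  qed
  from tendsto_mult[OF q this]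
  have L: "((\<lambda>t. (complex_of_real t powr \<gamma> - 1) / (complex_of_real t - 1) * ((complex_of_real t - 1) * g t)) \<longlongrightarrow> 0) (at_left 1)" by simp
  have "\<forall>\<^sub>F t in at_left 1. (complex_of_real t powr \<gamma> - 1) / (complex_of_real t - 1) * ((complex_of_real t - 1) * g t) = (complex_of_real t powr \<gamma> - 1) * g t"
    using ev by eventually_elim auto
  from tendsto_cong[OF this] L show ?thesis unfolding g_def by blast
qed

text \<open>
  The divergent parts cancel in the combination \<open>d\<close>, whose partial sums are those of the limit
  formula for the digamma function at \<open>1/2 + \<alpha>\<close>, \<open>1/2 - \<alpha>\<close> and \<open>1/2\<close>; the last value gives
  \<open>ln 2\<close> and Euler's constant.
\<close>
lemma odd_sum_Digamma_sums:
  assumes \<alpha>: "\<bar>Re \<alpha>\<bar> < 1/2"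
  defines "d \<equiv> \<lambda>k. 1 / (1 + 2 * \<alpha> + 2 * of_nat k) + 1 / (1 + 2 * - \<alpha> + 2 * of_nat k) - 2 / (1 + 2 * 0 + 2 * of_nat k)"
  shows "d sums (- (1/2) * (Digamma (1/2 - \<alpha>) + Digamma (1/2 + \<alpha>) + 4 * of_real (ln 2) + 2 * of_real euler_mascheroni))"
    and "summable (\<lambda>k. norm (d k))"
proof -
  define \<delta> where "\<delta> = 1 - 2 * \<bar>Re \<alpha>\<bar>"
  have \<delta>: "\<delta> > 0" using \<alpha> by (simp add: \<delta>_def)
  have h: "1/2 + \<alpha> \<noteq> 0" "1/2 - \<alpha> \<noteq> 0" "(1/2::complex) \<noteq> 0"
    using \<alpha> by (auto simp: complex_eq_iff)
  note L = Digamma_LIMSEQ[OF h(1)] Digamma_LIMSEQ[OF h(2)] Digamma_LIMSEQ[OF h(3)]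
  have "(\<lambda>m. 1/2 * (2 * (of_real (ln (real m)) - (\<Sum>n<m. inverse (1/2 + of_nat n))) - (of_real (ln (real m)) - (\<Sum>n<m. inverse (1/2 + \<alpha> + of_nat n)))
      - (of_real (ln (real m)) - (\<Sum>n<m. inverse (1/2 - \<alpha> + of_nat n))))) \<longlonglongrightarrow> 1/2 * (2 * Digamma (1/2) - Digamma (1/2 + \<alpha>) - Digamma (1/2 - \<alpha>))"
    by (intro tendsto_intros L)
  moreover have "1/2 * (2 * (of_real (ln (real m)) - (\<Sum>n<m. inverse (1/2 + of_nat n))) - (of_real (ln (real m)) - (\<Sum>n<m. inverse (1/2 + \<alpha> + of_nat n)))
      - (of_real (ln (real m)) - (\<Sum>n<m. inverse (1/2 - \<alpha> + of_nat n)))) = (\<Sum>n<m. d n)" for m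
  proof -
    have i: "1 / (1 + 2 * \<beta> + 2 * of_nat n) = 1/2 * inverse (1/2 + \<beta> + of_nat n)" for \<beta> :: complex and n
    proof -
      have "1 + 2 * \<beta> + 2 * of_nat n = 2 * (1/2 + \<beta> + of_nat n)" by (simp add: algebra_simps)
      then show ?thesis by (simp only: divide_inverse inverse_mult_distrib) simp
    qed
    have "d n = 1/2 * inverse (1/2 + \<alpha> + of_nat n) + 1/2 * inverse (1/2 - \<alpha> + of_nat n) - inverse (1/2 + of_nat n)" for n
    proof -
      have "2 / (1 + 2 * 0 + 2 * of_nat n) = 2 * (1 / (1 + 2 * 0 + 2 * of_nat n :: complex))" by simp
      moreover have "1/2 + - \<alpha> + of_nat n = 1/2 - \<alpha> + of_nat n" "1/2 + 0 + of_nat n = (1/2 + of_nat n :: complex)" by simp_all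
      moreover have "2 * (1/2 * x) = x" for x :: complex by simp
      ultimately show ?thesis unfolding d_def i by (simp only: i)
    qed
    then have "(\<Sum>n<m. d n) = 1/2 * (\<Sum>n<m. inverse (1/2 + \<alpha> + of_nat n)) + 1/2 * (\<Sum>n<m. inverse (1/2 - \<alpha> + of_nat n)) - (\<Sum>n<m. inverse (1/2 + of_nat n))"
      by (simp add: sum.distrib sum_subtractf sum_distrib_left)
    then show ?thesis by (simp add: algebra_simps)
  qed
  ultimately have "d sums (1/2 * (2 * Digamma (1/2) - Digamma (1/2 + \<alpha>) - Digamma (1/2 - \<alpha>)))" by (simp add: sums_def)
  also have "1/2 * (2 * Digamma (1/2) - Digamma (1/2 + \<alpha>) - Digamma (1/2 - \<alpha>)) = - (1/2) * (Digamma (1/2 - \<alpha>) + Digamma (1/2 + \<alpha>) + 4 * of_real (ln 2) + 2 * of_real euler_mascheroni)"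
    by (simp add: Digamma_one_half algebra_simps)
  finally show "d sums (- (1/2) * (Digamma (1/2 - \<alpha>) + Digamma (1/2 + \<alpha>) + 4 * of_real (ln 2) + 2 * of_real euler_mascheroni))" .
  show "summable (\<lambda>k. norm (d k))"
  proof (rule summable_comparison_test')
    have "summable (\<lambda>k. inverse (real k ^ 2))" by (rule inverse_power_summable) simp
    then have "summable (\<lambda>k. 1 / real (Suc k) ^ 2)"
      by (subst (asm) summable_Suc_iff [symmetric]) (simp only: inverse_eq_divide)
    then show "summable (\<lambda>k. 8 * norm \<alpha> ^ 2 / \<delta>\<^sup>2 * (1 / real (Suc k) ^ 2))" by (rule summable_mult)
    fix k
    define n :: complex where "n = 1 + 2 * of_nat k"
    define m where "m = 2 * real k + 1"
    have m: "m \<ge> 1" by (simp add: m_def)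
    have n: "norm n = m"
    proof -
      have "n = of_real m" by (simp add: n_def m_def)
      then show ?thesis using m by (simp only: norm_of_real abs_of_nonneg)
    qed
    have ge: "\<delta> * m \<le> norm (n + 2 * \<alpha>)" "\<delta> * m \<le> norm (n - 2 * \<alpha>)"
      using odd_sum_denominator_ge[OF \<alpha>, of k] odd_sum_denominator_ge[of "- \<alpha>" k] \<alpha> by (simp_all add: n_def m_def \<delta>_def algebra_simps)
    have dm: "\<delta> * m > 0" using \<delta> m by simp
    have nz: "n + 2 * \<alpha> \<noteq> 0" "n - 2 * \<alpha> \<noteq> 0" "n \<noteq> 0" using ge dm n m by auto
    have "d k = 1 / (n + 2 * \<alpha>) + 1 / (n - 2 * \<alpha>) - 2 / n" by (simp add: d_def n_def algebra_simps)
    \<comment> \<open>The combination is of order \<open>1 / k^3\<close>; a bound of order \<open>1 / k^2\<close> gives absolute convergence.\<close>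
    also have "\<dots> = 8 * \<alpha>\<^sup>2 / (n * (n + 2 * \<alpha>) * (n - 2 * \<alpha>))" using nz by (simp add: divide_simps) (simp add: power2_eq_square algebra_simps)
    finally have "norm (d k) = 8 * norm \<alpha> ^ 2 / (m * norm (n + 2 * \<alpha>) * norm (n - 2 * \<alpha>))" by (simp add: norm_divide norm_mult norm_power n)
    also have "\<dots> \<le> 8 * norm \<alpha> ^ 2 / (1 * (\<delta> * m) * (\<delta> * m))"
      using nz dm m ge \<delta> by (intro divide_left_mono mult_mono mult_pos_pos) auto
    also have "\<dots> = 8 * norm \<alpha> ^ 2 / \<delta>\<^sup>2 * (1 / m ^ 2)" by (simp add: power2_eq_square)
    also have "\<dots> \<le> 8 * norm \<alpha> ^ 2 / \<delta>\<^sup>2 * (1 / real (Suc k) ^ 2)"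
      using m by (intro mult_left_mono divide_left_mono power_mono) (auto simp: m_def)
    finally show "norm (norm (d k)) \<le> 8 * norm \<alpha> ^ 2 / \<delta>\<^sup>2 * (1 / real (Suc k) ^ 2)" by simp
  qed
qed

text \<open>
  The value at \<open>a = b\<close> is the limit along \<open>a = t b\<close>, \<open>t \<rightarrow> 1\<close>. Each summand diverges there, but
  splitting \<open>t powr (2 * \<alpha>) = 1 + (t powr (2 * \<alpha>) - 1)\<close> leaves a power series that converges
  absolutely on the closed disc and two terms that vanish.
\<close>
lemma KK_integral_2_eq:
  assumes \<alpha>: "\<alpha> \<noteq> 0" "\<bar>Re \<alpha>\<bar> < 1/2" and b: "Re b > 0"
  shows "KK_integral 2 \<alpha> b b = - (of_real pi ^ 2 / (16 * b ^ 2)) * csc (of_real pi * \<alpha>) ^ 2 *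
         (Digamma (1/2 - \<alpha>) + Digamma (1/2 + \<alpha>) + 4 * of_real (ln 2) + 2 * of_real euler_mascheroni)"
proof -
  have b0: "b \<noteq> 0" using b by auto
  define d where "d k = 1 / (1 + 2 * \<alpha> + 2 * of_nat k) + 1 / (1 + 2 * - \<alpha> + 2 * of_nat k) - 2 / (1 + 2 * 0 + 2 * of_nat k)" for k
  define S where "S = - (1/2) * (Digamma (1/2 - \<alpha>) + Digamma (1/2 + \<alpha>) + 4 * of_real (ln 2) + 2 * of_real euler_mascheroni)"
  have d: "d sums S" "summable (\<lambda>k. norm (d k))" unfolding d_def S_def by (rule odd_sum_Digamma_sums[OF \<alpha>(2)])+
  define P where "P = of_real pi ^ 2 / (8 * b ^ 2) * csc (of_real pi * \<alpha>) ^ 2"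
  define E where "E t = (\<Sum>k. d k * (of_real t ^ 2) ^ k) + (complex_of_real t powr (2 * \<alpha>) - 1) * odd_sum \<alpha> (of_real t ^ 2)
     + (complex_of_real t powr (- 2 * \<alpha>) - 1) * odd_sum (- \<alpha>) (of_real t ^ 2)" for t
  have \<sigma>: "4 * \<bar>Re \<alpha>\<bar> < 2" "(2::real) \<le> 4" using \<alpha> by auto
  have "KK_integral 2 \<alpha> b (1 * b) = P * (S + 0 + 0)"
  proof (rule KK_integral_left_transfer[OF \<sigma> b])
    show "Re (1 * b) > 0" using b by simp
    show "KK_integral 2 \<alpha> b (of_real t * (1 * b)) = P * E t" if "0 < t" "t < 1" for t
    proof -
      have sl: "of_real t * b \<in> slit_halfplane b" using that b b0 by (auto simp: slit_halfplane_def)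
      have nt: "norm (complex_of_real t) < 1" using that by simp
      have t2: "norm (complex_of_real t ^ 2) < 1" using that by (simp add: norm_power power_less_one_iff)
      have s: "(\<lambda>k. (of_real t ^ 2) ^ k / (1 + 2 * \<beta> + 2 * of_nat k)) sums odd_sum \<beta> (of_real t ^ 2)" if "\<bar>Re \<beta>\<bar> < 1/2" for \<beta>
        unfolding odd_sum_def by (intro summable_sums summable_odd_sum t2 that)
      have "(\<lambda>k. (of_real t ^ 2) ^ k / (1 + 2 * \<alpha> + 2 * of_nat k) + (of_real t ^ 2) ^ k / (1 + 2 * - \<alpha> + 2 * of_nat k) - 2 * ((of_real t ^ 2) ^ k / (1 + 2 * 0 + 2 * of_nat k)))
         sums (odd_sum \<alpha> (of_real t ^ 2) + odd_sum (- \<alpha>) (of_real t ^ 2) - 2 * odd_sum 0 (of_real t ^ 2))"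
        by (intro sums_add sums_diff sums_mult s) (use \<alpha> in auto)
      also have "(\<lambda>k. (of_real t ^ 2) ^ k / (1 + 2 * \<alpha> + 2 * of_nat k) + (of_real t ^ 2) ^ k / (1 + 2 * - \<alpha> + 2 * of_nat k) - 2 * ((of_real t ^ 2) ^ k / (1 + 2 * 0 + 2 * of_nat k)))
         = (\<lambda>k. d k * (of_real t ^ 2) ^ k)" unfolding d_def by (intro ext) (simp add: left_diff_distrib distrib_right)
      finally have ds: "(\<Sum>k. d k * (of_real t ^ 2) ^ k) = odd_sum \<alpha> (of_real t ^ 2) + odd_sum (- \<alpha>) (of_real t ^ 2) - 2 * odd_sum 0 (of_real t ^ 2)"
        by (rule sums_unique[symmetric])
      have "E t = of_real t powr (2 * \<alpha>) * odd_sum \<alpha> (of_real t ^ 2) + of_real t powr (- 2 * \<alpha>) * odd_sum (- \<alpha>) (of_real t ^ 2) - 2 * odd_sum 0 (of_real t ^ 2)"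
        unfolding E_def ds by (simp only: left_diff_distrib) simp
      then show ?thesis using KK_integral_2_disc[OF \<alpha> b sl nt] by (simp add: P_def)
    qed
    have "((\<lambda>t. \<Sum>k. d k * (of_real t ^ 2) ^ k) \<longlongrightarrow> S) (at_left 1)"
      using power_series_tendsto_left_1[OF d(2)] sums_unique[OF d(1)] by simp
    then show "((\<lambda>t. P * E t) \<longlongrightarrow> P * (S + 0 + 0)) (at_left 1)"
      unfolding E_def by (intro tendsto_mult tendsto_add tendsto_const powr_odd_sum_tendsto_0) (use \<alpha> in auto)
  qed
  then show ?thesis by (simp add: P_def S_def)
qed

section \<open>Polylogarithms and the order zero\<close>

text \<open>
  The odd part of the polylogarithm of order \<open>s\<close>: \<open>z * odd_power_sum s (z^2)\<close> is Legendre's chi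
  function.
\<close>
definition odd_power_sum :: "nat \<Rightarrow> complex \<Rightarrow> complex" where
  "odd_power_sum s z = (\<Sum>k. z ^ k / (2 * of_nat k + 1) ^ s)"

lemma norm_odd_of_nat: "norm (2 * of_nat k + 1 :: complex) = 2 * real k + 1"
  using norm_of_nat[of "2 * k + 1", where 'a=complex] by (simp add: add.commute)

lemma odd_of_nat_nonzero: "(2 * of_nat k + 1 :: complex) \<noteq> 0"
proof
  assume "(2 * of_nat k + 1 :: complex) = 0"
  then have "2 * real k + 1 = 0" using norm_odd_of_nat[of k] by simp
  then show False by linarith
qed

lemma of_nat_powr_numeral: "complex_of_nat (Suc k) powr 2 = of_nat (Suc k) ^ 2" "complex_of_nat (Suc k) powr 3 = of_nat (Suc k) ^ 3"
  using powr_nat'[of "of_nat (Suc k) :: complex" 2] powr_nat'[of "of_nat (Suc k) :: complex" 3] by (simp_all del: of_nat_Suc)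

lemma summable_polylog_coeff:
  assumes "s \<ge> 2"
  shows "summable (\<lambda>k. norm (1 / complex_of_nat (Suc k) ^ s))"
proof -
  have "summable (\<lambda>k. inverse (real k ^ s))" by (rule inverse_power_summable[OF assms])
  then have "summable (\<lambda>k. inverse (real (Suc k) ^ s))" by (subst summable_Suc_iff)
  moreover have "norm (1 / complex_of_nat (Suc k) ^ s) = inverse (real (Suc k) ^ s)" for k
    by (simp only: norm_divide norm_power norm_of_nat norm_one inverse_eq_divide)
  ultimately show ?thesis by (simp only:)
qed

lemma polylog_eq:
  "polylog 2 z = (\<Sum>k. z ^ Suc k / of_nat (Suc k) ^ 2)" "polylog 3 z = (\<Sum>k. z ^ Suc k / of_nat (Suc k) ^ 3)"
  unfolding polylog_def of_nat_powr_numeral by (rule refl)+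

lemma summable_polylog:
  fixes z :: complex
  assumes "s \<ge> 2" "norm z \<le> 1"
  shows "summable (\<lambda>k. z ^ Suc k / of_nat (Suc k) ^ s)"
proof (rule summable_comparison_test'[OF summable_polylog_coeff[OF assms(1)]])
  fix k
  have "norm z ^ Suc k \<le> 1" using assms(2) by (intro power_le_one) auto
  then have "norm z ^ Suc k * norm (1 / complex_of_nat (Suc k) ^ s) \<le> 1 * norm (1 / complex_of_nat (Suc k) ^ s)"
    by (intro mult_right_mono) auto
  then show "norm (z ^ Suc k / of_nat (Suc k) ^ s) \<le> norm (1 / complex_of_nat (Suc k) ^ s)"
    unfolding norm_divide norm_power norm_one by simp
qed

lemma polylog_odd_part:
  assumes "s \<ge> 2" "norm z \<le> 1"
  shows "(\<Sum>k. z ^ Suc k / of_nat (Suc k) ^ s) - (\<Sum>k. (- z) ^ Suc k / of_nat (Suc k) ^ s) = 2 * (z * odd_power_sum s (z\<^sup>2))"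
proof -
  have nz: "norm (- z) \<le> 1" using assms by simp
  define g where "g k = z ^ Suc k / of_nat (Suc k) ^ s - (- z) ^ Suc k / of_nat (Suc k) ^ s" for k
  have "g sums ((\<Sum>k. z ^ Suc k / of_nat (Suc k) ^ s) - (\<Sum>k. (- z) ^ Suc k / of_nat (Suc k) ^ s))"
    unfolding g_def by (intro sums_diff summable_sums summable_polylog assms(1) assms(2) nz)
  moreover have "(\<lambda>m. g (2 * m)) sums x \<longleftrightarrow> g sums x" for x
  proof (rule sums_mono_reindex)
    show "strict_mono ((*) (2::nat))" by (simp add: strict_mono_def)
    fix n :: nat assume "n \<notin> range ((*) 2)"
    then have "odd n" by (auto elim!: evenE)
    then show "g n = 0" by (simp add: g_def power_minus[of z])
  qed
  ultimately have 1: "(\<lambda>m. g (2 * m)) sums ((\<Sum>k. z ^ Suc k / of_nat (Suc k) ^ s) - (\<Sum>k. (- z) ^ Suc k / of_nat (Suc k) ^ s))" by blast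
  have g2: "g (2 * m) = 2 * (z * ((z\<^sup>2) ^ m / (2 * of_nat m + 1) ^ s))" for m
    by (simp add: g_def power_minus[of z] power_mult add.commute)
  show ?thesis
  proof (cases "z = 0")
    case True
    then show ?thesis by simp
  next
    case False
    have "summable (\<lambda>m. 2 * (z * ((z\<^sup>2) ^ m / (2 * of_nat m + 1) ^ s)))" using sums_summable[OF 1] unfolding g2 .
    then have "summable (\<lambda>m. (z\<^sup>2) ^ m / (2 * of_nat m + 1) ^ s)" using False by (simp add: summable_cmult_iff mult.assoc [symmetric] del: times_divide_eq_right)
    then have "(\<lambda>m. 2 * (z * ((z\<^sup>2) ^ m / (2 * of_nat m + 1) ^ s))) sums (2 * (z * odd_power_sum s (z\<^sup>2)))"
      unfolding odd_power_sum_def by (intro sums_mult summable_sums)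
    with 1 show ?thesis unfolding g2 using sums_unique2 by blast
  qed
qed

lemma polylog_odd:
  assumes "norm z \<le> 1"
  shows "polylog 2 z - polylog 2 (- z) = 2 * (z * odd_power_sum 2 (z\<^sup>2))"
    and "polylog 3 z - polylog 3 (- z) = 2 * (z * odd_power_sum 3 (z\<^sup>2))"
  unfolding polylog_eq by (rule polylog_odd_part[OF _ assms]; simp)+

lemma continuous_on_polylog:
  assumes "s = 2 \<or> s = 3"
  shows "continuous_on (cball 0 1) (polylog s)"
proof -
  define n :: nat where "n = (if s = 2 then 2 else 3)"
  have n: "n \<ge> 2" "polylog s = (\<lambda>z. \<Sum>k. z ^ Suc k / of_nat (Suc k) ^ n)"
    using assms by (auto simp: n_def polylog_eq fun_eq_iff simp del: power_Suc of_nat_Suc)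
  have "continuous_on (cball 0 1) (\<lambda>z. z * (\<Sum>k. 1 / complex_of_nat (Suc k) ^ n * z ^ k))"
    by (intro continuous_on_mult continuous_on_id continuous_on_power_series_closed_disc summable_polylog_coeff n(1))
  moreover have "polylog s z = z * (\<Sum>k. 1 / complex_of_nat (Suc k) ^ n * z ^ k)" if "z \<in> cball 0 1" for z
  proof -
    have "summable (\<lambda>k. 1 / complex_of_nat (Suc k) ^ n * z ^ k)"
    proof (rule summable_comparison_test'[OF summable_polylog_coeff[OF n(1)]])
      fix k
      have "norm z ^ k \<le> 1" using that by (intro power_le_one) auto
      then show "norm (1 / complex_of_nat (Suc k) ^ n * z ^ k) \<le> norm (1 / complex_of_nat (Suc k) ^ n)"
        unfolding norm_mult norm_power by (intro mult_left_le) auto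
    qed
    from suminf_mult[OF this, of z] show ?thesis unfolding n(2) by (simp add: mult_ac)
  qed
  ultimately show ?thesis by (subst continuous_on_cong[OF refl]) auto
qed

text \<open>
  The even part of the series of \<open>polylog 3\<close> at 1 is 1/8 of the whole.
\<close>
lemma polylog_3_one: "polylog 3 1 - polylog 3 (- 1) = 7 / 4 * of_real (\<Sum>k. 1 / real (Suc k) ^ 3)"
proof -
  define Z where "Z = (\<Sum>k. 1 / complex_of_nat (Suc k) ^ 3)"
  have sm: "summable (\<lambda>k. 1 / complex_of_nat (Suc k) ^ 3)" using summable_norm_cancel[OF summable_polylog_coeff[of 3]] by simp
  have "summable (\<lambda>k. inverse (real k ^ 3))" by (rule inverse_power_summable) simp
  then have smr: "summable (\<lambda>k. 1 / real (Suc k) ^ 3)"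
    by (subst (asm) summable_Suc_iff [symmetric]) (simp only: inverse_eq_divide)
  have Zr: "of_real (\<Sum>k. 1 / real (Suc k) ^ 3) = Z" unfolding Z_def by (subst suminf_of_real[OF smr]) simp
  have p1: "polylog 3 1 = Z" unfolding polylog_eq Z_def by simp
  define g where "g k = 1 ^ Suc k / complex_of_nat (Suc k) ^ 3 + (- 1) ^ Suc k / of_nat (Suc k) ^ 3" for k
  have "g sums (polylog 3 1 + polylog 3 (- 1))"
    unfolding g_def polylog_eq by (intro sums_add summable_sums summable_polylog) auto
  moreover have "(\<lambda>m. g (Suc (2 * m))) sums x \<longleftrightarrow> g sums x" for x
  proof (rule sums_mono_reindex)
    show "strict_mono (\<lambda>m::nat. Suc (2 * m))" by (simp add: strict_mono_def)
    fix n :: nat assume n: "n \<notin> range (\<lambda>m. Suc (2 * m))"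
    have "even n"
    proof (rule ccontr)
      assume "odd n"
      then obtain m where "n = 2 * m + 1" by (rule oddE)
      then show False using n by auto
    qed
    then show "g n = 0" by (simp add: g_def)
  qed
  ultimately have 1: "(\<lambda>m. g (Suc (2 * m))) sums (polylog 3 1 + polylog 3 (- 1))" by blast
  have g2: "g (Suc (2 * m)) = 1/4 * (1 / complex_of_nat (Suc m) ^ 3)" for m
  proof -
    have "complex_of_nat (Suc (Suc (2 * m))) = 2 * of_nat (Suc m)" by simp
    then have "complex_of_nat (Suc (Suc (2 * m))) ^ 3 = 8 * of_nat (Suc m) ^ 3" by (simp only: power_mult_distrib) simp
    then show ?thesis unfolding g_def by (simp del: of_nat_Suc)
  qed
  have "(\<lambda>m. 1/4 * (1 / complex_of_nat (Suc m) ^ 3)) sums (1/4 * Z)"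
    unfolding Z_def by (intro sums_mult summable_sums sm)
  then have "polylog 3 1 + polylog 3 (- 1) = 1/4 * Z" using 1 unfolding g2 by (rule sums_unique2[rotated])
  then have h: "polylog 3 1 + polylog 3 (- 1) = 1/4 * Z" .
  have "polylog 3 (- 1) = (polylog 3 1 + polylog 3 (- 1)) - polylog 3 1" by simp
  then have "polylog 3 (- 1) = 1/4 * Z - Z" unfolding h unfolding p1 .
  then show ?thesis unfolding Zr p1 by simp
qed

lemma summable_odd_power_sum:
  fixes z :: complex
  assumes "norm z < 1"
  shows "summable (\<lambda>k. z ^ k / (2 * of_nat k + 1) ^ s)" "summable (\<lambda>k. norm z ^ k)"
proof -
  show g: "summable (\<lambda>k. norm z ^ k)" using assms by (intro summable_geometric) simp
  show "summable (\<lambda>k. z ^ k / (2 * of_nat k + 1) ^ s)"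
  proof (rule summable_comparison_test'[OF g])
    fix k
    have "norm (2 * of_nat k + 1 :: complex) = 2 * real k + 1"
      using norm_odd_of_nat[of k] by simp
    then have "1 \<le> norm (2 * of_nat k + 1 :: complex) ^ s" by (simp add: one_le_power)
    then have "norm z ^ k / norm (2 * of_nat k + 1 :: complex) ^ s \<le> norm z ^ k / 1" by (intro divide_left_mono) auto
    then show "norm (z ^ k / (2 * of_nat k + 1) ^ s) \<le> norm z ^ k" by (simp add: norm_divide norm_power)
  qed
qed

text \<open>
  The second order remainder of \<open>odd_sum \<beta>\<close> at \<open>\<beta> = 0\<close>, up to the factor \<open>4 * \<beta>^2\<close>.
\<close>
definition odd_remainder :: "complex \<Rightarrow> complex \<Rightarrow> complex" where
  "odd_remainder \<beta> z = (\<Sum>k. z ^ k / ((2 * of_nat k + 1) ^ 2 * (1 + 2 * \<beta> + 2 * of_nat k)))"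

lemma norm_odd_remainder_term_le:
  assumes "\<bar>Re \<beta>\<bar> \<le> 1/4"
  shows "norm (z ^ k / ((2 * of_nat k + 1) ^ 2 * (1 + 2 * \<beta> + 2 * of_nat k))) \<le> 2 * norm z ^ k"
proof -
  have n: "norm (2 * of_nat k + 1 :: complex) = 2 * real k + 1"
    using norm_odd_of_nat[of k] by simp
  have "1 \<le> (2 * real k + 1) ^ 2" by (simp add: one_le_power)
  moreover have "1/2 \<le> norm (1 + 2 * \<beta> + 2 * of_nat k)" using norm_odd_sum_denominator[of k \<beta>] assms by linarith
  ultimately have "1 * (1/2) \<le> (2 * real k + 1) ^ 2 * norm (1 + 2 * \<beta> + 2 * of_nat k)" by (intro mult_mono) auto
  then have "norm z ^ k / ((2 * real k + 1) ^ 2 * norm (1 + 2 * \<beta> + 2 * of_nat k)) \<le> norm z ^ k / (1/2)"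
    by (intro frac_le) auto
  then show ?thesis unfolding norm_divide norm_mult norm_power n by simp
qed

text \<open>
  Termwise \<open>1 / (n + 2 \<beta>) = 1 / n - 2 \<beta> / n^2 + 4 \<beta>^2 / (n^2 (n + 2 \<beta>))\<close> with \<open>n = 2 k + 1\<close>. The
  double zero of \<open>sin (pi \<alpha>)^2\<close> at \<open>\<alpha> = 0\<close> calls for exactly this order.
\<close>
lemma odd_sum_expansion:
  assumes "norm z < 1" "\<bar>Re \<beta>\<bar> \<le> 1/4"
  shows "odd_sum \<beta> z = odd_sum 0 z - 2 * \<beta> * odd_power_sum 2 z + 4 * \<beta>\<^sup>2 * odd_remainder \<beta> z"
proof -
  have z1: "\<bar>Re \<beta>\<bar> < 1/2" "\<bar>Re 0\<bar> < 1/2" using assms(2) by auto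
  have sr: "summable (\<lambda>k. z ^ k / ((2 * of_nat k + 1) ^ 2 * (1 + 2 * \<beta> + 2 * of_nat k)))"
    by (rule summable_comparison_test'[OF summable_mult[OF summable_odd_power_sum(2)[OF assms(1)], of 2]])
       (rule norm_odd_remainder_term_le[OF assms(2)])
  have "(\<lambda>k. z ^ k / (1 + 2 * 0 + 2 * of_nat k) - 2 * \<beta> * (z ^ k / (2 * of_nat k + 1) ^ 2) + 4 * \<beta>\<^sup>2 * (z ^ k / ((2 * of_nat k + 1) ^ 2 * (1 + 2 * \<beta> + 2 * of_nat k))))
    sums (odd_sum 0 z - 2 * \<beta> * odd_power_sum 2 z + 4 * \<beta>\<^sup>2 * odd_remainder \<beta> z)"
    unfolding odd_sum_def odd_power_sum_def odd_remainder_def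
    by (intro sums_add sums_diff sums_mult summable_sums sr summable_odd_sum summable_odd_power_sum(1) assms(1) z1(2))
  moreover have "z ^ k / (1 + 2 * 0 + 2 * of_nat k) - 2 * \<beta> * (z ^ k / (2 * of_nat k + 1) ^ 2) + 4 * \<beta>\<^sup>2 * (z ^ k / ((2 * of_nat k + 1) ^ 2 * (1 + 2 * \<beta> + 2 * of_nat k)))
     = z ^ k / (1 + 2 * \<beta> + 2 * of_nat k)" for k
  proof -
    define n :: complex where "n = 2 * of_nat k + 1"
    have n0: "n \<noteq> 0" unfolding n_def by (rule odd_of_nat_nonzero)
    have nb: "n + 2 * \<beta> \<noteq> 0" using norm_odd_sum_denominator[of k \<beta>] z1(1) by (auto simp: n_def algebra_simps)
    have "1 / n - 2 * \<beta> / n ^ 2 + 4 * \<beta>\<^sup>2 / (n ^ 2 * (n + 2 * \<beta>)) = 1 / (n + 2 * \<beta>)"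
      using n0 nb by (simp add: divide_simps) (simp add: power2_eq_square algebra_simps)
    then have h: "z ^ k * (1 / n - 2 * \<beta> / n ^ 2 + 4 * \<beta>\<^sup>2 / (n ^ 2 * (n + 2 * \<beta>))) = z ^ k * (1 / (n + 2 * \<beta>))" by (simp only:)
    have r: "1 + 2 * 0 + 2 * of_nat k = n" "1 + 2 * \<beta> + 2 * of_nat k = n + 2 * \<beta>" by (simp_all add: n_def)
    show ?thesis unfolding r n_def[symmetric] using h by (simp only: distrib_left right_diff_distrib) (simp add: mult_ac)
  qed
  ultimately have "(\<lambda>k. z ^ k / (1 + 2 * \<beta> + 2 * of_nat k)) sums (odd_sum 0 z - 2 * \<beta> * odd_power_sum 2 z + 4 * \<beta>\<^sup>2 * odd_remainder \<beta> z)"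
    by (simp only:)
  then show ?thesis unfolding odd_sum_def[of \<beta>] by (rule sums_unique[symmetric])
qed

lemma odd_remainder_tendsto:
  assumes "norm z < 1" "X \<longlonglongrightarrow> 0" "\<And>n. \<bar>Re (X n)\<bar> \<le> 1/4"
  shows "(\<lambda>n::nat. odd_remainder (X n) z) \<longlonglongrightarrow> odd_power_sum 3 z"
proof -
  have "(\<lambda>n. odd_remainder (X n) z) \<longlonglongrightarrow> (\<Sum>k. z ^ k / ((2 * of_nat k + 1) ^ 2 * (1 + 2 * 0 + 2 * of_nat k)))"
    unfolding odd_remainder_def
  proof (intro conjunct2[OF conjunct2[OF tannerys_theorem]])
    show "(\<lambda>n. z ^ k / ((2 * of_nat k + 1) ^ 2 * (1 + 2 * X n + 2 * of_nat k))) \<longlonglongrightarrow> z ^ k / ((2 * of_nat k + 1) ^ 2 * (1 + 2 * 0 + 2 * of_nat k))" for k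
    proof (intro tendsto_intros assms(2))
      have "(2 * of_nat k + 1 :: complex) \<noteq> 0" by (rule odd_of_nat_nonzero)
      then show "(2 * of_nat k + 1) ^ 2 * (1 + 2 * 0 + 2 * of_nat k) \<noteq> (0::complex)" by (simp add: add.commute)
    qed
    show "\<forall>\<^sub>F (k, n) in sequentially \<times>\<^sub>F sequentially. norm (z ^ k / ((2 * of_nat k + 1) ^ 2 * (1 + 2 * X n + 2 * of_nat k))) \<le> 2 * norm z ^ k"
      by (rule always_eventually) (use norm_odd_remainder_term_le[OF assms(3)] in \<open>simp only: split_beta split: prod.split, blast\<close>)
    show "summable (\<lambda>k. 2 * norm z ^ k)" by (intro summable_mult summable_odd_power_sum(2) assms(1))
  qed simp
  moreover have "(2 * of_nat k + 1) ^ 2 * (1 + 2 * 0 + 2 * of_nat k) = (2 * of_nat k + 1 :: complex) ^ 3" for k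
    by (simp add: power3_eq_cube power2_eq_square add.commute)
  ultimately show ?thesis unfolding odd_power_sum_def by simp
qed

lemma KK_integral_order_tendsto:
  assumes a: "Re a > 0" and b: "Re b > 0" and X: "X \<longlonglongrightarrow> 0" "\<And>n::nat. \<bar>Re (X n)\<bar> \<le> 1/8"
  shows "(\<lambda>n. KK_integral 2 (X n) b a) \<longlonglongrightarrow> KK_integral 2 0 b a"
proof -
  obtain g where g: "integrable lborel g"
    "\<And>\<nu> v. \<bar>Re \<nu>\<bar> \<le> 1/8 \<Longrightarrow> norm (exp (of_real 2 * of_real v) * bessel_K \<nu> (a * of_real (exp v)) ^ 2 * bessel_K \<nu> (b * of_real (exp v)) ^ 2) \<le> g v"
    by (rule KK_dominated[of "1/8" 2, OF _ _ _ a b]) (auto intro: that)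
  have K: "(\<lambda>n. bessel_K (X n) z) \<longlonglongrightarrow> bessel_K 0 z" if "Re z > 0" for z
  proof -
    have "isCont (\<lambda>\<nu>. bessel_K \<nu> z) 0"
      using holomorphic_on_imp_continuous_on[OF holomorphic_bessel_K_order[OF that]] by (simp add: continuous_on_eq_continuous_at)
    then show ?thesis using X(1) by (rule isCont_tendsto_compose)
  qed
  show ?thesis unfolding KK_integral_def
  proof (rule integral_dominated_convergence[where w = g, OF measurable_KK[OF a b] measurable_KK[OF a b] g(1)])
    show "AE v in lborel. (\<lambda>n. exp (of_real 2 * of_real v) * bessel_K (X n) (a * of_real (exp v)) ^ 2 * bessel_K (X n) (b * of_real (exp v)) ^ 2)
       \<longlonglongrightarrow> exp (of_real 2 * of_real v) * bessel_K 0 (a * of_real (exp v)) ^ 2 * bessel_K 0 (b * of_real (exp v)) ^ 2"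
      by (intro AE_I2 tendsto_intros K) (use a b in auto)
    show "AE v in lborel. norm (exp (of_real 2 * of_real v) * bessel_K (X n) (a * of_real (exp v)) ^ 2 * bessel_K (X n) (b * of_real (exp v)) ^ 2) \<le> g v" for n
      by (intro AE_I2 g(2) X(2))
  qed
qed

lemma difference_quotient_at_0:
  fixes f :: "complex \<Rightarrow> complex"
  assumes "(f has_field_derivative D) (at 0)" "X \<longlonglongrightarrow> 0" "\<And>n. X n \<noteq> 0"
  shows "(\<lambda>n::nat. (f (X n) - f 0) / X n) \<longlonglongrightarrow> D"
proof -
  have "filterlim X (at 0) sequentially" unfolding filterlim_at using assms(2,3) by simp
  from filterlim_compose[OF assms(1)[unfolded has_field_derivative_iff] this] show ?thesis by simp
qed

text \<open>
  The limit \<open>\<alpha> \<rightarrow> 0\<close> for nonzero orders. The squared cosecant has a double pole, and the bracket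
  vanishes to second order; its second order coefficient collects the terms in \<open>Ln w\<close> from the
  powers and in the odd power sums from the expansion.
\<close>
lemma KK_integral_0_disc:
  assumes b: "Re b > 0" and w: "w * b \<in> slit_halfplane b" "norm w < 1"
  shows "KK_integral 2 0 b (w * b) = 1 / (2 * b ^ 2) *
     (Ln w ^ 2 * odd_sum 0 (w\<^sup>2) - 2 * Ln w * odd_power_sum 2 (w\<^sup>2) + 2 * odd_power_sum 3 (w\<^sup>2))"
proof -
  \<comment> \<open>Nonzero orders tending to 0 with \<open>\<bar>Re (X n)\<bar> \<le> 1/8\<close>, the range in which a common majorant is available.\<close>
  define X where "X n = complex_of_real (1 / real (n + 8))" for n :: nat
  have X0: "X n \<noteq> 0" for n unfolding X_def of_real_eq_0_iff by simp
  have Xr: "\<bar>Re (X n)\<bar> \<le> 1/8" for n unfolding X_def by simp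
  have "(\<lambda>n. 1 / real (n + 8)) \<longlonglongrightarrow> 0" by real_asymp
  from tendsto_of_real[OF this] have X: "X \<longlonglongrightarrow> 0" unfolding X_def of_real_0 .
  then have mX: "(\<lambda>n. - X n) \<longlonglongrightarrow> 0" using tendsto_minus by fastforce
  have a: "Re (w * b) > 0" and w0: "w \<noteq> 0" using w(1) by (auto simp: slit_halfplane_def)
  define z where "z = w\<^sup>2"
  have z: "norm z < 1" using w(2) by (simp add: z_def norm_power power_less_one_iff)
  define L where "L = Ln w"
  define A B where "A = odd_sum 0 z" and "B = odd_power_sum 2 z"
  define u where "u n = exp (2 * L * X n)" for n
  define v where "v n = exp (- (2 * L) * X n)" for n
  define p where "p n = (u n - 1) / X n" for n
  define s where "s n = (sin (of_real pi * X n) - sin (of_real pi * 0)) / X n" for n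
  \<comment> \<open>The bracket divided by \<open>X n * X n\<close>, written through the difference quotient \<open>p n\<close> of the power \<open>u n\<close> and \<open>v n = 1 / u n\<close>.\<close>
  define T where "T n = p n * p n * v n * A - 2 * p n * (1 + v n) * B
      + 4 * (u n * odd_remainder (X n) z + v n * odd_remainder (- X n) z)" for n
  have "((\<lambda>x. exp (2 * L * x)) has_field_derivative 2 * L) (at 0)" by (auto intro!: derivative_eq_intros)
  from difference_quotient_at_0[OF this X X0] have p: "p \<longlonglongrightarrow> 2 * L" unfolding p_def u_def by simp
  have "((\<lambda>x. sin (of_real pi * x)) has_field_derivative of_real pi) (at 0)" by (auto intro!: derivative_eq_intros)
  from difference_quotient_at_0[OF this X X0] have s: "s \<longlonglongrightarrow> of_real pi" unfolding s_def .
  have "u \<longlonglongrightarrow> exp (2 * L * 0)" "v \<longlonglongrightarrow> exp (- (2 * L) * 0)" unfolding u_def v_def by (intro tendsto_intros X)+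
  then have uv: "u \<longlonglongrightarrow> 1" "v \<longlonglongrightarrow> 1" by simp_all
  have X4: "\<bar>Re (X n)\<bar> \<le> 1/4" "\<bar>Re (- X n)\<bar> \<le> 1/4" for n using Xr[of n] by auto
  have R: "(\<lambda>n. odd_remainder (X n) z) \<longlonglongrightarrow> odd_power_sum 3 z" "(\<lambda>n. odd_remainder (- X n) z) \<longlonglongrightarrow> odd_power_sum 3 z"
    by (rule odd_remainder_tendsto[OF z X X4(1)]) (rule odd_remainder_tendsto[OF z mX X4(2)])
  have T: "T \<longlonglongrightarrow> 2 * L * (2 * L) * 1 * A - 2 * (2 * L) * (1 + 1) * B + 4 * (1 * odd_power_sum 3 z + 1 * odd_power_sum 3 z)"
    unfolding T_def by (intro tendsto_intros p uv R)
  have eq: "KK_integral 2 (X n) b (w * b) = of_real pi ^ 2 / (8 * b ^ 2) * (1 / s n) ^ 2 * T n" for n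
  proof -
    have r: "\<bar>Re (X n)\<bar> < 1/2" "\<bar>Re (X n)\<bar> \<le> 1/4" "\<bar>Re (- X n)\<bar> \<le> 1/4" using Xr[of n] by auto
    have U: "w powr (2 * X n) = u n" "w powr (- 2 * X n) = v n"
      using w0 by (simp_all add: powr_def u_def v_def L_def mult_ac)
    have uv1: "u n * v n = 1" unfolding u_def v_def by (simp add: exp_add [symmetric])
    have up: "u n = 1 + X n * p n" using X0[of n] by (simp add: p_def)
    have 1: "u n + v n - 2 = X n * X n * (p n * p n * v n)"
    proof -
      have "(u n - 1) * (u n - 1) * v n = u n * (u n * v n) - 2 * (u n * v n) + v n" by (simp add: algebra_simps)
      then have "(u n - 1) * (u n - 1) * v n = u n - 2 + v n" unfolding uv1 by simp
      moreover have "u n - 1 = X n * p n" unfolding up by simp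
      ultimately show ?thesis by (simp add: algebra_simps)
    qed
    have 2: "u n - v n = X n * (p n * (1 + v n))"
    proof -
      have "(u n - 1) * (1 + v n) = u n + u n * v n - 1 - v n" by (simp add: algebra_simps)
      then have "(u n - 1) * (1 + v n) = u n - v n" unfolding uv1 by simp
      moreover have "u n - 1 = X n * p n" unfolding up by simp
      ultimately show ?thesis by (simp add: algebra_simps)
    qed
    have "u n * odd_sum (X n) z + v n * odd_sum (- X n) z - 2 * odd_sum 0 z
      = (u n + v n - 2) * A - 2 * X n * ((u n - v n) * B) + X n * X n * (4 * (u n * odd_remainder (X n) z + v n * odd_remainder (- X n) z))"
      unfolding odd_sum_expansion[OF z r(2)] odd_sum_expansion[OF z r(3)] A_def B_def
      by (simp add: algebra_simps power2_eq_square)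
    also have "\<dots> = X n * X n * T n" unfolding 1 2 T_def by (simp add: algebra_simps)
    finally have E: "u n * odd_sum (X n) z + v n * odd_sum (- X n) z - 2 * odd_sum 0 z = X n * X n * T n" .
    have S: "csc (of_real pi * X n) = 1 / (X n * s n)" using X0[of n] by (simp add: csc_def s_def)
    have "KK_integral 2 (X n) b (w * b) = of_real pi ^ 2 / (8 * b ^ 2) * (1 / (X n * s n)) ^ 2 * (X n * X n * T n)"
      using KK_integral_2_disc[OF X0[of n] r(1) b w] unfolding U z_def[symmetric] E S .
    also have "\<dots> = of_real pi ^ 2 / (8 * b ^ 2) * (1 / s n) ^ 2 * T n"
      using X0[of n] by (simp add: power2_eq_square mult_ac)
    finally show ?thesis .
  qed
  have "(\<lambda>n. of_real pi ^ 2 / (8 * b ^ 2) * (1 / s n) ^ 2 * T n) \<longlonglongrightarrow>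
     of_real pi ^ 2 / (8 * b ^ 2) * (1 / of_real pi) ^ 2 * (2 * L * (2 * L) * 1 * A - 2 * (2 * L) * (1 + 1) * B + 4 * (1 * odd_power_sum 3 z + 1 * odd_power_sum 3 z))"
    by (intro tendsto_intros s T) simp
  moreover have "(\<lambda>n. of_real pi ^ 2 / (8 * b ^ 2) * (1 / s n) ^ 2 * T n) \<longlonglongrightarrow> KK_integral 2 0 b (w * b)"
    using KK_integral_order_tendsto[OF a b X Xr] unfolding eq .
  ultimately have "KK_integral 2 0 b (w * b) = of_real pi ^ 2 / (8 * b ^ 2) * (1 / of_real pi) ^ 2 * (2 * L * (2 * L) * 1 * A - 2 * (2 * L) * (1 + 1) * B + 4 * (1 * odd_power_sum 3 z + 1 * odd_power_sum 3 z))"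
    by (rule LIMSEQ_unique[rotated])
  also have "\<dots> = 1 / (8 * b ^ 2) * (8 * (L * L * A / 2 - L * B + odd_power_sum 3 z))"
    by (simp add: power_divide algebra_simps)
  also have "\<dots> = 1 / (2 * b ^ 2) * (L * L * A - 2 * L * B + 2 * odd_power_sum 3 z)"
    by (simp add: divide_simps)
  finally show ?thesis by (simp add: L_def A_def B_def z_def power2_eq_square)
qed

definition polylog_form :: "complex \<Rightarrow> complex" where
  "polylog_form w = ln w ^ 2 * arctanh w - ln w * (polylog 2 w - polylog 2 (- w)) + polylog 3 w - polylog 3 (- w)"

lemma KK_integral_0_disc_polylog:
  assumes b: "Re b > 0" and w: "w * b \<in> slit_halfplane b" "norm w < 1"
  shows "KK_integral 2 0 b (w * b) = 1 / (2 * (w * b) * b) * polylog_form w"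
proof -
  have w0: "w \<noteq> 0" using w(1) by (auto simp: slit_halfplane_def)
  have n: "norm w \<le> 1" using w(2) by simp
  define A B C where "A = odd_sum 0 (w\<^sup>2)" and "B = odd_power_sum 2 (w\<^sup>2)" and "C = odd_power_sum 3 (w\<^sup>2)"
  have "polylog_form w = ln w ^ 2 * (w * A) - ln w * (2 * (w * B)) + (2 * (w * C))"
    unfolding polylog_form_def polylog_odd(1)[OF n] arctanh_eq_odd_sum[OF w(2)] A_def B_def C_def polylog_odd(2)[OF n, symmetric]
    by simp
  also have "\<dots> = w * (ln w ^ 2 * A - 2 * ln w * B + 2 * C)" by (simp add: algebra_simps)
  finally have f: "polylog_form w = w * (ln w ^ 2 * A - 2 * ln w * B + 2 * C)" .
  show ?thesis unfolding KK_integral_0_disc[OF assms] f A_def[symmetric] B_def[symmetric] C_def[symmetric]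
    using w0 by (simp add: power2_eq_square)
qed

lemma polylog_radial:
  assumes "norm w \<le> 1" "s = 2 \<or> s = 3"
  shows "((\<lambda>t. polylog s (of_real t * w)) \<longlongrightarrow> polylog s w) (at_left (1::real))"
proof -
  have "continuous_on {0..1} (\<lambda>t::real. polylog s (of_real t * w))"
  proof (rule continuous_on_compose2[OF continuous_on_polylog[OF assms(2)]])
    show "(\<lambda>t. complex_of_real t * w) ` {0..1} \<subseteq> cball 0 1"
      using assms(1) by (auto simp: norm_mult intro!: mult_le_one)
  qed (intro continuous_intros)
  then have "((\<lambda>t. polylog s (of_real t * w)) \<longlongrightarrow> polylog s (of_real 1 * w)) (at 1 within {0..1})"
    unfolding continuous_on_def by (rule bspec) simp
  then show ?thesis by (simp add: at_within_Icc_at_left)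
qed

lemma radius_in_slit_halfplane:
  assumes b: "Re b > 0" and w: "Re (w * b) > 0" "norm w \<le> 1" and t: "0 < t" "t < 1"
  shows "of_real t * w * b \<in> slit_halfplane b" "norm (of_real t * w) < 1"
proof -
  have b0: "b \<noteq> 0" using b by auto
  have "norm (of_real t * w) \<le> t * 1" using t w(2) unfolding norm_mult by (intro mult_mono) auto
  then show n: "norm (of_real t * w) < 1" using t by simp
  have "Re (of_real t * w * b) = t * Re (w * b)" unfolding mult.assoc by simp
  moreover have "of_real t * w \<noteq> of_real x" if "x \<ge> 1" for x
  proof
    assume "of_real t * w = complex_of_real x"
    then have "norm (of_real t * w) = \<bar>x\<bar>" by simp
    then show False using n that by simp
  qed
  ultimately show "of_real t * w * b \<in> slit_halfplane b" using t w(1) b0 by (auto simp: slit_halfplane_def)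
qed

text \<open>
  On the unit circle the formula is reached along the radius. The limit is a hypothesis here
  because at \<open>w = 1\<close> the formula itself is not continuous term by term.
\<close>
lemma KK_integral_0_radial:
  assumes b: "Re b > 0" and w: "Re (w * b) > 0" "norm w \<le> 1"
    and lim: "((\<lambda>t. polylog_form (of_real t * w)) \<longlongrightarrow> P) (at_left (1::real))"
  shows "KK_integral 2 0 b (w * b) = 1 / (2 * (w * b) * b) * P"
proof (rule KK_integral_left_transfer[OF _ _ b w(1)])
  have nz: "2 * (of_real 1 * (w * b)) * b \<noteq> 0" using b w(1) by auto
  show "KK_integral 2 0 b (of_real t * (w * b)) = 1 / (2 * (of_real t * (w * b)) * b) * polylog_form (of_real t * w)"
    if "0 < t" "t < 1" for t
    using KK_integral_0_disc_polylog[OF b radius_in_slit_halfplane[OF b w that]] unfolding mult.assoc .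
  have "((\<lambda>t. 1 / (2 * (of_real t * (w * b)) * b) * polylog_form (of_real t * w)) \<longlongrightarrow> 1 / (2 * (of_real 1 * (w * b)) * b) * P) (at_left (1::real))"
    by (intro tendsto_intros lim nz)
  then show "((\<lambda>t. 1 / (2 * (of_real t * (w * b)) * b) * polylog_form (of_real t * w)) \<longlongrightarrow> 1 / (2 * (w * b) * b) * P) (at_left (1::real))"
    by simp
qed simp_all

lemma KK_integral_0:
  assumes a: "Re a > 0" and b: "Re b > 0" and n: "norm (a / b) \<le> 1" and ab: "a \<noteq> b"
  shows "KK_integral 2 0 b a = 1 / (2 * a * b) * polylog_form (a / b)"
proof -
  have b0: "b \<noteq> 0" using b by auto
  define w where "w = a / b"
  have wb: "w * b = a" using b0 by (simp add: w_def)
  have w: "Re (w * b) > 0" "norm w \<le> 1" unfolding wb unfolding w_def by (rule a, rule n)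
  have "w \<noteq> of_real x" if "x \<ge> 1" for x
  proof
    assume e: "w = of_real x"
    then have "x = 1" using w(2) that by simp
    then show False using e ab wb by simp
  qed
  then have "a \<in> slit_halfplane b" using a by (auto simp: slit_halfplane_def w_def)
  note q = slit_halfplane_quotient[OF this b, folded w_def]
  have i: "((\<lambda>t. of_real t * w) \<longlongrightarrow> w) (at_left (1::real))"
  proof -
    have "((\<lambda>t. of_real t * w) \<longlongrightarrow> of_real 1 * w) (at_left (1::real))" by (intro tendsto_intros)
    then show ?thesis by simp
  qed
  have pm: "((\<lambda>t. polylog s (- (of_real t * w))) \<longlongrightarrow> polylog s (- w)) (at_left (1::real))" if "s = 2 \<or> s = 3" for s
    using polylog_radial[of "- w" s] w(2) that by simp
  have "((\<lambda>t. polylog_form (of_real t * w)) \<longlongrightarrow> polylog_form w) (at_left (1::real))"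
    unfolding polylog_form_def arctanh_def
    by (intro tendsto_intros i q polylog_radial pm w(2)) simp_all
  from KK_integral_0_radial[OF b w this] show ?thesis unfolding wb unfolding w_def .
qed

text \<open>
  The logarithm vanishes at 1 and its square beats the logarithmic singularity of the inverse
  hyperbolic tangent, so only the trilogarithms remain.
\<close>
lemma KK_integral_0_eq:
  assumes b: "Re b > 0"
  shows "KK_integral 2 0 b b = 7 / (8 * b ^ 2) * of_real (\<Sum>k. 1 / real (Suc k) ^ 3)"
proof -
  have ev: "\<forall>\<^sub>F t in at_left (1::real). t \<in> {0<..<1}" by (rule eventually_at_leftI[of 0]) auto
  define P where "P = polylog 3 1 - polylog 3 (- 1)"
  define G where "G t = of_real (ln t ^ 2 * ((ln (1 + t) - ln (1 - t)) / 2))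
     - of_real (ln t) * (polylog 2 (of_real t * 1) - polylog 2 (of_real t * - 1)) + polylog 3 (of_real t * 1) - polylog 3 (of_real t * - 1)" for t :: real
  have 1: "((\<lambda>t::real. ln t ^ 2 * ((ln (1 + t) - ln (1 - t)) / 2)) \<longlongrightarrow> 0) (at_left 1)" by real_asymp
  have 2: "((\<lambda>t::real. ln t) \<longlongrightarrow> 0) (at_left 1)" by real_asymp
  have "(G \<longlongrightarrow> of_real 0 - of_real 0 * (polylog 2 1 - polylog 2 (- 1)) + polylog 3 1 - polylog 3 (- 1)) (at_left 1)"
    unfolding G_def by (intro tendsto_add tendsto_diff tendsto_mult tendsto_of_real 1 2 polylog_radial) simp_all
  then have G: "(G \<longlongrightarrow> P) (at_left 1)" by (simp add: P_def)
  have "\<forall>\<^sub>F t in at_left (1::real). G t = polylog_form (of_real t * 1)" using ev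
  proof eventually_elim
    case (elim t)
    have "Ln (of_real t) = of_real (ln t)" "Ln (1 + of_real t) = of_real (ln (1 + t))" "Ln (1 - of_real t) = of_real (ln (1 - t))"
      using elim Ln_of_real[of t] Ln_of_real[of "1 + t"] Ln_of_real[of "1 - t"] by simp_all
    then show ?case by (simp add: G_def polylog_form_def arctanh_def)
  qed
  from tendsto_cong[OF this] G have "((\<lambda>t. polylog_form (of_real t * 1)) \<longlongrightarrow> P) (at_left (1::real))" by blast
  from KK_integral_0_radial[of b 1, OF b _ _ this] b
  have "KK_integral 2 0 b b = 1 / (2 * b * b) * P" by simp
  then show ?thesis unfolding P_def polylog_3_one by (simp add: power2_eq_square)
qed

section \<open>The integrals of products of four Bessel functions\<close>

theorem theorem2p5:
  fixes a b :: complex and H :: "complex set"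
  assumes "Re a > 0" and "Re b > 0"
    and "H = {w. Im w > 0} \<or> H = {w. Im w < 0}"
  shows
    "(\<forall>\<alpha>::complex. \<alpha> \<noteq> 0 \<and> \<bar>Re \<alpha>\<bar> < 1/4 \<longrightarrow>
       ((\<lambda>x::real. bessel_K \<alpha> (a * of_real x) ^ 2 * bessel_K \<alpha> (b * of_real x) ^ 2) has_integral
         of_real pi ^ 4 / (8 * b) * csc (2 * of_real pi * \<alpha>) *
         (csc (of_real pi * \<alpha>) * Gamma (2 * \<alpha> + 1/2) / (Gamma (1/2 - \<alpha>) * Gamma (1 + \<alpha>) ^ 3)
            * (a / (2 * b)) powr (2 * \<alpha>)
            * side_value H (\<lambda>w. hypergeo [1/2, \<alpha> + 1/2, \<alpha> + 1/2, 2 * \<alpha> + 1/2]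
                                         [2 * \<alpha> + 1, \<alpha> + 1, \<alpha> + 1] (w ^ 2)) (a / b)
          + csc (of_real pi * \<alpha>) * Gamma (1/2 - 2 * \<alpha>) / (Gamma (\<alpha> + 1/2) * Gamma (1 - \<alpha>) ^ 3)
            * (a / (2 * b)) powr (- 2 * \<alpha>)
            * side_value H (\<lambda>w. hypergeo [1/2, 1/2 - 2 * \<alpha>, 1/2 - \<alpha>, 1/2 - \<alpha>]
                                         [1 - 2 * \<alpha>, 1 - \<alpha>, 1 - \<alpha>] (w ^ 2)) (a / b)
          - 2 / (of_real pi * \<alpha>)
            * side_value H (\<lambda>w. hypergeo [1/2, 1/2, \<alpha> + 1/2, 1/2 - \<alpha>]
                                         [1, 1 - \<alpha>, \<alpha> + 1] (w ^ 2)) (a / b))) {0<..})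
     \<and>
     (\<forall>\<alpha>::complex. \<alpha> \<noteq> 0 \<and> \<bar>Re \<alpha>\<bar> < 1/2 \<and> a \<noteq> b \<longrightarrow>
       ((\<lambda>x::real. of_real x * bessel_K \<alpha> (a * of_real x) ^ 2 * bessel_K \<alpha> (b * of_real x) ^ 2) has_integral
         of_real pi ^ 2 / (8 * a ^ 2) * csc (of_real pi * \<alpha>) ^ 2 *
         ((a / b) powr (2 + 2 * \<alpha>) / (1 + 2 * \<alpha>)
            * side_value H (\<lambda>w. hypergeo [1, 1/2 + \<alpha>] [3/2 + \<alpha>] (w ^ 2)) (a / b)
          + (a / b) powr (2 - 2 * \<alpha>) / (1 - 2 * \<alpha>)
            * side_value H (\<lambda>w. hypergeo [1, 1/2 - \<alpha>] [3/2 - \<alpha>] (w ^ 2)) (a / b)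
          - 2 * a / b * side_value H arctanh (a / b))) {0<..})
     \<and>
     (\<forall>\<alpha>::complex. \<alpha> \<noteq> 0 \<and> \<bar>Re \<alpha>\<bar> < 1/2 \<and> a = b \<longrightarrow>
       ((\<lambda>x::real. of_real x * bessel_K \<alpha> (a * of_real x) ^ 4) has_integral
         - (of_real pi ^ 2 / (16 * a ^ 2)) * csc (of_real pi * \<alpha>) ^ 2 *
         (Digamma (1/2 - \<alpha>) + Digamma (1/2 + \<alpha>) + 4 * of_real (ln 2)
          + 2 * of_real euler_mascheroni)) {0<..})
     \<and>
     (norm (a / b) \<le> 1 \<and> a \<noteq> b \<longrightarrow>
       ((\<lambda>x::real. of_real x * bessel_K 0 (a * of_real x) ^ 2 * bessel_K 0 (b * of_real x) ^ 2) has_integral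
         1 / (2 * a * b) *
         (ln (a / b) ^ 2 * arctanh (a / b)
          - ln (a / b) * (polylog 2 (a / b) - polylog 2 (- (a / b)))
          + polylog 3 (a / b) - polylog 3 (- (a / b)))) {0<..})
     \<and>
     (a = b \<longrightarrow>
       ((\<lambda>x::real. of_real x * bessel_K 0 (a * of_real x) ^ 4) has_integral
         7 / (8 * a ^ 2) * of_real (\<Sum>k. 1 / real (Suc k) ^ 3)) {0<..})"
proof (intro conjI allI impI; (elim conjE)?)
  fix \<alpha> :: complex assume \<alpha>: "\<alpha> \<noteq> 0" "\<bar>Re \<alpha>\<bar> < 1/4"
  show "((\<lambda>x::real. bessel_K \<alpha> (a * of_real x) ^ 2 * bessel_K \<alpha> (b * of_real x) ^ 2) has_integral
         of_real pi ^ 4 / (8 * b) * csc (2 * of_real pi * \<alpha>) *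
         (csc (of_real pi * \<alpha>) * Gamma (2 * \<alpha> + 1/2) / (Gamma (1/2 - \<alpha>) * Gamma (1 + \<alpha>) ^ 3)
            * (a / (2 * b)) powr (2 * \<alpha>)
            * side_value H (\<lambda>w. hypergeo [1/2, \<alpha> + 1/2, \<alpha> + 1/2, 2 * \<alpha> + 1/2]
                                         [2 * \<alpha> + 1, \<alpha> + 1, \<alpha> + 1] (w ^ 2)) (a / b)
          + csc (of_real pi * \<alpha>) * Gamma (1/2 - 2 * \<alpha>) / (Gamma (\<alpha> + 1/2) * Gamma (1 - \<alpha>) ^ 3)
            * (a / (2 * b)) powr (- 2 * \<alpha>)
            * side_value H (\<lambda>w. hypergeo [1/2, 1/2 - 2 * \<alpha>, 1/2 - \<alpha>, 1/2 - \<alpha>]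
                                         [1 - 2 * \<alpha>, 1 - \<alpha>, 1 - \<alpha>] (w ^ 2)) (a / b)
          - 2 / (of_real pi * \<alpha>)
            * side_value H (\<lambda>w. hypergeo [1/2, 1/2, \<alpha> + 1/2, 1/2 - \<alpha>]
                                         [1, 1 - \<alpha>, \<alpha> + 1] (w ^ 2)) (a / b))) {0<..}"
    by (rule has_integral_KK_1[OF _ assms(1,2) KK_integral_1[OF \<alpha> assms]]) (use \<alpha> in simp)
next
  fix \<alpha> :: complex assume \<alpha>: "\<alpha> \<noteq> 0" "\<bar>Re \<alpha>\<bar> < 1/2" and ab: "a \<noteq> b"
  show "((\<lambda>x::real. of_real x * bessel_K \<alpha> (a * of_real x) ^ 2 * bessel_K \<alpha> (b * of_real x) ^ 2) has_integral
         of_real pi ^ 2 / (8 * a ^ 2) * csc (of_real pi * \<alpha>) ^ 2 *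
         ((a / b) powr (2 + 2 * \<alpha>) / (1 + 2 * \<alpha>)
            * side_value H (\<lambda>w. hypergeo [1, 1/2 + \<alpha>] [3/2 + \<alpha>] (w ^ 2)) (a / b)
          + (a / b) powr (2 - 2 * \<alpha>) / (1 - 2 * \<alpha>)
            * side_value H (\<lambda>w. hypergeo [1, 1/2 - \<alpha>] [3/2 - \<alpha>] (w ^ 2)) (a / b)
          - 2 * a / b * side_value H arctanh (a / b))) {0<..}"
    by (rule has_integral_KK_2[OF _ assms(1,2) KK_integral_2[OF \<alpha> assms ab]]) (use \<alpha> in simp)
next
  fix \<alpha> :: complex assume \<alpha>: "\<alpha> \<noteq> 0" "\<bar>Re \<alpha>\<bar> < 1/2" and ab: "a = b"
  have "2 * \<bar>Re \<alpha>\<bar> < 1" using \<alpha> by simp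
  from has_integral_KK_2[OF this assms(2,2) KK_integral_2_eq[OF \<alpha> assms(2)]]
  show "((\<lambda>x::real. of_real x * bessel_K \<alpha> (a * of_real x) ^ 4) has_integral
         - (of_real pi ^ 2 / (16 * a ^ 2)) * csc (of_real pi * \<alpha>) ^ 2 *
         (Digamma (1/2 - \<alpha>) + Digamma (1/2 + \<alpha>) + 4 * of_real (ln 2)
          + 2 * of_real euler_mascheroni)) {0<..}"
    unfolding ab mult.assoc power_add [symmetric] numeral_plus_numeral semiring_norm .
next
  assume n: "norm (a / b) \<le> 1" and ab: "a \<noteq> b"
  show "((\<lambda>x::real. of_real x * bessel_K 0 (a * of_real x) ^ 2 * bessel_K 0 (b * of_real x) ^ 2) has_integral
         1 / (2 * a * b) *
         (ln (a / b) ^ 2 * arctanh (a / b)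
          - ln (a / b) * (polylog 2 (a / b) - polylog 2 (- (a / b)))
          + polylog 3 (a / b) - polylog 3 (- (a / b)))) {0<..}"
    by (rule has_integral_KK_2[OF _ assms(1,2) KK_integral_0[OF assms(1,2) n ab, unfolded polylog_form_def]]) simp
next
  assume ab: "a = b"
  have "2 * \<bar>Re 0\<bar> < 1" by simp
  from has_integral_KK_2[OF this assms(2,2) KK_integral_0_eq[OF assms(2)]]
  show "((\<lambda>x::real. of_real x * bessel_K 0 (a * of_real x) ^ 4) has_integral
         7 / (8 * a ^ 2) * of_real (\<Sum>k. 1 / real (Suc k) ^ 3)) {0<..}"
    unfolding ab mult.assoc power_add [symmetric] numeral_plus_numeral semiring_norm .
qed

end
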